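(* Let $T>0$, let $r\ge 6$ be an integer, and assume that for $0\le t\le T$ there exists a regular solution $(\theta,L)$ of the system $$L_t=0,\qquad \theta_t=\Big(\frac{2\pi}{L}\Big)^3\Big[\theta_{\alpha\alpha\alpha}+\frac{\theta_\alpha^3}{2}\Big]$$ with $\theta(\cdot,t)\in C^{r+3}[0,2\pi]$ (the space defined in the context) and whose third derivative with respect to time is continuous with respect to time. Let $k=\frac{2\pi}{L}\theta_\alpha$. Let $\widetilde{\theta}^{\,j}_m$ denote the numerical solution obtained with the Crank-Nicholson-type (CN) scheme: $\widetilde\theta^{\,0}_m=\theta(\alpha_m,0)$ and, for every wave number $m=-N/2+1,\dots,N/2$, $$\widehat{\widetilde\theta^{\,1}_m}=\widehat{\widetilde\theta^{\,0}_m}+\Delta t\Big(-i\Big(\frac{2\pi m}{L}\Big)^3\widehat{\widetilde\theta^{\,0}_m}+\widehat{\widetilde{NL}^{\,0}_m}\Big),$$ $$\widehat{\widetilde\theta^{\,j+1}_m}=\zeta^1_m\,\widehat{\widetilde\theta^{\,j-1}_m}+2\Delta t\,\zeta^2_m\,\widehat{\widetilde{NL}^{\,j}_m}\quad(j\ge 1),$$ where $\gamma_m=\Delta t\big(\frac{2\pi m}{L}\big)^3$, $\zeta^1_m=\frac{1-i\gamma_m}{1+i\gamma_m}$ and $\zeta^2_m=\frac{1-i\gamma_m}{1+\gamma_m^2}$. Then there exist constants $h_0=h_0(T,k)>0$, $C_0=C_0(T,k)>0$ and a constant $C(T)$ independent of the discretization parameters $h,\Delta t$ and of $j$, such that whenever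 $h\le h_0$ and $\frac{\Delta t}{h}\le C_0$, $$\|\widetilde\theta^{\,j}-\theta(\cdot,t_j)\|_{l^2}\le C(T)(h^r+\Delta t^2)$$ for all $j\ge 0$ with $t_j=j\Delta t\le T$.
   Context: Setting: $\theta(\alpha,t)$ is the tangent angle and $L>0$ the (time-independent) length of a curve evolving under Airy flow, parametrized by $\alpha$ proportional to arclength $s$ ($s_\alpha=L/2\pi$); the curvature $k=\theta_s=\frac{2\pi}{L}\theta_\alpha$ solves the modified Korteweg-de Vries equation $k_t=k_{sss}+\frac32k^2k_s$. Functions of $\alpha$ are $2\pi$-periodic. Function space: $C^{q}[0,2\pi]$ is the set of $2\pi$-periodic functions $f$ whose first $q$ derivatives exist over $(0,2\pi)$ (existence understood in the almost everywhere Riemann-Stieltjes sense), are of bounded variation over $[0,2\pi]$, and whose first $q-1$ derivatives are $2\pi$-periodic. Discretization: $N=2^p$, $h=2\pi/N$, grid points $\alpha_k=kh$ for $k=-N/2+1,\dots,N/2$; $\Delta t>0$ is the time step and $t_j=j\Delta t$. For a grid function $f=(f_k)$ the discrete Fourier coefficients are $\widehat{f_m}=\frac1N\sum_{k=-N/2+1}^{N/2}f_ke^{-im\alpha_k}$, with inverse $f_k=\sum_{m=-N/2+1}^{N/2}\widehat{f_m}e^{im\alpha_k}$. The spectral derivative $S_h$ is defined by $\widehat{S_hf_m}=im\,\widehat{f_m}$. The discrete nonlinear term is the grid function $\widetilde{NL}^{\,j}_k=\frac12\big(\frac{2\pi}{L}\big)^3\big(S_h\widetilde\theta^{\,j}_k\big)^3$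 (computed pointwise in physical space), and $\widehat{\widetilde{NL}^{\,j}_m}$ are its discrete Fourier coefficients. Norm: $\|f\|_{l^2}^2=\sum_{m=-N/2+1}^{N/2}|f_m|^2h$; $\theta(\cdot,t_j)$ in this norm means its restriction to the grid. *)

theory Defs
  imports "HOL-Analysis.Analysis"
begin

definition bounded_variation_on :: "real \<Rightarrow> real \<Rightarrow> (real \<Rightarrow> real) \<Rightarrow> bool" where
  "bounded_variation_on a b f \<longleftrightarrow>
     (\<exists>M. \<forall>(n::nat) (x :: nat \<Rightarrow> real). mono x \<and> range x \<subseteq> {a..b} \<longrightarrow>
        (\<Sum>i<n. \<bar>f (x (Suc i)) - f (x i)\<bar>) \<le> M)"

definition periodic_2pi :: "(real \<Rightarrow> real) \<Rightarrow> bool" where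
  "periodic_2pi f \<longleftrightarrow> (\<forall>x. f (x + 2 * pi) = f x)"

text \<open>
  A derivative in the almost everywhere Riemann--Stieltjes sense: \<open>g'\<close> is the pointwise derivative
  of \<open>g\<close> almost everywhere, and \<open>dg = g' dx\<close> as Stieltjes differentials. The second clause matters:
  without it a jump function would have derivative 0. It is applied below only to \<open>g'\<close> of bounded
  variation, so the integral is an ordinary Riemann integral.
\<close>
definition ae_derivative :: "(real \<Rightarrow> real) \<Rightarrow> (real \<Rightarrow> real) \<Rightarrow> bool" where
  "ae_derivative g g' \<longleftrightarrow>
     (AE x in lborel. x \<in> {0<..<2*pi} \<longrightarrow> (g has_real_derivative g' x) (at x)) \<and>
     (\<forall>x\<in>{0..2*pi}. (g' has_integral (g x - g 0)) {0..x})"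

text \<open>The space $C^q[0,2\pi]$; \<open>D j\<close> is the \<open>j\<close>-th derivative. \<open>D q\<close> need not be periodic.\<close>
definition C_per :: "nat \<Rightarrow> (real \<Rightarrow> real) set" where
  "C_per q = {f. periodic_2pi f \<and>
     (\<exists>D :: nat \<Rightarrow> real \<Rightarrow> real. D 0 = f \<and>
        (\<forall>j<q. ae_derivative (D j) (D (Suc j)) \<and> bounded_variation_on 0 (2*pi) (D (Suc j))) \<and>
        (\<forall>j<q. periodic_2pi (D j)))}"

text \<open>
  \<open>\<theta> \<alpha> t\<close> is the tangent angle. The equation $L_t = 0$ is encoded by taking \<open>L\<close> to be a number.
  At \<open>t = 0\<close> and \<open>t = T\<close> the time derivatives \<open>d1\<close>, \<open>d2\<close>, \<open>d3\<close> are one-sided.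
\<close>
definition regular_airy_solution ::
    "nat \<Rightarrow> real \<Rightarrow> real \<Rightarrow> (real \<Rightarrow> real \<Rightarrow> real) \<Rightarrow> bool" where
  "regular_airy_solution r T L \<theta> \<longleftrightarrow>
     L > 0 \<and>
     (\<forall>t\<in>{0..T}. (\<lambda>\<alpha>. \<theta> \<alpha> t) \<in> C_per (r + 3)) \<and>
     (\<exists>d1 d2 d3 :: real \<Rightarrow> real \<Rightarrow> real.
        (\<forall>\<alpha>. \<forall>t\<in>{0..T}.
           (\<theta> \<alpha> has_real_derivative d1 \<alpha> t) (at t within {0..T}) \<and>
           (d1 \<alpha> has_real_derivative d2 \<alpha> t) (at t within {0..T}) \<and>
           (d2 \<alpha> has_real_derivative d3 \<alpha> t) (at t within {0..T}) \<and>
           d1 \<alpha> t = (2*pi/L)^3 *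
             ((deriv ^^ 3) (\<lambda>\<beta>. \<theta> \<beta> t) \<alpha> + (deriv (\<lambda>\<beta>. \<theta> \<beta> t) \<alpha>)^3 / 2)) \<and>
        (\<forall>\<alpha>. continuous_on {0..T} (d3 \<alpha>)))"

text \<open>
  Grid functions are complex-valued functions on the integers of which only the values on
  \<open>grid_idx N\<close> matter, \<open>N\<close> even. The numerical solution is complex in general: the spectral
  derivative multiplies the unpaired mode $m = N/2$ by $iN/2$.
\<close>
definition grid_idx :: "nat \<Rightarrow> int set" where
  "grid_idx N = {- (int N div 2) + 1 .. int N div 2}"

definition mesh :: "nat \<Rightarrow> real" where
  "mesh N = 2 * pi / real N"

definition grid_pt :: "nat \<Rightarrow> int \<Rightarrow> real" where
  "grid_pt N k = of_int k * mesh N"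

definition dft :: "nat \<Rightarrow> (int \<Rightarrow> complex) \<Rightarrow> int \<Rightarrow> complex" where
  "dft N f m = (1 / of_nat N) * (\<Sum>k\<in>grid_idx N. f k * exp (- \<i> * of_int m * of_real (grid_pt N k)))"

definition idft :: "nat \<Rightarrow> (int \<Rightarrow> complex) \<Rightarrow> int \<Rightarrow> complex" where
  "idft N c k = (\<Sum>m\<in>grid_idx N. c m * exp (\<i> * of_int m * of_real (grid_pt N k)))"

definition spectral_deriv :: "nat \<Rightarrow> (int \<Rightarrow> complex) \<Rightarrow> int \<Rightarrow> complex" where
  "spectral_deriv N f = idft N (\<lambda>m. \<i> * of_int m * dft N f m)"

definition NL :: "nat \<Rightarrow> real \<Rightarrow> (int \<Rightarrow> complex) \<Rightarrow> int \<Rightarrow> complex" where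
  "NL N L f k = (1/2) * of_real ((2*pi/L)^3) * (spectral_deriv N f k)^3"

definition l2_norm :: "nat \<Rightarrow> (int \<Rightarrow> complex) \<Rightarrow> real" where
  "l2_norm N f = sqrt (\<Sum>m\<in>grid_idx N. (cmod (f m))^2 * mesh N)"

definition cn_gamma :: "real \<Rightarrow> real \<Rightarrow> int \<Rightarrow> real" where
  "cn_gamma L dt m = dt * (2 * pi * of_int m / L)^3"

definition cn_zeta1 :: "real \<Rightarrow> real \<Rightarrow> int \<Rightarrow> complex" where
  "cn_zeta1 L dt m =
     (1 - \<i> * of_real (cn_gamma L dt m)) / (1 + \<i> * of_real (cn_gamma L dt m))"

definition cn_zeta2 :: "real \<Rightarrow> real \<Rightarrow> int \<Rightarrow> complex" where
  "cn_zeta2 L dt m =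
     (1 - \<i> * of_real (cn_gamma L dt m)) / of_real (1 + (cn_gamma L dt m)^2)"

text \<open>\<open>v j k\<close> is the numerical solution at time \<open>j * dt\<close> and grid point \<open>k\<close>.\<close>
definition cn_scheme ::
    "nat \<Rightarrow> real \<Rightarrow> real \<Rightarrow> (real \<Rightarrow> real) \<Rightarrow> (nat \<Rightarrow> int \<Rightarrow> complex) \<Rightarrow> bool" where
  "cn_scheme N L dt u0 v \<longleftrightarrow>
     (\<forall>k\<in>grid_idx N. v 0 k = of_real (u0 (grid_pt N k))) \<and>
     (\<forall>m\<in>grid_idx N.
        dft N (v 1) m = dft N (v 0) m +
          of_real dt * (- \<i> * of_real ((2 * pi * of_int m / L)^3) * dft N (v 0) m
                        + dft N (NL N L (v 0)) m)) \<and>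
     (\<forall>j\<ge>1. \<forall>m\<in>grid_idx N.
        dft N (v (j + 1)) m = cn_zeta1 L dt m * dft N (v (j - 1)) m +
          2 * of_real dt * cn_zeta2 L dt m * dft N (NL N L (v j)) m)"

end

theory Submission
  imports Defs
begin

text \<open>
Write \<open>a = 2 * pi / L\<close>, \<open>u = \<theta>_x\<close> and \<open>c t m\<close> for the Fourier coefficients of \<open>\<theta>(., t)\<close>. The theorem rests on three
things: bounds on the exact solution that are uniform in time, stability of the scheme linearised at the exact
solution, and constants that can be read off the curvature.

Uniform bounds. Membership in the space \<open>C_per (r + 3)\<close> at each time gives a finite Sobolev norm of order \<open>r + 3\<close> at
each time (\<open>C_per_classical\<close>, \<open>lipschitz_fourier_bound\<close>) but no bound that is uniform in time, so this must be
derived from the equation. Where the norm is locally bounded, space regularity becomes joint regularity and the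
equation may be differentiated (\<open>D_t_der\<close>). There the first three invariants of the modified Korteweg-de Vries
equation are constant and control \<open>u''\<close> in mean square (\<open>E_conserved\<close>, \<open>B2_le_H2\<close>), and the squared Sobolev norm of
\<open>u\<close> with the weight truncated at frequency \<open>n\<close> grows at most exponentially at a rate that sees only \<open>u''\<close>, uniformly in
\<open>n\<close>: the cubic term is a quartic form on frequencies with sum zero, whose symbol cancels between the two largest
ones (\<open>phi_sum_bound\<close>, \<open>yn_growth\<close>). Hence bounds persist across an interval of good times, and Baire's theorem
excludes bad times (\<open>enter_gap\<close>, \<open>sobolev_bounded\<close>).

Stability. The error of the discrete Fourier coefficients satisfies the leapfrog scheme with the implicit phase
\<open>\<gamma> m = dt * (a * m)^3\<close> and the explicit operator \<open>3/2 * a^3 * u^2 * d/dx\<close>. On pairs of modes that do not alias, this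
operator is skew up to order zero, in the plain and in the first-order norm. The pairs near opposite ends of the
spectrum are not, but their phases differ by at least a fixed multiple of \<open>dt * N^3\<close>, so summation by parts in time gains the two powers of \<open>N\<close>
that are needed (\<open>energy_step\<close>, \<open>leapfrog_stability\<close>, \<open>grid_stability\<close>). Time consistency uses that three time
derivatives of the coefficients are bounded in \<open>\<ell>\<^sup>2\<close> and two remain so after multiplication by \<open>m^3\<close>; this is where nine
space derivatives, that is \<open>r \<ge> 6\<close>, enter (\<open>time_consistency\<close>). The nonlinear error terms are absorbed if the spectral derivative
of the error is below \<open>1 / N\<close> in the sup norm. This follows from the first-order estimate by continuation
(\<open>bootstrap\<close>), after which the plain estimate gives the rate (\<open>error_bound\<close>, \<open>l2_error\<close>).

Constants. The continuation argument is run with nine derivatives whatever \<open>r\<close> is, so mesh size and step ratio depend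
only on \<open>T\<close>, \<open>a\<close> and Sobolev norms of the curvature \<open>k\<close>. The scale \<open>a\<close> is not determined by \<open>k\<close>, but all admissible \<open>a\<close> solve one
cubic equation unless the curvature vanishes (\<open>finite_scales\<close>). In that exceptional case \<open>\<theta>\<close> is constant and the scheme
is exact (\<open>constant_solution_exact\<close>).
\<close>

section \<open>Fourier coefficients of periodic functions\<close>

abbreviation ek :: "int => real => complex" where
 "ek m x \<equiv> cis (of_int m * x)"

abbreviation cr :: "(real => real) => real => complex" where
 "cr f \<equiv> (\<lambda>x. complex_of_real (f x))"

definition fc :: "(real => complex) => int => complex" where
 "fc f m = integral {0..2*pi} (\<lambda>x. f x * ek (-m) x) / complex_of_real (2*pi)"

lemma ek_mult: "ek m x * ek n x = ek (m + n) x"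
 by (simp add: cis_mult algebra_simps)

lemma ek_uminus: "cnj (ek m x) = ek (-m) x"
 by (simp add: cis_cnj)

lemma ek_2pi: "cis (of_int m * (2*pi)) = 1"
 using cis_multiple_2pi[of "of_int m"] by (simp add: mult.commute mult.left_commute)

lemma ek_periodic: "ek m (x + 2*pi) = ek m x"
 by (simp add: distrib_left cis_mult[symmetric] ek_2pi)

lemma continuous_on_ek [continuous_intros]:
 "continuous_on S f ==> continuous_on S (\<lambda>x. ek m (f x))"
 unfolding cis_conv_exp by (intro continuous_intros)

lemma ek_has_vector_derivative:
 "((\<lambda>x. ek m x) has_vector_derivative (\<i> * of_int m * ek m x)) (at x within S)"
proof -
 have "((\<lambda>z. exp (\<i> * of_int m * z)) has_field_derivative (\<i> * of_int m * exp (\<i> * of_int m * of_real x)))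
   (at (of_real x))"
  by (auto intro!: derivative_eq_intros)
 then have "((\<lambda>x. exp (\<i> * of_int m * of_real x)) has_vector_derivative (\<i> * of_int m * exp (\<i> * of_int m * of_real x))) (at x within S)"
  by (rule has_vector_derivative_real_field)
 then show ?thesis
  by (simp add: cis_conv_exp mult.assoc)
qed

lemma integral_ek: "integral {0..2*pi} (ek m) = (if m = 0 then of_real (2*pi) else 0)"
proof (cases "m = 0")
 case True
 then show ?thesis by (simp add: scaleR_conv_of_real)
next
 case False
 have "((\<lambda>x. ek m x) has_integral (ek m (2*pi) / (\<i> * of_int m) - ek m 0 / (\<i> * of_int m))) {0..2*pi}"
 proof (rule fundamental_theorem_of_calculus)
  fix x :: real
  have "((\<lambda>x. ek m x / (\<i> * of_int m)) has_vector_derivative (\<i> * of_int m * ek m x) / (\<i> * of_int m))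
    (at x within {0..2*pi})"
   by (intro has_vector_derivative_divide ek_has_vector_derivative)
  then show "((\<lambda>x. ek m x / (\<i> * of_int m)) has_vector_derivative ek m x) (at x within {0..2*pi})"
   using False by simp
 qed auto
 then have "integral {0..2*pi} (ek m) = ek m (2*pi) / (\<i> * of_int m) - ek m 0 / (\<i> * of_int m)"
  by (rule integral_unique)
 also have "... = 0" by (simp add: ek_2pi)
 finally show ?thesis using False by simp
qed

lemma fc_add:
 assumes "continuous_on {0..2*pi} f" "continuous_on {0..2*pi} g"
 shows "fc (\<lambda>x. f x + g x) m = fc f m + fc g m"
proof -
 have "integral {0..2*pi} (\<lambda>x. f x * ek (-m) x + g x * ek (-m) x)
   = integral {0..2*pi} (\<lambda>x. f x * ek (-m) x) + integral {0..2*pi} (\<lambda>x. g x * ek (-m) x)"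
  by (intro integral_add integrable_continuous_real continuous_intros assms)
 then show ?thesis
  by (simp add: fc_def distrib_right add_divide_distrib)
qed

lemma fc_cmult: "fc (\<lambda>x. c * f x) m = c * fc f m"
 by (simp add: fc_def mult.assoc)

lemma fc_diff:
 assumes "continuous_on {0..2*pi} f" "continuous_on {0..2*pi} g"
 shows "fc (\<lambda>x. f x - g x) m = fc f m - fc g m"
 using fc_add[OF assms(1), of "\<lambda>x. (-1) * g x" m] assms(2) fc_cmult[of "-1" g m]
 by (simp add: continuous_on_minus)

lemma fc_ek: "fc (ek n) m = (if m = n then 1 else 0)"
proof -
 have "(\<lambda>x. ek n x * ek (-m) x) = ek (n - m)"
  by (simp add: fun_eq_iff cis_mult algebra_simps)
 then show ?thesis
  unfolding fc_def by (simp only: integral_ek) auto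
qed

lemma fc_mult_ek: "fc (\<lambda>x. f x * ek n x) m = fc f (m - n)"
proof -
 have "(\<lambda>x. f x * ek n x * ek (-m) x) = (\<lambda>x. f x * ek (-(m - n)) x)"
  by (simp add: fun_eq_iff cis_mult mult.assoc algebra_simps)
 then show ?thesis by (simp add: fc_def)
qed

lemma fc_const: "fc (\<lambda>x. c) m = (if m = 0 then c else 0)"
proof -
 have "fc (\<lambda>x. c * ek 0 x) m = c * (if m = 0 then 1 else 0)"
  by (simp only: fc_cmult fc_ek)
 then show ?thesis by simp
qed

lemma fc_cnj_real: "fc (cr f) (- m) = cnj (fc (cr f) m)"
proof -
 have "cnj (integral {0..2*pi} (\<lambda>x. cr f x * ek (-m) x)) = integral {0..2*pi} (\<lambda>x. cnj (cr f x * ek (-m) x))"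
  by (rule integral_cnj)
 also have "(\<lambda>x. cnj (cr f x * ek (-m) x)) = (\<lambda>x. cr f x * ek m x)"
  by (simp add: fun_eq_iff cis_cnj)
 finally show ?thesis by (simp add: fc_def)
qed

text \<open>
 Subtracting one Fourier mode removes exactly its share of the mean square, so an induction on the
 finite set of modes gives Bessel's inequality.
\<close>
lemma bessel_step:
 assumes "continuous_on {0..2*pi} f"
 shows "integral {0..2*pi} (\<lambda>x. (cmod (f x - fc f m * ek m x))^2)
    = integral {0..2*pi} (\<lambda>x. (cmod (f x))^2) - 2*pi * (cmod (fc f m))^2"
proof -
 define c where "c = fc f m"
 have pt: "(cmod (f x - c * ek m x))^2
   = (cmod (f x))^2 - 2 * Re (cnj c * (f x * ek (-m) x)) + (cmod c)^2" for x
 proof -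
  have "complex_of_real ((cmod (f x - c * ek m x))^2)
    = (f x - c * ek m x) * (cnj (f x) - cnj c * ek (-m) x)"
   using complex_norm_square[of "f x - c * ek m x"] by (simp add: ek_uminus)
  also have "... = f x * cnj (f x) + c * cnj c * (ek m x * ek (-m) x)
    - (cnj c * (f x * ek (-m) x) + c * (cnj (f x) * ek m x))"
   by (simp add: algebra_simps)
  also have "c * (cnj (f x) * ek m x) = cnj (cnj c * (f x * ek (-m) x))"
   by (simp add: cis_cnj)
  also have "cnj c * (f x * ek (-m) x) + cnj (cnj c * (f x * ek (-m) x))
    = of_real (2 * Re (cnj c * (f x * ek (-m) x)))"
   by (rule complex_add_cnj)
  also have "ek m x * ek (-m) x = 1" by (simp add: cis_mult)
  also have "f x * cnj (f x) = of_real ((cmod (f x))^2)"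
   by (simp only: complex_norm_square)
  also have "c * cnj c = of_real ((cmod c)^2)"
   by (simp only: complex_norm_square)
  finally have "complex_of_real ((cmod (f x - c * ek m x))^2) =
   of_real ((cmod (f x))^2 - 2 * Re (cnj c * (f x * ek (-m) x)) + (cmod c)^2)"
   by simp
  then show ?thesis by (simp only: of_real_eq_iff)
 qed
 have co: "continuous_on {0..2*pi} (\<lambda>x. cnj c * (f x * ek (-m) x))"
  by (intro continuous_intros assms)
 have I: "integral {0..2*pi} (\<lambda>x. Re (cnj c * (f x * ek (-m) x))) = 2*pi * (cmod c)^2"
 proof -
  have "integral {0..2*pi} (\<lambda>x. Re (cnj c * (f x * ek (-m) x)))
    = Re (integral {0..2*pi} (\<lambda>x. cnj c * (f x * ek (-m) x)))"
   using integral_linear[OF integrable_continuous_real[OF co] bounded_linear_Re] by (simp add: o_def)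
  also have "integral {0..2*pi} (\<lambda>x. cnj c * (f x * ek (-m) x)) = cnj c * (of_real (2*pi) * c)"
   by (simp add: c_def fc_def)
  also have "... = of_real (2*pi * (cmod c)^2)"
   by (simp add: complex_norm_square[of c, symmetric] mult.left_commute[of "cnj c"] mult.commute[of "cnj c"] del: of_real_power)
  finally show ?thesis by (simp only: Re_complex_of_real)
 qed
 have "integral {0..2*pi} (\<lambda>x. (cmod (f x - c * ek m x))^2)
   = integral {0..2*pi} (\<lambda>x. (cmod (f x))^2 - 2 * Re (cnj c * (f x * ek (-m) x)) + (cmod c)^2)"
  by (simp add: pt)
 also have "... = integral {0..2*pi} (\<lambda>x. (cmod (f x))^2 - 2 * Re (cnj c * (f x * ek (-m) x)))
   + integral {0..2*pi} (\<lambda>x. (cmod c)^2)"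
  by (intro integral_add integrable_continuous_real continuous_intros assms)
 also have "integral {0..2*pi} (\<lambda>x. (cmod (f x))^2 - 2 * Re (cnj c * (f x * ek (-m) x)))
  = integral {0..2*pi} (\<lambda>x. (cmod (f x))^2) - integral {0..2*pi} (\<lambda>x. 2 * Re (cnj c * (f x * ek (-m) x)))"
  by (intro integral_diff integrable_continuous_real continuous_intros assms)
 also have "integral {0..2*pi} (\<lambda>x. 2 * Re (cnj c * (f x * ek (-m) x))) = 2 * (2*pi * (cmod c)^2)"
  by (simp only: integral_mult_right I)
 finally show ?thesis by (simp add: c_def)
qed

lemma bessel:
 assumes "finite A" "continuous_on {0..2*pi} f"
 shows "2*pi * (\<Sum>m\<in>A. (cmod (fc f m))^2) \<le> integral {0..2*pi} (\<lambda>x. (cmod (f x))^2)"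
 using assms
proof (induction A arbitrary: f rule: finite_induct)
 case empty
 then show ?case
  by (auto intro!: integral_nonneg integrable_continuous_real continuous_intros)
next
 case (insert m A)
 define g where "g = (\<lambda>x. f x - fc f m * ek m x)"
 have cg: "continuous_on {0..2*pi} g"
  unfolding g_def by (intro continuous_intros insert.prems)
 have fg: "fc g n = fc f n" if "n \<in> A" for n
 proof -
  have "fc g n = fc f n - fc (\<lambda>x. fc f m * ek m x) n"
   unfolding g_def by (intro fc_diff continuous_intros insert.prems)
  also have "fc (\<lambda>x. fc f m * ek m x) n = 0"
   using that insert.hyps fc_cmult[of "fc f m" "ek m" n] by (auto simp: fc_ek)
  finally show ?thesis by simp
 qed
 have "2*pi * (\<Sum>n\<in>A. (cmod (fc f n))^2) \<le> integral {0..2*pi} (\<lambda>x. (cmod (g x))^2)"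
  using insert.IH[OF cg] by (simp add: fg)
 also have "... = integral {0..2*pi} (\<lambda>x. (cmod (f x))^2) - 2*pi * (cmod (fc f m))^2"
  unfolding g_def by (rule bessel_step[OF insert.prems])
 finally show ?case using insert.hyps by (simp add: distrib_left)
qed

lemma bessel_real:
 assumes "finite A" "continuous_on {0..2*pi} f"
 shows "2*pi * (\<Sum>m\<in>A. (cmod (fc (cr f) m))^2) \<le> integral {0..2*pi} (\<lambda>x. (f x)^2)"
 using bessel[OF assms(1), of "cr f"] assms(2) by (simp add: continuous_on_of_real)

lemma bessel_bounded:
 assumes "finite A" "continuous_on {0..2*pi} f" "\<And>x. x \<in> {0..2*pi} ==> \<bar>f x\<bar> \<le> B"
 shows "(\<Sum>m\<in>A. (cmod (fc (cr f) m))^2) \<le> B^2"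
proof -
 have "integral {0..2*pi} (\<lambda>x. (f x)^2) \<le> integral {0..2*pi} (\<lambda>x. B^2)"
  using assms(3) by (intro integral_le integrable_continuous_real continuous_intros assms(2))
   (auto simp: abs_le_square_iff[symmetric] intro: order_trans[OF _ abs_ge_self])
 then have "2*pi * (\<Sum>m\<in>A. (cmod (fc (cr f) m))^2) \<le> 2*pi * B^2"
  using order_trans[OF bessel_real[OF assms(1,2)]] by simp
 then show ?thesis by simp
qed

lemma fc_tendsto_0:
 assumes "continuous_on {0..2*pi} f" and "inj (\<phi> :: nat => int)"
 shows "(\<lambda>n. fc f (\<phi> n)) \<longlonglongrightarrow> 0"
proof -
 have "summable (\<lambda>n. (cmod (fc f (\<phi> n)))^2)"
 proof (rule summableI_nonneg_bounded[where x = "integral {0..2*pi} (\<lambda>x. (cmod (f x))^2) / (2*pi)"])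
  fix n
  have "(\<Sum>i<n. (cmod (fc f (\<phi> i)))^2) = (\<Sum>m\<in>\<phi> ` {..<n}. (cmod (fc f m))^2)"
   using assms(2) by (subst sum.reindex) (auto intro: inj_on_subset)
  also have "2*pi * ... \<le> integral {0..2*pi} (\<lambda>x. (cmod (f x))^2)"
   by (rule bessel[OF _ assms(1)]) simp
  finally show "(\<Sum>i<n. (cmod (fc f (\<phi> i)))^2) \<le> integral {0..2*pi} (\<lambda>x. (cmod (f x))^2) / (2*pi)"
   by (simp add: field_simps)
 qed simp
 then have "(\<lambda>n. (cmod (fc f (\<phi> n)))^2) \<longlonglongrightarrow> 0"
  by (rule summable_LIMSEQ_zero)
 then have "(\<lambda>n. sqrt ((cmod (fc f (\<phi> n)))^2)) \<longlonglongrightarrow> sqrt 0"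
  by (rule tendsto_real_sqrt)
 then show ?thesis
  by (simp add: tendsto_norm_zero_iff)
qed

text \<open>
 Chernoff's argument: \<open>f y - f x = g y * (ek 1 (y - x) - 1)\<close> with \<open>g\<close> continuous, because \<open>f\<close> is
 differentiable at the zeros of the second factor.  On the Fourier side this makes the partial sums
 of the series at \<open>x\<close> telescope.
\<close>
lemma fourier_inversion:
 assumes per: "periodic_2pi f" and der: "\<And>x. (f has_real_derivative f' x) (at x)"
 shows "(\<lambda>n. \<Sum>m\<in>{- int n..int n}. fc (cr f) m * ek m x) \<longlonglongrightarrow> of_real (f x)"
proof -
 define q where "q y = cis (y - x)" for y
 define g where "g y = (if q y = 1 then - \<i> * of_real (f' y) else of_real (f y - f x) / (q y - 1))" for y
 have fx: "f y = f x" if "q y = 1" for y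
 proof -
  have "cos (y - x) = 1"
   using \<open>q y = 1\<close> by (simp add: q_def complex_eq_iff)
  then obtain n :: int where n: "y - x = 2 * pi * n"
   unfolding cos_one_2pi_int by (auto simp: mult_ac)
  have *: "f (z + 2 * pi * of_nat k) = f z" for z k
  proof (induction k)
   case (Suc k)
   have "f (z + 2 * pi * of_nat (Suc k)) = f ((z + 2 * pi * of_nat k) + 2*pi)"
    by (simp add: algebra_simps)
   then show ?case using per Suc by (simp only: periodic_2pi_def)
  qed simp
  show ?thesis
  proof (cases "n \<ge> 0")
   case True
   then show ?thesis using *[of x "nat n"] n by (simp add: algebra_simps)
  next
   case False
   then show ?thesis using *[of y "nat (-n)"] n by (simp add: algebra_simps)
  qed
 qed
 have id: "complex_of_real (f y) - of_real (f x) = g y * (q y - 1)" for y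
  using fx by (auto simp: g_def)
 have cq: "isCont q y" for y
  unfolding q_def by (auto intro!: continuous_intros simp: cis_conv_exp)
 have "isCont g y" for y
 proof (cases "q y = 1")
  case False
  have "eventually (\<lambda>z. q z \<noteq> 1) (nhds y)"
   using tendsto_imp_eventually_ne[OF cq[of y, unfolded isCont_def] False] False
   by (simp add: eventually_nhds_conv_at)
  then have ev: "eventually (\<lambda>z. g z = of_real (f z - f x) / (q z - 1)) (nhds y)"
   by eventually_elim (simp add: g_def)
  have "isCont (\<lambda>z. complex_of_real (f z - f x) / (q z - 1)) y"
   using False DERIV_isCont[OF der] by (intro continuous_intros cq) auto
  then show ?thesis using isCont_cong[OF ev] by simp
 next
  case True
  have sc: "cos (y - x) = 1" "sin (y - x) = 0"
   using True by (auto simp: q_def complex_eq_iff)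
  have 1: "((\<lambda>z. (f z - f y) / (z - y)) \<longlongrightarrow> f' y) (at y)"
   using der[of y] by (simp add: has_field_derivative_iff)
  have "((\<lambda>z. cos (z - x)) has_real_derivative 0) (at y)" "((\<lambda>z. sin (z - x)) has_real_derivative 1) (at y)"
   using sc by (auto intro!: derivative_eq_intros)
  then have "((\<lambda>z. (cos (z - x) - 1) / (z - y)) \<longlongrightarrow> 0) (at y)"
    "((\<lambda>z. (sin (z - x)) / (z - y)) \<longlongrightarrow> 1) (at y)"
   using sc by (simp_all add: has_field_derivative_iff)
  then have 2: "((\<lambda>z. Complex ((cos (z - x) - 1) / (z - y)) (sin (z - x) / (z - y))) \<longlongrightarrow> Complex 0 1) (at y)"
   by (rule tendsto_Complex)
  have "((\<lambda>z. of_real ((f z - f y) / (z - y)) / Complex ((cos (z - x) - 1) / (z - y)) (sin (z - x) / (z - y)))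
    \<longlongrightarrow> of_real (f' y) / Complex 0 1) (at y)"
   by (intro tendsto_divide tendsto_of_real 1 2) (simp add: complex_eq_iff)
  moreover have "eventually (\<lambda>z. q z \<noteq> 1) (at y)"
  proof -
   have "eventually (\<lambda>z. Complex ((cos (z - x) - 1) / (z - y)) (sin (z - x) / (z - y)) \<noteq> 0) (at y)"
    by (rule tendsto_imp_eventually_ne[OF 2]) (simp add: complex_eq_iff)
   then show ?thesis
    by eventually_elim (auto simp: q_def complex_eq_iff)
  qed
  then have "eventually (\<lambda>z. of_real ((f z - f y) / (z - y)) / Complex ((cos (z - x) - 1) / (z - y)) (sin (z - x) / (z - y)) = g z) (at y)"
   using eventually_neq_at_within[of y]
  proof eventually_elim
   case (elim z)
   have "Complex ((cos (z - x) - 1) / (z - y)) (sin (z - x) / (z - y)) = (q z - 1) / of_real (z - y)"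
    by (simp add: complex_eq_iff q_def Re_divide_of_real Im_divide_of_real del: of_real_diff)
   then show ?case using elim fx[OF True] by (simp add: g_def)
  qed
  moreover have "of_real (f' y) / Complex 0 1 = g y"
  proof -
   have "Complex 0 1 = \<i>" by (simp add: complex_eq_iff)
   then show ?thesis using True by (simp add: g_def divide_i)
  qed
  ultimately have "(g \<longlongrightarrow> g y) (at y)"
   by (auto elim: Lim_transform_eventually)
  then show ?thesis by (simp add: isCont_def)
 qed
 then have cg: "continuous_on {0..2*pi} g"
  by (simp add: continuous_at_imp_continuous_on)
 have cf: "continuous_on {0..2*pi} (cr f)"
  using DERIV_isCont[OF der] by (intro continuous_on_of_real) (simp add: continuous_at_imp_continuous_on)
 have qe: "q y = cis (-x) * ek 1 y" for y
  by (simp add: q_def cis_mult)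
 have coef: "fc (cr f) m = (if m = 0 then of_real (f x) else 0) + (cis (-x) * fc g (m - 1) - fc g m)" for m
 proof -
  have "cr f = (\<lambda>y. of_real (f x) + (cis (-x) * (g y * ek 1 y) - g y))"
   using id by (auto simp: fun_eq_iff qe algebra_simps)
  then have "fc (cr f) m = fc (\<lambda>y. of_real (f x) + (cis (-x) * (g y * ek 1 y) - g y)) m"
   by simp
  also have "... = fc (\<lambda>y. of_real (f x)) m + fc (\<lambda>y. cis (-x) * (g y * ek 1 y) - g y) m"
   by (intro fc_add continuous_intros cg)
  also have "fc (\<lambda>y. cis (-x) * (g y * ek 1 y) - g y) m = fc (\<lambda>y. cis (-x) * (g y * ek 1 y)) m - fc g m"
   by (intro fc_diff continuous_intros cg)
  also have "fc (\<lambda>y. cis (-x) * (g y * ek 1 y)) m = cis (-x) * fc g (m - 1)"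
   using fc_cmult[of "cis (-x)" "\<lambda>y. g y * ek 1 y" m] fc_mult_ek[of g 1 m] by simp
  finally show ?thesis by (simp add: fc_const)
 qed
 have tel: "(\<Sum>m\<in>{- int n..int n}. fc (cr f) m * ek m x)
   = of_real (f x) + (ek (- int n - 1) x * fc g (- int n - 1) - ek (int n) x * fc g (int n))" for n
 proof (induction n)
  case 0
  show ?case by (simp add: coef)
 next
  case (Suc n)
  have S: "{- int (Suc n)..int (Suc n)} = insert (int n + 1) (insert (- int n - 1) {- int n..int n})"
   by auto
  have 1: "(\<Sum>m\<in>{- int (Suc n)..int (Suc n)}. fc (cr f) m * ek m x)
   = fc (cr f) (int n + 1) * ek (int n + 1) x + (fc (cr f) (- int n - 1) * ek (- int n - 1) x
    + (\<Sum>m\<in>{- int n..int n}. fc (cr f) m * ek m x))"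
   unfolding S by (subst sum.insert; simp)+
  have 2: "cis (-x) * ek (int n + 1) x = ek (int n) x" "cis (-x) * ek (- int n - 1) x = ek (- int n - 2) x"
   by (auto simp: cis_mult algebra_simps)
  have 3: "fc (cr f) (int n + 1) * ek (int n + 1) x
    = (cis (-x) * ek (int n + 1) x) * fc g (int n) - ek (int n + 1) x * fc g (int n + 1)"
   by (simp add: coef algebra_simps)
  have 4: "fc (cr f) (- int n - 1) * ek (- int n - 1) x
    = (cis (-x) * ek (- int n - 1) x) * fc g (- int n - 2) - ek (- int n - 1) x * fc g (- int n - 1)"
  proof -
   have "- int n - 1 \<noteq> 0" "- int n - 1 - 1 = - int n - 2" by auto
   then show ?thesis by (simp add: coef algebra_simps)
  qed
  have 5: "- int (Suc n) - 1 = - int n - 2" "int (Suc n) = int n + 1" by auto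
  show ?case
   unfolding 1 3 4 Suc 2 unfolding 5 by (simp add: algebra_simps)
 qed
 have "(\<lambda>n. fc g (int n)) \<longlonglongrightarrow> 0" "(\<lambda>n. fc g (- int n - 1)) \<longlonglongrightarrow> 0"
  by (auto intro!: fc_tendsto_0 cg injI)
 then have "(\<lambda>n. norm (fc g (int n))) \<longlonglongrightarrow> 0" "(\<lambda>n. norm (fc g (- int n - 1))) \<longlonglongrightarrow> 0"
  by (auto simp: tendsto_norm_zero_iff)
 then have "(\<lambda>n. ek (int n) x * fc g (int n)) \<longlonglongrightarrow> 0" "(\<lambda>n. ek (- int n - 1) x * fc g (- int n - 1)) \<longlonglongrightarrow> 0"
  by - (rule tendsto_norm_zero_cancel, simp only: norm_mult norm_cis mult_1)+
 then have "(\<lambda>n. of_real (f x) + (ek (- int n - 1) x * fc g (- int n - 1) - ek (int n) x * fc g (int n)))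
   \<longlonglongrightarrow> of_real (f x) + (0 - 0)"
  by (intro tendsto_intros)
 then show ?thesis by (simp only: tel) simp
qed

lemma fc_deriv:
 assumes per: "periodic_2pi f" and der: "\<And>x. (f has_real_derivative f' x) (at x)"
  and cf': "continuous_on {0..2*pi} f'"
 shows "fc (cr f') m = \<i> * of_int m * fc (cr f) m"
proof -
 have cf: "continuous_on {0..2*pi} f"
  using DERIV_isCont[OF der] by (simp add: continuous_at_imp_continuous_on)
 have "((\<lambda>x. of_real (f' x) * ek (-m) x + of_real (f x) * (\<i> * of_int (-m) * ek (-m) x))
   has_integral (of_real (f (2*pi)) * ek (-m) (2*pi) - of_real (f 0) * ek (-m) 0)) {0..2*pi}"
 proof (rule fundamental_theorem_of_calculus)
  fix x :: real
  have d1: "((\<lambda>x. complex_of_real (f x)) has_vector_derivative of_real (f' x)) (at x within {0..2*pi})"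
   using has_vector_derivative_of_real[of f "f' x" "at x within {0..2*pi}"]
    has_field_derivative_at_within[OF der]
   by (auto simp: has_real_derivative_iff_has_vector_derivative)
  show "((\<lambda>x. of_real (f x) * ek (-m) x) has_vector_derivative
    of_real (f' x) * ek (-m) x + of_real (f x) * (\<i> * of_int (-m) * ek (-m) x)) (at x within {0..2*pi})"
   using has_vector_derivative_mult[OF d1 ek_has_vector_derivative[of "-m"]]
   by (simp add: add.commute)
 qed auto
 moreover have "of_real (f (2*pi)) * ek (-m) (2*pi) - of_real (f 0) * ek (-m) 0 = 0"
  using per[unfolded periodic_2pi_def, rule_format, of 0] ek_2pi[of "-m"] by simp
 ultimately have "integral {0..2*pi} (\<lambda>x. of_real (f' x) * ek (-m) x + of_real (f x) * (\<i> * of_int (-m) * ek (-m) x)) = 0"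
  by (simp add: integral_unique)
 moreover have "integral {0..2*pi} (\<lambda>x. of_real (f' x) * ek (-m) x + of_real (f x) * (\<i> * of_int (-m) * ek (-m) x))
   = integral {0..2*pi} (\<lambda>x. of_real (f' x) * ek (-m) x) + integral {0..2*pi} (\<lambda>x. of_real (f x) * (\<i> * of_int (-m) * ek (-m) x))"
  by (intro integral_add integrable_continuous_real continuous_intros continuous_on_of_real cf cf')
 moreover have "integral {0..2*pi} (\<lambda>x. of_real (f x) * (\<i> * of_int (-m) * ek (-m) x))
   = (\<i> * of_int (-m)) * integral {0..2*pi} (\<lambda>x. of_real (f x) * ek (-m) x)"
  by (subst integral_mult_right[symmetric]) (simp add: mult_ac)
 ultimately have "integral {0..2*pi} (\<lambda>x. of_real (f' x) * ek (-m) x)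
   = \<i> * of_int m * integral {0..2*pi} (\<lambda>x. of_real (f x) * ek (-m) x)"
  by (simp add: add_eq_0_iff)
 then show ?thesis by (simp add: fc_def)
qed

lemma integral_periodic_shift:
 fixes F :: "real => complex"
 assumes c: "continuous_on UNIV F" and per: "\<And>x. F (x + 2*pi) = F x" and d: "0 \<le> d" "d \<le> 2*pi"
 shows "integral {0..2*pi} (\<lambda>x. F (x + d)) = integral {0..2*pi} F"
proof -
 have c': "continuous_on S F" for S using c continuous_on_subset by blast
 have i: "F integrable_on {u..v}" for u v by (rule integrable_continuous_real[OF c'])
 have "integral {0..2*pi} (\<lambda>x. F (x + d)) = integral {0 + d..2*pi + d} F"
  using integral_shift[of 0 d "2*pi" F] c' by (simp add: o_def)
 also have "... = integral {d..2*pi} F + integral {2*pi..2*pi + d} F"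
  using d Henstock_Kurzweil_Integration.integral_combine[OF _ _ i, of d "2*pi" "2*pi + d"] by simp
 also have "integral {2*pi..2*pi + d} F = integral {0..d} F"
 proof -
  have "integral {0..d} (F \<circ> (\<lambda>x. x + 2*pi)) = integral {0 + 2*pi..d + 2*pi} F"
   by (rule integral_shift[OF c'])
  moreover have "F \<circ> (\<lambda>x. x + 2*pi) = F" by (simp add: fun_eq_iff per)
  ultimately show ?thesis by (simp add: add.commute)
 qed
 also have "integral {d..2*pi} F + integral {0..d} F = integral {0..2*pi} F"
  using d Henstock_Kurzweil_Integration.integral_combine[OF _ _ i, of 0 d "2*pi"] by (simp add: add.commute)
 finally show ?thesis .
qed

text \<open>
 A Lipschitz function has a square integrable derivative; Bessel's inequality for the difference
 quotients expresses this without differentiating.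
\<close>
lemma lipschitz_fourier_bound:
 assumes per: "periodic_2pi f" and lip: "\<And>x y. \<bar>f x - f y\<bar> \<le> K * \<bar>x - y\<bar>" and A: "finite A"
 shows "(\<Sum>m\<in>A. (of_int m)^2 * (cmod (fc (cr f) m))^2) \<le> K^2"
proof -
 have K: "K \<ge> 0" using lip[of 1 0] by simp
 have cf: "continuous_on UNIV f"
 proof (rule lipschitz_on_continuous_on)
  show "K-lipschitz_on UNIV f" using lip K by (auto simp: lipschitz_on_def dist_real_def)
 qed
 have cfS: "continuous_on S f" for S using cf continuous_on_subset by blast
 have cs: "continuous_on S (\<lambda>x. f (x + d))" for S d
  by (rule continuous_on_compose2[OF cf]) (auto intro!: continuous_intros)
 have sh: "fc (cr (\<lambda>x. f (x + d))) m = cis (of_int m * d) * fc (cr f) m" if "0 \<le> d" "d \<le> 2*pi" for d m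
 proof -
  have "integral {0..2*pi} (\<lambda>x. of_real (f (x + d)) * ek (-m) (x + d)) = integral {0..2*pi} (\<lambda>x. of_real (f x) * ek (-m) x)"
   using per by (intro integral_periodic_shift[where F = "\<lambda>x. of_real (f x) * ek (-m) x"] that continuous_intros continuous_on_of_real cf)
    (auto simp: periodic_2pi_def ek_periodic[of "-m", simplified])
  moreover have "(\<lambda>x. of_real (f (x + d)) * ek (-m) (x + d)) = (\<lambda>x. cis (- (of_int m * d)) * (of_real (f (x + d)) * ek (-m) x))"
   by (simp add: fun_eq_iff cis_mult algebra_simps)
  ultimately have e: "cis (- (of_int m * d)) * integral {0..2*pi} (\<lambda>x. of_real (f (x + d)) * ek (-m) x) = integral {0..2*pi} (\<lambda>x. of_real (f x) * ek (-m) x)"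
   by simp
  have "cis (of_int m * d) * integral {0..2*pi} (\<lambda>x. of_real (f x) * ek (-m) x)
    = (cis (of_int m * d) * cis (- (of_int m * d))) * integral {0..2*pi} (\<lambda>x. of_real (f (x + d)) * ek (-m) x)"
   by (simp only: e[symmetric] mult.assoc)
  then show ?thesis by (simp add: fc_def cis_mult)
 qed
 have main: "(\<Sum>m\<in>A. (cmod ((cis (of_int m * d) - 1) / of_real d))^2 * (cmod (fc (cr f) m))^2) \<le> K^2"
  if d: "0 < d" "d < 2*pi" for d
 proof -
  define g where "g = (\<lambda>x. (f (x + d) - f x) / d)"
  have "fc (cr g) m = ((cis (of_int m * d) - 1) / of_real d) * fc (cr f) m" for m
  proof -
   have "cr g = (\<lambda>x. (1 / of_real d) * (of_real (f (x + d)) - of_real (f x)))"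
    by (simp add: g_def fun_eq_iff)
   then have "fc (cr g) m = (1 / of_real d) * fc (\<lambda>x. of_real (f (x + d)) - of_real (f x)) m"
    by (simp only: fc_cmult)
   also have "fc (\<lambda>x. of_real (f (x + d)) - of_real (f x)) m = fc (cr (\<lambda>x. f (x + d))) m - fc (cr f) m"
    by (intro fc_diff continuous_intros continuous_on_of_real cs cfS)
   also have "... = (cis (of_int m * d) - 1) * fc (cr f) m"
    using sh[of d m] d by (simp add: algebra_simps)
   finally show ?thesis by simp
  qed
  moreover have "(\<Sum>m\<in>A. (cmod (fc (cr g) m))^2) \<le> K^2"
  proof (rule bessel_bounded[OF A])
   show "continuous_on {0..2*pi} g"
    unfolding g_def using d by (intro continuous_intros cs cfS) auto
   show "\<bar>g x\<bar> \<le> K" for x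
    using lip[of "x + d" x] d by (simp add: g_def abs_divide divide_simps)
  qed
  ultimately show ?thesis by (simp only: norm_mult power_mult_distrib)
 qed
 have lim: "((\<lambda>d. (cmod ((cis (of_int m * d) - 1) / of_real d))^2) \<longlongrightarrow> (of_int m)^2) (at_right 0)" for m
 proof -
  have "((\<lambda>d::real. cos (of_int m * d)) has_real_derivative 0) (at 0)" "((\<lambda>d::real. sin (of_int m * d)) has_real_derivative of_int m) (at 0)"
   by (auto intro!: derivative_eq_intros)
  then have "((\<lambda>d::real. (cos (of_int m * d) - 1) / d) \<longlongrightarrow> 0) (at 0)" "((\<lambda>d::real. sin (of_int m * d) / d) \<longlongrightarrow> of_int m) (at 0)"
   by (simp_all add: has_field_derivative_iff)
  then have "((\<lambda>d::real. ((cos (of_int m * d) - 1) / d)^2 + (sin (of_int m * d) / d)^2) \<longlongrightarrow> 0^2 + (of_int m)^2) (at 0)"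
   by (intro tendsto_intros)
  moreover have "(cmod ((cis (of_int m * d) - 1) / of_real d))^2 = ((cos (of_int m * d) - 1) / d)^2 + (sin (of_int m * d) / d)^2" for d
   by (simp add: cmod_power2 Re_divide_of_real Im_divide_of_real)
  ultimately show ?thesis
   by (simp add: filterlim_at_split)
 qed
 show ?thesis
 proof (rule tendsto_upperbound)
  show "((\<lambda>d. \<Sum>m\<in>A. (cmod ((cis (of_int m * d) - 1) / of_real d))^2 * (cmod (fc (cr f) m))^2)
    \<longlongrightarrow> (\<Sum>m\<in>A. (of_int m)^2 * (cmod (fc (cr f) m))^2)) (at_right 0)"
   by (intro tendsto_intros lim)
  show "\<forall>\<^sub>F d in at_right 0. (\<Sum>m\<in>A. (cmod ((cis (of_int m * d) - 1) / of_real d))^2 * (cmod (fc (cr f) m))^2) \<le> K^2"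
   using eventually_at_right_real[of 0 "2*pi"] by (rule eventually_mono) (auto intro!: main)
 qed simp
qed

section \<open>Periodic functions with bounded derivatives\<close>

text \<open>One constant for all derivatives up to order \<open>k\<close> keeps explicit constants manageable: products and sums
 of such functions are of the same kind.\<close>
primrec Cb :: "nat => real => (real => real) => bool" where
 "Cb 0 M f \<longleftrightarrow> periodic_2pi f \<and> (\<forall>x. \<bar>f x\<bar> \<le> M) \<and> continuous_on UNIV f"
| "Cb (Suc k) M f \<longleftrightarrow> periodic_2pi f \<and> (\<forall>x. \<bar>f x\<bar> \<le> M) \<and>
   (\<exists>f'. (\<forall>x. (f has_real_derivative f' x) (at x)) \<and> Cb k M f')"

lemma Cb_bound: "Cb k M f ==> \<bar>f x\<bar> \<le> M"
 by (cases k) auto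

lemma Cb_periodic: "Cb k M f ==> periodic_2pi f"
 by (cases k) auto

lemma Cb_nonneg: "Cb k M f ==> 0 \<le> M"
 using Cb_bound[of k M f 0] by linarith

lemma Cb_continuous: "Cb k M f ==> continuous_on S f"
proof (cases k)
 case (Suc j)
 assume "Cb k M f"
 then obtain f' where "\<And>x. (f has_real_derivative f' x) (at x)" using Suc by auto
 then show ?thesis by (meson DERIV_isCont continuous_at_imp_continuous_on)
qed (auto intro: continuous_on_subset)

lemma Cb_SucD: "Cb (Suc k) M f ==> Cb k M f"
proof (induction k arbitrary: f)
 case 0
 then show ?case using Cb_continuous[OF 0] by auto
next
 case (Suc k)
 then obtain f' where "\<And>x. (f has_real_derivative f' x) (at x)" "Cb (Suc k) M f'" by auto
 then show ?case using Suc by auto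
qed

lemma Cb_le: "Cb k M f ==> j \<le> k ==> Cb j M f"
 by (induction k) (auto simp: le_Suc_eq dest: Cb_SucD simp del: Cb.simps)

lemma Cb_add: "Cb k M f ==> Cb k M' g ==> Cb k (M + M') (\<lambda>x. f x + g x)"
proof (induction k arbitrary: f g)
 case 0
 then show ?case
  by (auto simp: periodic_2pi_def intro!: continuous_intros order_trans[OF abs_triangle_ineq] add_mono)
next
 case (Suc k)
 from Suc.prems obtain f' g' where f': "\<And>x. (f has_real_derivative f' x) (at x)" "Cb k M f'"
  and g': "\<And>x. (g has_real_derivative g' x) (at x)" "Cb k M' g'" by auto
 have "\<forall>x. ((\<lambda>x. f x + g x) has_real_derivative f' x + g' x) (at x)"
  using f' g' by (auto intro!: derivative_eq_intros)
 with Suc.IH[OF f'(2) g'(2)] Suc.prems show ?case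
  by (auto simp: periodic_2pi_def intro!: order_trans[OF abs_triangle_ineq] add_mono)
qed

lemma Cb_cmult: "Cb k M f ==> Cb k (\<bar>c\<bar> * M) (\<lambda>x. c * f x)"
proof (induction k arbitrary: f)
 case 0
 then show ?case
  by (auto simp: periodic_2pi_def abs_mult intro!: continuous_intros mult_left_mono)
next
 case (Suc k)
 from Suc.prems obtain f' where f': "\<And>x. (f has_real_derivative f' x) (at x)" "Cb k M f'" by auto
 have "\<forall>x. ((\<lambda>x. c * f x) has_real_derivative c * f' x) (at x)"
  using f' by (auto intro!: derivative_eq_intros)
 with Suc.IH[OF f'(2)] Suc.prems show ?case
  by (auto simp: periodic_2pi_def abs_mult intro!: mult_left_mono)
qed

lemma Cb_mult: "Cb k M f ==> Cb k M' g ==> Cb k (2^k * (M * M')) (\<lambda>x. f x * g x)"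
proof (induction k arbitrary: f g)
 case 0
 then show ?case
  by (auto simp: periodic_2pi_def abs_mult intro!: continuous_intros mult_mono' )
next
 case (Suc k)
 have MM: "M \<ge> 0" "M' \<ge> 0" using Cb_nonneg Suc.prems by blast+
 from Suc.prems obtain f' g' where f': "\<And>x. (f has_real_derivative f' x) (at x)" "Cb k M f'"
  and g': "\<And>x. (g has_real_derivative g' x) (at x)" "Cb k M' g'" by auto
 have der: "\<forall>x. ((\<lambda>x. f x * g x) has_real_derivative f' x * g x + f x * g' x) (at x)"
  using f' g' by (auto intro!: derivative_eq_intros)
 have "Cb k (2^k * (M * M') + 2^k * (M * M')) (\<lambda>x. f' x * g x + f x * g' x)"
  using Suc.prems by (intro Cb_add Suc.IH f' g' Cb_SucD[of k])
 moreover have "2^k * (M * M') + 2^k * (M * M') = 2 ^ Suc k * (M * M')" by simp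
 ultimately have cb: "Cb k (2 ^ Suc k * (M * M')) (\<lambda>x. f' x * g x + f x * g' x)" by (simp only:)
 have bd: "\<forall>x. \<bar>f x * g x\<bar> \<le> 2 ^ Suc k * (M * M')"
 proof
  fix x
  have "\<bar>f x * g x\<bar> \<le> M * M'"
   unfolding abs_mult using Cb_bound[OF Suc.prems(1)] Cb_bound[OF Suc.prems(2)] MM
   by (intro mult_mono) auto
  also have "... \<le> 2 ^ Suc k * (M * M')"
   using mult_right_mono[OF one_le_power[of "2::real" "Suc k"], of "M * M'"] MM by simp
  finally show "\<bar>f x * g x\<bar> \<le> 2 ^ Suc k * (M * M')" .
 qed
 have per: "periodic_2pi (\<lambda>x. f x * g x)"
  using Cb_periodic[OF Suc.prems(1)] Cb_periodic[OF Suc.prems(2)] by (simp add: periodic_2pi_def)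
 show ?case
  unfolding Cb.simps(2) by (intro conjI per bd exI[of _ "\<lambda>x. f' x * g x + f x * g' x"] der cb)
qed

lemma Cb_l2:
 "Cb k M f ==> finite A ==> (\<Sum>m\<in>A. (of_int m)^(2*k) * (cmod (fc (cr f) m))^2) \<le> M^2"
proof (induction k arbitrary: f)
 case 0
 show ?case
  using bessel_bounded[OF 0(2) Cb_continuous[OF 0(1)] Cb_bound[OF 0(1)]] by simp
next
 case (Suc k)
 then obtain f' where f': "\<And>x. (f has_real_derivative f' x) (at x)" "Cb k M f'" by auto
 have "fc (cr f') m = \<i> * of_int m * fc (cr f) m" for m
  using fc_deriv[OF Cb_periodic[OF Suc.prems(1)] f'(1) Cb_continuous[OF f'(2)]] .
 then have "(cmod (fc (cr f') m))^2 = (of_int m)^2 * (cmod (fc (cr f) m))^2" for m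
  by (simp add: norm_mult power_mult_distrib)
 then have "(of_int m)^(2*Suc k) * (cmod (fc (cr f) m))^2 = (of_int m)^(2*k) * (cmod (fc (cr f') m))^2" for m
  by (simp add: power2_eq_square mult_ac)
 then show ?case using Suc.IH[OF f'(2) Suc.prems(2)] by (simp only:)
qed

text \<open>A Sobolev seminorm of order \<open>S\<close> on coefficient sequences, stated through finite partial sums,
 so that bounds pass to limits term by term.\<close>
definition sob :: "nat => real => (int => complex) => bool" where
 "sob S K c \<longleftrightarrow> (\<forall>A. finite A \<longrightarrow> (\<Sum>m\<in>A. (of_int m)^(2*S) * (cmod (c m))^2) \<le> K^2)"

lemma Cb_sob: "Cb k M f ==> sob k M (fc (cr f))"
 unfolding sob_def using Cb_l2 by blast

lemma sob_mono: "sob S K c ==> 0 \<le> K ==> K \<le> K' ==> sob S K' c"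
 unfolding sob_def by (meson order_trans power_mono)

lemma inverse_squares_bound:
 assumes "finite A" "0 \<notin> A"
 shows "(\<Sum>m\<in>A. 1 / (of_int m)^2) \<le> (4::real)"
proof -
 have suc: "(\<Sum>k=1..Suc n. 1 / (real k)^2) \<le> 2 - 1 / real (Suc n)" for n
 proof (induction n)
  case (Suc n)
  have "1 / (real (Suc (Suc n)))^2 \<le> 1 / real (Suc n) - 1 / real (Suc (Suc n))"
  proof -
   have "1 / real (Suc n) - 1 / real (Suc (Suc n)) = 1 / (real (Suc n) * real (Suc (Suc n)))"
    by (simp add: divide_simps)
   moreover have "1 / (real (Suc (Suc n)))^2 \<le> 1 / (real (Suc n) * real (Suc (Suc n)))"
    unfolding power2_eq_square by (intro divide_left_mono mult_right_mono mult_pos_pos) auto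
   ultimately show ?thesis by simp
  qed
  then show ?case using Suc by simp
 qed simp
 have pos: "(\<Sum>k=1..n. 1 / (real k)^2) \<le> 2" for n
 proof (cases n)
  case (Suc l)
  have "0 \<le> 1 / real (Suc l)" by simp
  then show ?thesis using suc[of l] unfolding Suc by linarith
 qed simp
 obtain n where n: "A \<subseteq> {- int n..int n}"
 proof -
  obtain B where B: "\<And>m. m \<in> A ==> \<bar>m\<bar> \<le> B"
   using finite_imageI[OF assms(1), of abs] by (metis Max_ge imageI)
  show thesis by (rule that[of "nat B"]) (use B in fastforce)
 qed
 have "(\<Sum>m\<in>A. 1 / (of_int m)^2) \<le> (\<Sum>m\<in>int ` {1..n} \<union> (\<lambda>k. - int k) ` {1..n}. 1 / (of_int m)^2 :: real)"
 proof (rule sum_mono2)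
  show "A \<subseteq> int ` {1..n} \<union> (\<lambda>k. - int k) ` {1..n}"
  proof
   fix m assume "m \<in> A"
   then have "m \<noteq> 0" "- int n \<le> m" "m \<le> int n" using n assms(2) by auto
   then have "m = int (nat m) \<and> nat m \<in> {1..n} \<or> m = - int (nat (-m)) \<and> nat (-m) \<in> {1..n}" by auto
   then show "m \<in> int ` {1..n} \<union> (\<lambda>k. - int k) ` {1..n}" by blast
  qed
 qed auto
 also have "... = (\<Sum>m\<in>int ` {1..n}. 1 / (of_int m)^2) + (\<Sum>m\<in>(\<lambda>k. - int k) ` {1..n}. 1 / (of_int m)^2)"
  by (rule sum.union_disjoint) auto
 also have "... = 2 * (\<Sum>k=1..n. 1 / (real k)^2)"
  by (simp add: sum.reindex inj_on_def)
 also have "... \<le> 4" using pos[of n] by simp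
 finally show ?thesis .
qed

text \<open>One order of decay is spent on the convergence of \<open>\<Sum>1 / m^2\<close>, through the Cauchy-Schwarz inequality.\<close>
lemma sob_l1:
 assumes "sob S K c" "0 \<le> K" "finite A" "0 \<notin> A" "j < S"
 shows "(\<Sum>m\<in>A. \<bar>of_int m\<bar>^j * cmod (c m)) \<le> 2 * K"
proof -
 have "(\<Sum>m\<in>A. \<bar>of_int m\<bar>^j * cmod (c m)) \<le> (\<Sum>m\<in>A. \<bar>1 / of_int m\<bar> * \<bar>of_int m ^ S * cmod (c m)\<bar>)"
 proof (rule sum_mono)
  fix m assume "m \<in> A"
  then have m: "\<bar>real_of_int m\<bar> \<ge> 1" using assms(4) by (cases "m = 0") auto
  have "\<bar>real_of_int m\<bar>^j = 1 / \<bar>of_int m\<bar> * \<bar>of_int m\<bar>^(Suc j)"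
   using m by (auto simp: field_simps)
  also have "... \<le> 1 / \<bar>of_int m\<bar> * \<bar>of_int m\<bar>^S"
   using m assms(5) by (intro mult_left_mono power_increasing) auto
  finally have "\<bar>real_of_int m\<bar>^j * cmod (c m) \<le> 1 / \<bar>of_int m\<bar> * \<bar>of_int m\<bar>^S * cmod (c m)"
   by (rule mult_right_mono) simp
  then show "\<bar>real_of_int m\<bar>^j * cmod (c m) \<le> \<bar>1 / of_int m\<bar> * \<bar>of_int m ^ S * cmod (c m)\<bar>"
   by (simp add: abs_mult power_abs)
 qed
 also have "... \<le> L2_set (\<lambda>m. 1 / of_int m) A * L2_set (\<lambda>m. of_int m ^ S * cmod (c m)) A"
  by (rule L2_set_mult_ineq)
 also have "... \<le> 2 * K"
 proof (rule mult_mono)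
  have "(\<Sum>m\<in>A. (1 / real_of_int m)^2) \<le> 2^2"
   using inverse_squares_bound[OF assms(3,4)] by (simp add: power_divide)
  then show "L2_set (\<lambda>m. 1 / real_of_int m) A \<le> 2"
   unfolding L2_set_def by (intro real_le_lsqrt) (auto intro: sum_nonneg)
  have "(\<Sum>m\<in>A. (of_int m ^ S * cmod (c m))^2) \<le> K^2"
   using assms(1,3) by (simp add: sob_def power_mult_distrib power_mult[symmetric] mult.commute)
  then show "L2_set (\<lambda>m. of_int m ^ S * cmod (c m)) A \<le> K"
   unfolding L2_set_def using assms(2) by (intro real_le_lsqrt) (auto intro: sum_nonneg)
 qed (auto simp: L2_set_nonneg)
 finally show ?thesis .
qed

lemma sob_tail:
 assumes "sob S K c" "0 \<le> K" "finite A" and R: "R > 0" "\<And>m. m \<in> A ==> \<bar>of_int m\<bar> \<ge> R" and "j + i < S"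
 shows "(\<Sum>m\<in>A. \<bar>of_int m\<bar>^j * cmod (c m)) \<le> 2 * K / R^i"
proof -
 have "R^i * (\<Sum>m\<in>A. \<bar>of_int m\<bar>^j * cmod (c m)) \<le> (\<Sum>m\<in>A. \<bar>of_int m\<bar>^(j+i) * cmod (c m))"
  unfolding sum_distrib_left
 proof (rule sum_mono)
  fix m assume "m \<in> A"
  then have "R^i \<le> \<bar>real_of_int m\<bar>^i" using R by (intro power_mono) auto
  then have "R^i * (\<bar>real_of_int m\<bar>^j * cmod (c m)) \<le> \<bar>real_of_int m\<bar>^i * (\<bar>real_of_int m\<bar>^j * cmod (c m))"
   by (rule mult_right_mono) simp
  then show "R^i * (\<bar>real_of_int m\<bar>^j * cmod (c m)) \<le> \<bar>real_of_int m\<bar>^(j+i) * cmod (c m)"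
   by (simp add: power_add mult_ac)
 qed
 also have "... \<le> 2 * K"
  using assms by (intro sob_l1[of S]) force+
 finally show ?thesis using R(1) by (simp add: field_simps)
qed

text \<open>The symmetric partial sums converge to \<open>f\<close>, and each of them beyond \<open>I\<close> differs from the sum over \<open>I\<close> by at most \<open>E\<close>.\<close>
lemma fourier_truncation:
 assumes "periodic_2pi f" "\<And>x. (f has_real_derivative f' x) (at x)" "finite I"
  and E: "\<And>A. finite A ==> A \<inter> I = {} ==> (\<Sum>m\<in>A. cmod (fc (cr f) m)) \<le> E"
 shows "cmod (of_real (f x) - (\<Sum>m\<in>I. fc (cr f) m * ek m x)) \<le> E"
proof -
 have "(\<lambda>n. cmod ((\<Sum>m\<in>{- int n..int n}. fc (cr f) m * ek m x) - (\<Sum>m\<in>I. fc (cr f) m * ek m x)))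
   \<longlonglongrightarrow> cmod (of_real (f x) - (\<Sum>m\<in>I. fc (cr f) m * ek m x))"
  by (intro tendsto_intros fourier_inversion[OF assms(1,2)])
 moreover obtain B where B: "\<And>m. m \<in> I ==> \<bar>m\<bar> \<le> B"
  using finite_imageI[OF assms(3), of abs] by (metis Max_ge imageI)
 have "cmod ((\<Sum>m\<in>{- int n..int n}. fc (cr f) m * ek m x) - (\<Sum>m\<in>I. fc (cr f) m * ek m x)) \<le> E"
  if "n \<ge> nat B" for n
 proof -
  have sub: "I \<subseteq> {- int n..int n}" using B that by fastforce
  have "(\<Sum>m\<in>{- int n..int n}. fc (cr f) m * ek m x) - (\<Sum>m\<in>I. fc (cr f) m * ek m x)
    = (\<Sum>m\<in>{- int n..int n} - I. fc (cr f) m * ek m x)"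
   by (subst sum.subset_diff[OF sub]) auto
  also have "cmod ... \<le> (\<Sum>m\<in>{- int n..int n} - I. cmod (fc (cr f) m * ek m x))"
   by (rule norm_sum)
  also have "... \<le> E"
   using E[of "{- int n..int n} - I"] by (auto simp: norm_mult)
  finally show ?thesis .
 qed
 ultimately show ?thesis
  by (intro Lim_bounded[where M = "nat B"]) auto
qed

lemma norm_cis_diff: "cmod (cis a - cis b) \<le> \<bar>a - b\<bar>"
proof -
 have "cis a - cis b = cis b * (cis (a - b) - 1)"
  by (simp add: algebra_simps cis_mult)
 then have "cmod (cis a - cis b) = cmod (cis (a - b) - 1)"
  by (simp add: norm_mult)
 also have "(cmod (cis (a - b) - 1))^2 = (2 * sin ((a - b) / 2))^2"
 proof -
  have "(cmod (cis (a - b) - 1))^2 = (cos (a-b) - 1)^2 + (sin (a-b))^2"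
   by (simp add: cmod_power2)
  also have "... = (cos (a-b))^2 + (sin (a-b))^2 + 1 - 2 * cos (a-b)"
   by (simp add: power2_diff)
  also have "... = 2 - 2 * cos (2 * ((a - b) / 2))"
  proof -
   have e: "2 * ((a - b) / 2) = a - b" by simp
   show ?thesis unfolding e using sin_cos_squared_add2[of "a - b"] by simp
  qed
  also have "... = (2 * sin ((a - b) / 2))^2"
   by (subst cos_double_sin) (simp add: power_mult_distrib)
  finally show ?thesis .
 qed
 then have "cmod (cis (a - b) - 1) = \<bar>2 * sin ((a - b) / 2)\<bar>"
  by (metis norm_ge_zero real_sqrt_abs real_sqrt_unique)
 also have "... \<le> \<bar>a - b\<bar>"
  using abs_sin_x_le_abs_x[of "(a - b) / 2"] by (simp add: abs_mult)
 finally show ?thesis .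
qed

lemma fourier_lipschitz:
 assumes "periodic_2pi f" "\<And>x. (f has_real_derivative f' x) (at x)"
  and E: "\<And>A. finite A ==> (\<Sum>m\<in>A. \<bar>of_int m\<bar> * cmod (fc (cr f) m)) \<le> E"
 shows "\<bar>f x - f y\<bar> \<le> E * \<bar>x - y\<bar>"
proof -
 have "(\<lambda>n. cmod ((\<Sum>m\<in>{- int n..int n}. fc (cr f) m * ek m x) - (\<Sum>m\<in>{- int n..int n}. fc (cr f) m * ek m y)))
   \<longlonglongrightarrow> cmod (of_real (f x) - of_real (f y))"
  by (intro tendsto_intros fourier_inversion[OF assms(1,2)])
 moreover have "cmod ((\<Sum>m\<in>A. fc (cr f) m * ek m x) - (\<Sum>m\<in>A. fc (cr f) m * ek m y)) \<le> E * \<bar>x - y\<bar>" if "finite A" for A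
 proof -
  have "cmod ((\<Sum>m\<in>A. fc (cr f) m * ek m x) - (\<Sum>m\<in>A. fc (cr f) m * ek m y))
    = cmod (\<Sum>m\<in>A. fc (cr f) m * (ek m x - ek m y))"
   by (simp add: sum_subtractf algebra_simps)
  also have "... \<le> (\<Sum>m\<in>A. cmod (fc (cr f) m * (ek m x - ek m y)))"
   by (rule norm_sum)
  also have "... \<le> (\<Sum>m\<in>A. (\<bar>of_int m\<bar> * cmod (fc (cr f) m)) * \<bar>x - y\<bar>)"
  proof (rule sum_mono)
   fix m
   have "cmod (ek m x - ek m y) \<le> \<bar>of_int m\<bar> * \<bar>x - y\<bar>"
    using norm_cis_diff[of "of_int m * x" "of_int m * y"] by (simp add: right_diff_distrib[symmetric] abs_mult)
   then show "cmod (fc (cr f) m * (ek m x - ek m y)) \<le> (\<bar>of_int m\<bar> * cmod (fc (cr f) m)) * \<bar>x - y\<bar>"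
    using mult_left_mono[of "cmod (ek m x - ek m y)" "\<bar>of_int m\<bar> * \<bar>x - y\<bar>" "cmod (fc (cr f) m)"]
    by (simp add: norm_mult mult_ac)
  qed
  also have "... \<le> E * \<bar>x - y\<bar>"
   unfolding sum_distrib_right[symmetric] by (rule mult_right_mono[OF E[OF that]]) simp
  finally show ?thesis .
 qed
 ultimately have "cmod (of_real (f x) - of_real (f y)) \<le> E * \<bar>x - y\<bar>"
  by (intro Lim_bounded[where M = 0]) auto
 then show ?thesis
  by (simp only: of_real_diff[symmetric] norm_of_real)
qed

lemma deriv_le_lipschitz:
 assumes "(f has_real_derivative d) (at x)" "\<And>y. \<bar>f y - f x\<bar> \<le> E * \<bar>y - x\<bar>"
 shows "\<bar>d\<bar> \<le> E"
proof -
 have "((\<lambda>y. \<bar>(f y - f x) / (y - x)\<bar>) \<longlongrightarrow> \<bar>d\<bar>) (at x)"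
  using assms(1) by (intro tendsto_rabs) (simp add: has_field_derivative_iff)
 moreover have "eventually (\<lambda>y. \<bar>(f y - f x) / (y - x)\<bar> \<le> E) (at x)"
  using eventually_neq_at_within[of x]
  by eventually_elim (use assms(2) in \<open>simp add: abs_divide divide_simps\<close>)
 ultimately show ?thesis
  using tendsto_upperbound[OF _ _ trivial_limit_at] by blast
qed

section \<open>The spaces \<open>C_per\<close>\<close>

definition per_smooth :: "nat => (real => real) => bool" where
 "per_smooth p f \<longleftrightarrow> (\<forall>j\<le>p. periodic_2pi ((deriv ^^ j) f) \<and> continuous_on UNIV ((deriv ^^ j) f)) \<and>
   (\<forall>j<p. \<forall>x. ((deriv ^^ j) f has_real_derivative (deriv ^^ Suc j) f x) (at x))"

lemma periodic_2pi_int: "periodic_2pi f ==> f (x + 2 * pi * of_int n) = f x"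
proof (induction n rule: int_induct[where k = 0])
 case (step1 i)
 then have "f ((x + 2*pi * of_int i) + 2*pi) = f x" by (simp add: periodic_2pi_def)
 then show ?case by (simp add: algebra_simps)
next
 case (step2 i)
 then have "f ((x + 2*pi * of_int (i - 1)) + 2*pi) = f (x + 2*pi * of_int (i - 1))" by (simp add: periodic_2pi_def)
 then show ?case using step2 by (simp add: algebra_simps)
qed simp

lemma reduce_2pi: obtains n :: int and y :: real where "x = y + 2 * pi * of_int n" "0 \<le> y" "y < 2 * pi"
proof
 define n where "n = \<lfloor>x / (2*pi)\<rfloor>"
 show "x = (x - 2*pi * of_int n) + 2*pi * of_int n" by simp
 have "of_int n \<le> x / (2*pi)" "x / (2*pi) < of_int n + 1" unfolding n_def by linarith+
 then have "of_int n * (2*pi) \<le> x" "x < (of_int n + 1) * (2*pi)"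
  by (simp_all only: pos_le_divide_eq pos_divide_less_eq pi_gt_zero zero_less_mult_iff zero_less_numeral simp_thms)
 then show "0 \<le> x - 2*pi * of_int n" "x - 2*pi * of_int n < 2*pi"
  by (simp_all add: algebra_simps)
qed

lemma lipschitz_periodic_extend:
 assumes per: "periodic_2pi f" and lip: "\<And>x y. x \<in> {0..2*pi} ==> y \<in> {0..2*pi} ==> \<bar>f x - f y\<bar> \<le> B * \<bar>x - y\<bar>"
 shows "\<bar>f x - f y\<bar> \<le> B * \<bar>x - y\<bar>"
proof -
 have B: "B \<ge> 0"
 proof -
  have "0 \<le> \<bar>f 1 - f 0\<bar>" by simp
  also have "... \<le> B * \<bar>1 - 0\<bar>" using pi_gt3 by (intro lip) auto
  finally show ?thesis by simp
 qed
 have main: "\<bar>f x - f y\<bar> \<le> B * \<bar>x - y\<bar>" if "x \<le> y" for x y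
 proof -
  obtain n x0 where x0: "x = x0 + 2*pi * of_int n" "0 \<le> x0" "x0 < 2*pi" by (rule reduce_2pi)
  define y0 where "y0 = y - 2*pi * of_int n"
  have fx: "f x = f x0" "f y = f y0" "y - x = y0 - x0" "x0 \<le> y0"
   using periodic_2pi_int[OF per, of x0 n] periodic_2pi_int[OF per, of y0 n] x0 that by (auto simp: y0_def)
  consider "y0 \<le> 2*pi" | "2*pi < y0" "y0 - 2*pi \<le> x0" | "x0 < y0 - 2*pi" by linarith
  then have "\<bar>f x0 - f y0\<bar> \<le> B * (y0 - x0)"
  proof cases
   case 1
   then show ?thesis using lip[of x0 y0] x0 fx by auto
  next
   case 2
   have "f y0 = f (y0 - 2*pi)" "f (2*pi) = f 0"
    using per by (metis periodic_2pi_def diff_add_cancel, metis periodic_2pi_def add_0)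
   moreover have "\<bar>f x0 - f (2*pi)\<bar> \<le> B * (2*pi - x0)" using lip[of x0 "2*pi"] x0 by auto
   moreover have "\<bar>f (y0 - 2*pi) - f 0\<bar> \<le> B * (y0 - 2*pi)" using lip[of "y0 - 2*pi" 0] x0 2 by auto
   ultimately show ?thesis by (simp add: algebra_simps)
  next
   case 3
   obtain k z where z: "y0 = z + 2*pi * of_int k" "0 \<le> z" "z < 2*pi" by (rule reduce_2pi)
   have "\<bar>f x0 - f z\<bar> \<le> B * \<bar>x0 - z\<bar>" using lip[of x0 z] x0 z by auto
   also have "... \<le> B * (y0 - x0)" using B 3 x0 z by (intro mult_left_mono) auto
   finally show ?thesis using periodic_2pi_int[OF per, of z k] z by simp
  qed
  then show ?thesis using fx \<open>x \<le> y\<close> by simp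
 qed
 show ?thesis
  using main[of x y] main[of y x] by (cases "x \<le> y") (auto simp: abs_minus_commute)
qed

lemma bounded_variation_bounded:
 assumes "bounded_variation_on 0 (2*pi) g"
 obtains B where "\<And>x. x \<in> {0..2*pi} ==> \<bar>g x\<bar> \<le> B"
proof -
 obtain M where M: "\<And>(n::nat) (x :: nat => real). mono x ==> range x \<subseteq> {0..2*pi} ==>
    (\<Sum>i<n. \<bar>g (x (Suc i)) - g (x i)\<bar>) \<le> M"
  using assms unfolding bounded_variation_on_def by blast
 show thesis
 proof
  fix x :: real assume x: "x \<in> {0..2*pi}"
  define s where "s = (\<lambda>i::nat. if i = 0 then 0 else x)"
  have "mono s" "range s \<subseteq> {0..2*pi}" using x by (auto simp: s_def mono_def)
  from M[OF this, of 1] have "\<bar>g x - g 0\<bar> \<le> M" by (simp add: s_def)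
  then show "\<bar>g x\<bar> \<le> M + \<bar>g 0\<bar>" by linarith
 qed
qed

lemma lipschitz_of_integral:
 fixes g g' :: "real => real"
 assumes I: "\<And>x. x \<in> {0..2*pi} ==> (g' has_integral (g x - g 0)) {0..x}"
  and B: "\<And>x. x \<in> {0..2*pi} ==> \<bar>g' x\<bar> \<le> B" and xy: "x \<in> {0..2*pi}" "y \<in> {0..2*pi}"
 shows "\<bar>g x - g y\<bar> \<le> B * \<bar>x - y\<bar>"
proof -
 have main: "\<bar>g x - g y\<bar> \<le> B * \<bar>x - y\<bar>" if xy: "x \<in> {0..2*pi}" "y \<in> {0..2*pi}" "x \<le> y" for x y
 proof -
  have iy: "g' integrable_on {0..y}" using I[OF xy(2)] by blast
  have ixy: "g' integrable_on {x..y}" using integrable_on_subinterval[OF iy] xy by auto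
  have "integral {0..x} g' + integral {x..y} g' = integral {0..y} g'"
   using xy by (intro Henstock_Kurzweil_Integration.integral_combine iy) auto
  then have "integral {x..y} g' = g y - g x"
   using I[OF xy(1)] I[OF xy(2)] by (simp add: integral_unique)
  then have "(g' has_integral (g y - g x)) {x..y}" using ixy by (simp add: has_integral_integral)
  moreover have "B \<ge> 0" using B[of 0] by auto
  ultimately have "norm (g y - g x) \<le> B * (y - x)"
   using has_integral_bound[of B g' "g y - g x" x y] B xy by auto
  then show ?thesis using xy by (simp add: abs_minus_commute)
 qed
 show ?thesis
  using main[of x y] main[of y x] xy by (cases "x \<le> y") (auto simp: abs_minus_commute)
qed

text \<open>The fundamental theorem of calculus on one period; periodicity of the derivative is what makes it hold at the
 end points \<open>0\<close> and \<open>2 * pi\<close> too.\<close>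
lemma derivative_of_integral_periodic:
 fixes g g' :: "real => real"
 assumes I: "\<And>x. x \<in> {0..2*pi} ==> (g' has_integral (g x - g 0)) {0..x}"
  and c: "continuous_on UNIV g'" and per: "periodic_2pi g" "periodic_2pi g'"
 shows "(g has_real_derivative g' x) (at x)"
proof -
 have within: "(g has_real_derivative g' y) (at y within {0..2*pi})" if "y \<in> {0..2*pi}" for y
 proof -
  have "((\<lambda>x. integral {0..x} g' + g 0) has_real_derivative g' y + 0) (at y within {0..2*pi})"
   using c that by (intro DERIV_add integral_has_real_derivative DERIV_const) (auto intro: continuous_on_subset)
  then show ?thesis
   using that integral_unique[OF I]
   by (auto intro!: has_field_derivative_transform_within[where d = 1 and g = g])
 qed
 have at: "(g has_real_derivative g' y) (at y)" if "0 \<le> y" "y < 2*pi" for y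
 proof (cases "y = 0")
  case False
  then have "at y within {0..2*pi} = at y" using that by (intro at_within_interior) auto
  then show ?thesis using within[of y] that by simp
 next
  case True
  have 1: "((\<lambda>z. (g z - g 0) / (z - 0)) \<longlongrightarrow> g' 0) (at 0 within {0..2*pi})"
   using within[of 0] by (simp add: has_field_derivative_iff)
  have im: "(\<lambda>z::real. z + 2*pi) ` {-2*pi..0} = {0..2*pi}" by simp
  have "(g has_real_derivative g' (0 + 2*pi)) (at (0 + 2*pi) within (\<lambda>z. z + 2*pi) ` {-2*pi..0})"
   unfolding im using within[of "2*pi"] by simp
  moreover have "((\<lambda>z. z + 2*pi) has_real_derivative 1) (at 0 within {-2*pi..0})"
   by (auto intro!: derivative_eq_intros)
  ultimately have "(g \<circ> (\<lambda>z. z + 2*pi) has_real_derivative g' (0 + 2*pi) * 1) (at 0 within {-2*pi..0})"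
   by (rule DERIV_image_chain)
  moreover have "g \<circ> (\<lambda>z. z + 2*pi) = g" "g' (0 + 2*pi) = g' 0"
   using per by (auto simp: periodic_2pi_def fun_eq_iff simp del: add_0)
  ultimately have 2: "((\<lambda>z. (g z - g 0) / (z - 0)) \<longlongrightarrow> g' 0) (at 0 within {-2*pi..0})"
   by (simp add: has_field_derivative_iff)
  have "((\<lambda>z. (g z - g 0) / (z - 0)) \<longlongrightarrow> g' 0) (at 0 within {-2*pi..0} \<union> {0..2*pi})"
   using 1 2 by (rule Lim_Un[rotated])
  moreover have "at (0::real) within {-2*pi..0} \<union> {0..2*pi} = at 0"
   by (rule at_within_nhd[of _ "{-1<..<1}"]) (use pi_gt3 in auto)
  ultimately show ?thesis using True by (simp add: has_field_derivative_iff)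
 qed
 obtain n y where y: "x = y + 2*pi * of_int n" "0 \<le> y" "y < 2*pi" by (rule reduce_2pi)
 have "((\<lambda>z. g (z + (- 2*pi * of_int n))) has_real_derivative g' y) (at x)"
  using at[OF y(2,3)] y(1) by (simp only: DERIV_shift[symmetric]) simp
 moreover have "(\<lambda>z. g (z + (- 2*pi * of_int n))) = g"
  using periodic_2pi_int[OF per(1), of _ "- n"] by (simp add: fun_eq_iff)
 moreover have "g' y = g' x" using periodic_2pi_int[OF per(2), of y n] y by simp
 ultimately show ?thesis by simp
qed

text \<open>
 Below the top order the almost everywhere derivatives are classical ones; the last of them is
 Lipschitz, being the integral of a function of bounded variation.
\<close>
lemma C_per_classical:
 assumes "f \<in> C_per q" "q \<ge> 1"
 shows "per_smooth (q - 1) f"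
  and "\<exists>K. \<forall>x y. \<bar>(deriv ^^ (q - 1)) f x - (deriv ^^ (q - 1)) f y\<bar> \<le> K * \<bar>x - y\<bar>"
proof -
 obtain D :: "nat => real => real" where D0: "D 0 = f"
  and ae: "\<And>j. j < q ==> ae_derivative (D j) (D (Suc j))"
  and bv: "\<And>j. j < q ==> bounded_variation_on 0 (2*pi) (D (Suc j))"
  and per: "\<And>j. j < q ==> periodic_2pi (D j)"
  using assms(1) unfolding C_per_def by auto
 have I: "\<And>x. x \<in> {0..2*pi} ==> (D (Suc j) has_integral (D j x - D j 0)) {0..x}" if "j < q" for j
  using ae[OF that] by (auto simp: ae_derivative_def)
 have lip: "\<exists>B. \<forall>x y. \<bar>D j x - D j y\<bar> \<le> B * \<bar>x - y\<bar>" if jq: "j < q" for j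
 proof -
  obtain B where B: "\<And>x. x \<in> {0..2*pi} ==> \<bar>D (Suc j) x\<bar> \<le> B"
   using bounded_variation_bounded[OF bv[OF jq]] by blast
  show ?thesis
   using lipschitz_periodic_extend[OF per[OF jq]] lipschitz_of_integral[OF I[OF jq] B] by blast
 qed
 have cont: "continuous_on UNIV (D j)" if jq: "j < q" for j
 proof -
  obtain B where B: "\<And>x y. \<bar>D j x - D j y\<bar> \<le> B * \<bar>x - y\<bar>" using lip[OF jq] by blast
  moreover have "B \<ge> 0" using B[of 1 0] by simp
  ultimately have "B-lipschitz_on UNIV (D j)" by (auto simp: lipschitz_on_def dist_real_def)
  then show ?thesis by (rule lipschitz_on_continuous_on)
 qed
 have der: "(D j has_real_derivative D (Suc j) x) (at x)" if "Suc j < q" for j x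
  using that by (intro derivative_of_integral_periodic I cont per) auto
 have eq: "(deriv ^^ j) f = D j" if "j < q" for j
  using that
 proof (induction j)
  case (Suc j)
  then have "deriv (D j) = D (Suc j)" using der[of j] by (auto simp: fun_eq_iff intro!: DERIV_imp_deriv)
  then show ?case using Suc by simp
 qed (simp add: D0)
 show "per_smooth (q - 1) f"
  unfolding per_smooth_def
 proof (intro conjI allI impI)
  fix j assume "j \<le> q - 1"
  then have "j < q" using assms(2) by auto
  then show "periodic_2pi ((deriv ^^ j) f)" "continuous_on UNIV ((deriv ^^ j) f)"
   using eq per cont by auto
 next
  fix j x assume "j < q - 1"
  then have "Suc j < q" by auto
  then show "((deriv ^^ j) f has_real_derivative (deriv ^^ Suc j) f x) (at x)"
   using eq[of j] eq[of "Suc j"] der[of j x] by auto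
 qed
 show "\<exists>K. \<forall>x y. \<bar>(deriv ^^ (q - 1)) f x - (deriv ^^ (q - 1)) f y\<bar> \<le> K * \<bar>x - y\<bar>"
  using lip[of "q - 1"] eq[of "q - 1"] assms(2) by auto
qed

section \<open>A quartic form with a truncated Sobolev weight\<close>

text \<open>The quartic form \<open>\<integral> f g h k\<close> on the Fourier side.\<close>
definition QP :: "int set => (int => 'a::comm_ring_1) => (int => 'a) => (int => 'a) => (int => 'a) => 'a" where
 "QP I f g h k = (\<Sum>a\<in>I. \<Sum>b\<in>I. \<Sum>c\<in>I. \<Sum>d\<in>I. if a + b + c + d = 0 then f a * g b * h c * k d else 0)"

lemma QP_swap12: "QP I f g h k = QP I g f h k"
proof -
 have "QP I f g h k = (\<Sum>b\<in>I. \<Sum>a\<in>I. \<Sum>c\<in>I. \<Sum>d\<in>I. if a + b + c + d = 0 then f a * g b * h c * k d else 0)"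
  unfolding QP_def by (rule sum.swap)
 also have "... = QP I g f h k"
  unfolding QP_def by (intro sum.cong refl) (auto simp: ac_simps)
 finally show ?thesis .
qed

lemma QP_swap23: "QP I f g h k = QP I f h g k"
proof -
 have "QP I f g h k = (\<Sum>a\<in>I. \<Sum>c\<in>I. \<Sum>b\<in>I. \<Sum>d\<in>I. if a + b + c + d = 0 then f a * g b * h c * k d else 0)"
  unfolding QP_def by (rule sum.cong[OF refl], rule sum.swap)
 also have "... = QP I f h g k"
  unfolding QP_def by (intro sum.cong refl) (auto simp: ac_simps)
 finally show ?thesis .
qed

lemma QP_swap34: "QP I f g h k = QP I f g k h"
proof -
 have "QP I f g h k = (\<Sum>a\<in>I. \<Sum>b\<in>I. \<Sum>d\<in>I. \<Sum>c\<in>I. if a + b + c + d = 0 then f a * g b * h c * k d else 0)"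
  unfolding QP_def by (rule sum.cong[OF refl], rule sum.cong[OF refl], rule sum.swap)
 also have "... = QP I f g k h"
  unfolding QP_def by (intro sum.cong refl) (auto simp: ac_simps)
 finally show ?thesis .
qed

lemma QP_bound:
 fixes A B E :: "int => real"
 assumes fin: "finite I" and nn: "\<And>n. A n \<ge> 0" "\<And>n. B n \<ge> 0" "\<And>n. E n \<ge> 0"
 shows "QP I A A B E \<le> (\<Sum>n\<in>I. B n) * (\<Sum>n\<in>I. E n) * (\<Sum>n\<in>I. (A n)^2)"
proof -
 have inner: "(\<Sum>a\<in>I. \<Sum>b\<in>I. if a + b + c + d = 0 then A a * A b else 0) \<le> (\<Sum>n\<in>I. (A n)^2)" for c d
 proof -
  have "(\<Sum>a\<in>I. \<Sum>b\<in>I. if a + b + c + d = 0 then A a * A b else 0)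
    \<le> (\<Sum>a\<in>I. \<Sum>b\<in>I. (if b = - a - c - d then (A a)^2 / 2 else 0) + (if a = - b - c - d then (A b)^2 / 2 else 0))"
  proof (intro sum_mono)
   fix a b
   have "A a * A b \<le> (A a)^2 / 2 + (A b)^2 / 2"
    using sum_squares_bound[of "A a" "A b"] by (simp add: field_simps)
   then show "(if a + b + c + d = 0 then A a * A b else 0)
     \<le> (if b = - a - c - d then (A a)^2 / 2 else 0) + (if a = - b - c - d then (A b)^2 / 2 else 0)"
    by (auto simp: algebra_simps)
  qed
  also have "... = (\<Sum>a\<in>I. \<Sum>b\<in>I. if b = - a - c - d then (A a)^2 / 2 else 0)
    + (\<Sum>b\<in>I. \<Sum>a\<in>I. if a = - b - c - d then (A b)^2 / 2 else 0)"
   unfolding sum.distrib by (subst (3) sum.swap) simp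
  also have "... \<le> (\<Sum>a\<in>I. (A a)^2 / 2) + (\<Sum>b\<in>I. (A b)^2 / 2)"
   by (intro add_mono sum_mono) (auto simp: sum.delta fin)
  also have "... = (\<Sum>n\<in>I. (A n)^2)"
   by (simp add: sum.distrib[symmetric])
  finally show ?thesis .
 qed
 define W where "W = (\<Sum>n\<in>I. (A n)^2)"
 have "QP I A A B E = QP I B E A A"
  by (metis QP_swap12 QP_swap23 QP_swap34)
 also have "... = (\<Sum>c\<in>I. \<Sum>d\<in>I. B c * E d * (\<Sum>a\<in>I. \<Sum>b\<in>I. if a + b + c + d = 0 then A a * A b else 0))"
  unfolding QP_def sum_distrib_left by (intro sum.cong refl) (auto simp: ac_simps)
 also have "... \<le> (\<Sum>c\<in>I. \<Sum>d\<in>I. B c * E d * (\<Sum>n\<in>I. (A n)^2))"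
  by (intro sum_mono mult_left_mono inner mult_nonneg_nonneg nn)
 also have "... = (\<Sum>n\<in>I. B n) * (\<Sum>n\<in>I. E n) * (\<Sum>n\<in>I. (A n)^2)"
  unfolding W_def[symmetric] unfolding sum_product unfolding sum_distrib_right ..
 finally show ?thesis unfolding W_def .
qed

definition rho :: "nat => nat => int => real" where
 "rho s n0 n = (min \<bar>of_int n\<bar> (real n0)) ^ s"

lemma rho_nonneg: "0 \<le> rho s n0 n"
 by (simp add: rho_def)

lemma rho_mono: "\<bar>m\<bar> \<le> \<bar>n\<bar> ==> rho s n0 m \<le> rho s n0 n"
 unfolding rho_def by (intro power_mono) auto

lemma rho_triple:
 assumes "\<bar>m\<bar> \<le> 3 * \<bar>n\<bar>" shows "rho s n0 m \<le> 3^s * rho s n0 n"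
proof -
 have "\<bar>real_of_int m\<bar> \<le> 3 * \<bar>real_of_int n\<bar>" using assms by linarith
 then have "min \<bar>real_of_int m\<bar> (real n0) \<le> 3 * min \<bar>real_of_int n\<bar> (real n0)" by auto
 then show ?thesis unfolding rho_def power_mult_distrib[symmetric] by (rule power_mono) simp
qed

lemma power_difference_bound:
 assumes "0 \<le> q" "q \<le> (p::real)" shows "q * (p^k - q^k) \<le> real k * p^k * (p - q)"
proof (induction k)
 case (Suc k)
 have "q * (p^Suc k - q^Suc k) = p * (q * (p^k - q^k)) + (p - q) * q^Suc k"
  by (simp add: algebra_simps)
 also have "... \<le> p * (real k * p^k * (p - q)) + (p - q) * p^Suc k"
  using assms Suc by (intro add_mono mult_left_mono power_mono) auto
 also have "... = real (Suc k) * p^Suc k * (p - q)"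
  by (simp add: algebra_simps)
 finally show ?case .
qed simp

text \<open>The symbol of the derivative of the truncated Sobolev energy. Truncating the weight at frequency \<open>n0\<close> makes that energy
 finite and differentiable in time under the sole assumption of a bounded lower norm.\<close>
definition phi :: "nat => nat => int => real" where
 "phi s n0 n = of_int n * (rho s n0 n)^2"

lemma phi_uminus: "phi s n0 (- n) = - phi s n0 n"
 by (simp add: phi_def rho_def)

lemma phi_lipschitz_aux:
 assumes "\<bar>y\<bar> \<le> \<bar>x\<bar>"
 shows "\<bar>phi s n0 x - phi s n0 y\<bar> \<le> (2 * real s + 1) * (rho s n0 x)^2 * \<bar>of_int x - of_int y\<bar>"
proof -
 define p where "p = min \<bar>real_of_int x\<bar> (real n0)"
 define q where "q = min \<bar>real_of_int y\<bar> (real n0)"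
 have pq: "0 \<le> q" "q \<le> p" using assms by (auto simp: p_def q_def)
 have rs: "(rho s n0 x)^2 = p^(2 * s)" "(rho s n0 y)^2 = q^(2 * s)"
  by (simp_all add: rho_def p_def q_def power_mult[symmetric] mult.commute)
 have "\<bar>real_of_int y\<bar> * (p^(2 * s) - q^(2 * s)) \<le> 2 * real s * p^(2 * s) * \<bar>of_int x - of_int y\<bar>"
 proof (cases "\<bar>real_of_int y\<bar> \<ge> real n0")
  case True
  then have "p = q" using assms by (auto simp: p_def q_def)
  then show ?thesis using pq by simp
 next
  case False
  then have q: "q = \<bar>real_of_int y\<bar>" by (simp add: q_def)
  have "q * (p^(2 * s) - q^(2 * s)) \<le> real (2 * s) * p^(2 * s) * (p - q)"
   by (rule power_difference_bound[OF pq])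
  also have "... \<le> real (2 * s) * p^(2 * s) * \<bar>of_int x - of_int y\<bar>"
   using pq q by (intro mult_left_mono) (auto simp: p_def)
  finally show ?thesis using q by simp
 qed
 moreover have "p^(2 * s) \<ge> q^(2 * s)" using pq by (intro power_mono) auto
 moreover have "phi s n0 x - phi s n0 y = (of_int x - of_int y) * p^(2 * s) + of_int y * (p^(2 * s) - q^(2 * s))"
  by (simp add: phi_def rs algebra_simps)
 then have "\<bar>phi s n0 x - phi s n0 y\<bar> \<le> \<bar>of_int x - of_int y\<bar> * \<bar>p^(2 * s)\<bar> + \<bar>of_int y\<bar> * \<bar>p^(2 * s) - q^(2 * s)\<bar>"
  by (simp only: abs_mult[symmetric] abs_triangle_ineq)
 ultimately show ?thesis
  using pq by (simp add: rs algebra_simps)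
qed

text \<open>
 On \<open>a + b + c + d = 0\<close> the two largest frequencies are comparable and nearly opposite, so the odd
 function \<open>phi\<close> cancels between them up to the two small frequencies.  The constant does not depend
 on the truncation \<open>n0\<close>.
\<close>
lemma phi_sum_top_pair:
 assumes sum0: "a + b + c + d = 0" and le: "\<bar>c\<bar> \<le> \<bar>a\<bar>" "\<bar>d\<bar> \<le> \<bar>a\<bar>" "\<bar>c\<bar> \<le> \<bar>b\<bar>" "\<bar>d\<bar> \<le> \<bar>b\<bar>"
 shows "\<bar>phi s n0 a + phi s n0 b + phi s n0 c + phi s n0 d\<bar>
   \<le> ((2 * real s + 1) * 3^s + 1) * (rho s n0 a * rho s n0 b * (\<bar>of_int c\<bar> + \<bar>of_int d\<bar>))"
proof -
 define ra where "ra = rho s n0 a"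
 define rb where "rb = rho s n0 b"
 have nn: "ra \<ge> 0" "rb \<ge> 0" by (auto simp: ra_def rb_def rho_nonneg)
 have tri: "\<bar>a\<bar> \<le> 3 * \<bar>b\<bar>" "\<bar>b\<bar> \<le> 3 * \<bar>a\<bar>" using sum0 le by linarith+
 have r3: "ra \<le> 3^s * rb" "rb \<le> 3^s * ra"
  unfolding ra_def rb_def using tri by (auto intro: rho_triple)
 have sq: "ra^2 \<le> 3^s * (ra * rb)" "rb^2 \<le> 3^s * (ra * rb)"
  using mult_left_mono[OF r3(1) nn(1)] mult_right_mono[OF r3(2) nn(2)]
  by (auto simp: power2_eq_square mult_ac)
 have ab: "of_int a - of_int (- b) = - (of_int c + of_int d :: real)"
  using sum0 by (simp flip: of_int_add add: add_eq_0_iff)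
 have 1: "\<bar>phi s n0 a + phi s n0 b\<bar> \<le> (2 * real s + 1) * (3^s * (ra * rb)) * (\<bar>of_int c\<bar> + \<bar>of_int d\<bar>)"
 proof -
  have "\<bar>phi s n0 a - phi s n0 (- b)\<bar> \<le> (2 * real s + 1) * (3^s * (ra * rb)) * \<bar>of_int a - of_int (- b)\<bar>"
  proof (cases "\<bar>- b\<bar> \<le> \<bar>a\<bar>")
   case True
   from phi_lipschitz_aux[OF this, of s n0]
   have "\<bar>phi s n0 a - phi s n0 (- b)\<bar> \<le> (2 * real s + 1) * ra^2 * \<bar>of_int a - of_int (- b)\<bar>"
    by (simp add: ra_def)
   also have "... \<le> (2 * real s + 1) * (3^s * (ra * rb)) * \<bar>of_int a - of_int (- b)\<bar>"
    using sq by (intro mult_right_mono mult_left_mono) auto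
   finally show ?thesis .
  next
   case False
   then have "\<bar>a\<bar> \<le> \<bar>- b\<bar>" by simp
   from phi_lipschitz_aux[OF this, of s n0]
   have "\<bar>phi s n0 a - phi s n0 (- b)\<bar> \<le> (2 * real s + 1) * rb^2 * \<bar>of_int a - of_int (- b)\<bar>"
    by (simp add: rb_def rho_def abs_minus_commute)
   also have "... \<le> (2 * real s + 1) * (3^s * (ra * rb)) * \<bar>of_int a - of_int (- b)\<bar>"
    using sq by (intro mult_right_mono mult_left_mono) auto
   finally show ?thesis .
  qed
  also have "... \<le> (2 * real s + 1) * (3^s * (ra * rb)) * (\<bar>of_int c\<bar> + \<bar>of_int d\<bar>)"
   unfolding ab using nn by (intro mult_left_mono) auto
  finally show ?thesis by (simp add: phi_uminus)
 qed
 have small: "\<bar>phi s n0 n\<bar> \<le> ra * rb * \<bar>of_int n\<bar>" if "\<bar>n\<bar> \<le> \<bar>a\<bar>" "\<bar>n\<bar> \<le> \<bar>b\<bar>" for n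
 proof -
  have "(rho s n0 n)^2 \<le> ra * rb"
   unfolding power2_eq_square ra_def rb_def using that by (intro mult_mono rho_mono rho_nonneg)
  then show ?thesis
   by (simp add: phi_def abs_mult mult.commute mult_left_mono)
 qed
 have "\<bar>phi s n0 a + phi s n0 b + phi s n0 c + phi s n0 d\<bar>
   \<le> \<bar>phi s n0 a + phi s n0 b\<bar> + \<bar>phi s n0 c\<bar> + \<bar>phi s n0 d\<bar>" by linarith
 also have "... \<le> (2 * real s + 1) * (3^s * (ra * rb)) * (\<bar>of_int c\<bar> + \<bar>of_int d\<bar>)
   + ra * rb * \<bar>of_int c\<bar> + ra * rb * \<bar>of_int d\<bar>"
  using 1 small[of c] small[of d] le by (intro add_mono) auto
 also have "... = ((2 * real s + 1) * 3^s + 1) * (ra * rb * (\<bar>of_int c\<bar> + \<bar>of_int d\<bar>))"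
  by (simp add: algebra_simps)
 finally show ?thesis by (simp only: ra_def rb_def)
qed

definition Cq :: "nat => real" where "Cq s = (2 * real s + 1) * 3^s + 1"

lemma Cq_pos: "Cq s > 0"
 unfolding Cq_def by (intro add_nonneg_pos mult_nonneg_nonneg) auto

text \<open>The estimate for the top pair of frequencies, made symmetric in all four arguments by listing every pair.\<close>
lemma phi_sum_bound:
 fixes s n0 :: nat
 assumes sum0: "a + b + c + d = 0"
 defines "r \<equiv> rho s n0"
 shows "\<bar>phi s n0 a + phi s n0 b + phi s n0 c + phi s n0 d\<bar> \<le> Cq s *
   (r a * r b * (\<bar>of_int c\<bar> + \<bar>of_int d\<bar>) + r a * r c * (\<bar>of_int b\<bar> + \<bar>of_int d\<bar>)
   + r a * r d * (\<bar>of_int b\<bar> + \<bar>of_int c\<bar>) + r b * r c * (\<bar>of_int a\<bar> + \<bar>of_int d\<bar>)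
   + r b * r d * (\<bar>of_int a\<bar> + \<bar>of_int c\<bar>) + r c * r d * (\<bar>of_int a\<bar> + \<bar>of_int b\<bar>))"
  (is "?L \<le> Cq s * (?ab + ?ac + ?ad + ?bc + ?bd + ?cd)")
proof -
 have nn: "?ab \<ge> 0" "?ac \<ge> 0" "?ad \<ge> 0" "?bc \<ge> 0" "?bd \<ge> 0" "?cd \<ge> 0"
  by (auto simp: r_def rho_nonneg intro!: mult_nonneg_nonneg)
 have key: "?L \<le> Cq s * t ==> t \<le> ?ab + ?ac + ?ad + ?bc + ?bd + ?cd ==> ?thesis" for t
  using Cq_pos[of s] by (meson less_imp_le mult_left_mono order_trans)
 consider "\<bar>c\<bar> \<le> \<bar>a\<bar>" "\<bar>d\<bar> \<le> \<bar>a\<bar>" "\<bar>c\<bar> \<le> \<bar>b\<bar>" "\<bar>d\<bar> \<le> \<bar>b\<bar>"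
  | "\<bar>b\<bar> \<le> \<bar>a\<bar>" "\<bar>d\<bar> \<le> \<bar>a\<bar>" "\<bar>b\<bar> \<le> \<bar>c\<bar>" "\<bar>d\<bar> \<le> \<bar>c\<bar>"
  | "\<bar>b\<bar> \<le> \<bar>a\<bar>" "\<bar>c\<bar> \<le> \<bar>a\<bar>" "\<bar>b\<bar> \<le> \<bar>d\<bar>" "\<bar>c\<bar> \<le> \<bar>d\<bar>"
  | "\<bar>a\<bar> \<le> \<bar>b\<bar>" "\<bar>d\<bar> \<le> \<bar>b\<bar>" "\<bar>a\<bar> \<le> \<bar>c\<bar>" "\<bar>d\<bar> \<le> \<bar>c\<bar>"
  | "\<bar>a\<bar> \<le> \<bar>b\<bar>" "\<bar>c\<bar> \<le> \<bar>b\<bar>" "\<bar>a\<bar> \<le> \<bar>d\<bar>" "\<bar>c\<bar> \<le> \<bar>d\<bar>"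
  | "\<bar>a\<bar> \<le> \<bar>c\<bar>" "\<bar>b\<bar> \<le> \<bar>c\<bar>" "\<bar>a\<bar> \<le> \<bar>d\<bar>" "\<bar>b\<bar> \<le> \<bar>d\<bar>" by (smt (verit))
 then show ?thesis
 proof cases
  case 1
  show ?thesis
   by (rule key[of ?ab], use phi_sum_top_pair[of a b c d s n0] 1 sum0 in \<open>simp add: Cq_def r_def add_ac\<close>)
     (use nn in linarith)
 next
  case 2
  show ?thesis
   by (rule key[of ?ac], use phi_sum_top_pair[of a c b d s n0] 2 sum0 in \<open>simp add: Cq_def r_def add_ac\<close>)
     (use nn in linarith)
 next
  case 3
  show ?thesis
   by (rule key[of ?ad], use phi_sum_top_pair[of a d b c s n0] 3 sum0 in \<open>simp add: Cq_def r_def add_ac\<close>)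
     (use nn in linarith)
 next
  case 4
  show ?thesis
   by (rule key[of ?bc], use phi_sum_top_pair[of b c a d s n0] 4 sum0 in \<open>simp add: Cq_def r_def add_ac\<close>)
     (use nn in linarith)
 next
  case 5
  show ?thesis
   by (rule key[of ?bd], use phi_sum_top_pair[of b d a c s n0] 5 sum0 in \<open>simp add: Cq_def r_def add_ac\<close>)
     (use nn in linarith)
 next
  case 6
  show ?thesis
   by (rule key[of ?cd], use phi_sum_top_pair[of c d a b s n0] 6 sum0 in \<open>simp add: Cq_def r_def add_ac\<close>)
     (use nn in linarith)
 qed
qed

text \<open>By symmetry of the form the symbol may be replaced by a quarter of its sum over the four frequencies; the two arguments
 that carry \<open>rho\<close> are paired by Young's inequality and the two others are summed in \<open>\<ell>^1\<close>.\<close>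
lemma QP_phi_bound:
 fixes u :: "int => complex"
 assumes fin: "finite I"
 shows "cmod (QP I u u u (\<lambda>n. of_real (phi s n0 n) * u n))
   \<le> 3 * Cq s * ((\<Sum>n\<in>I. \<bar>of_int n\<bar> * cmod (u n)) * (\<Sum>n\<in>I. cmod (u n)) * (\<Sum>n\<in>I. (rho s n0 n * cmod (u n))^2))"
proof -
 define p where "p = (\<lambda>n. of_real (phi s n0 n) * u n)"
 define A where "A = (\<lambda>n. rho s n0 n * cmod (u n))"
 define B where "B = (\<lambda>n::int. \<bar>of_int n\<bar> * cmod (u n))"
 define E where "E = (\<lambda>n. cmod (u n))"
 define W where "W = (\<Sum>n\<in>I. B n) * (\<Sum>n\<in>I. E n) * (\<Sum>n\<in>I. (A n)^2)"
 have "4 * QP I u u u p = QP I p u u u + QP I u p u u + QP I u u p u + QP I u u u p"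
 proof -
  have "QP I u u p u = QP I u u u p" by (rule QP_swap34)
  moreover have "QP I u p u u = QP I u u p u" by (rule QP_swap23)
  moreover have "QP I p u u u = QP I u p u u" by (rule QP_swap12)
  ultimately show ?thesis by simp
 qed
 also have "... = (\<Sum>a\<in>I. \<Sum>b\<in>I. \<Sum>c\<in>I. \<Sum>d\<in>I. if a + b + c + d = 0 then
   of_real (phi s n0 a + phi s n0 b + phi s n0 c + phi s n0 d) * (u a * u b * u c * u d) else 0)"
  unfolding QP_def sum.distrib[symmetric] p_def by (intro sum.cong refl) (simp add: algebra_simps)
 finally have 4: "4 * cmod (QP I u u u p) = cmod (\<Sum>a\<in>I. \<Sum>b\<in>I. \<Sum>c\<in>I. \<Sum>d\<in>I. if a + b + c + d = 0 then
   of_real (phi s n0 a + phi s n0 b + phi s n0 c + phi s n0 d) * (u a * u b * u c * u d) else 0)"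
  by (metis norm_mult norm_numeral)
 also have "... \<le> (\<Sum>a\<in>I. \<Sum>b\<in>I. \<Sum>c\<in>I. \<Sum>d\<in>I. if a + b + c + d = 0 then
   \<bar>phi s n0 a + phi s n0 b + phi s n0 c + phi s n0 d\<bar> * (E a * E b * E c * E d) else 0)"
  by (intro order_trans[OF norm_sum] sum_mono) (auto simp: norm_mult E_def simp del: of_real_add)
 also have "... \<le> (\<Sum>a\<in>I. \<Sum>b\<in>I. \<Sum>c\<in>I. \<Sum>d\<in>I. Cq s * (if a + b + c + d = 0 then
   A a * A b * B c * E d + A a * A b * E c * B d + A a * B b * A c * E d + A a * E b * A c * B d
  + A a * B b * E c * A d + A a * E b * B c * A d + B a * A b * A c * E d + E a * A b * A c * B d
  + B a * A b * E c * A d + E a * A b * B c * A d + B a * E b * A c * A d + E a * B b * A c * A d else 0))"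
 proof (intro sum_mono)
  fix a b c d
  show "(if a + b + c + d = 0 then \<bar>phi s n0 a + phi s n0 b + phi s n0 c + phi s n0 d\<bar> * (E a * E b * E c * E d) else 0)
   \<le> Cq s * (if a + b + c + d = 0 then
   A a * A b * B c * E d + A a * A b * E c * B d + A a * B b * A c * E d + A a * E b * A c * B d
  + A a * B b * E c * A d + A a * E b * B c * A d + B a * A b * A c * E d + E a * A b * A c * B d
  + B a * A b * E c * A d + E a * A b * B c * A d + B a * E b * A c * A d + E a * B b * A c * A d else 0)"
  proof (cases "a + b + c + d = 0")
   case True
   have E0: "E n \<ge> 0" for n by (simp add: E_def)
   have AB: "A n = rho s n0 n * E n" "B n = \<bar>of_int n\<bar> * E n" for n by (simp_all add: A_def B_def E_def)
   show ?thesis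
    using mult_right_mono[OF phi_sum_bound[OF True, of s n0], of "E a * E b * E c * E d"] E0 True
    by (simp add: AB algebra_simps)
  qed simp
 qed
 also have "... = Cq s * (QP I A A B E + QP I A A E B + QP I A B A E + QP I A E A B
  + QP I A B E A + QP I A E B A + QP I B A A E + QP I E A A B
  + QP I B A E A + QP I E A B A + QP I B E A A + QP I E B A A)"
  unfolding QP_def sum.distrib[symmetric] sum_distrib_left[symmetric]
  by (intro arg_cong[where f = "\<lambda>x. Cq s * x"] sum.cong refl) simp
 also have "... = Cq s * (12 * QP I A A B E)"
 proof -
  have 1: "QP I A A E B = QP I A A B E" by (rule QP_swap34)
  have 2: "QP I A B A E = QP I A A B E" by (rule QP_swap23)
  have 3: "QP I A E A B = QP I A A B E" using 1 by (simp add: QP_swap23[of I A E])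
  have 4: "QP I A B E A = QP I A A B E" using 2 by (simp add: QP_swap34[of I A B E])
  have 5: "QP I A E B A = QP I A A B E" using 3 by (simp add: QP_swap34[of I A E B])
  have 6: "QP I B A A E = QP I A A B E" using 2 by (simp add: QP_swap12[of I B A])
  have 7: "QP I E A A B = QP I A A B E" using 3 by (simp add: QP_swap12[of I E A])
  have 8: "QP I B A E A = QP I A A B E" using 4 by (simp add: QP_swap12[of I B A])
  have 9: "QP I E A B A = QP I A A B E" using 5 by (simp add: QP_swap12[of I E A])
  have 10: "QP I B E A A = QP I A A B E" using 8 by (simp add: QP_swap23[of I B E])
  have 11: "QP I E B A A = QP I A A B E" using 9 by (simp add: QP_swap23[of I E B])
  show ?thesis by (simp only: 1 2 3 4 5 6 7 8 9 10 11) simp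
 qed
 also have "... \<le> Cq s * (12 * W)"
 proof -
  have "QP I A A B E \<le> W"
   unfolding W_def by (rule QP_bound[OF fin]) (auto simp: A_def B_def E_def rho_nonneg)
  then show ?thesis using Cq_pos[of s] by simp
 qed
 finally have "4 * cmod (QP I u u u p) \<le> 4 * (3 * Cq s * W)" by (simp only: mult_ac)
 then have "cmod (QP I u u u p) \<le> 3 * Cq s * W" by (simp only: mult_le_cancel_left_pos zero_less_numeral)
 then show ?thesis by (simp add: p_def W_def A_def B_def E_def)
qed

lemma fc_sum:
 assumes "finite A" "\<And>i. i \<in> A ==> continuous_on {0..2*pi} (f i)"
 shows "fc (\<lambda>x. \<Sum>i\<in>A. f i x) m = (\<Sum>i\<in>A. fc (f i) m)"
 using assms
proof (induction A rule: finite_induct)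
 case (insert i A)
 have "fc (\<lambda>x. f i x + (\<Sum>i\<in>A. f i x)) m = fc (f i) m + fc (\<lambda>x. \<Sum>i\<in>A. f i x) m"
  using insert by (intro fc_add continuous_on_sum) auto
 then show ?case using insert by simp
qed (simp add: fc_def)

definition trig :: "int set => (int => complex) => real => complex" where
 "trig I c x = (\<Sum>m\<in>I. c m * ek m x)"

lemma continuous_on_trig [continuous_intros]: "continuous_on S f ==> continuous_on S (\<lambda>x. trig I c (f x))"
 unfolding trig_def by (intro continuous_intros)

lemma fc_trig_cube:
 assumes fin: "finite I"
 shows "fc (\<lambda>x. (trig I u x)^3) m = (\<Sum>a\<in>I. \<Sum>b\<in>I. \<Sum>c\<in>I. if a + b + c = m then u a * u b * u c else 0)"
proof -
 have expand: "(\<lambda>x. (trig I u x)^3) = (\<lambda>x. \<Sum>a\<in>I. \<Sum>b\<in>I. \<Sum>c\<in>I. (u a * u b * u c) * ek (a + b + c) x)"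
 proof
  fix x
  have "(trig I u x)^3 = (\<Sum>a\<in>I. u a * ek a x) * ((\<Sum>b\<in>I. u b * ek b x) * (\<Sum>c\<in>I. u c * ek c x))"
   by (simp add: power3_eq_cube trig_def mult.assoc)
  also have "... = (\<Sum>a\<in>I. \<Sum>b\<in>I. \<Sum>c\<in>I. (u a * ek a x) * ((u b * ek b x) * (u c * ek c x)))"
   unfolding sum_product unfolding sum_distrib_left ..
  also have "... = (\<Sum>a\<in>I. \<Sum>b\<in>I. \<Sum>c\<in>I. (u a * u b * u c) * (ek a x * (ek b x * ek c x)))"
   by (intro sum.cong refl) (simp only: ac_simps)
  also have "... = (\<Sum>a\<in>I. \<Sum>b\<in>I. \<Sum>c\<in>I. (u a * u b * u c) * ek (a + b + c) x)"
   by (simp only: ek_mult add.assoc)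
  finally show "(trig I u x)^3 = (\<Sum>a\<in>I. \<Sum>b\<in>I. \<Sum>c\<in>I. (u a * u b * u c) * ek (a + b + c) x)" .
 qed
 have "fc (\<lambda>x. (trig I u x)^3) m
   = (\<Sum>a\<in>I. \<Sum>b\<in>I. \<Sum>c\<in>I. fc (\<lambda>x. (u a * u b * u c) * ek (a + b + c) x) m)"
 proof -
  define F where "F = (\<lambda>a b c x. (u a * u b * u c) * ek (a + b + c) x)"
  have c: "continuous_on {0..2*pi} (F a b c)" for a b c
   unfolding F_def by (intro continuous_intros)
  have 1: "fc (\<lambda>x. \<Sum>c\<in>I. F a b c x) m = (\<Sum>c\<in>I. fc (F a b c) m)" for a b
   by (rule fc_sum[OF fin c])
  have 2: "fc (\<lambda>x. \<Sum>b\<in>I. \<Sum>c\<in>I. F a b c x) m = (\<Sum>b\<in>I. fc (\<lambda>x. \<Sum>c\<in>I. F a b c x) m)" for a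
   by (rule fc_sum[OF fin]) (intro continuous_on_sum c)
  have 3: "fc (\<lambda>x. \<Sum>a\<in>I. \<Sum>b\<in>I. \<Sum>c\<in>I. F a b c x) m = (\<Sum>a\<in>I. fc (\<lambda>x. \<Sum>b\<in>I. \<Sum>c\<in>I. F a b c x) m)"
   by (rule fc_sum[OF fin]) (intro continuous_on_sum c)
  have "(\<lambda>x. (trig I u x)^3) = (\<lambda>x. \<Sum>a\<in>I. \<Sum>b\<in>I. \<Sum>c\<in>I. F a b c x)"
   by (simp only: F_def expand)
  then have "fc (\<lambda>x. (trig I u x)^3) m = (\<Sum>a\<in>I. \<Sum>b\<in>I. \<Sum>c\<in>I. fc (F a b c) m)" by (simp only: 1 2 3)
  then show ?thesis by (simp only: F_def)
 qed
 also have "... = (\<Sum>a\<in>I. \<Sum>b\<in>I. \<Sum>c\<in>I. if a + b + c = m then u a * u b * u c else 0)"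
  by (intro sum.cong refl) (auto simp only: fc_cmult fc_ek if_True if_False mult_1_right mult_zero_right split: if_splits)
 finally show ?thesis .
qed

lemma cube_pairing_QP:
 assumes fin: "finite I" and sym: "\<And>m. m \<in> I ==> - m \<in> I" and her: "\<And>m. u (- m) = cnj (u m)"
 shows "(\<Sum>m\<in>I. w m * cnj (u m) * fc (\<lambda>x. (trig I u x)^3) m) = QP I u u u (\<lambda>d. w (- d) * u d)"
proof -
 have "(\<Sum>m\<in>I. w m * cnj (u m) * fc (\<lambda>x. (trig I u x)^3) m)
   = (\<Sum>d\<in>I. w (- d) * u d * fc (\<lambda>x. (trig I u x)^3) (- d))"
  by (rule sum.reindex_bij_witness[of _ uminus uminus]) (auto simp: sym her)
 also have "... = (\<Sum>d\<in>I. \<Sum>a\<in>I. \<Sum>b\<in>I. \<Sum>c\<in>I. if a + b + c + d = 0 then u a * u b * u c * (w (- d) * u d) else 0)"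
  unfolding fc_trig_cube[OF fin] sum_distrib_left
  by (intro sum.cong refl) (auto simp: algebra_simps add_eq_0_iff)
 also have "... = (\<Sum>a\<in>I. \<Sum>d\<in>I. \<Sum>b\<in>I. \<Sum>c\<in>I. if a + b + c + d = 0 then u a * u b * u c * (w (- d) * u d) else 0)"
  by (rule sum.swap)
 also have "... = (\<Sum>a\<in>I. \<Sum>b\<in>I. \<Sum>d\<in>I. \<Sum>c\<in>I. if a + b + c + d = 0 then u a * u b * u c * (w (- d) * u d) else 0)"
  by (rule sum.cong[OF refl], rule sum.swap)
 also have "... = QP I u u u (\<lambda>d. w (- d) * u d)"
  unfolding QP_def by (rule sum.cong[OF refl], rule sum.cong[OF refl], rule sum.swap)
 finally show ?thesis .
qed

lemma QP_sum_zero: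
 fixes u :: "int => complex"
 shows "QP I u u u (\<lambda>n. of_int n * u n) = 0"
proof -
 define p where "p = (\<lambda>n. of_int n * u n)"
 have "4 * QP I u u u p = QP I p u u u + QP I u p u u + QP I u u p u + QP I u u u p"
 proof -
  have "QP I u u p u = QP I u u u p" by (rule QP_swap34)
  moreover have "QP I u p u u = QP I u u p u" by (rule QP_swap23)
  moreover have "QP I p u u u = QP I u p u u" by (rule QP_swap12)
  ultimately show ?thesis by simp
 qed
 also have "... = (\<Sum>a\<in>I. \<Sum>b\<in>I. \<Sum>c\<in>I. \<Sum>d\<in>I. if a + b + c + d = 0 then
   (of_int a + of_int b + of_int c + of_int d) * (u a * u b * u c * u d) else 0)"
  unfolding QP_def sum.distrib[symmetric] p_def by (intro sum.cong refl) (simp add: algebra_simps)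
 also have "... = 0" by (intro sum.neutral ballI) (auto simp flip: of_int_add)
 finally show ?thesis by (simp add: p_def)
qed

lemma QP_diff: "QP I f g h (\<lambda>n. k n - l n) = QP I f g h k - QP I f g h l"
 unfolding QP_def sum_subtractf[symmetric] by (intro sum.cong refl) (simp add: algebra_simps)

lemma QP_scale: "QP I f g h (\<lambda>n. r * k n) = r * QP I f g h k"
 unfolding QP_def sum_distrib_left by (intro sum.cong refl) (simp add: algebra_simps)

text \<open>
 The weight \<open>n0^(2s) - rho^2\<close> is supported in \<open>\<bar>m\<bar> < n0\<close>; adding a constant weight costs nothing
 because it pairs \<open>u\<^sup>3\<close> with a total derivative.
\<close>
lemma truncated_weight_pairing:
 assumes fin: "finite I" and sym: "\<And>m. m \<in> I ==> - m \<in> I" and her: "\<And>m. u (- m) = cnj (u m)"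
 shows "cmod (\<Sum>m\<in>I. of_real (of_int m * (real n0 ^ (2 * s) - (rho s n0 m)^2)) * cnj (u m) * fc (\<lambda>x. (trig I u x)^3) m)
   \<le> 3 * Cq s * ((\<Sum>n\<in>I. \<bar>of_int n\<bar> * cmod (u n)) * (\<Sum>n\<in>I. cmod (u n)) * (\<Sum>n\<in>I. (rho s n0 n * cmod (u n))^2))"
proof -
 define w :: "int => complex" where "w m = of_real (of_int m * (real n0 ^ (2 * s) - (rho s n0 m)^2))" for m
 have w: "(\<lambda>d. w (- d) * u d) = (\<lambda>d. of_real (phi s n0 d) * u d - of_real (real n0 ^ (2 * s)) * (of_int d * u d))"
  by (simp add: fun_eq_iff w_def phi_def rho_def algebra_simps)
 have "(\<Sum>m\<in>I. w m * cnj (u m) * fc (\<lambda>x. (trig I u x)^3) m) = QP I u u u (\<lambda>d. w (- d) * u d)"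
  by (rule cube_pairing_QP[where w = w and u = u and I = I, OF fin sym her])
 also have "... = QP I u u u (\<lambda>d. of_real (phi s n0 d) * u d)"
  unfolding w QP_diff QP_scale by (simp add: QP_sum_zero)
 finally show ?thesis
  using QP_phi_bound[OF fin, of u s n0] by (simp only: w_def)
qed

section \<open>Passing between space and time regularity\<close>

lemma bessel_eq:
 assumes "finite A" "continuous_on {0..2*pi} f"
 shows "2*pi * (\<Sum>m\<in>A. (cmod (fc f m))^2)
    = integral {0..2*pi} (\<lambda>x. (cmod (f x))^2) - integral {0..2*pi} (\<lambda>x. (cmod (f x - trig A (fc f) x))^2)"
 using assms
proof (induction A arbitrary: f rule: finite_induct)
 case (insert m A)
 define g where "g = (\<lambda>x. f x - fc f m * ek m x)"
 have cg: "continuous_on {0..2*pi} g"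
  unfolding g_def by (intro continuous_intros insert.prems)
 have fg: "fc g n = fc f n" if "n \<in> A" for n
 proof -
  have "fc g n = fc f n - fc (\<lambda>x. fc f m * ek m x) n"
   unfolding g_def by (intro fc_diff continuous_intros insert.prems)
  also have "fc (\<lambda>x. fc f m * ek m x) n = 0"
   using that insert.hyps fc_cmult[of "fc f m" "ek m" n] by (auto simp: fc_ek)
  finally show ?thesis by simp
 qed
 have tg: "g x - trig A (fc g) x = f x - trig (insert m A) (fc f) x" for x
 proof -
  have "trig A (fc g) x = trig A (fc f) x"
   unfolding trig_def by (intro sum.cong refl) (simp add: fg)
  then show ?thesis using insert.hyps by (simp add: g_def trig_def)
 qed
 have "2*pi * (\<Sum>n\<in>A. (cmod (fc f n))^2) = 2*pi * (\<Sum>n\<in>A. (cmod (fc g n))^2)"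
  by (simp add: fg)
 also have "... = integral {0..2*pi} (\<lambda>x. (cmod (g x))^2) - integral {0..2*pi} (\<lambda>x. (cmod (g x - trig A (fc g) x))^2)"
  by (rule insert.IH[OF cg])
 also have "integral {0..2*pi} (\<lambda>x. (cmod (g x))^2) = integral {0..2*pi} (\<lambda>x. (cmod (f x))^2) - 2*pi * (cmod (fc f m))^2"
  unfolding g_def by (rule bessel_step[OF insert.prems])
 finally show ?case using insert.hyps by (simp only: tg) (simp add: distrib_left)
qed (simp add: trig_def)

lemma fc_bound:
 assumes "continuous_on {0..2*pi} f" "\<And>x. x \<in> {0..2*pi} ==> cmod (f x) \<le> B"
 shows "cmod (fc f m) \<le> B"
proof -
 have "norm (integral {0..2*pi} (\<lambda>x. f x * ek (-m) x)) \<le> B * (2*pi - 0)"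
  using assms by (intro integral_bound continuous_intros) (auto simp: norm_mult)
 then show ?thesis
  by (simp add: fc_def norm_divide norm_mult field_simps)
qed

lemma mvt_at:
 assumes "\<And>x. (f has_real_derivative f' x) (at x)" "d > 0"
 obtains z where "x < z" "z < x + d" "f (x + d) - f x = d * f' z"
 using MVT2[of x "x + d" f f'] assms by auto

lemma x_derivative_continuous_in_t:
 fixes g g' :: "real => real => real"
 assumes der: "\<And>t x. t \<in> J ==> (g t has_real_derivative g' t x) (at x)"
  and lip: "\<And>t x y. t \<in> J ==> \<bar>g' t x - g' t y\<bar> \<le> B * \<bar>x - y\<bar>"
  and cont: "\<And>x. continuous_on J (\<lambda>t. g t x)"
 shows "continuous_on J (\<lambda>t. g' t x)"
proof (cases "J = {}")
 case False
 then obtain t0 where "t0 \<in> J" by blast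
 then have B: "B \<ge> 0" using lip[of t0 1 0] by auto
 define q where "q n t = (g t (x + 1 / real (Suc n)) - g t x) / (1 / real (Suc n))" for n t
 show ?thesis
 proof (rule uniform_limit_theorem)
  show "\<forall>\<^sub>F n in sequentially. continuous_on J (q n)"
   unfolding q_def by (intro always_eventually allI continuous_intros cont) auto
  show "uniform_limit J q (\<lambda>t. g' t x) sequentially"
   unfolding uniform_limit_iff
  proof (intro allI impI)
   fix e :: real assume e: "e > 0"
   have "(\<lambda>n. B * (1 / real (Suc n))) \<longlonglongrightarrow> B * 0"
    by (intro tendsto_intros LIMSEQ_Suc[OF lim_1_over_n])
   then have "eventually (\<lambda>n. B * (1 / real (Suc n)) < e) sequentially"
    using e by (auto intro: order_tendstoD)
   then show "\<forall>\<^sub>F n in sequentially. \<forall>t\<in>J. dist (q n t) (g' t x) < e"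
   proof eventually_elim
    case (elim n)
    show ?case
    proof
     fix t assume t: "t \<in> J"
     obtain z where z: "x < z" "z < x + 1 / real (Suc n)" "g t (x + 1 / real (Suc n)) - g t x = 1 / real (Suc n) * g' t z"
      using mvt_at[of "g t" "g' t" "1 / real (Suc n)" x] der[OF t] by auto
     have "q n t = g' t z" by (simp only: q_def z(3)) simp
     then have "dist (q n t) (g' t x) \<le> B * \<bar>z - x\<bar>" using lip[OF t] by (simp add: dist_real_def)
     also have "... \<le> B * (1 / real (Suc n))" using z B by (intro mult_left_mono) auto
     finally show "dist (q n t) (g' t x) < e" using elim by simp
    qed
   qed
  qed
 qed simp
qed simp

text \<open>Differentiability in time passes from \<open>g\<close> to its space derivative: the difference quotients in \<open>x\<close>
 have time derivatives that converge uniformly, by the Lipschitz bound on \<open>h'\<close>.\<close>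
lemma x_derivative_t_derivative:
 fixes g g' h h' :: "real => real => real"
 assumes J: "convex J" and t: "t \<in> J"
  and tder: "\<And>t x. t \<in> J ==> ((\<lambda>t. g t x) has_real_derivative h t x) (at t within J)"
  and gder: "\<And>t x. t \<in> J ==> (g t has_real_derivative g' t x) (at x)"
  and hder: "\<And>t x. t \<in> J ==> (h t has_real_derivative h' t x) (at x)"
  and lip: "\<And>t x y. t \<in> J ==> \<bar>h' t x - h' t y\<bar> \<le> B * \<bar>x - y\<bar>"
 shows "((\<lambda>t. g' t x) has_real_derivative h' t x) (at t within J)"
proof -
 have B: "B \<ge> 0" using lip[OF t, of 1 0] by auto
 define q where "q n t = (g t (x + 1 / real (Suc n)) - g t x) / (1 / real (Suc n))" for n t
 define r where "r n t = (h t (x + 1 / real (Suc n)) - h t x) / (1 / real (Suc n))" for n t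
 have lim: "(\<lambda>n. q n t) \<longlonglongrightarrow> g' t x" if "t \<in> J" for t
 proof -
  have "((\<lambda>d. (g t (x + d) - g t x) / d) \<longlongrightarrow> g' t x) (at 0)"
   using gder[OF that, of x] by (simp add: DERIV_def)
  moreover have "filterlim (\<lambda>n. 1 / real (Suc n)) (at 0) sequentially"
   using LIMSEQ_Suc[OF lim_1_over_n] by (simp add: filterlim_at del: of_nat_Suc)
  ultimately show ?thesis unfolding q_def by (rule filterlim_compose)
 qed
 have "\<exists>G. \<forall>t\<in>J. (\<lambda>n. q n t) \<longlonglongrightarrow> G t \<and> (G has_derivative (*) (h' t x)) (at t within J)"
 proof (rule has_derivative_sequence[where f = q and f' = "\<lambda>n t. (*) (r n t)" and ?x0.0 = t and l = "g' t x"])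
  fix n t assume "t \<in> J"
  then have "((q n) has_real_derivative r n t) (at t within J)"
   unfolding q_def r_def by (intro DERIV_cdivide DERIV_diff tder)
  then show "((q n) has_derivative (*) (r n t)) (at t within J)"
   by (simp add: has_field_derivative_def)
 next
  fix e :: real assume e: "e > 0"
  have "(\<lambda>n. B * (1 / real (Suc n))) \<longlonglongrightarrow> B * 0"
   by (intro tendsto_intros LIMSEQ_Suc[OF lim_1_over_n])
  then have "eventually (\<lambda>n. B * (1 / real (Suc n)) < e) sequentially"
   using e by (auto intro: order_tendstoD)
  then show "\<forall>\<^sub>F n in sequentially. \<forall>t\<in>J. \<forall>k. norm (r n t * k - h' t x * k) \<le> e * norm k"
  proof eventually_elim
   case (elim n)
   show ?case
   proof (intro ballI allI)
    fix t k assume t: "t \<in> J"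
    obtain z where z: "x < z" "z < x + 1 / real (Suc n)" "h t (x + 1 / real (Suc n)) - h t x = 1 / real (Suc n) * h' t z"
     using mvt_at[of "h t" "h' t" "1 / real (Suc n)" x] hder[OF t] by auto
    have "r n t = h' t z" by (simp only: r_def z(3)) simp
    then have "\<bar>r n t - h' t x\<bar> \<le> B * \<bar>z - x\<bar>" using lip[OF t] by simp
    also have "... \<le> B * (1 / real (Suc n))" using z B by (intro mult_left_mono) auto
    finally have "\<bar>r n t - h' t x\<bar> \<le> e" using elim by simp
    then show "norm (r n t * k - h' t x * k) \<le> e * norm k"
     by (simp add: left_diff_distrib[symmetric] abs_mult mult_right_mono)
   qed
  qed
 qed (use J t lim in auto)
 then obtain G where G: "\<And>t. t \<in> J ==> (\<lambda>n. q n t) \<longlonglongrightarrow> G t"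
   "\<And>t. t \<in> J ==> (G has_derivative (*) (h' t x)) (at t within J)" by blast
 have eq: "G t = g' t x" if "t \<in> J" for t
  using LIMSEQ_unique[OF G(1) lim] that by blast
 have "(G has_real_derivative h' t x) (at t within J)"
  using G(2)[OF t] by (simp add: has_field_derivative_def)
 then show ?thesis
  by (rule has_field_derivative_transform_within[where d = 1]) (use t eq in auto)
qed

lemma jointly_continuous:
 fixes g :: "real => real => real"
 assumes lip: "\<And>t x y. t \<in> J ==> \<bar>g t x - g t y\<bar> \<le> B * \<bar>x - y\<bar>"
  and cont: "\<And>x. continuous_on J (\<lambda>t. g t x)"
 shows "continuous_on (J \<times> X) (\<lambda>(t, x). g t x)"
 unfolding continuous_on_def
proof
 fix p assume "p \<in> J \<times> X"
 then obtain t0 x0 where p: "p = (t0, x0)" "t0 \<in> J" by auto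
 let ?F = "at p within J \<times> X"
 have fst: "((\<lambda>q. fst q) \<longlongrightarrow> t0) ?F" and snd: "((\<lambda>q. snd q) \<longlongrightarrow> x0) ?F"
  using p by (auto intro!: tendsto_eq_intros)
 have "((\<lambda>q. g (fst q) x0) \<longlongrightarrow> g t0 x0) ?F"
  by (rule continuous_on_tendsto_compose[OF cont fst p(2)]) (auto simp: eventually_at_filter intro!: always_eventually)
 then have "((\<lambda>q. B * \<bar>snd q - x0\<bar> + \<bar>g (fst q) x0 - g t0 x0\<bar>) \<longlongrightarrow> B * \<bar>x0 - x0\<bar> + \<bar>g t0 x0 - g t0 x0\<bar>) ?F"
  by (intro tendsto_intros snd)
 then have lim: "((\<lambda>q. B * \<bar>snd q - x0\<bar> + \<bar>g (fst q) x0 - g t0 x0\<bar>) \<longlongrightarrow> 0) ?F" by simp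
 have "((\<lambda>q. g (fst q) (snd q) - g t0 x0) \<longlongrightarrow> 0) ?F"
 proof (rule Lim_null_comparison[OF _ lim])
  have "norm (g (fst q) (snd q) - g t0 x0) \<le> B * \<bar>snd q - x0\<bar> + \<bar>g (fst q) x0 - g t0 x0\<bar>" if "q \<in> J \<times> X" for q
   using lip[of "fst q" "snd q" x0] that by (auto simp: mem_Times_iff)
  then show "eventually (\<lambda>q. norm (g (fst q) (snd q) - g t0 x0) \<le> B * \<bar>snd q - x0\<bar> + \<bar>g (fst q) x0 - g t0 x0\<bar>) ?F"
   by (auto simp: eventually_at_filter intro!: always_eventually)
 qed
 then have "((\<lambda>q. g (fst q) (snd q)) \<longlongrightarrow> g t0 x0) ?F"
  by (rule LIM_zero_cancel)
 then show "((\<lambda>(t, x). g t x) \<longlongrightarrow> (\<lambda>(t, x). g t x) p) ?F"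
  by (simp add: p(1) case_prod_unfold)
qed

lemma lipschitz_of_deriv:
 assumes "\<And>x. (f has_real_derivative f' x) (at x)" "\<And>x. \<bar>f' x\<bar> \<le> B"
 shows "\<bar>f x - f y\<bar> \<le> B * \<bar>x - y\<bar>"
 using field_differentiable_bound[of UNIV f f' B x y] assms by auto

lemma integral_t_derivative:
 fixes g h :: "real => real => real"
 assumes "convex J" "t \<in> J"
  and "\<And>t x. t \<in> J ==> ((\<lambda>t. g t x) has_real_derivative h t x) (at t within J)"
  and "\<And>t. t \<in> J ==> continuous_on {0..2*pi} (g t)"
  and "continuous_on (J \<times> {0..2*pi}) (\<lambda>(t, x). h t x)"
 shows "((\<lambda>t. integral {0..2*pi} (g t)) has_real_derivative integral {0..2*pi} (h t)) (at t within J)"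
 by (rule leibniz_rule_field_derivative[of J 0 "2*pi" g h t, unfolded cbox_interval])
   (use assms in \<open>auto intro: integrable_continuous_real\<close>)

lemma fc_t_derivative:
 fixes g h :: "real => real => real"
 assumes J: "convex J" "t \<in> J"
  and der: "\<And>t x. t \<in> J ==> ((\<lambda>t. g t x) has_real_derivative h t x) (at t within J)"
  and cg: "\<And>t. t \<in> J ==> continuous_on {0..2*pi} (g t)"
  and ch: "continuous_on (J \<times> {0..2*pi}) (\<lambda>(t, x). h t x)"
 shows "((\<lambda>t. fc (cr (g t)) m) has_vector_derivative fc (cr (h t)) m) (at t within J)"
proof -
 have "((\<lambda>t. integral (cbox 0 (2*pi)) (\<lambda>x. of_real (g t x) * ek (-m) x)) has_vector_derivative
   integral (cbox 0 (2*pi)) (\<lambda>x. of_real (h t x) * ek (-m) x)) (at t within J)"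
 proof (rule leibniz_rule_vector_derivative[OF _ _ _ J(2) J(1)])
  fix t x assume t: "t \<in> J"
  have "((\<lambda>t. complex_of_real (g t x)) has_vector_derivative of_real (h t x)) (at t within J)"
   using has_vector_derivative_of_real[of "\<lambda>t. g t x" "h t x" "at t within J"] der[OF t]
   by (auto simp: has_real_derivative_iff_has_vector_derivative)
  then show "((\<lambda>t. of_real (g t x) * ek (-m) x) has_vector_derivative of_real (h t x) * ek (-m) x) (at t within J)"
   by (rule has_vector_derivative_mult_left)
 next
  fix t assume "t \<in> J"
  then show "(\<lambda>x. of_real (g t x) * ek (-m) x) integrable_on cbox 0 (2*pi)"
   using cg by (simp add: integrable_continuous_real continuous_intros continuous_on_of_real)
 next
  have "continuous_on (J \<times> {0..2*pi}) (\<lambda>q. of_real (h (fst q) (snd q)) * ek (-m) (snd q))"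
   using ch by (intro continuous_intros continuous_on_of_real) (simp_all add: split_beta)
  then show "continuous_on (J \<times> cbox 0 (2*pi)) (\<lambda>(t, x). of_real (h t x) * ek (-m) x)"
   by (simp add: split_beta)
 qed
 then have "((\<lambda>t. integral {0..2*pi} (\<lambda>x. of_real (g t x) * ek (-m) x) / complex_of_real (2*pi)) has_vector_derivative
   integral {0..2*pi} (\<lambda>x. of_real (h t x) * ek (-m) x) / complex_of_real (2*pi)) (at t within J)"
  by (intro has_vector_derivative_divide) simp
 then show ?thesis by (simp only: fc_def)
qed

lemma cmod_squared_derivative:
 assumes "(f has_vector_derivative f') (at t within J)"
 shows "((\<lambda>t. (cmod (f t))^2) has_real_derivative 2 * Re (cnj (f t) * f')) (at t within J)"
proof -
 have "((\<lambda>t. Re (f t)) has_real_derivative Re f') (at t within J)" "((\<lambda>t. Im (f t)) has_real_derivative Im f') (at t within J)"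
  using bounded_linear.has_vector_derivative[OF bounded_linear_Re assms]
     bounded_linear.has_vector_derivative[OF bounded_linear_Im assms]
  by (simp_all add: has_real_derivative_iff_has_vector_derivative)
 moreover have "((\<lambda>t. (g t)^2) has_real_derivative 2 * g t * d) (at t within J)"
  if "(g has_real_derivative d) (at t within J)" for g :: "real => real" and d
  using that by (auto intro!: derivative_eq_intros)
 ultimately have "((\<lambda>t. (Re (f t))^2 + (Im (f t))^2) has_real_derivative 2 * Re (f t) * Re f' + 2 * Im (f t) * Im f') (at t within J)"
  by (intro DERIV_add)
 then show ?thesis by (simp add: cmod_power2 algebra_simps)
qed

text \<open>Two-sided, because bounds are carried both forward and backward in time.\<close>
lemma gronwall_two_sided:
 fixes y y' :: "real => real"
 assumes J: "convex J" "t1 \<in> J" "t2 \<in> J" and C: "C \<ge> 0"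
  and der: "\<And>t. t \<in> J ==> (y has_real_derivative y' t) (at t within J)"
  and bd: "\<And>t. t \<in> J ==> \<bar>y' t\<bar> \<le> C * y t"
 shows "y t2 \<le> exp (C * \<bar>t2 - t1\<bar>) * y t1"
proof -
 have ivl: "{min t1 t2..max t1 t2} \<subseteq> J"
  using J by (metis convex_contains_segment closed_segment_eq_real_ivl max_def min_def)
 have mono: "exp (\<sigma> * C * (v - w)) * y v \<le> y w"
  if "\<sigma> = 1 \<or> \<sigma> = -1" "(w - v) * \<sigma> \<ge> 0" "v \<in> {t1, t2}" "w \<in> {t1, t2}" for \<sigma> v w
 proof -
  define z where "z t = y t * exp (\<sigma> * C * (t - w))" for t
  have zd: "(z has_real_derivative ((y' t + \<sigma> * C * y t) * exp (\<sigma> * C * (t - w)))) (at t within J)" if "t \<in> J" for t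
   unfolding z_def by (auto intro!: derivative_eq_intros der[OF that] simp: algebra_simps)
  have sgn: "\<sigma> * ((y' t + \<sigma> * C * y t) * exp (\<sigma> * C * (t - w))) \<ge> 0" if "t \<in> J" for t
  proof -
   have "\<sigma> * (y' t + \<sigma> * C * y t) \<ge> 0"
    using bd[OF that] \<open>\<sigma> = 1 \<or> \<sigma> = -1\<close> by (auto simp: abs_le_iff algebra_simps)
   then show ?thesis by (simp add: mult.assoc[symmetric])
  qed
  show ?thesis
  proof (cases "v = w")
   case False
   define l r where "l = min v w" and "r = max v w"
   have sub: "{l..r} \<subseteq> J" using that ivl J by (auto simp: l_def r_def min_def max_def split: if_splits)
   have "l < r" using False by (auto simp: l_def r_def)
   have "\<exists>x\<in>{l<..<r}. z r - z l = ((y' x + \<sigma> * C * y x) * exp (\<sigma> * C * (x - w))) * (r - l)"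
   proof (rule mvt_simple[OF \<open>l < r\<close>])
    fix x assume "l \<le> x" "x \<le> r"
    then have "x \<in> J" using sub by auto
    then have "(z has_real_derivative ((y' x + \<sigma> * C * y x) * exp (\<sigma> * C * (x - w)))) (at x within {l..r})"
     by (rule has_field_derivative_subset[OF zd sub])
    then show "(z has_derivative (*) ((y' x + \<sigma> * C * y x) * exp (\<sigma> * C * (x - w)))) (at x within {l..r})"
     by (simp add: has_field_derivative_def)
   qed
   then obtain x where x: "x \<in> {l<..<r}" "z r - z l = ((y' x + \<sigma> * C * y x) * exp (\<sigma> * C * (x - w))) * (r - l)"
    by blast
   have "\<sigma> * (z r - z l) \<ge> 0"
    unfolding x(2) using sgn[of x] sub x(1) \<open>l < r\<close> by (simp add: mult.assoc[symmetric] subset_iff)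
   moreover have "(\<sigma> = 1 \<and> l = v \<and> r = w) \<or> (\<sigma> = -1 \<and> l = w \<and> r = v)"
    using that False by (auto simp: l_def r_def)
   ultimately have "z v \<le> z w" by auto
   then show ?thesis by (simp add: z_def mult.commute)
  qed simp
 qed
 show ?thesis
 proof (cases "t1 \<le> t2")
  case True
  have "exp (-1 * C * (t2 - t1)) * y t2 \<le> y t1" by (rule mono) (use True in auto)
  then have "exp (C * (t2 - t1)) * (exp (-1 * C * (t2 - t1)) * y t2) \<le> exp (C * (t2 - t1)) * y t1"
   by (rule mult_left_mono) simp
  moreover have "exp (C * (t2 - t1)) * exp (-1 * C * (t2 - t1)) = 1" by (simp add: exp_minus_inverse)
  ultimately show ?thesis using True by (simp only: mult.assoc[symmetric] mult_1 abs_of_nonneg diff_ge_0_iff_ge)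
 next
  case False
  have "exp (1 * C * (t2 - t1)) * y t2 \<le> y t1" by (rule mono) (use False in auto)
  then have "exp (C * (t1 - t2)) * (exp (1 * C * (t2 - t1)) * y t2) \<le> exp (C * (t1 - t2)) * y t1"
   by (rule mult_left_mono) simp
  moreover have "exp (C * (t1 - t2)) * exp (1 * C * (t2 - t1)) = 1" by (simp add: exp_add[symmetric] algebra_simps)
  ultimately have "y t2 \<le> exp (C * (t1 - t2)) * y t1" by (simp only: mult.assoc[symmetric] mult_1)
  then show ?thesis using False by (simp only: abs_minus_commute[of t2] abs_of_nonneg diff_ge_0_iff_ge)
 qed
qed

section \<open>The Airy flow on time intervals where the Sobolev norm is bounded\<close>

locale airy_flow =
 fixes a T :: real and S :: nat and \<theta> :: "real => real => real"
 assumes a_pos: "a > 0" and T_nonneg: "T \<ge> 0" and S_ge: "S \<ge> 9"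
  and smooth: "\<And>t. t \<in> {0..T} ==> per_smooth (S - 1) (\<lambda>x. \<theta> x t)"
  and sob_each: "\<And>t. t \<in> {0..T} ==> \<exists>K\<ge>0. sob S K (fc (cr (\<lambda>x. \<theta> x t)))"
  and flow: "\<And>t x. t \<in> {0..T} ==> ((\<lambda>t. \<theta> x t) has_real_derivative
    a^3 * ((deriv ^^ 3) (\<lambda>x. \<theta> x t) x + (deriv (\<lambda>x. \<theta> x t) x)^3 / 2)) (at t within {0..T})"
begin

definition D :: "nat => real => real => real" where "D j t = (deriv ^^ j) (\<lambda>x. \<theta> x t)"

definition c :: "real => int => complex" where "c t = fc (cr (\<lambda>x. \<theta> x t))"

lemma D_der: "t \<in> {0..T} ==> j < S - 1 ==> (D j t has_real_derivative D (Suc j) t x) (at x)"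
 using smooth unfolding per_smooth_def D_def by blast

lemma D_per: "t \<in> {0..T} ==> j \<le> S - 1 ==> periodic_2pi (D j t)"
 using smooth unfolding per_smooth_def D_def by blast

lemma D_cont: "t \<in> {0..T} ==> j \<le> S - 1 ==> continuous_on X (D j t)"
 using smooth continuous_on_subset unfolding per_smooth_def D_def by blast

lemma D0: "D 0 t x = \<theta> x t"
 by (simp add: D_def)

lemma fc_D: "t \<in> {0..T} ==> j \<le> S - 1 ==> fc (cr (D j t)) m = (\<i> * of_int m)^j * c t m"
proof (induction j)
 case (Suc j)
 have "fc (cr (D (Suc j) t)) m = \<i> * of_int m * fc (cr (D j t)) m"
  using Suc.prems by (intro fc_deriv D_per D_der D_cont) auto
 then show ?case using Suc by simp
qed (simp add: D_def c_def)

lemma D_bound: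
 assumes t: "t \<in> {0..T}" and K: "sob S K (c t)" "0 \<le> K" and j: "1 \<le> j" "j \<le> S - 1"
 shows "\<bar>D j t x\<bar> \<le> 2 * K"
proof -
 obtain i where i: "j = Suc i" using j by (cases j) auto
 have "\<bar>D i t x - D i t y\<bar> \<le> 2 * K * \<bar>x - y\<bar>" for x y
 proof (rule fourier_lipschitz[where f' = "D j t"])
  show "periodic_2pi (D i t)" using t j i by (intro D_per) auto
  show "(D i t has_real_derivative D j t x) (at x)" for x
   using t j i D_der[of t i x] by auto
  fix A :: "int set" assume A: "finite A"
  have "(\<Sum>m\<in>A. \<bar>of_int m\<bar> * cmod (fc (cr (D i t)) m)) = (\<Sum>m\<in>A. \<bar>of_int m\<bar>^j * cmod (c t m))"
   using t j i by (intro sum.cong refl) (simp add: fc_D norm_mult norm_power)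
  also have "... = (\<Sum>m\<in>A - {0}. \<bar>of_int m\<bar>^j * cmod (c t m))"
   using A i by (intro sum.mono_neutral_right) auto
  also have "... \<le> 2 * K"
   using A K j S_ge by (intro sob_l1[of S]) auto
  finally show "(\<Sum>m\<in>A. \<bar>of_int m\<bar> * cmod (fc (cr (D i t)) m)) \<le> 2 * K" .
 qed
 moreover have "(D i t has_real_derivative D j t x) (at x)"
  using D_der[OF t, of i x] i j by simp
 ultimately show ?thesis
  using deriv_le_lipschitz by blast
qed

definition "P0 t x = D 3 t x + (D 1 t x)^3 / 2"
definition "P1 t x = D 4 t x + 3/2 * (D 1 t x)^2 * D 2 t x"
definition "P2 t x = D 5 t x + 3 * D 1 t x * (D 2 t x)^2 + 3/2 * (D 1 t x)^2 * D 3 t x"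
definition "P3 t x = D 6 t x + 3 * (D 2 t x)^3 + 9 * D 1 t x * D 2 t x * D 3 t x + 3/2 * (D 1 t x)^2 * D 4 t x"
definition "P4 t x = D 7 t x + 18 * (D 2 t x)^2 * D 3 t x + 9 * D 1 t x * (D 3 t x)^2
  + 12 * D 1 t x * D 2 t x * D 4 t x + 3/2 * (D 1 t x)^2 * D 5 t x"
definition "P5 t x = D 8 t x + 45 * D 2 t x * (D 3 t x)^2 + 30 * (D 2 t x)^2 * D 4 t x
  + 30 * D 1 t x * D 3 t x * D 4 t x + 15 * D 1 t x * D 2 t x * D 5 t x + 3/2 * (D 1 t x)^2 * D 6 t x"

lemma D_der': assumes "t \<in> {0..T}"
 shows "(D 0 t has_real_derivative D 1 t x) (at x)" "(D 1 t has_real_derivative D 2 t x) (at x)"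
  "(D 2 t has_real_derivative D 3 t x) (at x)" "(D 3 t has_real_derivative D 4 t x) (at x)"
  "(D 4 t has_real_derivative D 5 t x) (at x)" "(D 5 t has_real_derivative D 6 t x) (at x)"
  "(D 6 t has_real_derivative D 7 t x) (at x)" "(D 7 t has_real_derivative D 8 t x) (at x)"
 using D_der[OF assms, of 0 x] D_der[OF assms, of 1 x] D_der[OF assms, of 2 x] D_der[OF assms, of 3 x]
  D_der[OF assms, of 4 x] D_der[OF assms, of 5 x] D_der[OF assms, of 6 x] D_der[OF assms, of 7 x] S_ge
 by (simp_all add: numeral_eq_Suc)

lemma P_der: assumes "t \<in> {0..T}"
 shows "(P0 t has_real_derivative P1 t x) (at x)" "(P1 t has_real_derivative P2 t x) (at x)"
  "(P2 t has_real_derivative P3 t x) (at x)" "(P3 t has_real_derivative P4 t x) (at x)"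
  "(P4 t has_real_derivative P5 t x) (at x)"
 unfolding P0_def[abs_def] P1_def[abs_def] P2_def[abs_def] P3_def[abs_def] P4_def[abs_def] P5_def
 by (auto intro!: derivative_eq_intros D_der'[OF assms] simp: power2_eq_square power3_eq_cube algebra_simps
   simp del: One_nat_def)

lemma flow_P0: "t \<in> {0..T} ==> ((\<lambda>t. D 0 t x) has_real_derivative a^3 * P0 t x) (at t within {0..T})"
 using flow[of t x] by (simp add: D_def P0_def)

lemma abs_prod_le: "\<bar>x\<bar> \<le> p ==> \<bar>y\<bar> \<le> q ==> \<bar>x * y\<bar> \<le> p * (q::real)"
 unfolding abs_mult by (intro mult_mono) auto

lemma abs_pow_le: "\<bar>x\<bar> \<le> p ==> \<bar>x ^ n\<bar> \<le> (p::real) ^ n"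
 by (simp add: power_abs power_mono)

lemma abs_num_le: "\<bar>numeral n :: real\<bar> \<le> numeral n" "\<bar>numeral n / numeral k :: real\<bar> \<le> numeral n / numeral k"
 by simp_all

lemma abs_sum_le: "\<bar>x\<bar> \<le> p ==> \<bar>y\<bar> \<le> q ==> \<bar>x + y\<bar> \<le> p + (q::real)"
 by linarith

lemma P_bound:
 assumes "t \<in> {0..T}" "\<And>j. j \<in> {1..8} ==> \<bar>D j t x\<bar> \<le> B"
 shows "\<bar>P1 t x\<bar> \<le> B + 3/2 * B^2 * B"
  "\<bar>P2 t x\<bar> \<le> B + 3 * B * B^2 + 3/2 * B^2 * B"
  "\<bar>P3 t x\<bar> \<le> B + 3 * B^3 + 9 * B * B * B + 3/2 * B^2 * B"
  "\<bar>P4 t x\<bar> \<le> B + 18 * B^2 * B + 9 * B * B^2 + 12 * B * B * B + 3/2 * B^2 * B"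
  "\<bar>P5 t x\<bar> \<le> B + 45 * B * B^2 + 30 * B^2 * B + 30 * B * B * B + 15 * B * B * B + 3/2 * B^2 * B"
 unfolding P1_def P2_def P3_def P4_def P5_def
 by (intro abs_sum_le abs_prod_le abs_pow_le abs_num_le assms(2); simp)+

end

text \<open>The smoothness in \<open>airy_flow\<close> is only that of each time slice. A Sobolev bound that is uniform on \<open>J\<close> turns it
 into joint smoothness, because it makes the difference quotients in space converge uniformly.\<close>
locale airy_interval = airy_flow +
 fixes J :: "real set" and K :: real
 assumes J_sub: "J \<subseteq> {0..T}" and J_convex: "convex J" and K_nonneg: "0 \<le> K"
  and sobJ: "\<And>t. t \<in> J ==> sob S K (c t)"
begin

lemma JT: "t \<in> J ==> t \<in> {0..T}"
 using J_sub by blast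

lemma DJ_bound: "t \<in> J ==> 1 \<le> j ==> j \<le> S - 1 ==> \<bar>D j t x\<bar> \<le> 2 * K"
 using D_bound JT sobJ K_nonneg by blast

lemma DJ_lip: "t \<in> J ==> Suc j \<le> S - 1 ==> \<bar>D j t x - D j t y\<bar> \<le> 2 * K * \<bar>x - y\<bar>"
 by (rule lipschitz_of_deriv[where f' = "D (Suc j) t"]) (auto intro!: D_der DJ_bound JT)

lemma D_t_cont: "j \<le> S - 2 ==> continuous_on J (\<lambda>t. D j t x)"
proof (induction j arbitrary: x)
 case 0
 have "continuous_on {0..T} (\<lambda>t. D 0 t x)"
  using flow_P0 by (meson DERIV_continuous continuous_on_eq_continuous_within)
 then show ?case using J_sub continuous_on_subset by blast
next
 case (Suc j)
 show ?case
  by (rule x_derivative_continuous_in_t[where g = "D j" and B = "2 * K"])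
    (use Suc in \<open>auto intro!: D_der DJ_lip JT\<close>)
qed

lemma D_joint: "j \<le> S - 2 ==> continuous_on (J \<times> X) (\<lambda>q. D j (fst q) (snd q))"
 using jointly_continuous[where g = "D j" and B = "2 * K" and J = J and X = X] D_t_cont[of j] DJ_lip[of _ j] S_ge
 by (force simp: split_beta)

lemma D_joint': "continuous_on (J \<times> X) (\<lambda>q. D 0 (fst q) (snd q))" "continuous_on (J \<times> X) (\<lambda>q. D 1 (fst q) (snd q))"
 "continuous_on (J \<times> X) (\<lambda>q. D 2 (fst q) (snd q))" "continuous_on (J \<times> X) (\<lambda>q. D 3 (fst q) (snd q))"
 "continuous_on (J \<times> X) (\<lambda>q. D 4 (fst q) (snd q))" "continuous_on (J \<times> X) (\<lambda>q. D 5 (fst q) (snd q))"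
 "continuous_on (J \<times> X) (\<lambda>q. D 6 (fst q) (snd q))" "continuous_on (J \<times> X) (\<lambda>q. D 7 (fst q) (snd q))"
 using S_ge by (auto intro!: D_joint)

lemma P_joint: "continuous_on (J \<times> X) (\<lambda>q. P0 (fst q) (snd q))" "continuous_on (J \<times> X) (\<lambda>q. P1 (fst q) (snd q))"
 "continuous_on (J \<times> X) (\<lambda>q. P2 (fst q) (snd q))" "continuous_on (J \<times> X) (\<lambda>q. P3 (fst q) (snd q))"
 "continuous_on (J \<times> X) (\<lambda>q. P4 (fst q) (snd q))"
 unfolding P0_def P1_def P2_def P3_def P4_def
 by (intro continuous_intros D_joint'; simp)+

lemma D_t_der:
 assumes t: "t \<in> J"
 shows "((\<lambda>t. D 0 t x) has_real_derivative a^3 * P0 t x) (at t within J)"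
  "((\<lambda>t. D 1 t x) has_real_derivative a^3 * P1 t x) (at t within J)"
  "((\<lambda>t. D 2 t x) has_real_derivative a^3 * P2 t x) (at t within J)"
  "((\<lambda>t. D 3 t x) has_real_derivative a^3 * P3 t x) (at t within J)"
  "((\<lambda>t. D 4 t x) has_real_derivative a^3 * P4 t x) (at t within J)"
proof -
 have bd: "\<exists>C. \<forall>t\<in>J. \<forall>x. \<bar>P2 t x\<bar> \<le> C \<and> \<bar>P3 t x\<bar> \<le> C \<and> \<bar>P4 t x\<bar> \<le> C \<and> \<bar>P5 t x\<bar> \<le> C"
 proof -
  have D8: "\<bar>D j t x\<bar> \<le> 2 * K" if "t \<in> J" "j \<in> {1..8}" for t j x
   using that S_ge by (intro DJ_bound) auto
  obtain C2 C3 C4 C5 where "\<And>t x. t \<in> J ==> \<bar>P2 t x\<bar> \<le> C2" "\<And>t x. t \<in> J ==> \<bar>P3 t x\<bar> \<le> C3"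
   "\<And>t x. t \<in> J ==> \<bar>P4 t x\<bar> \<le> C4" "\<And>t x. t \<in> J ==> \<bar>P5 t x\<bar> \<le> C5"
   using P_bound(2-5)[OF JT D8] by meson
  then show ?thesis
   by (intro exI[of _ "max (max C2 C3) (max C4 C5)"]) (auto simp: le_max_iff_disj)
 qed
 then obtain C where C: "\<And>t x. t \<in> J ==> \<bar>P2 t x\<bar> \<le> C" "\<And>t x. t \<in> J ==> \<bar>P3 t x\<bar> \<le> C"
  "\<And>t x. t \<in> J ==> \<bar>P4 t x\<bar> \<le> C" "\<And>t x. t \<in> J ==> \<bar>P5 t x\<bar> \<le> C" by blast
 have lip: "\<bar>a^3 * f t x - a^3 * f t y\<bar> \<le> (a^3 * C) * \<bar>x - y\<bar>"
  if "t \<in> J" "\<And>x. (f t has_real_derivative f' t x) (at x)" "\<And>x. \<bar>f' t x\<bar> \<le> C" for f f' :: "real => real => real" and t x y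
 proof -
  have "\<bar>a^3 * f t x - a^3 * f t y\<bar> = a^3 * \<bar>f t x - f t y\<bar>"
   using a_pos by (simp add: right_diff_distrib[symmetric] abs_mult)
  also have "... \<le> a^3 * (C * \<bar>x - y\<bar>)"
   using a_pos that by (intro mult_left_mono lipschitz_of_deriv[where f' = "f' t"]) auto
  finally show ?thesis by simp
 qed
 have 0: "((\<lambda>t. D 0 t x) has_real_derivative a^3 * P0 t x) (at t within J)" if "t \<in> J" for t x
  using flow_P0[OF JT[OF that]] J_sub by (rule has_field_derivative_subset)
 have 1: "((\<lambda>t. D 1 t x) has_real_derivative a^3 * P1 t x) (at t within J)" if "t \<in> J" for t x
  by (rule x_derivative_t_derivative[OF J_convex that, where g = "D 0" and g' = "D 1" and h = "\<lambda>t x. a^3 * P0 t x"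
     and h' = "\<lambda>t x. a^3 * P1 t x" and B = "a^3 * C"])
    (auto intro!: 0 D_der' DERIV_cmult P_der JT lip[where f' = P2] C simp del: One_nat_def)
 have 2: "((\<lambda>t. D 2 t x) has_real_derivative a^3 * P2 t x) (at t within J)" if "t \<in> J" for t x
  by (rule x_derivative_t_derivative[OF J_convex that, where g = "D 1" and g' = "D 2" and h = "\<lambda>t x. a^3 * P1 t x"
     and h' = "\<lambda>t x. a^3 * P2 t x" and B = "a^3 * C"])
    (auto intro!: 1 D_der' DERIV_cmult P_der JT lip[where f' = P3] C simp del: One_nat_def)
 have 3: "((\<lambda>t. D 3 t x) has_real_derivative a^3 * P3 t x) (at t within J)" if "t \<in> J" for t x
  by (rule x_derivative_t_derivative[OF J_convex that, where g = "D 2" and g' = "D 3" and h = "\<lambda>t x. a^3 * P2 t x"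
     and h' = "\<lambda>t x. a^3 * P3 t x" and B = "a^3 * C"])
    (auto intro!: 2 D_der' DERIV_cmult P_der JT lip[where f' = P4] C simp del: One_nat_def)
 have 4: "((\<lambda>t. D 4 t x) has_real_derivative a^3 * P4 t x) (at t within J)"
  by (rule x_derivative_t_derivative[OF J_convex t, where g = "D 3" and g' = "D 4" and h = "\<lambda>t x. a^3 * P3 t x"
     and h' = "\<lambda>t x. a^3 * P4 t x" and B = "a^3 * C"])
    (auto intro!: 3 D_der' DERIV_cmult P_der JT lip[where f' = P5] C simp del: One_nat_def)
 show "((\<lambda>t. D 0 t x) has_real_derivative a^3 * P0 t x) (at t within J)"
  "((\<lambda>t. D 1 t x) has_real_derivative a^3 * P1 t x) (at t within J)"
  "((\<lambda>t. D 2 t x) has_real_derivative a^3 * P2 t x) (at t within J)"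
  "((\<lambda>t. D 3 t x) has_real_derivative a^3 * P3 t x) (at t within J)"
  "((\<lambda>t. D 4 t x) has_real_derivative a^3 * P4 t x) (at t within J)"
  by (fact 0[OF t] 1[OF t] 2[OF t] 3[OF t] 4)+
qed

end

section \<open>Conservation laws of the modified Korteweg--de Vries equation\<close>

text \<open>The density of the third invariant changes by a total space derivative; the flux is found by matching monomials of equal weight.\<close>
lemma flux_identity:
 fixes u v p q r s w y z :: real
 assumes "w = p - u^3/2" "y = q - 3/2 * u^2 * v" "z = r - 3 * u * v^2 - 3/2 * u^2 * w"
 shows "(2 * y * r + 2 * w * s) - (2 * z * q + 2 * y * r)
   - (10 * u * v * v * q + 5 * u^2 * w * q + 5 * u^2 * v * r)
   + 2 * q * r + (2 * u * v * p^2 + u^2 * (2 * p * q))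
   - ((v * v^2 + u * (2 * v * w) + 5 * u^4 * v / 4) * p
     + (u * v^2 + u^5 / 4) * q)
   + 1/4 * (2 * (v^2 + u^4 / 4) * (2 * v * w + 4 * u^3 * v / 4))
  = 2 * w * s - 5 * u * v^2 * q - 5 * u^2 * v * r + 3/4 * u^5 * q"
 using assms by algebra

context airy_flow
begin

definition "E0 t = integral {0..2*pi} (\<lambda>x. (D 1 t x)^2)"
definition "E1 t = integral {0..2*pi} (\<lambda>x. (D 2 t x)^2 - (D 1 t x)^4 / 4)"
definition "E2 t = integral {0..2*pi} (\<lambda>x. (D 3 t x)^2 - 5/2 * (D 1 t x)^2 * (D 2 t x)^2 + (D 1 t x)^6 / 8)"
definition "B2 t = integral {0..2*pi} (\<lambda>x. (D 3 t x)^2)"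

lemma D_cont': assumes "t \<in> {0..T}" shows "continuous_on X (D 0 t)" "continuous_on X (D 1 t)" "continuous_on X (D 2 t)"
 "continuous_on X (D 3 t)" "continuous_on X (D 4 t)" "continuous_on X (D 5 t)" "continuous_on X (D 6 t)" "continuous_on X (D 7 t)"
 using assms S_ge by (auto intro!: D_cont)

lemma D_ends: assumes "t \<in> {0..T}" shows "D 0 t (2*pi) = D 0 t 0" "D 1 t (2*pi) = D 1 t 0" "D 2 t (2*pi) = D 2 t 0" "D 3 t (2*pi) = D 3 t 0"
 "D 4 t (2*pi) = D 4 t 0" "D 5 t (2*pi) = D 5 t 0"
proof -
 have "D j t (2*pi) = D j t 0" if "j \<le> S - 1" for j
  using D_per[OF assms that] unfolding periodic_2pi_def by (metis add_0)
 then show "D 0 t (2*pi) = D 0 t 0" "D 1 t (2*pi) = D 1 t 0" "D 2 t (2*pi) = D 2 t 0" "D 3 t (2*pi) = D 3 t 0"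
 "D 4 t (2*pi) = D 4 t 0" "D 5 t (2*pi) = D 5 t 0"
  using S_ge by auto
qed

lemma P_ends: "t \<in> {0..T} ==> P0 t (2*pi) = P0 t 0" "t \<in> {0..T} ==> P1 t (2*pi) = P1 t 0" "t \<in> {0..T} ==> P2 t (2*pi) = P2 t 0"
 by (simp_all only: P0_def P1_def P2_def D_ends)

lemma flux0:
 assumes "t \<in> {0..T}"
 shows "((\<lambda>x. 2 * D 1 t x * D 3 t x - (D 2 t x)^2 + 3/4 * (D 1 t x)^4) has_real_derivative 2 * D 1 t x * P1 t x) (at x)"
proof -
 have "((\<lambda>x. 2 * D 1 t x * D 3 t x - (D 2 t x)^2 + 3/4 * (D 1 t x)^4) has_real_derivative
   (2 * D 2 t x * D 3 t x + 2 * D 1 t x * D 4 t x) - 2 * D 2 t x * D 3 t x + 3/4 * (4 * (D 1 t x)^3 * D 2 t x)) (at x)"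
  by (auto intro!: derivative_eq_intros D_der'[OF assms] simp del: One_nat_def)
 moreover have "(2 * D 2 t x * D 3 t x + 2 * D 1 t x * D 4 t x) - 2 * D 2 t x * D 3 t x + 3/4 * (4 * (D 1 t x)^3 * D 2 t x) = 2 * D 1 t x * P1 t x"
  unfolding P1_def by (simp add: field_simps power2_eq_square power3_eq_cube del: One_nat_def)
 ultimately show ?thesis by simp
qed

lemma flux1:
 assumes "t \<in> {0..T}"
 shows "((\<lambda>x. 2 * D 2 t x * P1 t x - (P0 t x)^2) has_real_derivative 2 * D 2 t x * P2 t x - (D 1 t x)^3 * P1 t x) (at x)"
proof -
 have "((\<lambda>x. 2 * D 2 t x * P1 t x - (P0 t x)^2) has_real_derivative
   (2 * D 3 t x * P1 t x + 2 * D 2 t x * P2 t x) - 2 * P0 t x * P1 t x) (at x)"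
  by (auto intro!: derivative_eq_intros D_der'[OF assms] P_der[OF assms] simp del: One_nat_def)
 moreover have "(2 * D 3 t x * P1 t x + 2 * D 2 t x * P2 t x) - 2 * P0 t x * P1 t x = 2 * D 2 t x * P2 t x - (D 1 t x)^3 * P1 t x"
  unfolding P0_def by (simp add: field_simps del: One_nat_def)
 ultimately show ?thesis by simp
qed

lemma flux2:
 assumes "t \<in> {0..T}"
 shows "((\<lambda>x. 2 * D 3 t x * P2 t x - 2 * D 4 t x * P1 t x - 5 * (D 1 t x)^2 * D 2 t x * P1 t x + (P1 t x)^2 + (D 1 t x)^2 * (P0 t x)^2
    - (D 1 t x * (D 2 t x)^2 + (D 1 t x)^5 / 4) * P0 t x + 1/4 * ((D 2 t x)^2 + (D 1 t x)^4 / 4)^2)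
   has_real_derivative 2 * D 3 t x * P3 t x - 5 * D 1 t x * (D 2 t x)^2 * P1 t x - 5 * (D 1 t x)^2 * D 2 t x * P2 t x + 3/4 * (D 1 t x)^5 * P1 t x) (at x)"
proof -
 have "((\<lambda>x. 2 * D 3 t x * P2 t x - 2 * D 4 t x * P1 t x - 5 * (D 1 t x)^2 * D 2 t x * P1 t x + (P1 t x)^2 + (D 1 t x)^2 * (P0 t x)^2
    - (D 1 t x * (D 2 t x)^2 + (D 1 t x)^5 / 4) * P0 t x + 1/4 * ((D 2 t x)^2 + (D 1 t x)^4 / 4)^2)
   has_real_derivative
   (2 * D 4 t x * P2 t x + 2 * D 3 t x * P3 t x) - (2 * D 5 t x * P1 t x + 2 * D 4 t x * P2 t x)
   - (10 * D 1 t x * D 2 t x * D 2 t x * P1 t x + 5 * (D 1 t x)^2 * D 3 t x * P1 t x + 5 * (D 1 t x)^2 * D 2 t x * P2 t x)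
   + 2 * P1 t x * P2 t x + (2 * D 1 t x * D 2 t x * (P0 t x)^2 + (D 1 t x)^2 * (2 * P0 t x * P1 t x))
   - ((D 2 t x * (D 2 t x)^2 + D 1 t x * (2 * D 2 t x * D 3 t x) + 5 * (D 1 t x)^4 * D 2 t x / 4) * P0 t x
     + (D 1 t x * (D 2 t x)^2 + (D 1 t x)^5 / 4) * P1 t x)
   + 1/4 * (2 * ((D 2 t x)^2 + (D 1 t x)^4 / 4) * (2 * D 2 t x * D 3 t x + 4 * (D 1 t x)^3 * D 2 t x / 4))) (at x)"
  by (auto intro!: derivative_eq_intros D_der'[OF assms] P_der[OF assms] simp: field_simps simp del: One_nat_def)
 moreover have "(2 * D 4 t x * P2 t x + 2 * D 3 t x * P3 t x) - (2 * D 5 t x * P1 t x + 2 * D 4 t x * P2 t x)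
   - (10 * D 1 t x * D 2 t x * D 2 t x * P1 t x + 5 * (D 1 t x)^2 * D 3 t x * P1 t x + 5 * (D 1 t x)^2 * D 2 t x * P2 t x)
   + 2 * P1 t x * P2 t x + (2 * D 1 t x * D 2 t x * (P0 t x)^2 + (D 1 t x)^2 * (2 * P0 t x * P1 t x))
   - ((D 2 t x * (D 2 t x)^2 + D 1 t x * (2 * D 2 t x * D 3 t x) + 5 * (D 1 t x)^4 * D 2 t x / 4) * P0 t x
     + (D 1 t x * (D 2 t x)^2 + (D 1 t x)^5 / 4) * P1 t x)
   + 1/4 * (2 * ((D 2 t x)^2 + (D 1 t x)^4 / 4) * (2 * D 2 t x * D 3 t x + 4 * (D 1 t x)^3 * D 2 t x / 4))
  = 2 * D 3 t x * P3 t x - 5 * D 1 t x * (D 2 t x)^2 * P1 t x - 5 * (D 1 t x)^2 * D 2 t x * P2 t x + 3/4 * (D 1 t x)^5 * P1 t x"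
  by (rule flux_identity) (simp_all add: P0_def P1_def P2_def del: One_nat_def)
 ultimately show ?thesis by (simp only:)
qed

end

lemma energy2_derivative:
 fixes f g h :: "real => real"
 assumes f: "(f has_real_derivative f') (at t within J)" and g: "(g has_real_derivative g') (at t within J)"
  and h: "(h has_real_derivative h') (at t within J)"
 shows "((\<lambda>t. (h t)^2 - 5/2 * (f t)^2 * (g t)^2 + (f t)^6 / 8) has_real_derivative
   2 * h t * h' - (5 * f t * f' * (g t)^2 + 5 * (f t)^2 * g t * g') + 3/4 * (f t)^5 * f') (at t within J)"
proof -
 have f2: "((\<lambda>t. (f t)^2) has_real_derivative 2 * f t * f') (at t within J)"
  and f6: "((\<lambda>t. (f t)^6 / 8) has_real_derivative 3/4 * (f t)^5 * f') (at t within J)"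
  using f by (auto intro!: derivative_eq_intros)
 have g2: "((\<lambda>t. (g t)^2) has_real_derivative 2 * g t * g') (at t within J)"
  using g by (auto intro!: derivative_eq_intros)
 have h2: "((\<lambda>t. (h t)^2) has_real_derivative 2 * h t * h') (at t within J)"
  using h by (auto intro!: derivative_eq_intros)
 have "((\<lambda>t. 5/2 * (f t)^2 * (g t)^2) has_real_derivative 5 * f t * f' * (g t)^2 + 5 * (f t)^2 * g t * g') (at t within J)"
  by (rule DERIV_cong[OF DERIV_mult[OF DERIV_cmult[OF f2] g2]]) (simp add: algebra_simps)
 then show ?thesis by (intro DERIV_add DERIV_diff h2 f6)
qed

context airy_interval
begin

lemma conserved_density:
 fixes \<rho> \<sigma> F :: "real => real => real"
 assumes "\<And>t x. t \<in> J ==> ((\<lambda>t. \<rho> t x) has_real_derivative a^3 * \<sigma> t x) (at t within J)"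
  and "\<And>t. t \<in> J ==> continuous_on {0..2*pi} (\<rho> t)"
  and "continuous_on (J \<times> {0..2*pi}) (\<lambda>q. \<sigma> (fst q) (snd q))"
  and F: "\<And>t x. t \<in> J ==> (F t has_real_derivative \<sigma> t x) (at x)"
  and F2pi: "\<And>t. t \<in> J ==> F t (2*pi) = F t 0"
  and "t1 \<in> J" "t2 \<in> J"
 shows "integral {0..2*pi} (\<rho> t1) = integral {0..2*pi} (\<rho> t2)"
proof -
 have "((\<lambda>t. integral {0..2*pi} (\<rho> t)) has_real_derivative 0) (at t within J)" if t: "t \<in> J" for t
 proof -
  have "((\<lambda>t. integral {0..2*pi} (\<rho> t)) has_real_derivative integral {0..2*pi} (\<lambda>x. a^3 * \<sigma> t x)) (at t within J)"
   using assms(1-3) by (intro integral_t_derivative[OF J_convex t]) (auto simp: case_prod_unfold intro!: continuous_intros)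
  moreover have "(\<sigma> t has_integral (F t (2*pi) - F t 0)) {0..2*pi}"
   using F[OF t] by (intro fundamental_theorem_of_calculus)
    (auto simp: has_real_derivative_iff_has_vector_derivative[symmetric] intro: has_field_derivative_at_within)
  then have "integral {0..2*pi} (\<lambda>x. a^3 * \<sigma> t x) = 0"
   by (simp add: integral_unique F2pi[OF t])
  ultimately show ?thesis by (simp only:)
 qed
 then obtain k where "\<forall>t\<in>J. integral {0..2*pi} (\<rho> t) = k"
  using has_field_derivative_zero_constant[OF J_convex] by blast
 then show ?thesis using assms(6,7) by simp
qed

text \<open>The time derivative of each density is the space derivative of a periodic flux.\<close>
lemma E_conserved:
 assumes "t1 \<in> J" "t2 \<in> J"
 shows "E0 t1 = E0 t2" "E1 t1 = E1 t2" "E2 t1 = E2 t2"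
proof -
 show "E0 t1 = E0 t2"
  unfolding E0_def
 proof (rule conserved_density[OF _ _ _ flux0[OF JT] _ assms])
  show "((\<lambda>t. (D 1 t x)^2) has_real_derivative a^3 * (2 * D 1 t x * P1 t x)) (at t within J)" if "t \<in> J" for t x
   by (auto intro!: derivative_eq_intros D_t_der[OF that] simp del: One_nat_def)
  show "continuous_on (J \<times> {0..2*pi}) (\<lambda>q. 2 * D 1 (fst q) (snd q) * P1 (fst q) (snd q))"
   by (intro continuous_intros D_joint' P_joint)
 qed (auto simp: D_ends[OF JT] simp del: One_nat_def intro!: continuous_intros D_cont'[OF JT] JT)
 show "E1 t1 = E1 t2"
  unfolding E1_def
 proof (rule conserved_density[OF _ _ _ flux1[OF JT] _ assms])
  show "((\<lambda>t. (D 2 t x)^2 - (D 1 t x)^4 / 4) has_real_derivative a^3 * (2 * D 2 t x * P2 t x - (D 1 t x)^3 * P1 t x)) (at t within J)" if "t \<in> J" for t x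
   by (auto intro!: derivative_eq_intros D_t_der[OF that] simp: field_simps simp del: One_nat_def)
  show "continuous_on (J \<times> {0..2*pi}) (\<lambda>q. 2 * D 2 (fst q) (snd q) * P2 (fst q) (snd q) - (D 1 (fst q) (snd q))^3 * P1 (fst q) (snd q))"
   by (intro continuous_intros D_joint' P_joint)
 qed (auto simp: D_ends[OF JT] P_ends[OF JT] simp del: One_nat_def intro!: continuous_intros D_cont'[OF JT] JT)
 show "E2 t1 = E2 t2"
  unfolding E2_def
 proof (rule conserved_density[OF _ _ _ flux2[OF JT] _ assms])
  show "((\<lambda>t. (D 3 t x)^2 - 5/2 * (D 1 t x)^2 * (D 2 t x)^2 + (D 1 t x)^6 / 8) has_real_derivative
   a^3 * (2 * D 3 t x * P3 t x - 5 * D 1 t x * (D 2 t x)^2 * P1 t x - 5 * (D 1 t x)^2 * D 2 t x * P2 t x + 3/4 * (D 1 t x)^5 * P1 t x)) (at t within J)" if "t \<in> J" for t x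
   using energy2_derivative[OF D_t_der(2)[OF that] D_t_der(3)[OF that] D_t_der(4)[OF that]]
   by (rule DERIV_cong) (simp add: algebra_simps del: One_nat_def)
  show "continuous_on (J \<times> {0..2*pi}) (\<lambda>q. 2 * D 3 (fst q) (snd q) * P3 (fst q) (snd q)
    - 5 * D 1 (fst q) (snd q) * (D 2 (fst q) (snd q))^2 * P1 (fst q) (snd q)
    - 5 * (D 1 (fst q) (snd q))^2 * D 2 (fst q) (snd q) * P2 (fst q) (snd q) + 3/4 * (D 1 (fst q) (snd q))^5 * P1 (fst q) (snd q))"
   by (intro continuous_intros D_joint' P_joint)
 qed (auto simp: D_ends[OF JT] P_ends[OF JT] simp del: One_nat_def intro!: continuous_intros D_cont'[OF JT] JT)
qed

end

text \<open>A function with a zero is controlled by its mean square and that of its derivative.\<close>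
lemma agmon:
 fixes f f' :: "real => real"
 assumes der: "\<And>x. (f has_real_derivative f' x) (at x)" and cf': "continuous_on UNIV f'"
  and x0: "x0 \<in> {0..2*pi}" "f x0 = 0" and l: "l > 0" and x: "x \<in> {0..2*pi}"
 shows "(f x)^2 \<le> l * integral {0..2*pi} (\<lambda>x. (f' x)^2) + integral {0..2*pi} (\<lambda>x. (f x)^2) / l"
proof -
 have cf: "continuous_on X f" for X using der by (meson DERIV_isCont continuous_at_imp_continuous_on)
 have cf'X: "continuous_on X f'" for X using cf' continuous_on_subset by blast
 define g where "g x = l * (f' x)^2 + (f x)^2 / l" for x
 have cg: "continuous_on X g" for X unfolding g_def by (intro continuous_intros cf cf'X) (use l in auto)
 have g0: "g x \<ge> 0" for x unfolding g_def using l by simp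
 have young: "\<bar>2 * f x * f' x\<bar> \<le> g x" for x
 proof -
  have "0 \<le> (sqrt l * f' x - f x / sqrt l)^2" "0 \<le> (sqrt l * f' x + f x / sqrt l)^2" by simp_all
  then show ?thesis using l by (auto simp: g_def power2_sum power2_diff power_mult_distrib power_divide abs_le_iff algebra_simps)
 qed
 have inc: "\<bar>(f w)^2 - (f v)^2\<bar> \<le> integral {0..2*pi} g" if vw: "v \<le> w" "v \<in> {0..2*pi}" "w \<in> {0..2*pi}" for v w
 proof -
  have "((\<lambda>x. 2 * f x * f' x) has_integral ((f w)^2 - (f v)^2)) {v..w}"
  proof (rule fundamental_theorem_of_calculus[OF vw(1)])
   fix x
   have "((\<lambda>x. (f x)^2) has_real_derivative 2 * f x * f' x) (at x within {v..w})"
    by (auto intro!: derivative_eq_intros has_field_derivative_at_within[OF der])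
   then show "((\<lambda>x. (f x)^2) has_vector_derivative 2 * f x * f' x) (at x within {v..w})"
    by (simp add: has_real_derivative_iff_has_vector_derivative)
  qed
  then have "\<bar>(f w)^2 - (f v)^2\<bar> = norm (integral {v..w} (\<lambda>x. 2 * f x * f' x))"
   by (simp add: integral_unique)
  also have "... \<le> integral {v..w} g"
   using young by (intro integral_norm_bound_integral integrable_continuous_real continuous_intros cf cf'X cg) auto
  also have "... \<le> integral {0..2*pi} g"
   using vw g0 by (intro integral_subset_le integrable_continuous_real cg) auto
  finally show ?thesis .
 qed
 have "(f x)^2 \<le> integral {0..2*pi} g"
  using inc[of x x0] inc[of x0 x] x x0 by (cases "x \<le> x0") auto
 also have "integral {0..2*pi} g = integral {0..2*pi} (\<lambda>x. l * (f' x)^2) + integral {0..2*pi} (\<lambda>x. (f x)^2 / l)"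
  unfolding g_def using l by (intro integral_add integrable_continuous_real continuous_intros cf cf'X) auto
 finally show ?thesis by simp
qed

context airy_flow
begin

definition Xb :: "real => real => real" where "Xb A e = 2 * \<bar>e\<bar> + A^2 * (A + 1)"
definition H2 :: "real => real => real => real" where "H2 A e1 e2 = \<bar>e2\<bar> + 5/2 * ((Xb A e1 + A) * Xb A e1)"

lemma integral_square_nonneg: "0 \<le> integral X (\<lambda>x. (f x :: real)^2)"
 by (cases "(\<lambda>x. (f x)^2) integrable_on X") (auto simp: integral_nonneg not_integrable_integral)

lemma E0_nonneg: "0 \<le> E0 t" unfolding E0_def by (rule integral_square_nonneg)
lemma B2_nonneg: "0 \<le> B2 t" unfolding B2_def by (rule integral_square_nonneg)

text \<open>
 The three invariants together bound the second derivative of \<open>D 1\<close>: the quartic and sextic terms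
 are of lower order by the interpolation above.
\<close>
lemma B2_le_H2:
 assumes t: "t \<in> {0..T}"
 shows "B2 t \<le> H2 (E0 t) (E1 t) (E2 t)"
proof -
 note del = One_nat_def
 define A where "A = E0 t"
 define X where "X = integral {0..2*pi} (\<lambda>x. (D 2 t x)^2)"
 note cont = D_cont'[OF t, of "{0..2*pi}"]
 have A0: "A \<ge> 0" using E0_nonneg by (simp add: A_def)
 have X0: "X \<ge> 0" unfolding X_def by (rule integral_square_nonneg)
 have "\<exists>z. 0 < z \<and> z < 2*pi \<and> D 0 t (2*pi) - D 0 t 0 = (2*pi - 0) * D 1 t z"
  using MVT2[of 0 "2*pi" "D 0 t" "D 1 t"] D_der'(1)[OF t] by auto
 then obtain z where "0 < z" "z < 2*pi" "D 0 t (2*pi) - D 0 t 0 = (2*pi - 0) * D 1 t z" by blast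
 then have z: "z \<in> {0..2*pi}" "D 1 t z = 0" using D_ends(1)[OF t] by (auto simp del: One_nat_def)
 have sup: "(D 1 t x)^2 \<le> l * X + A / l" if "l > 0" "x \<in> {0..2*pi}" for l x
  using agmon[OF D_der'(2)[OF t] D_cont'(3)[OF t] z that] by (simp add: X_def A_def E0_def)
 have X_le: "X \<le> Xb A (E1 t)"
 proof -
  define l where "l = 1 / (A + 1)"
  have l: "l > 0" "l * A \<le> 1" "A / l = A * (A + 1)" using A0 by (auto simp: l_def field_simps)
  have "integral {0..2*pi} (\<lambda>x. (D 1 t x)^4) \<le> integral {0..2*pi} (\<lambda>x. (l * X + A / l) * (D 1 t x)^2)"
  proof (rule integral_le)
   fix x assume "x \<in> {0..2*pi}"
   then have "(D 1 t x)^2 * (D 1 t x)^2 \<le> (l * X + A / l) * (D 1 t x)^2"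
    using sup[OF l(1)] by (intro mult_right_mono) auto
   then show "(D 1 t x)^4 \<le> (l * X + A / l) * (D 1 t x)^2" by (simp add: power4_eq_xxxx power2_eq_square mult.assoc)
  qed (intro integrable_continuous_real continuous_intros cont; use l in simp)+
  also have "... = (l * X + A / l) * A" by (simp only: integral_mult_right A_def E0_def)
  also have "... = (l * A) * X + A * (A / l)" by (simp add: algebra_simps)
  also have "... \<le> 1 * X + A * (A / l)" using l X0 A0 by (intro add_mono mult_right_mono) auto
  finally have q: "integral {0..2*pi} (\<lambda>x. (D 1 t x)^4) \<le> X + A^2 * (A + 1)" using l by (simp add: power2_eq_square)
  have "E1 t = X - integral {0..2*pi} (\<lambda>x. (D 1 t x)^4 / 4)"
   unfolding E1_def X_def by (intro integral_diff integrable_continuous_real continuous_intros cont) auto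
  then have e: "E1 t = X - integral {0..2*pi} (\<lambda>x. (D 1 t x)^4) / 4" by simp
  moreover have "0 \<le> A^2 * (A + 1)" using A0 by simp
  ultimately show ?thesis using q X0 unfolding Xb_def by linarith
 qed
 have "integral {0..2*pi} (\<lambda>x. (D 1 t x)^2 * (D 2 t x)^2) \<le> integral {0..2*pi} (\<lambda>x. (X + A) * (D 2 t x)^2)"
  using sup[of 1] by (intro integral_le integrable_continuous_real continuous_intros cont mult_right_mono) auto
 also have "... = (X + A) * X" by (simp add: X_def)
 also have "... \<le> (Xb A (E1 t) + A) * Xb A (E1 t)"
  using X_le X0 A0 by (intro mult_mono) auto
 finally have q: "integral {0..2*pi} (\<lambda>x. (D 1 t x)^2 * (D 2 t x)^2) \<le> (Xb A (E1 t) + A) * Xb A (E1 t)" .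
 have p: "0 \<le> integral {0..2*pi} (\<lambda>x. (D 1 t x)^6)"
  by (intro integral_nonneg integrable_continuous_real continuous_intros cont) simp
 have "E2 t = integral {0..2*pi} (\<lambda>x. (D 3 t x)^2 - 5/2 * (D 1 t x)^2 * (D 2 t x)^2) + integral {0..2*pi} (\<lambda>x. (D 1 t x)^6 / 8)"
  unfolding E2_def by (intro integral_add integrable_continuous_real continuous_intros cont) auto
 also have "integral {0..2*pi} (\<lambda>x. (D 3 t x)^2 - 5/2 * (D 1 t x)^2 * (D 2 t x)^2)
   = B2 t - integral {0..2*pi} (\<lambda>x. 5/2 * (D 1 t x)^2 * (D 2 t x)^2)"
  unfolding B2_def by (intro integral_diff integrable_continuous_real continuous_intros cont)
 finally have "E2 t = B2 t - 5/2 * integral {0..2*pi} (\<lambda>x. (D 1 t x)^2 * (D 2 t x)^2) + integral {0..2*pi} (\<lambda>x. (D 1 t x)^6) / 8"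
  by (simp add: mult.assoc)
 then have "B2 t \<le> E2 t + 5/2 * integral {0..2*pi} (\<lambda>x. (D 1 t x)^2 * (D 2 t x)^2)" using p by linarith
 also have "... \<le> \<bar>E2 t\<bar> + 5/2 * ((Xb A (E1 t) + A) * Xb A (E1 t))" using q by (intro add_mono) auto
 finally show ?thesis by (simp add: H2_def A_def)
qed

lemma integral_abs_bound:
 assumes "continuous_on {0..2*pi} f" "\<And>x. x \<in> {0..2*pi} ==> \<bar>f x\<bar> \<le> (C::real)"
 shows "\<bar>integral {0..2*pi} f\<bar> \<le> 2 * pi * C"
 using integral_bound[of 0 "2*pi" f C] assms by (simp add: mult.commute)

lemma H2_bounded_by_sobolev:
 shows "\<exists>\<Psi>. \<forall>t\<in>{0..T}. \<forall>K\<ge>0. sob S K (c t) \<longrightarrow> H2 (E0 t) (E1 t) (E2 t) \<le> \<Psi> K"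
proof -
 define e0 where "e0 K = 2 * pi * (2 * K)^2" for K :: real
 define e1 where "e1 K = 2 * pi * ((2 * K)^2 + (2 * K)^4)" for K :: real
 define e2 where "e2 K = 2 * pi * ((2 * K)^2 + 5/2 * (2 * K)^2 * (2 * K)^2 + (2 * K)^6)" for K :: real
 have "H2 (E0 t) (E1 t) (E2 t) \<le> H2 (e0 K) (e1 K) (e2 K)" if t: "t \<in> {0..T}" and K: "K \<ge> 0" "sob S K (c t)" for t K
 proof -
  note cont = D_cont'[OF t, of "{0..2*pi}"]
  have D: "\<bar>D 1 t x\<bar> \<le> 2 * K" "\<bar>D 2 t x\<bar> \<le> 2 * K" "\<bar>D 3 t x\<bar> \<le> 2 * K" for x
   using D_bound[OF t K(2,1)] S_ge by auto
  have 0: "E0 t \<le> e0 K"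
  proof -
   have "\<bar>E0 t\<bar> \<le> e0 K" unfolding E0_def e0_def
    by (intro integral_abs_bound continuous_intros cont abs_pow_le D)
   then show ?thesis by linarith
  qed
  have 1: "\<bar>E1 t\<bar> \<le> \<bar>e1 K\<bar>"
  proof -
   have "\<bar>E1 t\<bar> \<le> e1 K" unfolding E1_def e1_def
   proof (intro integral_abs_bound continuous_intros cont)
    fix x
    have "\<bar>(D 2 t x)^2\<bar> \<le> (2 * K)^2" "\<bar>(D 1 t x)^4\<bar> \<le> (2 * K)^4" by (intro abs_pow_le D)+
    then show "\<bar>(D 2 t x)^2 - (D 1 t x) ^ 4 / 4\<bar> \<le> (2 * K)^2 + (2 * K)^4" by linarith
   qed auto
   then show ?thesis by linarith
  qed
  have 2: "\<bar>E2 t\<bar> \<le> \<bar>e2 K\<bar>"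
  proof -
   have "\<bar>E2 t\<bar> \<le> e2 K" unfolding E2_def e2_def
   proof (intro integral_abs_bound continuous_intros cont)
    fix x
    have "\<bar>(D 3 t x)^2\<bar> \<le> (2 * K)^2" "\<bar>(D 1 t x)^6\<bar> \<le> (2 * K)^6" by (intro abs_pow_le D)+
    moreover have "\<bar>5/2 * (D 1 t x)^2 * (D 2 t x)^2\<bar> \<le> 5/2 * (2 * K)^2 * (2 * K)^2"
     by (intro abs_prod_le abs_pow_le abs_num_le D)
    ultimately show "\<bar>(D 3 t x)^2 - 5/2 * (D 1 t x)^2 * (D 2 t x)^2 + (D 1 t x) ^ 6 / 8\<bar>
      \<le> (2 * K)^2 + 5/2 * (2 * K)^2 * (2 * K)^2 + (2 * K)^6" by linarith
   qed auto
   then show ?thesis by linarith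
  qed
  have X: "Xb (E0 t) (E1 t) \<le> Xb (e0 K) (e1 K)" "0 \<le> Xb (E0 t) (E1 t)"
   unfolding Xb_def using 0 1 E0_nonneg[of t] by (auto intro!: add_mono mult_mono power_mono)
  then show ?thesis
   unfolding H2_def using 0 2 E0_nonneg[of t] by (intro add_mono mult_mono mult_left_mono) auto
 qed
 then show ?thesis by (intro exI[of _ "\<lambda>K. H2 (e0 K) (e1 K) (e2 K)"]) blast
qed

end

section \<open>Persistence of Sobolev regularity\<close>

lemma fourier_cube_limit:
 fixes u :: "real => real"
 assumes cu: "continuous_on {0..2*pi} u" and B: "\<And>x. x \<in> {0..2*pi} ==> \<bar>u x\<bar> \<le> B"
  and e: "e \<longlonglongrightarrow> 0" and app: "\<And>M x. cmod (of_real (u x) - trig (I M) (fc (cr u)) x) \<le> e M"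
 shows "(\<lambda>M. fc (\<lambda>x. (trig (I M) (fc (cr u)) x)^3) m) \<longlonglongrightarrow> fc (\<lambda>x. of_real (u x ^ 3)) m"
proof -
 have B0: "0 \<le> B" using B[of 0] by auto
 have e0: "0 \<le> e M" for M using app[where M = M and x = 0] norm_ge_zero order_trans by blast
 have cl: "(\<lambda>M. e M * (3 * (B + e M)^2)) \<longlonglongrightarrow> 0 * (3 * (B + 0)^2)"
  by (intro tendsto_intros e)
 have "(\<lambda>M. fc (\<lambda>x. (trig (I M) (fc (cr u)) x)^3) m - fc (\<lambda>x. of_real (u x ^ 3)) m) \<longlonglongrightarrow> 0"
 proof (rule Lim_null_comparison)
  show "(\<lambda>M. e M * (3 * (B + e M)^2)) \<longlonglongrightarrow> 0" using cl by simp
  show "\<forall>\<^sub>F M in sequentially. norm (fc (\<lambda>x. (trig (I M) (fc (cr u)) x)^3) m - fc (\<lambda>x. of_real (u x ^ 3)) m) \<le> e M * (3 * (B + e M)^2)"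
  proof (intro always_eventually allI)
   fix M
   let ?w = "trig (I M) (fc (cr u))"
   have "fc (\<lambda>x. (?w x)^3) m - fc (\<lambda>x. of_real (u x ^ 3)) m = fc (\<lambda>x. (?w x)^3 - of_real (u x ^ 3)) m"
    by (intro fc_diff[symmetric] continuous_intros continuous_on_of_real cu)
   also have "cmod ... \<le> e M * (3 * (B + e M)^2)"
   proof (rule fc_bound)
    show "continuous_on {0..2 * pi} (\<lambda>x. (?w x)^3 - of_real (u x ^ 3))"
     by (intro continuous_intros continuous_on_of_real cu)
    fix x :: real assume x: "x \<in> {0..2*pi}"
    define z where "z = complex_of_real (u x)"
    define w where "w = ?w x"
    have zw: "cmod (z - w) \<le> e M" using app by (simp add: z_def w_def)
    have z: "cmod z \<le> B + e M" using B[OF x] e0[of M] by (simp add: z_def)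
    have w: "cmod w \<le> B + e M"
     using norm_triangle_ineq4[of z "z - w"] zw B[OF x] by (simp add: z_def)
    have "w^3 - z^3 = - ((z - w) * (z^2 + z * w + w^2))"
     by (simp add: power2_eq_square power3_eq_cube algebra_simps)
    then have "cmod (w^3 - z^3) = cmod (z - w) * cmod (z^2 + z * w + w^2)"
     by (simp add: norm_mult)
    also have "... \<le> e M * (3 * (B + e M)^2)"
    proof (rule mult_mono[OF zw])
     have "cmod (z^2 + z * w + w^2) \<le> cmod z * cmod z + cmod z * cmod w + cmod w * cmod w"
      by (intro norm_triangle_le add_mono) (simp_all add: norm_mult power2_eq_square)
     also have "... \<le> (B + e M) * (B + e M) + (B + e M) * (B + e M) + (B + e M) * (B + e M)"
      using B0 e0[of M] by (intro add_mono mult_mono z w) auto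
     finally show "cmod (z^2 + z * w + w^2) \<le> 3 * (B + e M)^2" by (simp add: power2_eq_square)
    qed (use e0 in auto)
    finally show "cmod ((?w x)^3 - of_real (u x ^ 3)) \<le> e M * (3 * (B + e M)^2)"
     by (simp add: z_def w_def)
   qed
   finally show "norm (fc (\<lambda>x. (?w x)^3) m - fc (\<lambda>x. of_real (u x ^ 3)) m) \<le> e M * (3 * (B + e M)^2)" .
  qed
 qed
 then show ?thesis by (rule LIM_zero_cancel)
qed

abbreviation sym_ivl :: "nat => int set" where "sym_ivl M \<equiv> {- int M..int M}"

context airy_flow
begin

definition u :: "real => int => complex" where "u t = fc (cr (D 1 t))"

text \<open>The deficit of the truncated weight from its maximal value vanishes outside a finite set of modes; with the conserved mean square this
 turns the truncated energy \<open>yn\<close> into a finite sum.\<close>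
definition \<psi> :: "nat => int => real" where "\<psi> n m = real n ^ (2 * (S - 1)) - (rho (S - 1) n m)^2"

definition yn :: "nat => real => real" where
 "yn n t = real n ^ (2 * (S - 1)) * (E0 t / (2*pi)) - (\<Sum>m\<in>sym_ivl n. \<psi> n m * (cmod (u t m))^2)"

lemma u_c: "t \<in> {0..T} ==> u t m = \<i> * of_int m * c t m"
 using fc_D[of t 1 m] S_ge by (simp add: u_def)

lemma u_zero: "t \<in> {0..T} ==> u t 0 = 0"
 by (simp add: u_c)

lemma u_cnj: "u t (- m) = cnj (u t m)"
 unfolding u_def by (rule fc_cnj_real)

lemma psi_zero: "m \<notin> sym_ivl n ==> \<psi> n m = 0"
proof -
 assume "m \<notin> sym_ivl n"
 then have "min \<bar>real_of_int m\<bar> (real n) = real n" by auto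
 then have "rho (S - 1) n m = real n ^ (S - 1)" by (simp only: rho_def)
 then show ?thesis by (simp add: \<psi>_def power_mult[symmetric] mult.commute)
qed

lemma sum_split_psi:
 assumes "finite A" "sym_ivl n \<subseteq> A"
 shows "(\<Sum>m\<in>A. (rho (S - 1) n m * cmod (u t m))^2)
   = real n ^ (2 * (S - 1)) * (\<Sum>m\<in>A. (cmod (u t m))^2) - (\<Sum>m\<in>sym_ivl n. \<psi> n m * (cmod (u t m))^2)"
proof -
 have "(\<Sum>m\<in>A. (rho (S - 1) n m * cmod (u t m))^2)
   = real n ^ (2 * (S - 1)) * (\<Sum>m\<in>A. (cmod (u t m))^2) - (\<Sum>m\<in>A. \<psi> n m * (cmod (u t m))^2)"
  unfolding sum_distrib_left sum_subtractf[symmetric]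
  by (intro sum.cong refl) (simp add: \<psi>_def power_mult_distrib left_diff_distrib)
 also have "(\<Sum>m\<in>A. \<psi> n m * (cmod (u t m))^2) = (\<Sum>m\<in>sym_ivl n. \<psi> n m * (cmod (u t m))^2)"
  using assms psi_zero by (intro sum.mono_neutral_right) auto
 finally show ?thesis .
qed

lemma E0_fourier:
 assumes "t \<in> {0..T}" "finite A"
 shows "(\<Sum>m\<in>A. (cmod (u t m))^2) \<le> E0 t / (2*pi)"
proof -
 have "2*pi * (\<Sum>m\<in>A. (cmod (u t m))^2) \<le> E0 t"
  using bessel_real[OF assms(2) D_cont'(2)[OF assms(1)]] by (simp only: E0_def u_def)
 then show ?thesis by (simp add: pos_le_divide_eq mult.commute)
qed

lemma yn_lower:
 assumes t: "t \<in> {0..T}" and A: "finite A"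
 shows "(\<Sum>m\<in>A. (rho (S - 1) n m * cmod (u t m))^2) \<le> yn n t"
proof -
 have "(\<Sum>m\<in>A. (rho (S - 1) n m * cmod (u t m))^2) \<le> (\<Sum>m\<in>A \<union> sym_ivl n. (rho (S - 1) n m * cmod (u t m))^2)"
  using A by (intro sum_mono2) auto
 also have "... = real n ^ (2 * (S - 1)) * (\<Sum>m\<in>A \<union> sym_ivl n. (cmod (u t m))^2)
   - (\<Sum>m\<in>sym_ivl n. \<psi> n m * (cmod (u t m))^2)"
  using A by (intro sum_split_psi) auto
 also have "... \<le> yn n t"
  unfolding yn_def using A by (intro diff_right_mono mult_left_mono E0_fourier t) auto
 finally show ?thesis .
qed

lemma yn_nonneg: "t \<in> {0..T} ==> 0 \<le> yn n t"
 using yn_lower[of t "{}" n] by simp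

lemma u_approx:
 assumes t: "t \<in> {0..T}" and K: "sob S K (c t)" "0 \<le> K"
 shows "cmod (of_real (D 1 t x) - trig (sym_ivl M) (u t) x) \<le> 2 * K / real (Suc M)"
proof -
 have "cmod (of_real (D 1 t x) - (\<Sum>m\<in>sym_ivl M. fc (cr (D 1 t)) m * ek m x)) \<le> 2 * K / real (Suc M)"
 proof (rule fourier_truncation)
  show "periodic_2pi (D 1 t)" using t S_ge by (intro D_per) auto
  show "(D 1 t has_real_derivative D 2 t x) (at x)" for x using D_der'(2)[OF t] .
  fix A :: "int set" assume A: "finite A" "A \<inter> sym_ivl M = {}"
  have "(\<Sum>m\<in>A. cmod (fc (cr (D 1 t)) m)) = (\<Sum>m\<in>A. \<bar>of_int m\<bar>^1 * cmod (c t m))"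
   using u_c[OF t] by (intro sum.cong refl) (simp add: u_def norm_mult)
  also have "... \<le> 2 * K / real (Suc M) ^ 1"
  proof (rule sob_tail[OF K A(1)])
   show "real (Suc M) \<le> \<bar>real_of_int m\<bar>" if "m \<in> A" for m
   proof -
    have "m \<notin> sym_ivl M" using A(2) that by blast
    then have "int (Suc M) \<le> \<bar>m\<bar>" by auto
    then have "real_of_int (int (Suc M)) \<le> real_of_int \<bar>m\<bar>" by (simp only: of_int_le_iff)
    then show ?thesis by simp
   qed
  qed (use S_ge in auto)
  finally show "(\<Sum>m\<in>A. cmod (fc (cr (D 1 t)) m)) \<le> 2 * K / real (Suc M)" by simp
 qed simp
 then show ?thesis by (simp add: trig_def u_def)
qed

lemma tendsto_over_Suc: "(\<lambda>M. k / real (Suc M)) \<longlonglongrightarrow> 0"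
 using tendsto_mult[OF tendsto_const[of k] LIMSEQ_Suc[OF lim_1_over_n]] by simp

lemma yn_upper:
 assumes t: "t \<in> {0..T}" and K: "sob S K (c t)" "0 \<le> K"
 shows "yn n t \<le> K^2"
proof -
 define w where "w = real n ^ (2 * (S - 1))"
 define q where "q M = (2 * K / real (Suc M))^2" for M
 have main: "yn n t \<le> K^2 + w * q M" if M: "M \<ge> n" for M
 proof -
  have "2*pi * (\<Sum>m\<in>sym_ivl M. (cmod (u t m))^2)
    = integral {0..2*pi} (\<lambda>x. (cmod (of_real (D 1 t x)))^2) - integral {0..2*pi} (\<lambda>x. (cmod (of_real (D 1 t x) - trig (sym_ivl M) (u t) x))^2)"
   unfolding u_def by (rule bessel_eq) (auto intro!: continuous_on_of_real D_cont'[OF t] simp del: One_nat_def)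
  also have "integral {0..2*pi} (\<lambda>x. (cmod (of_real (D 1 t x)))^2) = E0 t"
   unfolding E0_def by simp
  finally have 1: "2*pi * (\<Sum>m\<in>sym_ivl M. (cmod (u t m))^2) = E0 t - integral {0..2*pi} (\<lambda>x. (cmod (of_real (D 1 t x) - trig (sym_ivl M) (u t) x))^2)" .
  have "integral {0..2*pi} (\<lambda>x. (cmod (of_real (D 1 t x) - trig (sym_ivl M) (u t) x))^2) \<le> integral {0..2*pi} (\<lambda>x. q M)"
   by (intro integral_le integrable_continuous_real continuous_intros continuous_on_of_real D_cont'[OF t]) (auto simp: q_def simp del: of_nat_Suc One_nat_def intro!: power_mono u_approx[OF t K])
  then have 2: "E0 t / (2*pi) \<le> (\<Sum>m\<in>sym_ivl M. (cmod (u t m))^2) + q M"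
   using 1 by (simp add: pos_divide_le_eq algebra_simps)
  have "yn n t \<le> w * ((\<Sum>m\<in>sym_ivl M. (cmod (u t m))^2) + q M) - (\<Sum>m\<in>sym_ivl n. \<psi> n m * (cmod (u t m))^2)"
   unfolding yn_def w_def[symmetric] using 2 by (intro diff_right_mono mult_left_mono) (auto simp: w_def)
  also have "... = (\<Sum>m\<in>sym_ivl M. (rho (S - 1) n m * cmod (u t m))^2) + w * q M"
   using M by (subst sum_split_psi) (auto simp: w_def distrib_left)
  also have "(\<Sum>m\<in>sym_ivl M. (rho (S - 1) n m * cmod (u t m))^2) \<le> (\<Sum>m\<in>sym_ivl M. (of_int m)^(2 * S) * (cmod (c t m))^2)"
  proof (rule sum_mono)
   fix m
   have "rho (S - 1) n m \<le> \<bar>of_int m\<bar> ^ (S - 1)"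
    unfolding rho_def by (intro power_mono) auto
   then have "rho (S - 1) n m * cmod (u t m) \<le> \<bar>of_int m\<bar> ^ (S - 1) * (\<bar>of_int m\<bar> * cmod (c t m))"
    unfolding u_c[OF t] by (simp add: norm_mult mult_right_mono)
   also have "... = \<bar>of_int m\<bar> ^ S * cmod (c t m)"
    using S_ge power_minus_mult[of S "\<bar>real_of_int m\<bar>"] by (simp add: mult.assoc[symmetric])
   finally have "(rho (S - 1) n m * cmod (u t m))^2 \<le> (\<bar>of_int m\<bar> ^ S * cmod (c t m))^2"
    by (intro power_mono) (auto simp: rho_nonneg)
   then show "(rho (S - 1) n m * cmod (u t m))^2 \<le> (of_int m)^(2 * S) * (cmod (c t m))^2"
    by (simp add: power_mult_distrib power_mult[symmetric] mult.commute[of S] power_even_abs)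
  qed
  also have "... \<le> K^2" using K(1) by (simp add: sob_def)
  finally show ?thesis by simp
 qed
 have "(\<lambda>M. K^2 + w * q M) \<longlonglongrightarrow> K^2 + w * 0^2"
  unfolding q_def by (intro tendsto_intros tendsto_over_Suc)
 then have "(\<lambda>M. K^2 + w * q M) \<longlonglongrightarrow> K^2" by simp
 then show ?thesis using main by (intro LIMSEQ_le_const[of _ _ "yn n t"]) auto
qed

lemma sob_from_yn:
 assumes t: "t \<in> {0..T}" and y: "\<And>n. yn n t \<le> K^2"
 shows "sob S K (c t)"
 unfolding sob_def
proof (intro allI impI)
 fix A :: "int set" assume A: "finite A"
 obtain B where B: "\<And>m. m \<in> A ==> \<bar>m\<bar> \<le> B"
  using finite_imageI[OF A, of abs] by (metis Max_ge imageI)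
 define n where "n = nat B"
 have "(\<Sum>m\<in>A. (of_int m)^(2 * S) * (cmod (c t m))^2) = (\<Sum>m\<in>A. (rho (S - 1) n m * cmod (u t m))^2)"
 proof (intro sum.cong refl)
  fix m assume "m \<in> A"
  then have "\<bar>real_of_int m\<bar> \<le> real n" using B[of m] unfolding n_def by linarith
  then have "rho (S - 1) n m = \<bar>of_int m\<bar> ^ (S - 1)" by (simp add: rho_def)
  then have "rho (S - 1) n m * cmod (u t m) = \<bar>of_int m\<bar> ^ (S - 1) * \<bar>of_int m\<bar> * cmod (c t m)"
   unfolding u_c[OF t] by (simp add: norm_mult)
  also have "... = \<bar>of_int m\<bar> ^ S * cmod (c t m)"
   using S_ge power_minus_mult[of S "\<bar>real_of_int m\<bar>"] by simp
  finally show "(of_int m)^(2 * S) * (cmod (c t m))^2 = (rho (S - 1) n m * cmod (u t m))^2"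
   by (simp add: power_mult_distrib power_mult[symmetric] mult.commute[of S] power_even_abs)
 qed
 also have "... \<le> K^2" using yn_lower[OF t A, of n] y[of n] by linarith
 finally show "(\<Sum>m\<in>A. (of_int m)^(2 * S) * (cmod (c t m))^2) \<le> K^2" .
qed

lemma sob_u_B2:
 assumes t: "t \<in> {0..T}"
 shows "sob 2 (sqrt (B2 t / (2*pi))) (u t)"
 unfolding sob_def
 proof (intro allI impI)
 fix A :: "int set" assume A: "finite A"
 have "fc (cr (D 3 t)) m = - ((of_int m)^2) * u t m" for m
 proof -
  have "fc (cr (D 3 t)) m = (\<i> * of_int m)^3 * c t m" using S_ge by (intro fc_D t) auto
  then show ?thesis unfolding u_c[OF t] by (simp add: power3_eq_cube power2_eq_square algebra_simps)
 qed
 then have "(\<Sum>m\<in>A. (of_int m)^(2*2) * (cmod (u t m))^2) = (\<Sum>m\<in>A. (cmod (fc (cr (D 3 t)) m))^2)"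
  by (intro sum.cong refl) (simp add: norm_mult norm_power power_mult_distrib power_mult[symmetric] power_even_abs)
 also have "... \<le> (sqrt (B2 t / (2*pi)))^2"
  using bessel_real[OF A D_cont'(4)[OF t]] using B2_nonneg[of t] by (simp add: B2_def field_simps)
 finally show "(\<Sum>m\<in>A. (of_int m)^(2*2) * (cmod (u t m))^2) \<le> (sqrt (B2 t / (2*pi)))^2" .
 qed

lemma D1_lip_B2:
 assumes t: "t \<in> {0..T}"
 shows "\<bar>D 1 t x - D 1 t y\<bar> \<le> 2 * sqrt (B2 t / (2*pi)) * \<bar>x - y\<bar>"
proof (rule fourier_lipschitz)
 show "periodic_2pi (D 1 t)" using t S_ge by (intro D_per) auto
 show "(D 1 t has_real_derivative D 2 t x) (at x)" for x by (rule D_der'(2)[OF t])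
 fix A :: "int set" assume A: "finite A"
 have "(\<Sum>m\<in>A. \<bar>of_int m\<bar> * cmod (fc (cr (D 1 t)) m)) = (\<Sum>m\<in>A - {0}. \<bar>of_int m\<bar>^1 * cmod (u t m))"
  unfolding u_def using A by (intro sum.mono_neutral_cong_right) auto
 also have "... \<le> 2 * sqrt (B2 t / (2*pi))"
  using A B2_nonneg[of t] by (intro sob_l1[OF sob_u_B2[OF t]]) auto
 finally show "(\<Sum>m\<in>A. \<bar>of_int m\<bar> * cmod (fc (cr (D 1 t)) m)) \<le> 2 * sqrt (B2 t / (2*pi))" .
qed

lemma B2_l1:
 assumes t: "t \<in> {0..T}" and A: "finite A"
 shows "(\<Sum>m\<in>A. \<bar>of_int m\<bar> * cmod (u t m)) * (\<Sum>m\<in>A. cmod (u t m)) \<le> B2 t"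
proof -
 define G where "G = sqrt (B2 t / (2*pi))"
 have G: "G \<ge> 0" "G^2 = B2 t / (2*pi)" using B2_nonneg[of t] by (auto simp: G_def)
 have "sob 2 G (u t)" using sob_u_B2[OF t] by (simp add: G_def)
 then have l1: "(\<Sum>m\<in>A - {0}. \<bar>of_int m\<bar>^j * cmod (u t m)) \<le> 2 * G" if "j < 2" for j
  using A that G by (intro sob_l1[of 2]) auto
 have drop0: "(\<Sum>m\<in>A. \<bar>of_int m\<bar>^j * cmod (u t m)) = (\<Sum>m\<in>A - {0}. \<bar>of_int m\<bar>^j * cmod (u t m))" for j
  using A u_zero[OF t] by (intro sum.mono_neutral_right) auto
 have "(\<Sum>m\<in>A. \<bar>of_int m\<bar>^1 * cmod (u t m)) * (\<Sum>m\<in>A. \<bar>of_int m\<bar>^0 * cmod (u t m)) \<le> (2 * G) * (2 * G)"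
  unfolding drop0 using G l1[of 1] l1[of 0] by (intro mult_mono sum_nonneg) auto
 also have "... = 4 * B2 t / (2*pi)" using G by (simp add: power2_eq_square)
 also have "... \<le> B2 t" using mult_right_mono[OF less_imp_le[OF pi_gt3], of "B2 t"] B2_nonneg[of t] by (simp add: field_simps)
 finally show ?thesis by simp
qed

text \<open>The rate of change of \<open>yn\<close> is linear in \<open>yn\<close> with a factor that sees only the second derivative.\<close>
lemma cubic_pairing_bound:
 assumes t: "t \<in> {0..T}"
 shows "cmod (\<Sum>m\<in>sym_ivl n. of_real (of_int m * \<psi> n m) * cnj (u t m) * fc (\<lambda>x. of_real (D 1 t x ^ 3)) m)
   \<le> 3 * Cq (S - 1) * (B2 t * yn n t)"
proof -
 obtain K where K: "sob S K (c t)" "0 \<le> K" using sob_each[OF t] by (auto simp: c_def)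
 have lim: "(\<lambda>M. fc (\<lambda>x. (trig (sym_ivl M) (u t) x)^3) m) \<longlonglongrightarrow> fc (\<lambda>x. of_real (D 1 t x ^ 3)) m" for m
  unfolding u_def
 proof (rule fourier_cube_limit[where B = "2 * K" and e = "\<lambda>M. 2 * K / real (Suc M)"])
  show "continuous_on {0..2*pi} (D 1 t)" by (rule D_cont'[OF t])
  show "\<bar>D 1 t x\<bar> \<le> 2 * K" for x using D_bound[OF t K, of 1] S_ge by simp
  show "(\<lambda>M. 2 * K / real (Suc M)) \<longlonglongrightarrow> 0" by (rule tendsto_over_Suc)
  show "cmod (cr (D 1 t) x - trig (sym_ivl M) (fc (cr (D 1 t))) x) \<le> 2 * K / real (Suc M)" for M x
   using u_approx[OF t K] by (simp add: u_def)
 qed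
 have "(\<lambda>M. cmod (\<Sum>m\<in>sym_ivl n. of_real (of_int m * \<psi> n m) * cnj (u t m) * fc (\<lambda>x. (trig (sym_ivl M) (u t) x)^3) m))
   \<longlonglongrightarrow> cmod (\<Sum>m\<in>sym_ivl n. of_real (of_int m * \<psi> n m) * cnj (u t m) * fc (\<lambda>x. of_real (D 1 t x ^ 3)) m)"
  by (intro tendsto_intros lim)
 moreover have "cmod (\<Sum>m\<in>sym_ivl n. of_real (of_int m * \<psi> n m) * cnj (u t m) * fc (\<lambda>x. (trig (sym_ivl M) (u t) x)^3) m)
   \<le> 3 * Cq (S - 1) * (B2 t * yn n t)" if M: "M \<ge> n" for M
 proof -
  have ext: "(\<Sum>m\<in>sym_ivl n. of_real (of_int m * \<psi> n m) * cnj (u t m) * fc (\<lambda>x. (trig (sym_ivl M) (u t) x)^3) m)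
    = (\<Sum>m\<in>sym_ivl M. of_real (of_int m * \<psi> n m) * cnj (u t m) * fc (\<lambda>x. (trig (sym_ivl M) (u t) x)^3) m)"
   using M psi_zero by (intro sum.mono_neutral_left) auto
  have "cmod (\<Sum>m\<in>sym_ivl n. of_real (of_int m * \<psi> n m) * cnj (u t m) * fc (\<lambda>x. (trig (sym_ivl M) (u t) x)^3) m)
    \<le> 3 * Cq (S - 1) * ((\<Sum>m\<in>sym_ivl M. \<bar>of_int m\<bar> * cmod (u t m)) * (\<Sum>m\<in>sym_ivl M. cmod (u t m))
     * (\<Sum>m\<in>sym_ivl M. (rho (S - 1) n m * cmod (u t m))^2))"
   unfolding ext unfolding \<psi>_def by (rule truncated_weight_pairing) (auto simp: u_cnj)
  also have "... \<le> 3 * Cq (S - 1) * (B2 t * yn n t)"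
   using Cq_pos[of "S - 1"] B2_nonneg[of t]
   by (intro mult_left_mono mult_mono B2_l1 yn_lower t sum_nonneg) auto
  finally show ?thesis .
 qed
 ultimately show ?thesis by (intro Lim_bounded[where M = n]) auto
qed

end

context airy_interval
begin

lemma u_t_derivative:
 assumes t: "t \<in> J"
 shows "((\<lambda>t. u t m) has_vector_derivative of_real (a^3) * (\<i> * of_int m * ((\<i> * of_int m)^2 * u t m + fc (\<lambda>x. of_real (D 1 t x ^ 3)) m / 2))) (at t within J)"
proof -
 have tT: "t \<in> {0..T}" using t JT by blast
 have "((\<lambda>t. fc (cr (D 1 t)) m) has_vector_derivative fc (cr (\<lambda>x. a^3 * P1 t x)) m) (at t within J)"
  by (rule fc_t_derivative[OF J_convex t, where h = "\<lambda>t x. a^3 * P1 t x"])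
    (auto simp: case_prod_unfold simp del: One_nat_def intro!: D_t_der D_cont'[OF JT] continuous_intros P_joint)
 moreover have "fc (cr (\<lambda>x. a^3 * P1 t x)) m = of_real (a^3) * fc (cr (P1 t)) m"
  using fc_cmult[of "of_real (a^3)" "cr (P1 t)" m] by simp
 moreover have "fc (cr (P1 t)) m = \<i> * of_int m * fc (cr (P0 t)) m"
 proof (rule fc_deriv)
  show "periodic_2pi (P0 t)" using D_per[OF tT, of 1] D_per[OF tT, of 3] S_ge by (simp add: periodic_2pi_def P0_def)
  show "(P0 t has_real_derivative P1 t x) (at x)" for x by (rule P_der[OF tT])
  show "continuous_on {0..2*pi} (P1 t)" unfolding P1_def[abs_def] by (intro continuous_intros D_cont'[OF tT])
 qed
 moreover have "fc (cr (P0 t)) m = fc (cr (D 3 t)) m + fc (\<lambda>x. of_real (D 1 t x ^ 3)) m / 2"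
 proof -
  have "cr (P0 t) = (\<lambda>x. of_real (D 3 t x) + (1/2) * of_real (D 1 t x ^ 3))" by (simp add: P0_def fun_eq_iff)
  then have "fc (cr (P0 t)) m = fc (\<lambda>x. of_real (D 3 t x) + (1/2) * of_real (D 1 t x ^ 3)) m" by simp
  also have "... = fc (cr (D 3 t)) m + fc (\<lambda>x. (1/2) * of_real (D 1 t x ^ 3)) m"
   by (intro fc_add continuous_intros continuous_on_of_real D_cont'[OF tT])
  also have "fc (\<lambda>x. (1/2) * of_real (D 1 t x ^ 3)) m = (1/2) * fc (\<lambda>x. of_real (D 1 t x ^ 3)) m"
   by (rule fc_cmult)
  finally show ?thesis by simp
 qed
 moreover have "fc (cr (D 3 t)) m = (\<i> * of_int m)^2 * u t m"
  using fc_D[OF tT, of 3 m] u_c[OF tT, of m] S_ge by (simp add: power3_eq_cube power2_eq_square)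
 ultimately show ?thesis by (simp only: u_def)
qed

text \<open>The linear part of the flow rotates the phases and drops out; the cubic part is bounded by a multiple of \<open>yn\<close> that is uniform in \<open>n\<close>.\<close>
lemma yn_growth:
 assumes b: "\<And>t. t \<in> J ==> B2 t \<le> b" and t12: "t1 \<in> J" "t2 \<in> J"
 shows "yn n t2 \<le> exp (a^3 * (3 * Cq (S - 1)) * b * \<bar>t2 - t1\<bar>) * yn n t1"
proof -
 have b0: "0 \<le> b" using b[OF t12(1)] B2_nonneg[of t1] by linarith
 define N where "N t = (\<Sum>m\<in>sym_ivl n. of_real (of_int m * \<psi> n m) * cnj (u t m) * fc (\<lambda>x. of_real (D 1 t x ^ 3)) m)" for t
 define y' where "y' t = 0 - (\<Sum>m\<in>sym_ivl n. \<psi> n m * (2 * Re (cnj (u t m) * (of_real (a^3) * (\<i> * of_int m * ((\<i> * of_int m)^2 * u t m + fc (\<lambda>x. of_real (D 1 t x ^ 3)) m / 2))))))" for t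
 have E0c: "((\<lambda>t. real n ^ (2 * (S - 1)) * (E0 t / (2*pi))) has_real_derivative 0) (at t within J)" if "t \<in> J" for t
 proof (rule has_field_derivative_transform_within[OF DERIV_const zero_less_one that])
  fix s assume "s \<in> J"
  then show "real n ^ (2 * (S - 1)) * (E0 t1 / (2*pi)) = real n ^ (2 * (S - 1)) * (E0 s / (2*pi))"
   using E_conserved(1)[OF t12(1)] by simp
 qed
 have der: "(yn n has_real_derivative y' t) (at t within J)" if t: "t \<in> J" for t
  unfolding yn_def[abs_def] y'_def
  by (intro DERIV_diff E0c[OF t] DERIV_sum DERIV_cmult cmod_squared_derivative u_t_derivative t)
 have y'_eq: "y' t = - (a^3 * Re (\<i> * N t))" for t
 proof -
  have "2 * Re (cnj (u t m) * (of_real (a^3) * (\<i> * of_int m * ((\<i> * of_int m)^2 * u t m + z / 2))))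
    = a^3 * Re (\<i> * (of_int m * cnj (u t m) * z))" for m z
   by (simp add: power2_eq_square field_simps)
  then have "y' t = - (\<Sum>m\<in>sym_ivl n. a^3 * Re (\<i> * (of_real (of_int m * \<psi> n m) * cnj (u t m) * fc (\<lambda>x. of_real (D 1 t x ^ 3)) m)))"
   unfolding y'_def by (simp only: diff_0) (intro arg_cong[where f = uminus] sum.cong refl, simp add: algebra_simps)
  then show ?thesis by (simp add: N_def sum_distrib_left Re_sum)
 qed
 show ?thesis
 proof (rule gronwall_two_sided[OF J_convex t12 _ der])
  show "0 \<le> a^3 * (3 * Cq (S - 1)) * b" using a_pos b0 Cq_pos[of "S - 1"] by auto
  fix t assume t: "t \<in> J"
  have "\<bar>y' t\<bar> \<le> a^3 * cmod (\<i> * N t)"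
   unfolding y'_eq abs_minus_cancel abs_mult using a_pos abs_Re_le_cmod[of "\<i> * N t"] by (simp add: mult_left_mono del: Re_i_times)
  also have "... \<le> a^3 * (3 * Cq (S - 1) * (B2 t * yn n t))"
  proof (rule mult_left_mono)
   have "cmod (\<i> * N t) = cmod (N t)" by (simp add: norm_mult)
   also have "... \<le> 3 * Cq (S - 1) * (B2 t * yn n t)"
    unfolding N_def by (rule cubic_pairing_bound[OF JT[OF t]])
   finally show "cmod (\<i> * N t) \<le> 3 * Cq (S - 1) * (B2 t * yn n t)" .
  qed (use a_pos in simp)
  also have "... \<le> a^3 * (3 * Cq (S - 1) * (b * yn n t))"
   using a_pos Cq_pos[of "S - 1"] b[OF t] yn_nonneg[OF JT[OF t]] by (intro mult_left_mono mult_right_mono) auto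
  finally show "\<bar>y' t\<bar> \<le> a^3 * (3 * Cq (S - 1)) * b * yn n t" by (simp add: mult.assoc)
 qed
qed

end

section \<open>Uniform bounds in time\<close>

context airy_flow
begin

text \<open>The good times, near which the Sobolev norm is bounded.\<close>
definition U :: "real set" where
 "U = {t \<in> {0..T}. \<exists>e>0. \<exists>K\<ge>0. \<forall>s\<in>{0..T}. \<bar>s - t\<bar> < e \<longrightarrow> sob S K (c s)}"

lemma sob_closed:
 assumes K: "K \<ge> 0" and tk: "\<And>k. tk k \<in> {0..T}" "\<And>k. sob S K (c (tk k))" and lim: "tk \<longlonglongrightarrow> t" and t: "t \<in> {0..T}"
 shows "sob S K (c t)"
proof -
 have th: "(\<lambda>k. \<theta> x (tk k)) \<longlonglongrightarrow> \<theta> x t" for x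
 proof -
  have "continuous_on {0..T} (\<lambda>t. D 0 t x)"
   using flow_P0 by (meson DERIV_continuous continuous_on_eq_continuous_within)
  then show ?thesis
   using continuous_on_tendsto_compose[of "{0..T}" "\<lambda>t. D 0 t x" tk t sequentially] lim t tk(1) by (simp add: D0)
 qed
 define g where "g s x = \<theta> x s - \<theta> 0 s" for s x
 have cth: "continuous_on X (\<lambda>x. \<theta> x s)" if "s \<in> {0..T}" for s X
  using D_cont'(1)[OF that] by (simp add: D_def)
 have fg: "fc (cr (g s)) m = c s m" if "s \<in> {0..T}" "m \<noteq> 0" for s m
 proof -
  have "cr (g s) = (\<lambda>x. of_real (\<theta> x s) - of_real (\<theta> 0 s))" by (simp add: g_def fun_eq_iff)
  then have "fc (cr (g s)) m = fc (\<lambda>x. of_real (\<theta> x s) - of_real (\<theta> 0 s)) m" by simp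
  also have "... = fc (\<lambda>x. of_real (\<theta> x s)) m - fc (\<lambda>x. of_real (\<theta> 0 s)) m"
   by (intro fc_diff continuous_intros continuous_on_of_real cth that)
  finally show ?thesis using that by (simp add: c_def fc_const)
 qed
 have gb: "\<bar>g (tk k) x\<bar> \<le> 2 * K * (2 * pi)" if "x \<in> {0..2*pi}" for k x
 proof -
  have "\<bar>D 0 (tk k) x - D 0 (tk k) 0\<bar> \<le> 2 * K * \<bar>x - 0\<bar>"
   using S_ge by (intro lipschitz_of_deriv[OF D_der'(1)[OF tk(1)]] D_bound tk K) auto
  also have "... \<le> 2 * K * (2 * pi)" using that K by (intro mult_left_mono) auto
  finally show ?thesis by (simp add: g_def D0)
 qed
 have cm: "(\<lambda>k. c (tk k) m) \<longlonglongrightarrow> c t m" if "m \<noteq> 0" for m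
 proof -
  have "(\<lambda>k. integral {0..2*pi} (\<lambda>x. of_real (g (tk k) x) * ek (-m) x)) \<longlonglongrightarrow> integral {0..2*pi} (\<lambda>x. of_real (g t x) * ek (-m) x)"
  proof (rule dominated_convergence(2)[where h = "\<lambda>x. 2 * K * (2 * pi)"])
   show "(\<lambda>x. of_real (g (tk k) x) * ek (-m) x) integrable_on {0..2*pi}" for k
    unfolding g_def by (intro integrable_continuous_real continuous_intros continuous_on_of_real cth tk)
   show "norm (of_real (g (tk k) x) * ek (-m) x) \<le> 2 * K * (2 * pi)" if "x \<in> {0..2*pi}" for k x
    using gb[OF that, of k] by (simp add: norm_mult)
   show "(\<lambda>k. of_real (g (tk k) x) * ek (-m) x) \<longlonglongrightarrow> of_real (g t x) * ek (-m) x" for x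
    unfolding g_def by (intro tendsto_intros th)
  qed auto
  then have "(\<lambda>k. fc (cr (g (tk k))) m) \<longlonglongrightarrow> fc (cr (g t)) m"
   unfolding fc_def by (intro tendsto_intros) auto
  then show ?thesis using fg that tk t by simp
 qed
 show ?thesis
  unfolding sob_def
 proof (intro allI impI)
  fix A :: "int set" assume A: "finite A"
  have drop: "(\<Sum>m\<in>A. (of_int m)^(2 * S) * (cmod (c s m))^2) = (\<Sum>m\<in>A - {0}. (of_int m)^(2 * S) * (cmod (c s m))^2)" for s
   using A S_ge by (intro sum.mono_neutral_right) auto
  have "(\<lambda>k. \<Sum>m\<in>A - {0}. (of_int m)^(2 * S) * (cmod (c (tk k) m))^2) \<longlonglongrightarrow> (\<Sum>m\<in>A - {0}. (of_int m)^(2 * S) * (cmod (c t m))^2)"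
   by (intro tendsto_intros cm) auto
  moreover have "(\<Sum>m\<in>A - {0}. (of_int m)^(2 * S) * (cmod (c (tk k) m))^2) \<le> K^2" for k
   using tk(2)[of k] A by (auto simp: sob_def)
  ultimately have "(\<Sum>m\<in>A - {0}. (of_int m)^(2 * S) * (cmod (c t m))^2) \<le> K^2"
   by (intro LIMSEQ_le_const2) auto
  then show "(\<Sum>m\<in>A. (of_int m)^(2 * S) * (cmod (c t m))^2) \<le> K^2" by (simp only: drop)
 qed
qed

lemma compact_U_bound:
 assumes "compact J" "J \<subseteq> U"
 shows "\<exists>K\<ge>0. \<forall>t\<in>J. sob S K (c t)"
proof -
 have "\<forall>t\<in>J. \<exists>e K. e > 0 \<and> K \<ge> 0 \<and> (\<forall>s\<in>{0..T}. \<bar>s - t\<bar> < e \<longrightarrow> sob S K (c s))"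
  using assms(2) by (auto simp: U_def)
 then obtain e K where eK: "\<And>t. t \<in> J ==> e t > 0 \<and> K t \<ge> 0 \<and> (\<forall>s\<in>{0..T}. \<bar>s - t\<bar> < e t \<longrightarrow> sob S (K t) (c s))"
  by metis
 have "J \<subseteq> (\<Union>t\<in>J. ball t (e t))" using eK by force
 then obtain F where F: "F \<subseteq> J" "finite F" "J \<subseteq> (\<Union>t\<in>F. ball t (e t))"
  using compactE_image[OF assms(1), of J "\<lambda>t. ball t (e t)"] by auto
 show ?thesis
 proof (intro exI conjI ballI)
  show "0 \<le> sum K F" using eK F by (intro sum_nonneg) auto
  fix s assume s: "s \<in> J"
  then obtain t where t: "t \<in> F" "\<bar>s - t\<bar> < e t" using F(3) by (auto simp: dist_real_def abs_minus_commute)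
  have "s \<in> {0..T}" using s assms(2) by (auto simp: U_def)
  then have "sob S (K t) (c s)" using eK t F(1) by blast
  moreover have "K t \<le> sum K F" using eK F t by (intro member_le_sum) auto
  ultimately show "sob S (sum K F) (c s)" using sob_mono eK t F(1) by blast
 qed
qed

lemma airy_intervalI:
 assumes "J \<subseteq> {0..T}" "convex J" "0 \<le> K" "\<And>t. t \<in> J ==> sob S K (c t)"
 shows "airy_interval a T S \<theta> J K"
 using assms by unfold_locales auto

lemma segment_sub: "s \<in> {0..T} ==> t \<in> {0..T} ==> closed_segment s t \<subseteq> {0..T}"
 by (rule closed_segment_subset) auto

lemma segment_half_open:
 assumes "p \<in> closed_segment s t - {s}" "q \<in> closed_segment s t - {s}"
 shows "closed_segment p q \<subseteq> closed_segment s t - {s :: real}"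
 using assms by (auto simp: closed_segment_eq_real_ivl split: if_splits)

text \<open>
 Bounds do not blow up when a gap of good times is entered from its end point \<open>s\<close>.  A first pass
 uses constants that depend on the gap, and shows that the conserved quantities do not jump at
 \<open>s\<close>; a second pass then has constants depending on the norm at \<open>s\<close> alone.
\<close>
lemma enter_gap:
 "\<exists>\<Phi>. \<forall>n\<ge>0. \<forall>s\<in>{0..T}. \<forall>t\<in>{0..T}. sob S n (c s) \<longrightarrow> closed_segment s t - {s} \<subseteq> U \<longrightarrow> 0 \<le> \<Phi> n \<and> sob S (\<Phi> n) (c t)"
proof -
 obtain \<Psi> where \<Psi>: "\<And>t K. t \<in> {0..T} ==> K \<ge> 0 ==> sob S K (c t) ==> H2 (E0 t) (E1 t) (E2 t) \<le> \<Psi> K"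
  using H2_bounded_by_sobolev by blast
 define C where "C = a^3 * (3 * Cq (S - 1))"
 have C0: "C \<ge> 0" using a_pos Cq_pos[of "S - 1"] by (simp add: C_def)
 define \<Phi> where "\<Phi> n = sqrt (exp (C * \<bar>\<Psi> n\<bar> * T)) * n" for n
 have main: "sob S (\<Phi> n) (c t)"
  if n: "n \<ge> 0" and s: "s \<in> {0..T}" and t: "t \<in> {0..T}" and sn: "sob S n (c s)" and H: "closed_segment s t - {s} \<subseteq> U" for n s t
 proof (cases "s = t")
  case True
  have "1 * n \<le> \<Phi> n" unfolding \<Phi>_def using n C0 T_nonneg by (intro mult_right_mono) auto
  then show ?thesis using sn n sob_mono True by auto
 next
  case False
  define G where "G = closed_segment s t - {s}"
  have GT: "G \<subseteq> {0..T}" using segment_sub[OF s t] by (auto simp: G_def)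
  have tG: "t \<in> G" using False by (simp add: G_def)
  have good: "\<exists>K. airy_interval a T S \<theta> (closed_segment p q) K" if "p \<in> G" "q \<in> G" for p q
  proof -
   have sub: "closed_segment p q \<subseteq> G" using segment_half_open that by (simp add: G_def)
   then obtain K where "K \<ge> 0" "\<forall>t\<in>closed_segment p q. sob S K (c t)"
    using compact_U_bound[of "closed_segment p q"] H by (auto simp: G_def)
   then show ?thesis using airy_intervalI[of "closed_segment p q" K] sub GT by auto
  qed
  define b where "b = H2 (E0 t) (E1 t) (E2 t)"
  have bG: "B2 q \<le> b" if q: "q \<in> G" for q
  proof -
   obtain K where "airy_interval a T S \<theta> (closed_segment q t) K" using good[OF q tG] by blast
   then interpret I: airy_interval a T S \<theta> "closed_segment q t" K .
   have "B2 q \<le> H2 (E0 q) (E1 q) (E2 q)" using q GT by (intro B2_le_H2) auto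
   then show ?thesis using I.E_conserved[of q t] by (simp add: b_def)
  qed
  have b0: "b \<ge> 0" using bG[OF tG] B2_nonneg[of t] by linarith
  have grow: "yn k q \<le> exp (C * b * T) * yn k p" if pq: "p \<in> G" "q \<in> G" for p q k
  proof -
   obtain K where "airy_interval a T S \<theta> (closed_segment p q) K" using good[OF pq] by blast
   then interpret I: airy_interval a T S \<theta> "closed_segment p q" K .
   have "yn k q \<le> exp (a^3 * (3 * Cq (S - 1)) * b * \<bar>q - p\<bar>) * yn k p"
    using segment_half_open[of p s t q] pq by (intro I.yn_growth bG) (auto simp: G_def)
   also have "exp (a^3 * (3 * Cq (S - 1)) * b * \<bar>q - p\<bar>) * yn k p \<le> exp (C * b * T) * yn k p"
   proof -
   have "p \<in> {0..T}" "q \<in> {0..T}" using pq GT by auto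
   then have "\<bar>q - p\<bar> \<le> T" by auto
   then show ?thesis
    using pq GT C0 b0 unfolding C_def[symmetric]
    by (intro mult_right_mono yn_nonneg) (auto intro!: mult_left_mono simp: subset_iff)
   qed
   finally show ?thesis .
  qed
  have ycont: "continuous_on (closed_segment s t) (yn k)" for k
  proof -
   define L where "L = 2 * sqrt (max b (B2 s) / (2*pi))"
   have seg: "closed_segment s t \<subseteq> {0..T}" by (rule segment_sub[OF s t])
   have lip: "\<bar>D 1 q x - D 1 q y\<bar> \<le> L * \<bar>x - y\<bar>" if q: "q \<in> closed_segment s t" for q x y
   proof -
    have "B2 q \<le> max b (B2 s)" using bG[of q] q by (cases "q = s") (auto simp: G_def)
    then have "2 * sqrt (B2 q / (2*pi)) \<le> L" unfolding L_def by (intro mult_left_mono real_sqrt_le_mono divide_right_mono) auto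
    then show ?thesis
     using D1_lip_B2[of q x y] q seg by (meson abs_ge_zero mult_right_mono order_trans subsetD)
   qed
   have c0: "continuous_on (closed_segment s t) (\<lambda>q. D 0 q x)" for x
   proof -
    have "continuous_on {0..T} (\<lambda>t. D 0 t x)"
     using flow_P0 by (meson DERIV_continuous continuous_on_eq_continuous_within)
    then show ?thesis using seg continuous_on_subset by blast
   qed
   have c1: "continuous_on (closed_segment s t) (\<lambda>q. D 1 q x)" for x
    by (rule x_derivative_continuous_in_t[where g = "D 0" and B = L]) (use seg lip c0 D_der'(1) in auto)
   have joint: "continuous_on (closed_segment s t \<times> {0..2*pi}) (\<lambda>q. D 1 (fst q) (snd q))"
    using jointly_continuous[of "closed_segment s t" "D 1" L "{0..2*pi}", OF lip c1] by (simp add: case_prod_unfold)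
   have cE: "continuous_on (closed_segment s t) E0"
   proof -
    have "continuous_on (closed_segment s t) (\<lambda>q. integral (cbox 0 (2*pi)) (\<lambda>x. (D 1 q x)^2))"
     by (rule integral_continuous_on_param) (auto simp: case_prod_unfold simp del: One_nat_def intro!: continuous_intros joint)
    then show ?thesis by (simp add: E0_def[abs_def])
   qed
   have cu: "continuous_on (closed_segment s t) (\<lambda>q. u q m)" for m
   proof -
    have "continuous_on (closed_segment s t) (\<lambda>q. integral (cbox 0 (2*pi)) (\<lambda>x. of_real (D 1 q x) * ek (-m) x))"
     by (rule integral_continuous_on_param)
       (auto simp: case_prod_unfold simp del: One_nat_def intro!: continuous_intros continuous_on_of_real joint)
    then show ?thesis unfolding u_def fc_def by (intro continuous_intros) auto
   qed
   show ?thesis unfolding yn_def[abs_def] by (intro continuous_intros cE cu) auto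
  qed
  have yG: "yn k q \<le> exp (C * b * T) * n^2" if q: "q \<in> G" for k q
  proof -
   define p where "p i = s + (1 / real (Suc i)) * (q - s)" for i
   have pG: "p i \<in> G" for i
   proof -
    have "p i = (1 - 1 / real (Suc i)) *\<^sub>R s + (1 / real (Suc i)) *\<^sub>R q" by (simp add: p_def algebra_simps add_divide_distrib[symmetric])
    moreover have "1 / real (Suc i) \<in> {0..1}" by (auto simp: field_simps)
    ultimately have "p i \<in> closed_segment s q"
     unfolding closed_segment_def mem_Collect_eq by (intro exI[of _ "1 / real (Suc i)"]) auto
    moreover have "closed_segment s q \<subseteq> closed_segment s t"
     using q by (intro closed_segment_subset) (auto simp: G_def)
    moreover have "p i \<noteq> s" using q by (auto simp: p_def G_def)
    ultimately show ?thesis by (auto simp: G_def)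
   qed
   have "(\<lambda>i. s + (1 / real (Suc i)) * (q - s)) \<longlonglongrightarrow> s + 0 * (q - s)"
    by (intro tendsto_intros tendsto_over_Suc)
   then have "p \<longlonglongrightarrow> s" by (simp add: p_def[abs_def])
   then have "(\<lambda>i. yn k (p i)) \<longlonglongrightarrow> yn k s"
    using pG by (intro continuous_on_tendsto_compose[OF ycont]) (auto simp: G_def)
   then have "(\<lambda>i. exp (C * b * T) * yn k (p i)) \<longlonglongrightarrow> exp (C * b * T) * yn k s"
    by (intro tendsto_intros)
   then have "yn k q \<le> exp (C * b * T) * yn k s"
    by (rule LIMSEQ_le_const) (intro exI[of _ 0] allI impI grow[OF pG q])
   also have "... \<le> exp (C * b * T) * n^2"
    using yn_upper[OF s sn n, of k] by (intro mult_left_mono) auto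
   finally show ?thesis .
  qed
  define K1 where "K1 = sqrt (exp (C * b * T)) * n"
  have K1: "K1^2 = exp (C * b * T) * n^2" "n \<le> K1"
  proof -
   show "K1^2 = exp (C * b * T) * n^2" by (simp add: K1_def power_mult_distrib)
   have "1 * n \<le> K1" unfolding K1_def using n C0 b0 T_nonneg by (intro mult_right_mono) auto
   then show "n \<le> K1" by simp
  qed
  have sobK1: "sob S K1 (c q)" if "q \<in> closed_segment s t" for q
  proof (cases "q = s")
   case True then show ?thesis using sob_mono[OF sn n K1(2)] by simp
  next
   case False
   then have "q \<in> G" using that by (simp add: G_def)
   then show ?thesis using GT yG K1 by (intro sob_from_yn) auto
  qed
  interpret I: airy_interval a T S \<theta> "closed_segment s t" K1
   by (rule airy_intervalI) (use segment_sub[OF s t] sobK1 n K1 in auto)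
  have "b = H2 (E0 s) (E1 s) (E2 s)" using I.E_conserved[of s t] by (simp add: b_def)
  then have "b \<le> \<bar>\<Psi> n\<bar>" using \<Psi>[OF s n sn] by linarith
  then have "C * b * T \<le> C * \<bar>\<Psi> n\<bar> * T" using C0 T_nonneg by (intro mult_left_mono mult_right_mono) auto
  then have "K1 \<le> \<Phi> n" unfolding K1_def \<Phi>_def using n by (intro mult_right_mono) auto
  then show ?thesis using sob_mono[OF sobK1[of t]] K1 n by auto
 qed
 show ?thesis
 proof (intro exI[of _ \<Phi>] allI impI ballI conjI)
  fix n s t assume a: "0 \<le> n" "s \<in> {0..T}" "t \<in> {0..T}" "sob S n (c s)" "closed_segment s t - {s} \<subseteq> U"
  show "0 \<le> \<Phi> n" using a(1) by (simp add: \<Phi>_def)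
  show "sob S (\<Phi> n) (c t)" by (rule main[OF a])
 qed
qed

text \<open>
 By Baire's theorem the norm is bounded near some time in any closed set of bad times; entering the
 adjacent gaps from that set bounds it in a whole neighbourhood.
\<close>
theorem sobolev_bounded: "\<exists>K\<ge>0. \<forall>t\<in>{0..T}. sob S K (c t)"
proof -
 define F where "F = {0..T} - U"
 have UT: "U \<subseteq> {0..T}" by (auto simp: U_def)
 have cF: "closed F"
 proof -
  have "openin (top_of_set {0..T}) U"
   unfolding openin_euclidean_subtopology_iff
  proof (intro conjI ballI UT)
   fix t assume "t \<in> U"
   then obtain e K where e: "e > 0" "K \<ge> 0" "\<forall>s\<in>{0..T}. \<bar>s - t\<bar> < e \<longrightarrow> sob S K (c s)" by (auto simp: U_def)
   show "\<exists>e>0. \<forall>x'\<in>{0..T}. dist x' t < e \<longrightarrow> x' \<in> U"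
   proof (intro exI[of _ "e / 2"] conjI ballI impI)
    show "e / 2 > 0" using e by simp
    fix s assume s: "s \<in> {0..T}" "dist s t < e / 2"
    have "sob S K (c r)" if "r \<in> {0..T}" "\<bar>r - s\<bar> < e / 2" for r
    proof -
     have "\<bar>s - t\<bar> < e / 2" using s by (simp add: dist_real_def)
     then have "\<bar>r - t\<bar> < e" using that by linarith
     then show ?thesis using e that by blast
    qed
    then show "s \<in> U"
     unfolding U_def mem_Collect_eq
     by (intro conjI exI[of _ "e / 2"] exI[of _ K] ballI impI) (use s e in auto)
   qed
  qed
  then have "closedin (top_of_set {0..T}) ({0..T} - U)"
   using UT by (simp add: closedin_def double_diff)
  then show ?thesis unfolding F_def by (rule closedin_closed_trans) simp
 qed
 obtain \<Phi> where \<Phi>: "\<And>n s t. n \<ge> 0 ==> s \<in> {0..T} ==> t \<in> {0..T} ==> sob S n (c s) ==> closed_segment s t - {s} \<subseteq> U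
   ==> 0 \<le> \<Phi> n \<and> sob S (\<Phi> n) (c t)"
  using enter_gap by blast
 have "F = {}"
 proof (rule ccontr)
  assume ne: "F \<noteq> {}"
  define Fn where "Fn n = {t \<in> {0..T}. sob S (real n) (c t)}" for n :: nat
  have clFn: "closed (Fn n)" for n
   unfolding closed_sequential_limits
  proof (intro allI impI)
   fix x l assume x: "(\<forall>k. x k \<in> Fn n) \<and> x \<longlonglongrightarrow> l"
   have xT: "x k \<in> {0..T}" and xs: "sob S (real n) (c (x k))" for k
    using x unfolding Fn_def by blast+
   have xl: "x \<longlonglongrightarrow> l" using x by blast
   have lT: "l \<in> {0..T}"
    by (rule closed_sequentially[OF closed_atLeastAtMost _ xl]) (rule xT)
   have "sob S (real n) (c l)"
    by (rule sob_closed[OF _ xT xs xl lT]) simp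
   then show "l \<in> Fn n" using lT by (simp add: Fn_def)
  qed
  have "\<exists>n. \<not> F \<subseteq> closure (F - Fn n)"
  proof (rule ccontr)
   assume dense: "\<not> (\<exists>n. \<not> F \<subseteq> closure (F - Fn n))"
   have "F \<subseteq> closure (\<Inter> (range (\<lambda>n. F - Fn n)))"
   proof (rule Baire[OF cF])
    fix X assume "X \<in> range (\<lambda>n. F - Fn n)"
    then obtain n where X: "X = F - Fn n" by blast
    have "openin (top_of_set F) (F - Fn n)"
     using clFn[of n] by (metis Diff_eq open_Compl openin_open_Int)
    then show "openin (top_of_set F) X \<and> F \<subseteq> closure X" using dense X by blast
   qed auto
   moreover have "\<Inter> (range (\<lambda>n. F - Fn n)) = {}"
   proof (rule ccontr)
    assume "\<Inter> (range (\<lambda>n. F - Fn n)) \<noteq> {}"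
    then obtain t where t: "\<And>n. t \<in> F - Fn n" by blast
    then have tT: "t \<in> {0..T}" by (auto simp: F_def)
    then obtain K where "K \<ge> 0" "sob S K (c t)" using sob_each by (auto simp: c_def)
    moreover obtain n where "K \<le> real n" using real_arch_simple by blast
    ultimately have "t \<in> Fn n" using tT sob_mono by (auto simp: Fn_def)
    then show False using t by blast
   qed
   ultimately have "F \<subseteq> closure {}" by (simp only:)
   then show False using ne by simp
  qed
  then obtain n ts where ts: "ts \<in> F" "ts \<notin> closure (F - Fn n)" by blast
  then obtain e where e1: "e > 0" "\<And>y. y \<in> F - Fn n ==> \<not> dist y ts < e"
   unfolding closure_approachable by blast
  have e: "e > 0" "ball ts e \<inter> (F - Fn n) = {}"
   using e1 by (auto simp: dist_commute)
  have tsT: "ts \<in> {0..T}" using ts(1) by (simp add: F_def)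
  have near: "sob S (max (real n) (\<Phi> n)) (c t)" if t: "t \<in> {0..T}" "\<bar>t - ts\<bar> < e" for t
  proof -
   have "compact (closed_segment ts t \<inter> F)" by (intro compact_Int_closed compact_segment cF)
   moreover have "closed_segment ts t \<inter> F \<noteq> {}" using ts(1) by auto
   ultimately obtain s where s: "s \<in> closed_segment ts t \<inter> F" "\<And>r. r \<in> closed_segment ts t \<inter> F ==> dist t s \<le> dist t r"
    using continuous_attains_inf[OF _ _ continuous_on_dist[OF continuous_on_const continuous_on_id],
      of "closed_segment ts t \<inter> F" t] by auto
   have sT: "s \<in> {0..T}" using s(1) by (simp add: F_def)
   have "s \<in> ball ts e"
    using s(1) t by (auto simp: closed_segment_eq_real_ivl dist_real_def split: if_splits)
   then have sn: "sob S (real n) (c s)" using s(1) e(2) by (auto simp: Fn_def)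
   have "closed_segment s t - {s} \<subseteq> U"
   proof
    fix r assume r: "r \<in> closed_segment s t - {s}"
    have "r \<in> closed_segment ts t"
     using r s(1) by (auto simp: closed_segment_eq_real_ivl split: if_splits)
    moreover have "dist t r < dist t s"
     using r by (auto simp: closed_segment_eq_real_ivl dist_real_def split: if_splits)
    ultimately have "r \<notin> F" using s(2)[of r] by force
    moreover have "r \<in> {0..T}" using r segment_sub[OF sT t(1)] by auto
    ultimately show "r \<in> U" by (simp add: F_def)
   qed
   from \<Phi>[OF _ sT t(1) sn this] show ?thesis
    using sob_mono[of S "\<Phi> n" "c t" "max (real n) (\<Phi> n)"] by auto
  qed
  have "ts \<in> U"
   unfolding U_def mem_Collect_eq
   by (intro conjI exI[of _ e] exI[of _ "max (real n) (\<Phi> n)"] ballI impI) (use tsT e(1) near in auto)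
  then show False using ts(1) by (simp add: F_def)
 qed
 then have "{0..T} \<subseteq> U" by (auto simp: F_def)
 then show ?thesis using compact_U_bound[of "{0..T}"] by auto
qed

end

section \<open>An energy method for the implicit-explicit leapfrog scheme\<close>

definition bil :: "int set => (int => int => complex) => (int => complex) => (int => complex) => complex" where
 "bil G A x y = (\<Sum>m\<in>G. \<Sum>n\<in>G. cnj (x m) * A m n * y n)"

definition sq :: "int set => (int => complex) => real" where
 "sq G x = (\<Sum>m\<in>G. (cmod (x m))^2)"

definition matv :: "int set => (int => int => complex) => (int => complex) => int => complex" where
 "matv G A x m = (\<Sum>n\<in>G. A m n * x n)"

definition schur :: "int set => real => (int => int => complex) => bool" where
 "schur G M A \<longleftrightarrow> (\<forall>m\<in>G. (\<Sum>n\<in>G. cmod (A m n)) \<le> M) \<and> (\<forall>n\<in>G. (\<Sum>m\<in>G. cmod (A m n)) \<le> M)"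

lemma sq_nonneg: "0 \<le> sq G x"
 by (simp add: sq_def sum_nonneg)

lemma sq_add_le: "sq G (\<lambda>m. x m + y m) \<le> 2 * sq G x + 2 * sq G y"
proof -
 have "(cmod (x m + y m))^2 \<le> 2 * (cmod (x m))^2 + 2 * (cmod (y m))^2" for m
 proof -
  have "(cmod (x m + y m))^2 \<le> (cmod (x m) + cmod (y m))^2"
   by (intro power_mono norm_triangle_ineq) simp
  also have "... \<le> 2 * (cmod (x m))^2 + 2 * (cmod (y m))^2"
   using sum_squares_bound[of "cmod (x m)" "cmod (y m)"] by (simp add: power2_sum)
  finally show ?thesis .
 qed
 then show ?thesis unfolding sq_def sum_distrib_left sum.distrib[symmetric] by (rule sum_mono)
qed

lemma bil_add_left: "bil G A (\<lambda>m. x m + y m) z = bil G A x z + bil G A y z"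
 by (simp add: bil_def sum.distrib[symmetric] algebra_simps)

lemma bil_diff_mat: "bil G (\<lambda>m n. A m n - B m n) x y = bil G A x y - bil G B x y"
 by (simp add: bil_def sum_subtractf[symmetric] algebra_simps)

lemma bil_matv: "bil G A x y = (\<Sum>m\<in>G. cnj (x m) * matv G A y m)"
 by (simp add: bil_def matv_def sum_distrib_left mult.assoc)

lemma schur_bound:
 assumes "finite G" "schur G M A"
 shows "cmod (bil G A x y) \<le> M / 2 * (sq G x + sq G y)"
proof -
 have "cmod (bil G A x y) \<le> (\<Sum>m\<in>G. \<Sum>n\<in>G. cmod (A m n) * ((cmod (x m))^2 / 2) + cmod (A m n) * ((cmod (y n))^2 / 2))"
  unfolding bil_def
 proof (intro order_trans[OF norm_sum] sum_mono)
  fix m n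
  have "cmod (x m) * cmod (y n) \<le> (cmod (x m))^2 / 2 + (cmod (y n))^2 / 2"
   using sum_squares_bound[of "cmod (x m)" "cmod (y n)"] by (simp add: field_simps)
  then have "cmod (A m n) * (cmod (x m) * cmod (y n)) \<le> cmod (A m n) * ((cmod (x m))^2 / 2 + (cmod (y n))^2 / 2)"
   by (rule mult_left_mono) simp
  then show "cmod (cnj (x m) * A m n * y n) \<le> cmod (A m n) * ((cmod (x m))^2 / 2) + cmod (A m n) * ((cmod (y n))^2 / 2)"
   by (simp add: norm_mult algebra_simps)
 qed
 also have "... = (\<Sum>m\<in>G. (\<Sum>n\<in>G. cmod (A m n)) * ((cmod (x m))^2 / 2)) + (\<Sum>n\<in>G. (\<Sum>m\<in>G. cmod (A m n)) * ((cmod (y n))^2 / 2))"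
 proof -
  have "(\<Sum>m\<in>G. \<Sum>n\<in>G. cmod (A m n) * ((cmod (y n))^2 / 2)) = (\<Sum>n\<in>G. \<Sum>m\<in>G. cmod (A m n) * ((cmod (y n))^2 / 2))"
   by (rule sum.swap)
  then show ?thesis by (simp only: sum.distrib sum_distrib_right)
 qed
 also have "... \<le> (\<Sum>m\<in>G. M * ((cmod (x m))^2 / 2)) + (\<Sum>n\<in>G. M * ((cmod (y n))^2 / 2))"
  using assms(2) by (intro add_mono sum_mono mult_right_mono) (auto simp: schur_def)
 also have "... = M / 2 * (sq G x + sq G y)"
  by (simp add: sq_def sum_distrib_left[symmetric] sum_divide_distrib[symmetric] algebra_simps)
 finally show ?thesis .
qed

lemma schur_matv:
 assumes "finite G" "schur G M A" "M > 0"
 shows "sq G (matv G A y) \<le> M^2 * sq G y"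
proof -
 define z where "z = matv G A y"
 have "bil G A (\<lambda>m. z m / of_real M) y = of_real (sq G z / M)"
  by (simp add: bil_matv z_def[symmetric] sq_def sum_divide_distrib complex_norm_square mult.commute del: of_real_power)
 then have "sq G z / M \<le> M / 2 * (sq G (\<lambda>m. z m / of_real M) + sq G y)"
  using schur_bound[OF assms(1,2), of "\<lambda>m. z m / of_real M" y] abs_ge_self[of "sq G z / M"]
  by (simp only: norm_of_real)
 also have "sq G (\<lambda>m. z m / of_real M) = sq G z / M^2"
  by (simp add: sq_def norm_divide power_divide sum_divide_distrib)
 finally show ?thesis using assms(3) by (simp add: z_def[symmetric] field_simps power2_eq_square)
qed

text \<open>The boundary term of the summation by parts: \<open>K\<close> is the aliased coupling divided by the phase difference.\<close>
definition Zf :: "int set => (int => real) => (int => int => complex) => (int => complex) => (int => complex) => real" where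
 "Zf G \<gamma> K y z = 2 * Re (- \<i> * (bil G K y z + bil G K z y)
   - (bil G (\<lambda>m n. K m n * of_real (\<gamma> n)) y z - bil G (\<lambda>m n. K m n * of_real (\<gamma> n)) z y))"

text \<open>
 The part \<open>P\<close> of the explicit operator couples modes with very different phases.  Dividing by the
 phase difference turns its contribution into a telescoping quantity \<open>Zf\<close> plus a term in which the
 right hand side \<open>f\<close> appears with the small kernel \<open>K\<close>: summation by parts in time.
\<close>
lemma energy_step:
 fixes xp x0 xm f R :: "int => complex"
 assumes eq: "\<And>m. m \<in> G ==> xp m - xm m + \<i> * of_real (\<gamma> m) * (xp m + xm m) = 2 * of_real dt * f m"
  and f: "\<And>m. m \<in> G ==> f m = matv G B x0 m + matv G P x0 m + R m"
  and KP: "\<And>m n. m \<in> G ==> n \<in> G ==> of_real dt * P m n = of_real (\<gamma> m - \<gamma> n) * K m n"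
 shows "sq G xp - sq G xm = 2 * dt * Re (bil G B (\<lambda>m. xp m + xm m) x0) + (Zf G \<gamma> K xp x0 - Zf G \<gamma> K x0 xm)
   + 4 * dt * Re (\<i> * (bil G K f x0 + bil G K x0 f)) + 2 * dt * Re (\<Sum>m\<in>G. cnj (xp m + xm m) * R m)"
proof -
 have 1: "(cmod (xp m))^2 - (cmod (xm m))^2 = 2 * dt * Re (cnj (xp m + xm m) * f m)" if "m \<in> G" for m
 proof -
  have "2 * of_real dt * (cnj (xp m + xm m) * f m) = cnj (xp m + xm m) * (2 * of_real dt * f m)" by simp
  also have "... = cnj (xp m + xm m) * (xp m - xm m) + \<i> * of_real (\<gamma> m) * ((xp m + xm m) * cnj (xp m + xm m))"
   unfolding eq[OF that, symmetric] by (simp add: algebra_simps)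
  finally have "Re (2 * of_real dt * (cnj (xp m + xm m) * f m)) = Re (cnj (xp m + xm m) * (xp m - xm m))
    + Re (\<i> * of_real (\<gamma> m) * ((xp m + xm m) * cnj (xp m + xm m)))" by simp
  also have "Re (\<i> * of_real (\<gamma> m) * ((xp m + xm m) * cnj (xp m + xm m))) = 0"
   by (simp add: algebra_simps)
  finally show ?thesis unfolding cmod_power2 by (simp add: power2_eq_square algebra_simps)
 qed
 have "sq G xp - sq G xm = (\<Sum>m\<in>G. 2 * dt * Re (cnj (xp m + xm m) * f m))"
  unfolding sq_def sum_subtractf[symmetric] by (intro sum.cong refl 1)
 also have "... = 2 * dt * Re (\<Sum>m\<in>G. cnj (xp m + xm m) * f m)"
  by (simp add: sum_distrib_left)
 also have "(\<Sum>m\<in>G. cnj (xp m + xm m) * f m)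
   = bil G B (\<lambda>m. xp m + xm m) x0 + bil G P (\<lambda>m. xp m + xm m) x0 + (\<Sum>m\<in>G. cnj (xp m + xm m) * R m)"
  unfolding bil_matv sum.distrib[symmetric] by (intro sum.cong refl) (simp only: f distrib_left)
 finally have 2: "sq G xp - sq G xm = 2 * dt * Re (bil G B (\<lambda>m. xp m + xm m) x0)
   + 2 * Re (of_real dt * bil G P (\<lambda>m. xp m + xm m) x0) + 2 * dt * Re (\<Sum>m\<in>G. cnj (xp m + xm m) * R m)"
  by (simp add: algebra_simps)
 have pt: "of_real dt * (cnj (xp m + xm m) * P m n * x0 n) =
   K m n * (- \<i> * ((cnj (xp m) * x0 n + cnj (x0 m) * xp n) - (cnj (x0 m) * xm n + cnj (xm m) * x0 n))
    - of_real (\<gamma> n) * ((cnj (xp m) * x0 n - cnj (x0 m) * xp n) - (cnj (x0 m) * xm n - cnj (xm m) * x0 n))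
    + 2 * \<i> * of_real dt * (cnj (f m) * x0 n + cnj (x0 m) * f n))"
  if m: "m \<in> G" and n: "n \<in> G" for m n
 proof -
  have em: "2 * of_real dt * cnj (f m) = cnj (xp m) - cnj (xm m) - \<i> * of_real (\<gamma> m) * (cnj (xp m) + cnj (xm m))"
   using arg_cong[OF eq[OF m], of cnj] by simp
  have "2 * \<i> * of_real dt * (cnj (f m) * x0 n + cnj (x0 m) * f n)
    = \<i> * ((2 * of_real dt * cnj (f m)) * x0 n + cnj (x0 m) * (2 * of_real dt * f n))"
   by (simp add: algebra_simps)
  also have "... = \<i> * ((cnj (xp m) - cnj (xm m) - \<i> * of_real (\<gamma> m) * (cnj (xp m) + cnj (xm m))) * x0 n
    + cnj (x0 m) * (xp n - xm n + \<i> * of_real (\<gamma> n) * (xp n + xm n)))"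
   by (simp only: em eq[OF n])
  finally have e: "2 * \<i> * of_real dt * (cnj (f m) * x0 n + cnj (x0 m) * f n) = ..." .
  have "of_real dt * (cnj (xp m + xm m) * P m n * x0 n) = (of_real dt * P m n) * (cnj (xp m + xm m) * x0 n)"
   by (simp add: algebra_simps)
  also have "... = of_real (\<gamma> m - \<gamma> n) * K m n * (cnj (xp m + xm m) * x0 n)"
   by (simp only: KP[OF m n])
  finally show ?thesis unfolding e by (simp add: algebra_simps)
 qed
 have "of_real dt * bil G P (\<lambda>m. xp m + xm m) x0 = (\<Sum>m\<in>G. \<Sum>n\<in>G. K m n *
   (- \<i> * ((cnj (xp m) * x0 n + cnj (x0 m) * xp n) - (cnj (x0 m) * xm n + cnj (xm m) * x0 n))
    - of_real (\<gamma> n) * ((cnj (xp m) * x0 n - cnj (x0 m) * xp n) - (cnj (x0 m) * xm n - cnj (xm m) * x0 n))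
    + 2 * \<i> * of_real dt * (cnj (f m) * x0 n + cnj (x0 m) * f n)))"
  unfolding bil_def sum_distrib_left by (intro sum.cong refl pt)
 also have "... = - \<i> * ((bil G K xp x0 + bil G K x0 xp) - (bil G K x0 xm + bil G K xm x0))
   - ((bil G (\<lambda>m n. K m n * of_real (\<gamma> n)) xp x0 - bil G (\<lambda>m n. K m n * of_real (\<gamma> n)) x0 xp)
    - (bil G (\<lambda>m n. K m n * of_real (\<gamma> n)) x0 xm - bil G (\<lambda>m n. K m n * of_real (\<gamma> n)) xm x0))
   + 2 * \<i> * of_real dt * (bil G K f x0 + bil G K x0 f)"
  unfolding bil_def sum_subtractf[symmetric] sum.distrib[symmetric] sum_distrib_left
  by (intro sum.cong refl) (simp add: algebra_simps)
 finally have e0: "of_real dt * bil G P (\<lambda>m. xp m + xm m) x0 = ..." .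
 have "2 * Re (of_real dt * bil G P (\<lambda>m. xp m + xm m) x0)
   = (Zf G \<gamma> K xp x0 - Zf G \<gamma> K x0 xm) + 4 * dt * Re (\<i> * (bil G K f x0 + bil G K x0 f))"
  unfolding e0 Zf_def by (simp add: algebra_simps)
 then show ?thesis using 2 by simp
qed

lemma Zf_bound:
 assumes "finite G" "schur G k K" "schur G k' (\<lambda>m n. K m n * of_real (\<gamma> n))"
 shows "\<bar>Zf G \<gamma> K y z\<bar> \<le> 2 * (k + k') * (sq G y + sq G z)"
proof -
 let ?L = "\<lambda>m n. K m n * of_real (\<gamma> n)"
 have "\<bar>Zf G \<gamma> K y z\<bar> \<le> 2 * cmod (- \<i> * (bil G K y z + bil G K z y) - (bil G ?L y z - bil G ?L z y))"
  unfolding Zf_def abs_mult by (intro mult_mono abs_Re_le_cmod) auto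
 also have "cmod (- \<i> * (bil G K y z + bil G K z y) - (bil G ?L y z - bil G ?L z y))
   \<le> cmod (- \<i> * (bil G K y z + bil G K z y)) + cmod (bil G ?L y z - bil G ?L z y)"
  by (rule norm_triangle_ineq4)
 also have "cmod (- \<i> * (bil G K y z + bil G K z y)) = cmod (bil G K y z + bil G K z y)" by (simp add: norm_mult)
 also have "cmod (bil G K y z + bil G K z y) + cmod (bil G ?L y z - bil G ?L z y)
  \<le> (cmod (bil G K y z) + cmod (bil G K z y)) + (cmod (bil G ?L y z) + cmod (bil G ?L z y))"
  by (intro add_mono norm_triangle_ineq norm_triangle_ineq4)
 also have "... \<le> (k / 2 * (sq G y + sq G z) + k / 2 * (sq G z + sq G y)) + (k' / 2 * (sq G y + sq G z) + k' / 2 * (sq G z + sq G y))"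
  by (intro add_mono schur_bound assms)
 finally show ?thesis by (simp add: algebra_simps)
qed

lemma Zf_diff: "Zf G \<gamma> (\<lambda>m n. K m n - K' m n) y z = Zf G \<gamma> K y z - Zf G \<gamma> K' y z"
 unfolding Zf_def left_diff_distrib bil_diff_mat by (simp add: algebra_simps)

lemma discrete_gronwall:
 fixes E :: "nat => real"
 assumes q: "0 \<le> q" "q \<le> 1/2" and p: "0 \<le> p" and E0: "0 \<le> E 0"
  and step: "\<And>j. 1 \<le> j ==> j \<le> J ==> E j - E (j - 1) \<le> q * (E j + E (j - 1)) + p"
  and pos: "\<And>j. j \<le> J ==> 0 \<le> E j"
  and j: "j \<le> J"
 shows "E j \<le> exp (4 * q * real j) * (E 0 + 2 * p * real j)"
 using j
proof (induction j)
 case (Suc j)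
 then have IH: "E j \<le> exp (4 * q * real j) * (E 0 + 2 * p * real j)" by simp
 have "E (Suc j) - E j \<le> q * (E (Suc j) + E j) + p" using step[of "Suc j"] Suc.prems by simp
 then have 1: "(1 - q) * E (Suc j) \<le> (1 + q) * E j + p" by (simp add: algebra_simps)
 have "(1 + q) * E j + p \<le> (1 - q) * ((1 + 4 * q) * E j + 2 * p)"
 proof -
  have "(1 - q) * ((1 + 4 * q) * E j + 2 * p) - ((1 + q) * E j + p) = 2 * q * (1 - 2 * q) * E j + (1 - 2 * q) * p"
   by (simp add: algebra_simps power2_eq_square)
  moreover have "0 \<le> 2 * q * (1 - 2 * q) * E j + (1 - 2 * q) * p"
   using q p pos[of j] Suc.prems by (intro add_nonneg_nonneg mult_nonneg_nonneg) auto
  ultimately show ?thesis by linarith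
 qed
 then have "(1 - q) * E (Suc j) \<le> (1 - q) * ((1 + 4 * q) * E j + 2 * p)" using 1 by linarith
 then have "E (Suc j) \<le> (1 + 4 * q) * E j + 2 * p" using q by (simp add: mult_le_cancel_left)
 also have "... \<le> exp (4 * q) * E j + 2 * p"
  using p pos[of j] Suc.prems exp_ge_add_one_self[of "4 * q"] by (intro add_mono mult_right_mono) auto
 also have "... \<le> exp (4 * q) * (exp (4 * q * real j) * (E 0 + 2 * p * real j)) + exp (4 * q * real (Suc j)) * (2 * p)"
 proof (intro add_mono mult_left_mono IH)
  have "1 * (2 * p) \<le> exp (4 * q * real (Suc j)) * (2 * p)"
   using p q by (intro mult_right_mono) auto
  then show "2 * p \<le> exp (4 * q * real (Suc j)) * (2 * p)" by simp
 qed simp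
 also have "... = exp (4 * q * real (Suc j)) * (E 0 + 2 * p * real (Suc j))"
  by (simp add: algebra_simps exp_add)
 finally show ?case .
qed simp

text \<open>The part \<open>B\<close> enters through its deviation from skew symmetry, after which it telescopes as well; \<open>Zf\<close> and the pairing
 with \<open>B\<close> are small compared with the energy, so the summed identity is a discrete Gronwall inequality.\<close>
lemma leapfrog_stability:
 fixes x :: "nat => int => complex" and B P K :: "nat => int => int => complex"
 assumes G: "finite G" and dt: "dt > 0" and cst: "b > 0" "k0 \<ge> 0" "k \<ge> 0" "k' \<ge> 0" "M \<ge> 0" "\<tau> \<ge> 0"
  and eq: "\<And>j m. 1 \<le> j ==> j \<le> J ==> m \<in> G ==>
    x (j+1) m - x (j-1) m + \<i> * of_real (\<gamma> m) * (x (j+1) m + x (j-1) m)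
     = 2 * of_real dt * (matv G (B j) (x j) m + matv G (P j) (x j) m + R j m)"
  and KP: "\<And>j m n. m \<in> G ==> n \<in> G ==> of_real dt * P j m n = of_real (\<gamma> m - \<gamma> n) * K j m n"
  and Bb: "\<And>j. j \<le> J ==> schur G b (B j)" and Pb: "\<And>j. j \<le> J ==> schur G b (P j)"
  and Bskew: "\<And>j. j \<le> J ==> schur G M (\<lambda>m n. B j m n + cnj (B j n m))"
  and Bdiff: "\<And>j. 1 \<le> j ==> j \<le> J ==> schur G M (\<lambda>m n. B (j-1) m n - B j m n)"
  and Kb: "\<And>j. j \<le> J ==> schur G k (K j)" "\<And>j. j \<le> J ==> schur G k' (\<lambda>m n. K j m n * of_real (\<gamma> n))"
  and Kdiff: "\<And>j. 1 \<le> j ==> j \<le> J ==> schur G (M * dt) (\<lambda>m n. K (j-1) m n - K j m n)"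
   "\<And>j. 1 \<le> j ==> j \<le> J ==> schur G (M * dt) (\<lambda>m n. (K (j-1) m n - K j m n) * of_real (\<gamma> n))"
  and Rb: "\<And>j. 1 \<le> j ==> j \<le> J ==> sq G (R j) \<le> M * sq G (x j) + \<tau>"
  and small: "dt * b \<le> 1/4" "k + k' \<le> 1/8" and kb: "k * b^2 \<le> k0"
  and dts: "dt * (8 * (1 + 4 * M + 8 * k0 + k)) \<le> 1/2"
  and j: "j \<le> J"
 shows "sq G (x (j+1)) + sq G (x j) \<le> exp (32 * (1 + 4 * M + 8 * k0 + k) * (dt * real j))
   * (4 * (sq G (x 1) + sq G (x 0)) + 16 * (dt * real j) * \<tau>)"
proof -
 define E where "E j = sq G (x (j+1)) + sq G (x j) - 2 * dt * Re (bil G (B j) (x (j+1)) (x j)) - Zf G \<gamma> (K j) (x (j+1)) (x j)" for j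
 define Cc where "Cc = 1 + 4 * M + 8 * k0 + k"
 have Ebd: "\<bar>E j - (sq G (x (j+1)) + sq G (x j))\<bar> \<le> (sq G (x (j+1)) + sq G (x j)) / 2" if j: "j \<le> J" for j
 proof -
  let ?s = "sq G (x (j+1)) + sq G (x j)"
  have s0: "0 \<le> ?s" using sq_nonneg[of G "x (j+1)"] sq_nonneg[of G "x j"] by linarith
  have "\<bar>Re (bil G (B j) (x (j+1)) (x j))\<bar> \<le> b / 2 * ?s"
   using order_trans[OF abs_Re_le_cmod schur_bound[OF G Bb[OF j], of "x (j+1)" "x j"]] .
  then have "\<bar>2 * dt * Re (bil G (B j) (x (j+1)) (x j))\<bar> \<le> 2 * dt * (b / 2 * ?s)"
   unfolding abs_mult using dt by (intro mult_mono) auto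
  also have "... = (dt * b) * ?s" by simp
  also have "... \<le> 1/4 * ?s" using small s0 by (intro mult_right_mono) auto
  finally have 1: "\<bar>2 * dt * Re (bil G (B j) (x (j+1)) (x j))\<bar> \<le> 1/4 * ?s" .
  have "\<bar>Zf G \<gamma> (K j) (x (j+1)) (x j)\<bar> \<le> 2 * (k + k') * ?s"
   by (rule Zf_bound[OF G Kb[OF j]])
  also have "... \<le> 1/4 * ?s" using small s0 by (intro mult_right_mono) auto
  finally show ?thesis using 1 unfolding E_def by linarith
 qed
 have half: "s / 2 \<le> e \<and> e \<le> 2 * s" if "\<bar>e - s\<bar> \<le> s / 2" "0 \<le> s" for e s :: real
 proof -
  have "e - s \<le> s / 2" "- (e - s) \<le> s / 2" using that(1) by (simp_all only: abs_le_iff)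
  then show ?thesis using that(2) by (intro conjI) linarith+
 qed
 have Elo: "(sq G (x (j+1)) + sq G (x j)) / 2 \<le> E j" and Ehi: "E j \<le> 2 * (sq G (x (j+1)) + sq G (x j))" if "j \<le> J" for j
  using half[OF Ebd[OF that]] sq_nonneg[of G "x (j+1)"] sq_nonneg[of G "x j"] by auto
 have step: "E j - E (j - 1) \<le> (dt * (8 * Cc)) * (E j + E (j - 1)) + 4 * dt * \<tau>" if j1: "1 \<le> j" and jJ: "j \<le> J" for j
 proof -
  define xp where "xp = x (j+1)"
  define x0 where "x0 = x j"
  define xm where "xm = x (j-1)"
  define f where "f m = matv G (B j) x0 m + matv G (P j) x0 m + R j m" for m
  define t where "t = sq G xp + sq G x0 + sq G xm"
  have nn: "0 \<le> sq G xp" "0 \<le> sq G x0" "0 \<le> sq G xm" by (simp_all add: sq_nonneg)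
  have jm: "j - 1 + 1 = j" "j - 1 \<le> J" using j1 jJ by auto
  have id: "sq G xp - sq G xm = 2 * dt * Re (bil G (B j) (\<lambda>m. xp m + xm m) x0) + (Zf G \<gamma> (K j) xp x0 - Zf G \<gamma> (K j) x0 xm)
   + 4 * dt * Re (\<i> * (bil G (K j) f x0 + bil G (K j) x0 f)) + 2 * dt * Re (\<Sum>m\<in>G. cnj (xp m + xm m) * R j m)"
   by (rule energy_step[where P = "P j"])
     (use eq[OF j1 jJ] KP in \<open>auto simp: xp_def x0_def xm_def f_def\<close>)
  have Ej: "E j - E (j - 1) = 2 * dt * (Re (bil G (B j) xm x0) + Re (bil G (B j) x0 xm)) + 2 * dt * (Re (bil G (B (j-1)) x0 xm) - Re (bil G (B j) x0 xm))
    + (Zf G \<gamma> (K (j-1)) x0 xm - Zf G \<gamma> (K j) x0 xm)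
    + 4 * dt * Re (\<i> * (bil G (K j) f x0 + bil G (K j) x0 f)) + 2 * dt * Re (\<Sum>m\<in>G. cnj (xp m + xm m) * R j m)"
   using id unfolding E_def jm xp_def[symmetric] x0_def[symmetric] xm_def[symmetric] bil_add_left
   by (simp add: algebra_simps)
  have a1: "Re (bil G (B j) xm x0) + Re (bil G (B j) x0 xm) \<le> M / 2 * (sq G xm + sq G x0)"
  proof -
   have "bil G (\<lambda>m n. cnj (B j n m)) xm x0 = (\<Sum>n\<in>G. \<Sum>m\<in>G. cnj (xm m) * cnj (B j n m) * x0 n)"
    unfolding bil_def by (rule sum.swap)
   also have "... = cnj (bil G (B j) x0 xm)"
    unfolding bil_def cnj_sum by (intro sum.cong refl) (simp add: mult_ac)
   finally have "Re (bil G (B j) x0 xm) = Re (bil G (\<lambda>m n. cnj (B j n m)) xm x0)" by simp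
   then have "Re (bil G (B j) xm x0) + Re (bil G (B j) x0 xm) = Re (bil G (\<lambda>m n. B j m n + cnj (B j n m)) xm x0)"
    by (simp add: bil_def sum.distrib algebra_simps)
   also have "... \<le> cmod (bil G (\<lambda>m n. B j m n + cnj (B j n m)) xm x0)" by (rule complex_Re_le_cmod)
   also have "... \<le> M / 2 * (sq G xm + sq G x0)" by (rule schur_bound[OF G Bskew[OF jJ]])
   finally show ?thesis .
  qed
  have a2: "Re (bil G (B (j-1)) x0 xm) - Re (bil G (B j) x0 xm) \<le> M / 2 * (sq G x0 + sq G xm)"
  proof -
   have "Re (bil G (B (j-1)) x0 xm) - Re (bil G (B j) x0 xm) = Re (bil G (\<lambda>m n. B (j-1) m n - B j m n) x0 xm)"
    by (simp add: bil_diff_mat)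
   also have "... \<le> cmod (bil G (\<lambda>m n. B (j-1) m n - B j m n) x0 xm)" by (rule complex_Re_le_cmod)
   also have "... \<le> M / 2 * (sq G x0 + sq G xm)" by (rule schur_bound[OF G Bdiff[OF j1 jJ]])
   finally show ?thesis .
  qed
  have a3: "Zf G \<gamma> (K (j-1)) x0 xm - Zf G \<gamma> (K j) x0 xm \<le> dt * (4 * M * (sq G x0 + sq G xm))"
  proof -
   have "Zf G \<gamma> (K (j-1)) x0 xm - Zf G \<gamma> (K j) x0 xm \<le> \<bar>Zf G \<gamma> (\<lambda>m n. K (j-1) m n - K j m n) x0 xm\<bar>"
    by (simp add: Zf_diff)
   also have "... \<le> 2 * (M * dt + M * dt) * (sq G x0 + sq G xm)"
    by (rule Zf_bound[OF G Kdiff[OF j1 jJ]])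
   finally show ?thesis by (simp add: algebra_simps)
  qed
  have Rs: "sq G (R j) \<le> M * sq G x0 + \<tau>" using Rb[OF j1 jJ] by (simp add: x0_def)
  have fs: "sq G f \<le> 8 * b^2 * sq G x0 + 2 * (M * sq G x0 + \<tau>)"
  proof -
   have f1: "sq G f \<le> 2 * sq G (\<lambda>m. matv G (B j) x0 m + matv G (P j) x0 m) + 2 * sq G (R j)"
    unfolding f_def by (rule sq_add_le)
   have "sq G (\<lambda>m. matv G (B j) x0 m + matv G (P j) x0 m) \<le> 2 * (b^2 * sq G x0) + 2 * (b^2 * sq G x0)"
    using sq_add_le[of G "matv G (B j) x0" "matv G (P j) x0"]
     schur_matv[OF G Bb[OF jJ] cst(1), of x0] schur_matv[OF G Pb[OF jJ] cst(1), of x0] by linarith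
   then have "sq G f \<le> 2 * (2 * (b^2 * sq G x0) + 2 * (b^2 * sq G x0)) + 2 * (M * sq G x0 + \<tau>)"
    by (intro order_trans[OF f1] add_mono mult_left_mono Rs) simp_all
   then show ?thesis by (simp add: mult.assoc mult.commute[of "b^2"])
  qed
  have a4: "2 * Re (\<i> * (bil G (K j) f x0 + bil G (K j) x0 f)) \<le> (16 * k0 + 4 * M + 2 * k) * sq G x0 + \<tau>"
  proof -
   have "Re (\<i> * (bil G (K j) f x0 + bil G (K j) x0 f)) \<le> cmod (\<i> * (bil G (K j) f x0 + bil G (K j) x0 f))"
    by (rule complex_Re_le_cmod)
   also have "... \<le> cmod (bil G (K j) f x0) + cmod (bil G (K j) x0 f)"
    using norm_triangle_ineq by (simp add: norm_mult)
   also have "... \<le> k / 2 * (sq G f + sq G x0) + k / 2 * (sq G x0 + sq G f)"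
    by (intro add_mono schur_bound[OF G Kb(1)[OF jJ]])
   also have "... = k * sq G f + k * sq G x0" by (simp add: algebra_simps)
   also have "... \<le> k * (8 * b^2 * sq G x0 + 2 * (M * sq G x0 + \<tau>)) + k * sq G x0"
    using fs cst by (intro add_mono mult_left_mono) auto
   also have "... = 8 * (k * b^2) * sq G x0 + (2 * k) * (M * sq G x0 + \<tau>) + k * sq G x0"
    by (simp add: algebra_simps)
   also have "... \<le> 8 * k0 * sq G x0 + (1/2) * (M * sq G x0 + \<tau>) + k * sq G x0"
    using kb small cst nn by (intro add_mono mult_right_mono mult_left_mono) auto
   finally have "2 * Re (\<i> * (bil G (K j) f x0 + bil G (K j) x0 f)) \<le> 16 * (k0 * sq G x0) + (M * sq G x0 + \<tau>) + 2 * (k * sq G x0)"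
    by (simp add: mult.assoc add_divide_distrib)
   moreover have "0 \<le> M * sq G x0" using cst nn by simp
   ultimately show ?thesis by (simp add: distrib_right mult.assoc)
  qed
  have a5: "Re (\<Sum>m\<in>G. cnj (xp m + xm m) * R j m) \<le> sq G xp + sq G xm + (M * sq G x0 + \<tau>)"
  proof -
   have "Re (\<Sum>m\<in>G. cnj (xp m + xm m) * R j m) \<le> (\<Sum>m\<in>G. (cmod (xp m + xm m))^2 / 2 + (cmod (R j m))^2 / 2)"
    unfolding Re_sum
   proof (rule sum_mono)
    fix m
    have "Re (cnj (xp m + xm m) * R j m) \<le> cmod (cnj (xp m + xm m) * R j m)" by (rule complex_Re_le_cmod)
    also have "... = cmod (xp m + xm m) * cmod (R j m)" by (simp only: norm_mult complex_mod_cnj)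
    also have "... \<le> (cmod (xp m + xm m))^2 / 2 + (cmod (R j m))^2 / 2"
     using sum_squares_bound[of "cmod (xp m + xm m)" "cmod (R j m)"] by (simp add: field_simps)
    finally show "Re (cnj (xp m + xm m) * R j m) \<le> (cmod (xp m + xm m))^2 / 2 + (cmod (R j m))^2 / 2" .
   qed
   also have "... = sq G (\<lambda>m. xp m + xm m) / 2 + sq G (R j) / 2"
    by (simp add: sq_def sum.distrib sum_divide_distrib)
   also have "... \<le> sq G xp + sq G xm + (M * sq G x0 + \<tau>)"
    using sq_add_le[of G xp xm] Rs sq_nonneg[of G "R j"] by linarith
   finally show ?thesis .
  qed
  have "E j - E (j - 1) \<le> 2 * dt * (M / 2 * (sq G xm + sq G x0)) + 2 * dt * (M / 2 * (sq G x0 + sq G xm))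
    + dt * (4 * M * (sq G x0 + sq G xm)) + 2 * dt * ((16 * k0 + 4 * M + 2 * k) * sq G x0 + \<tau>)
    + 2 * dt * (sq G xp + sq G xm + (M * sq G x0 + \<tau>))"
  proof -
   have "4 * dt * Re (\<i> * (bil G (K j) f x0 + bil G (K j) x0 f)) = 2 * dt * (2 * Re (\<i> * (bil G (K j) f x0 + bil G (K j) x0 f)))" by simp
   also have "... \<le> 2 * dt * ((16 * k0 + 4 * M + 2 * k) * sq G x0 + \<tau>)"
    using a4 dt by (intro mult_left_mono) auto
   finally show ?thesis
    unfolding Ej using dt a1 a2 a3 a5 by (intro add_mono mult_left_mono) auto
  qed
  also have "... = dt * (6 * M * (sq G x0 + sq G xm) + (32 * k0 + 10 * M + 4 * k) * sq G x0 + 2 * (sq G xp + sq G xm)) + 4 * dt * \<tau>"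
   by (simp add: algebra_simps)
  also have "... \<le> dt * ((2 * Cc) * (2 * t)) + 4 * dt * \<tau>"
  proof -
   have "6 * M * (sq G x0 + sq G xm) \<le> 6 * M * t" "(32 * k0 + 10 * M + 4 * k) * sq G x0 \<le> (32 * k0 + 10 * M + 4 * k) * t" "2 * (sq G xp + sq G xm) \<le> 2 * t"
    unfolding t_def using cst nn by (intro mult_left_mono; simp)+
   then have "6 * M * (sq G x0 + sq G xm) + (32 * k0 + 10 * M + 4 * k) * sq G x0 + 2 * (sq G xp + sq G xm) \<le> (6 * M + (32 * k0 + 10 * M + 4 * k) + 2) * t"
    by (simp add: distrib_right)
   also have "... \<le> ((2 * Cc) * 2) * t"
    unfolding Cc_def t_def using cst nn by (intro mult_right_mono) auto
   finally have "6 * M * (sq G x0 + sq G xm) + (32 * k0 + 10 * M + 4 * k) * sq G x0 + 2 * (sq G xp + sq G xm) \<le> (2 * Cc) * (2 * t)"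
    by (simp only: mult.assoc)
   then show ?thesis using dt by (intro add_mono mult_left_mono) auto
  qed
  also have "dt * ((2 * Cc) * (2 * t)) \<le> dt * ((2 * Cc) * (4 * (E j + E (j - 1))))"
  proof -
   have "t \<le> 2 * E j + 2 * E (j - 1)"
    using Elo[OF jJ] Elo[OF jm(2)] nn unfolding jm t_def xp_def x0_def xm_def add_divide_distrib by linarith
   moreover have "0 \<le> Cc" unfolding Cc_def using cst by simp
   ultimately show ?thesis using dt by (intro mult_left_mono) auto
  qed
  finally show ?thesis by (simp add: algebra_simps)
 qed
 have Cc0: "0 \<le> Cc" unfolding Cc_def using cst by simp
 have "E j \<le> exp (4 * (dt * (8 * Cc)) * real j) * (E 0 + 2 * (4 * dt * \<tau>) * real j)"
 proof (rule discrete_gronwall[where J = J])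
  show "dt * (8 * Cc) \<le> 1/2" using dts by (simp add: Cc_def)
  show "0 \<le> E j" if "j \<le> J" for j
   by (rule order_trans[OF _ Elo[OF that]]) (simp add: sq_nonneg)
  then show "0 \<le> E 0" by simp
 qed (use step Cc0 dt cst j in auto)
 also have "... \<le> exp (4 * (dt * (8 * Cc)) * real j) * (2 * (sq G (x 1) + sq G (x 0)) + 8 * (dt * real j) * \<tau>)"
  using Ehi[of 0] by (intro mult_left_mono) (auto simp: algebra_simps)
 finally have "(sq G (x (j+1)) + sq G (x j)) / 2 \<le> exp (4 * (dt * (8 * Cc)) * real j) * (2 * (sq G (x 1) + sq G (x 0)) + 8 * (dt * real j) * \<tau>)"
  by (rule order_trans[OF Elo[OF j]])
 then have "sq G (x (j+1)) + sq G (x j) \<le> 2 * (exp (4 * (dt * (8 * Cc)) * real j) * (2 * (sq G (x 1) + sq G (x 0)) + 8 * (dt * real j) * \<tau>))"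
  by (simp only: pos_divide_le_eq zero_less_numeral mult.commute)
 then show ?thesis by (simp add: Cc_def algebra_simps)
qed

section \<open>Discrete Fourier analysis on the grid\<close>

lemma sum_periodic_shift:
 fixes f :: "int => 'a::ab_group_add"
 assumes per: "\<And>k. f (k + int N) = f k"
 shows "(\<Sum>k\<in>{a..<a + int N}. f k) = (\<Sum>k\<in>{b..<b + int N}. f k)"
proof (cases "N = 0")
 case False
 have one: "(\<Sum>k\<in>{c + 1..<c + 1 + int N}. f k) = (\<Sum>k\<in>{c..<c + int N}. f k)" for c
 proof -
  have "{c..<c + int N} = insert c {c + 1..<c + int N}" "{c + 1..<c + 1 + int N} = insert (c + int N) {c + 1..<c + int N}"
   using False by auto
  then show ?thesis by (simp add: per)
 qed
 have "(\<Sum>k\<in>{c..<c + int N}. f k) = (\<Sum>k\<in>{0..<int N}. f k)" for c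
 proof (induction c rule: int_induct[where k = 0])
  case (step1 i) then show ?case using one[of i] by simp
 next
  case (step2 i) then show ?case using one[of "i - 1"] by simp
 qed simp
 then show ?thesis by (metis)
qed simp

lemma grid_idx_eq: "even N ==> grid_idx N = {- (int N div 2) + 1..<- (int N div 2) + 1 + int N}"
 unfolding grid_idx_def by (auto elim!: evenE)

lemma finite_grid [simp]: "finite (grid_idx N)"
 by (simp add: grid_idx_def)

lemma card_grid: "even N ==> card (grid_idx N) = N"
 by (simp add: grid_idx_eq)

lemma grid_bound: "m \<in> grid_idx N ==> 2 * \<bar>m\<bar> \<le> int N"
 by (auto simp: grid_idx_def)

lemma grid_sum_shift:
 fixes f :: "int => 'a::ab_group_add"
 assumes "even N" "\<And>k. f (k + int N) = f k"
 shows "(\<Sum>n\<in>grid_idx N. f (n - m)) = (\<Sum>n\<in>grid_idx N. f n)"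
proof -
 have "(\<Sum>n\<in>grid_idx N. f (n - m)) = (\<Sum>n\<in>{- (int N div 2) + 1 - m..<- (int N div 2) + 1 - m + int N}. f n)"
  unfolding grid_idx_eq[OF assms(1)]
  by (rule sum.reindex_bij_witness[of _ "\<lambda>n. n + m" "\<lambda>n. n - m"]) auto
 also have "... = (\<Sum>n\<in>grid_idx N. f n)"
  unfolding grid_idx_eq[OF assms(1)] by (rule sum_periodic_shift[where f = f, OF assms(2)])
 finally show ?thesis .
qed

lemma grid_pt_shift: "N > 0 ==> grid_pt N (k + int N) = grid_pt N k + 2 * pi"
 by (simp add: grid_pt_def mesh_def distrib_right add_divide_distrib)

lemma dft_alt: "dft N f m = (\<Sum>k\<in>grid_idx N. f k * ek (-m) (grid_pt N k)) / of_nat N"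
 by (simp add: dft_def cis_conv_exp mult_ac)

lemma idft_alt: "idft N y k = trig (grid_idx N) y (grid_pt N k)"
 by (simp add: idft_def trig_def cis_conv_exp mult_ac)

lemma dft_periodic: "N > 0 ==> dft N f (m + int N) = dft N f m"
proof -
 assume N: "N > 0"
 have "ek (-(m + int N)) (grid_pt N k) = ek (-m) (grid_pt N k)" for k
 proof -
  have "of_int (-(m + int N)) * grid_pt N k = of_int (-m) * grid_pt N k + of_int (-k) * (2*pi)"
   using N by (simp add: grid_pt_def mesh_def field_simps)
  then show ?thesis by (simp only: cis_mult[symmetric] ek_2pi mult_1_right)
 qed
 then show ?thesis by (simp only: dft_alt)
qed

lemma grid_orthogonality:
 assumes N: "even N" "N > 0"
 shows "(\<Sum>k\<in>grid_idx N. ek m (grid_pt N k)) = (if int N dvd m then of_nat N else 0)"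
proof -
 define z where "z = cis (of_int m * mesh N)"
 have sh: "ek m (grid_pt N (k - (-1))) = z * ek m (grid_pt N k)" for k
  by (simp add: z_def grid_pt_def cis_mult algebra_simps)
 have "(\<Sum>k\<in>grid_idx N. ek m (grid_pt N (k - (-1)))) = (\<Sum>k\<in>grid_idx N. ek m (grid_pt N k))"
  by (rule grid_sum_shift[OF N(1), where f = "\<lambda>k. ek m (grid_pt N k)"]) (simp only: grid_pt_shift[OF N(2)] ek_periodic)
 then have fix_pt: "z * (\<Sum>k\<in>grid_idx N. ek m (grid_pt N k)) = (\<Sum>k\<in>grid_idx N. ek m (grid_pt N k))"
  by (simp only: sh sum_distrib_left)
 show ?thesis
 proof (cases "int N dvd m")
  case True
  then obtain q where q: "m = int N * q" by blast
  have "ek m (grid_pt N k) = 1" for k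
  proof -
   have "of_int m * grid_pt N k = of_int (q * k) * (2*pi)" using N by (simp add: q grid_pt_def mesh_def)
   then show ?thesis by (simp only: ek_2pi)
  qed
  then show ?thesis using True card_grid[OF N(1)] by simp
 next
  case False
  have "z \<noteq> 1"
  proof
   assume "z = 1"
   then have "cos (of_int m * mesh N) = 1" by (simp add: z_def complex_eq_iff)
   then obtain q :: int where "of_int m * mesh N = of_int q * 2 * pi" unfolding cos_one_2pi_int by blast
   then have "real_of_int m = of_int (q * int N)" using N by (simp add: mesh_def field_simps)
   then have "m = q * int N" by (simp only: of_int_eq_iff)
   then show False using False by simp
  qed
  then show ?thesis using fix_pt False by simp
 qed
qed

lemma dft_sum: "dft N (\<lambda>k. \<Sum>i\<in>A. f i k) m = (\<Sum>i\<in>A. dft N (f i) m)"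
 unfolding dft_alt sum_distrib_right by (subst sum.swap) (simp add: sum_divide_distrib)

lemma dft_add: "dft N (\<lambda>k. f k + g k) m = dft N f m + dft N g m"
 by (simp add: dft_alt distrib_right sum.distrib add_divide_distrib)

lemma dft_diff: "dft N (\<lambda>k. f k - g k) m = dft N f m - dft N g m"
 by (simp add: dft_alt left_diff_distrib sum_subtractf diff_divide_distrib)

lemma dft_cmult: "dft N (\<lambda>k. c * f k) m = c * dft N f m"
 by (simp add: dft_alt sum_distrib_left mult.assoc)

lemma dft_mult_ek: "dft N (\<lambda>k. b k * ek n (grid_pt N k)) m = dft N b (m - n)"
proof -
 have "ek n x * ek (-m) x = ek (-(m - n)) x" for x by (simp add: cis_mult algebra_simps)
 then show ?thesis unfolding dft_alt by (simp only: mult.assoc)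
qed

lemma dft_mult_trig: "dft N (\<lambda>k. b k * trig I y (grid_pt N k)) m = (\<Sum>n\<in>I. dft N b (m - n) * y n)"
proof -
 have "(\<lambda>k. b k * trig I y (grid_pt N k)) = (\<lambda>k. \<Sum>n\<in>I. y n * (b k * ek n (grid_pt N k)))"
  by (simp add: trig_def sum_distrib_left fun_eq_iff mult_ac)
 then have "dft N (\<lambda>k. b k * trig I y (grid_pt N k)) m = (\<Sum>n\<in>I. dft N (\<lambda>k. y n * (b k * ek n (grid_pt N k))) m)"
  by (simp only: dft_sum)
 then show ?thesis by (simp only: dft_cmult dft_mult_ek mult.commute)
qed

lemma dft_trig:
 assumes N: "even N" "N > 0" and I: "I \<subseteq> grid_idx N" and m: "m \<in> grid_idx N"
 shows "dft N (\<lambda>k. trig I y (grid_pt N k)) m = (if m \<in> I then y m else 0)"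
proof -
 have fin: "finite I" using I finite_grid finite_subset by blast
 have "dft N (\<lambda>k. 1 * trig I y (grid_pt N k)) m = (\<Sum>n\<in>I. dft N (\<lambda>k. 1) (m - n) * y n)"
  by (rule dft_mult_trig)
 also have "... = (\<Sum>n\<in>I. if n = m then y n else 0)"
 proof (intro sum.cong refl)
  fix n assume "n \<in> I"
  then have n: "n \<in> grid_idx N" using I by blast
  have "int N dvd -(m - n) \<longleftrightarrow> n = m"
  proof
   assume d: "int N dvd -(m - n)"
   have "\<bar>-(m - n)\<bar> < int N" using m n unfolding grid_idx_def by auto
   then show "n = m" using d zdvd_imp_le[of "int N" "\<bar>-(m - n)\<bar>"] by (cases "m = n") auto
  qed simp
  then show "dft N (\<lambda>k. 1) (m - n) * y n = (if n = m then y n else 0)"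
   using grid_orthogonality[OF N, of "-(m - n)"] N by (simp add: dft_alt)
 qed
 also have "... = (if m \<in> I then y m else 0)" using fin by simp
 finally show ?thesis by simp
qed

lemma dft_cnj: "(\<And>k. cnj (b k) = b k) ==> dft N b (- l) = cnj (dft N b l)"
 by (simp add: dft_alt cis_cnj)

lemma dft_parseval:
 assumes N: "even N" "N > 0"
 shows "sq (grid_idx N) (dft N f) = sq (grid_idx N) f / real N"
proof -
 let ?G = "grid_idx N"
 have orth: "(\<Sum>m\<in>?G. ek (- m) (grid_pt N k) * ek m (grid_pt N l)) = (if l = k then of_nat N else 0)"
  if "k \<in> ?G" "l \<in> ?G" for k l
 proof -
  have "ek (- m) (grid_pt N k) * ek m (grid_pt N l) = ek (l - k) (grid_pt N m)" for m
   by (simp add: cis_mult grid_pt_def algebra_simps)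
  moreover have "int N dvd (l - k) \<longleftrightarrow> l = k"
  proof
   assume d: "int N dvd (l - k)"
   have "\<bar>l - k\<bar> < int N" using that unfolding grid_idx_def by auto
   then show "l = k" using d zdvd_imp_le[of "int N" "\<bar>l - k\<bar>"] by (cases "l = k") auto
  qed simp
  ultimately show ?thesis using grid_orthogonality[OF N, of "l - k"] by simp
 qed
 have "complex_of_real (sq ?G (dft N f)) = (\<Sum>m\<in>?G. dft N f m * cnj (dft N f m))"
  by (simp add: sq_def complex_norm_square del: of_real_power)
 also have "... = (\<Sum>m\<in>?G. \<Sum>k\<in>?G. \<Sum>l\<in>?G. (f k * cnj (f l)) * (ek (- m) (grid_pt N k) * ek m (grid_pt N l))) / (of_nat N)^2"
 proof -
  have pt: "dft N f m * cnj (dft N f m) = (\<Sum>k\<in>?G. \<Sum>l\<in>?G. (f k * cnj (f l)) * (ek (- m) (grid_pt N k) * ek m (grid_pt N l))) / (of_nat N)^2" for m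
  proof -
   have "dft N f m * cnj (dft N f m) = (\<Sum>k\<in>?G. f k * ek (- m) (grid_pt N k)) * (\<Sum>l\<in>?G. cnj (f l) * ek m (grid_pt N l)) / (of_nat N)^2"
    by (simp add: dft_alt cis_cnj power2_eq_square)
   also have "... = (\<Sum>k\<in>?G. \<Sum>l\<in>?G. (f k * ek (- m) (grid_pt N k)) * (cnj (f l) * ek m (grid_pt N l))) / (of_nat N)^2"
    by (simp only: sum_product)
   finally show ?thesis by (simp only: ac_simps)
  qed
  show ?thesis by (simp only: pt sum_divide_distrib[symmetric])
 qed
 also have "(\<Sum>m\<in>?G. \<Sum>k\<in>?G. \<Sum>l\<in>?G. (f k * cnj (f l)) * (ek (- m) (grid_pt N k) * ek m (grid_pt N l)))
   = (\<Sum>k\<in>?G. \<Sum>m\<in>?G. \<Sum>l\<in>?G. (f k * cnj (f l)) * (ek (- m) (grid_pt N k) * ek m (grid_pt N l)))"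
  by (rule sum.swap)
 also have "... = (\<Sum>k\<in>?G. \<Sum>l\<in>?G. \<Sum>m\<in>?G. (f k * cnj (f l)) * (ek (- m) (grid_pt N k) * ek m (grid_pt N l)))"
  by (rule sum.cong[OF refl], rule sum.swap)
 also have "... = (\<Sum>k\<in>?G. \<Sum>l\<in>?G. if l = k then f k * cnj (f l) * of_nat N else 0)"
 proof (intro sum.cong refl)
  fix k l assume "k \<in> ?G" "l \<in> ?G"
  then have "(\<Sum>m\<in>?G. (f k * cnj (f l)) * (ek (- m) (grid_pt N k) * ek m (grid_pt N l))) = (f k * cnj (f l)) * (if l = k then of_nat N else 0)"
   by (simp only: sum_distrib_left[symmetric] orth)
  then show "(\<Sum>m\<in>?G. (f k * cnj (f l)) * (ek (- m) (grid_pt N k) * ek m (grid_pt N l))) = (if l = k then f k * cnj (f l) * of_nat N else 0)"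
   by (simp only: mult_zero_right if_distrib[of "\<lambda>z. (f k * cnj (f l)) * z"])
 qed
 also have "... = (\<Sum>k\<in>?G. f k * cnj (f k) * of_nat N)"
  by (intro sum.cong refl) simp
 also have "... = complex_of_real (sq ?G f) * of_nat N"
  by (simp only: sq_def of_real_sum complex_norm_square sum_distrib_right)
 also have "... / (of_nat N)^2 = complex_of_real (sq ?G f / real N)"
  using N by (simp add: power2_eq_square)
 finally show ?thesis by (simp only: of_real_eq_iff)
qed

lemma dft_sup:
 assumes N: "even N" "N > 0" and e: "\<And>k. k \<in> grid_idx N ==> cmod (f k) \<le> e"
 shows "sq (grid_idx N) (dft N f) \<le> e^2"
proof -
 have "sq (grid_idx N) f \<le> (\<Sum>k\<in>grid_idx N. e^2)"
  unfolding sq_def using e by (intro sum_mono power_mono) auto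
 then show ?thesis using N card_grid[OF N(1)] by (simp add: dft_parseval[OF N] field_simps)
qed

lemma trig_parseval:
 assumes N: "even N" "N > 0"
 shows "sq (grid_idx N) (\<lambda>k. trig (grid_idx N) y (grid_pt N k)) = real N * sq (grid_idx N) y"
proof -
 have "sq (grid_idx N) (dft N (\<lambda>k. trig (grid_idx N) y (grid_pt N k))) = sq (grid_idx N) y"
  unfolding sq_def using dft_trig[OF N subset_refl] by (intro sum.cong refl) simp
 then show ?thesis using dft_parseval[OF N, of "\<lambda>k. trig (grid_idx N) y (grid_pt N k)"] N by (simp add: field_simps)
qed

section \<open>Stability of the linearised scheme in Sobolev norms\<close>

text \<open>The distance of \<open>l\<close> from the multiples of \<open>N\<close>, with representatives taken in the grid frequencies.\<close>
definition cyc :: "nat => int => int" where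
 "cyc N l = \<bar>(l + int N div 2 - 1) mod int N - int N div 2 + 1\<bar>"

lemma cyc_shift: "cyc N (l + q * int N) = cyc N l"
proof -
 have "l + q * int N + int N div 2 - 1 = (l + int N div 2 - 1) + q * int N" by simp
 then show ?thesis by (simp only: cyc_def mod_mult_self1)
qed

lemma cyc_periodic: "cyc N (l + int N) = cyc N l"
 using cyc_shift[of N l 1] by simp

lemma cyc_grid: "even N ==> l \<in> grid_idx N ==> cyc N l = \<bar>l\<bar>"
 unfolding cyc_def grid_idx_def by (auto elim!: evenE)

lemma cyc_uminus:
 assumes N: "even N" "N > 0"
 shows "cyc N (- l) = cyc N l"
proof -
 define h where "h = int N div 2"
 have h: "int N = 2 * h" using N by (auto elim!: evenE simp: h_def)
 define q where "q = (l + h - 1) div int N"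
 define r where "r = l - q * int N"
 have "r = (l + h - 1) mod int N - h + 1" by (simp add: r_def q_def minus_div_mult_eq_mod[symmetric])
 then have r: "- h < r" "r \<le> h" using N h pos_mod_bound[of "int N" "l + h - 1"] pos_mod_sign[of "int N" "l + h - 1"] by linarith+
 have gi: "x \<in> grid_idx N \<longleftrightarrow> - h < x \<and> x \<le> h" for x by (auto simp: grid_idx_def h_def)
 have "cyc N l = cyc N r" using cyc_shift[of N r q] by (simp add: r_def)
 also have "... = \<bar>r\<bar>" using cyc_grid[OF N(1)] gi r by auto
 finally have 1: "cyc N l = \<bar>r\<bar>" .
 have "cyc N (- l) = cyc N (- r)" using cyc_shift[of N "- r" "- q"] by (simp add: r_def)
 also have "... = \<bar>r\<bar>"
 proof (cases "r = h")
  case True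
  then have "cyc N (- r) = cyc N h" using cyc_periodic[of N "- h"] h by simp
  then show ?thesis using cyc_grid[OF N(1), of h] gi[of h] True r h N by auto
 next
  case False
  then show ?thesis using cyc_grid[OF N(1), of "- r"] gi[of "- r"] r by auto
 qed
 finally show ?thesis using 1 by simp
qed

text \<open>Pairs of high modes of opposite sign. Only for these can \<open>m - n\<close> be large while it is small modulo \<open>N\<close>, so that a smooth coefficient
 couples them.\<close>
definition aliased :: "nat => int => int => bool" where
 "aliased N m n \<longleftrightarrow> int N \<le> 4 * \<bar>m\<bar> \<and> int N \<le> 4 * \<bar>n\<bar> \<and> m * n < 0"

text \<open>Outside the aliased pairs the true frequency difference is comparable with the one modulo \<open>N\<close>, so a decaying coefficient
 compensates the factor \<open>m - n\<close> in the commutator.\<close>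
lemma no_alias_cyc:
 assumes N: "even N" "N > 0" and mn: "m \<in> grid_idx N" "n \<in> grid_idx N" and na: "\<not> aliased N m n"
 shows "\<bar>m - n\<bar> \<le> 3 * cyc N (m - n)"
proof -
 obtain h where h: "int N = 2 * h" using N by (auto elim!: evenE)
 have mh: "\<bar>m\<bar> \<le> h" "\<bar>n\<bar> \<le> h" using grid_bound[OF mn(1)] grid_bound[OF mn(2)] h by auto
 have h0: "h > 0" using h N by simp
 have ran: "- h < m" "- h < n" using mn h by (auto simp: grid_idx_def)
 have per: "cyc N (l - int N) = cyc N l" for l using cyc_periodic[of N "l - int N"] by simp
 have gi: "l \<in> grid_idx N \<longleftrightarrow> - h < l \<and> l \<le> h" for l using h by (auto simp: grid_idx_def)
 have small: "2 * \<bar>m - n\<bar> \<le> 3 * h" if "\<bar>m - n\<bar> > h"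
 proof -
  have "m * n < 0"
  proof (rule ccontr)
   assume "\<not> m * n < 0"
   then have "0 \<le> m \<and> 0 \<le> n \<or> m \<le> 0 \<and> n \<le> 0" by (simp add: not_less zero_le_mult_iff)
   then show False using that mh by linarith
  qed
  then have "\<not> (int N \<le> 4 * \<bar>m\<bar> \<and> int N \<le> 4 * \<bar>n\<bar>)" using na by (simp add: aliased_def)
  then have "2 * \<bar>m\<bar> < h \<or> 2 * \<bar>n\<bar> < h" using h by linarith
  moreover have "2 * z \<le> 3 * h" if "z \<le> p + q" "p \<le> h" "q \<le> h" "2 * p < h \<or> 2 * q < h" for z p q :: int
   using that by linarith
  ultimately show ?thesis using mh abs_triangle_ineq4 by blast
 qed
 consider "m - n \<in> grid_idx N" | "m - n = - h" | "m - n > h" | "m - n < - h" using gi[of "m - n"] by linarith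
 then show ?thesis
 proof cases
  case 1 then show ?thesis using cyc_grid[OF N(1)] by simp
 next
  case 2
  then have "cyc N (m - n) = cyc N h" using cyc_periodic[of N "- h"] h by simp
  also have "... = h" using cyc_grid[OF N(1), of h] gi[of h] h0 by simp
  finally show ?thesis using 2 h0 by simp
 next
  case 3
  have "m - n - int N \<in> grid_idx N" using 3 h mh ran unfolding gi by linarith
  then have "cyc N (m - n) = \<bar>m - n - int N\<bar>" using cyc_grid[OF N(1)] per by metis
  moreover have "2 * \<bar>m - n\<bar> \<le> 3 * h" using small 3 h0 by linarith
  moreover have "\<bar>m - n\<bar> = m - n" using 3 h0 by linarith
  moreover have "\<bar>m - n - int N\<bar> = int N - (m - n)" using 3 h mh ran by linarith
  moreover have "d \<le> 3 * z" if "z = w" "2 * d \<le> 3 * h" "w = int N - d" for d z w :: int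
   using that h by linarith
  ultimately show ?thesis by metis
 next
  case 4
  have "m - n + int N \<in> grid_idx N" using 4 h mh ran unfolding gi by linarith
  then have "cyc N (m - n) = \<bar>m - n + int N\<bar>" using cyc_grid[OF N(1)] cyc_periodic by metis
  moreover have "2 * \<bar>m - n\<bar> \<le> 3 * h" using small 4 h0 by linarith
  moreover have "\<bar>m - n\<bar> = n - m" using 4 h0 by linarith
  moreover have "\<bar>m - n + int N\<bar> = int N - (n - m)" using 4 h mh ran by linarith
  moreover have "d \<le> 3 * z" if "z = w" "2 * d \<le> 3 * h" "w = int N - d" for d z w :: int
   using that h by linarith
  ultimately show ?thesis by metis
 qed
qed

lemma schur_kernel:
 assumes N: "even N" and per: "\<And>l. f (l + int N) = f l" and ev: "\<And>l. f (- l) = f l"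
  and f: "(\<Sum>l\<in>grid_idx N. f l) \<le> M" and c: "c \<ge> 0"
  and A: "\<And>m n. m \<in> grid_idx N ==> n \<in> grid_idx N ==> cmod (A m n) \<le> c * f (m - n)"
 shows "schur (grid_idx N) (c * M) A"
 unfolding schur_def
proof (intro conjI ballI)
 fix m assume m: "m \<in> grid_idx N"
 have "(\<Sum>n\<in>grid_idx N. cmod (A m n)) \<le> (\<Sum>n\<in>grid_idx N. c * f (n - m))"
  using A[OF m] ev by (intro sum_mono) (metis minus_diff_eq)
 also have "... = c * (\<Sum>n\<in>grid_idx N. f n)"
  by (simp only: sum_distrib_left[symmetric] grid_sum_shift[where f = f, OF N per])
 finally show "(\<Sum>n\<in>grid_idx N. cmod (A m n)) \<le> c * M" using mult_left_mono[OF f c] by linarith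
next
 fix n assume n: "n \<in> grid_idx N"
 have "(\<Sum>m\<in>grid_idx N. cmod (A m n)) \<le> (\<Sum>m\<in>grid_idx N. c * f (m - n))"
  using A[OF _ n] by (intro sum_mono)
 also have "... = c * (\<Sum>n\<in>grid_idx N. f n)"
  by (simp only: sum_distrib_left[symmetric] grid_sum_shift[where f = f, OF N per])
 finally show "(\<Sum>m\<in>grid_idx N. cmod (A m n)) \<le> c * M" using mult_left_mono[OF f c] by linarith
qed

definition wt :: "real => int => real" where "wt \<kappa> m = sqrt (1 + \<kappa> * (of_int m)^2)"

lemma wt_sq: "0 \<le> \<kappa> ==> (wt \<kappa> m)^2 = 1 + \<kappa> * (of_int m)^2"
 by (simp add: wt_def)

lemma wt_ge_1: "0 \<le> \<kappa> ==> 1 \<le> wt \<kappa> m"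
 by (simp add: wt_def)

lemma wt_ratio_bound:
 assumes k: "\<kappa> = 0 \<or> \<kappa> = 1" and N: "even N" "N > 0" and mn: "m \<in> grid_idx N" "n \<in> grid_idx N"
 shows "wt \<kappa> m * \<bar>of_int n\<bar> / wt \<kappa> n \<le> real N"
proof -
 have b: "2 * \<bar>real_of_int m\<bar> \<le> real N" "2 * \<bar>real_of_int n\<bar> \<le> real N"
  using grid_bound[OF mn(1)] grid_bound[OF mn(2)] by linarith+
 have N2: "real N \<ge> 2" using N by (auto elim!: evenE)
 show ?thesis
  using k
 proof
  assume "\<kappa> = 0" then show ?thesis using b by (simp add: wt_def)
 next
  assume k1: "\<kappa> = 1"
  have pos: "wt \<kappa> n > 0" using wt_ge_1[of \<kappa> n] k1 by simp
  have "\<bar>real_of_int n\<bar> = sqrt ((of_int n)^2)" by simp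
  also have "... \<le> wt \<kappa> n" unfolding wt_def k1 by (intro real_sqrt_le_mono) simp
  finally have n: "\<bar>real_of_int n\<bar> / wt \<kappa> n \<le> 1" using pos by simp
  have "wt \<kappa> m \<le> real N"
  proof -
   have "4 * (real_of_int m)^2 \<le> (real N)^2" using power_mono[OF b(1), of 2] by (simp add: power_mult_distrib)
   moreover have "4 \<le> (real N)^2" using power_mono[OF N2, of 2] by simp
   ultimately have "1 + (real_of_int m)^2 \<le> (real N)^2" by linarith
   then show ?thesis unfolding wt_def k1 by (intro real_le_lsqrt) auto
  qed
  then have "wt \<kappa> m * (\<bar>real_of_int n\<bar> / wt \<kappa> n) \<le> real N * 1"
   using n pos wt_ge_1[of \<kappa> m] k1 by (intro mult_mono) auto
  then show ?thesis by simp
 qed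
qed

text \<open>The cubes of modes at opposite ends of the spectrum have opposite sign.\<close>
lemma cube_gap:
 assumes al: "aliased N m n"
 shows "(real N)^3 / 32 \<le> \<bar>(real_of_int m)^3 - (real_of_int n)^3\<bar>"
proof -
 have b: "real N / 4 \<le> \<bar>real_of_int m\<bar>" "real N / 4 \<le> \<bar>real_of_int n\<bar>" using al by (auto simp: aliased_def)
 have opp: "m > 0 \<and> n < 0 \<or> m < 0 \<and> n > 0" using al by (auto simp: aliased_def mult_less_0_iff)
 have "\<bar>(real_of_int m)^3 - (real_of_int n)^3\<bar> = \<bar>real_of_int m\<bar>^3 + \<bar>real_of_int n\<bar>^3"
  using opp
 proof
  assume o: "m > 0 \<and> n < 0"
  then have "(real_of_int m)^3 > 0" "(real_of_int n)^3 < 0" by (auto simp: power_less_zero_eq)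
  then have "\<bar>(real_of_int m)^3 - (real_of_int n)^3\<bar> = (real_of_int m)^3 - (real_of_int n)^3" by (intro abs_of_pos) linarith
  then show ?thesis using o by (simp add: power3_eq_cube)
 next
  assume o: "m < 0 \<and> n > 0"
  then have "(real_of_int n)^3 > 0" "(real_of_int m)^3 < 0" by (auto simp: power_less_zero_eq)
  then have "\<bar>(real_of_int m)^3 - (real_of_int n)^3\<bar> = - ((real_of_int m)^3 - (real_of_int n)^3)" by (intro abs_of_neg) linarith
  then show ?thesis using o by (simp add: power3_eq_cube)
 qed
 also have "... \<ge> (real N / 4)^3 + (real N / 4)^3" using b by (intro add_mono power_mono) auto
 finally show ?thesis by (simp add: power_divide)
qed

definition wsq :: "nat => real => (int => complex) => real" where
 "wsq N \<kappa> e = sq (grid_idx N) (\<lambda>m. of_real (wt \<kappa> m) * e m)"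

definition stab_const :: "real => real => real" where
 "stab_const a M = 2 + 12 * M + 256 * M^3 / a^3"

text \<open>The operator is conjugated with the weight \<open>wt \<kappa>\<close>. Its part on pairs that do not alias is skew up to a commutator controlled by
 \<open>\<Sum>\<bar>l\<bar> * cmod (\<beta> l)\<close>; the aliased part has norm of order \<open>N\<close>, but after division by the phase difference, of order \<open>dt * N^3\<close>, it is small enough to be
 summed by parts.\<close>
lemma grid_stability:
 fixes e R \<beta> :: "nat => int => complex"
 assumes k: "\<kappa> = 0 \<or> \<kappa> = 1" and N: "even N" "N > 0" and a: "a > 0" and dt: "dt > 0" and M: "M \<ge> 1" and \<tau>: "\<tau> \<ge> 0"
  and per: "\<And>j l. \<beta> j (l + int N) = \<beta> j l" and her: "\<And>j l. \<beta> j (- l) = cnj (\<beta> j l)"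
  and bM: "\<And>j. j \<le> J ==> (\<Sum>l\<in>grid_idx N. (1 + \<bar>of_int l\<bar>) * cmod (\<beta> j l)) \<le> M"
  and dM: "\<And>j. 1 \<le> j ==> j \<le> J ==> (\<Sum>l\<in>grid_idx N. cmod (\<beta> (j-1) l - \<beta> j l)) \<le> M * dt"
  and eq: "\<And>j m. 1 \<le> j ==> j \<le> J ==> m \<in> grid_idx N ==>
    e (j+1) m - e (j-1) m + \<i> * of_real (dt * (a * of_int m)^3) * (e (j+1) m + e (j-1) m)
     = 2 * of_real dt * ((\<Sum>n\<in>grid_idx N. \<beta> j (m - n) * (\<i> * of_int n * e j n)) + R j m)"
  and Rb: "\<And>j. 1 \<le> j ==> j \<le> J ==> wsq N \<kappa> (R j) \<le> M * wsq N \<kappa> (e j) + \<tau>"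
  and cfl: "64 * dt * real N * M \<le> 1" and Nbig: "512 * M \<le> a^3 * (real N)^2" and dts: "16 * stab_const a M * dt \<le> 1"
  and j: "j \<le> J"
 shows "wsq N \<kappa> (e (j+1)) + wsq N \<kappa> (e j) \<le> exp (32 * stab_const a M * (dt * real j))
   * (4 * (wsq N \<kappa> (e 1) + wsq N \<kappa> (e 0)) + 16 * (dt * real j) * \<tau>)"
proof -
 let ?G = "grid_idx N"
 have k0: "\<kappa> \<ge> 0" using k by auto
 have N1: "real N \<ge> 1" using N by simp
 define \<gamma> where "\<gamma> m = dt * (a * of_int m)^3" for m :: int
 define x where "x j m = of_real (wt \<kappa> m) * e j m" for j m
 define A where "A b m n = of_real (wt \<kappa> m / wt \<kappa> n) * (b (m - n) * (\<i> * of_int n))" for b :: "int => complex" and m n :: int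
 define B where "B j m n = (if aliased N m n then 0 else A (\<beta> j) m n)" for j m n
 define P where "P j m n = (if aliased N m n then A (\<beta> j) m n else 0)" for j m n
 define Q where "Q j m n = (if aliased N m n then A (\<beta> j) m n / of_real (a^3 * (of_int m^3 - of_int n^3)) else 0)" for j m n
 have wpos: "wt \<kappa> m > 0" for m using wt_ge_1[OF k0, of m] by linarith
 have Abound: "cmod (A b m n) \<le> real N * cmod (b (m - n))" if "m \<in> ?G" "n \<in> ?G" for b m n
 proof -
  have "cmod (A b m n) = (wt \<kappa> m * \<bar>of_int n\<bar> / wt \<kappa> n) * cmod (b (m - n))"
   using wpos[of m] wpos[of n] by (simp add: A_def norm_mult norm_divide)
  also have "... \<le> real N * cmod (b (m - n))"
   using wt_ratio_bound[OF k N that] by (rule mult_right_mono) simp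
  finally show ?thesis .
 qed
 have Adiff: "A b m n - A b' m n = A (\<lambda>l. b l - b' l) m n" for b b' m n
  by (simp add: A_def algebra_simps)
 have ev: "cmod (\<beta> j (- l)) = cmod (\<beta> j l)" for j l by (simp add: her)
 have evd: "cmod (\<beta> i (- l) - \<beta> j (- l)) = cmod (\<beta> i l - \<beta> j l)" for i j l
  unfolding her by (metis complex_cnj_diff complex_mod_cnj)
 have sumb: "(\<Sum>l\<in>?G. cmod (\<beta> j l)) \<le> M" if "j \<le> J" for j
  by (rule order_trans[OF sum_mono bM[OF that]]) (simp add: distrib_right)
 define ck where "ck = 32 / (a^3 * (real N)^2)"
 have ck: "ck \<ge> 0" using a by (simp add: ck_def)
 have Qbound: "cmod (A b m n / of_real (a^3 * (of_int m^3 - of_int n^3))) \<le> ck * cmod (b (m - n))"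
  if "m \<in> ?G" "n \<in> ?G" "aliased N m n" for b m n
 proof -
  have gap: "a^3 * ((real N)^3 / 32) \<le> a^3 * \<bar>(real_of_int m)^3 - (real_of_int n)^3\<bar>"
   using cube_gap[OF that(3)] a by (intro mult_left_mono) auto
  have "0 < a^3 * ((real N)^3 / 32)" using a N by simp
  then have "cmod (A b m n) / (a^3 * \<bar>(real_of_int m)^3 - (real_of_int n)^3\<bar>) \<le> (real N * cmod (b (m - n))) / (a^3 * ((real N)^3 / 32))"
   using gap Abound[OF that(1,2), of b] by (intro frac_le) auto
  also have "... = ck * cmod (b (m - n))" using a N1 by (simp add: ck_def field_simps power2_eq_square power3_eq_cube)
  finally have fin: "cmod (A b m n) / (a^3 * \<bar>(real_of_int m)^3 - (real_of_int n)^3\<bar>) \<le> ck * cmod (b (m - n))" .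
  have "cmod (complex_of_real (a^3 * (real_of_int m^3 - real_of_int n^3))) = a^3 * \<bar>(real_of_int m)^3 - (real_of_int n)^3\<bar>"
   unfolding norm_of_real abs_mult using a by simp
  then show ?thesis using fin by (simp only: norm_divide)
 qed
 have gb: "\<bar>\<gamma> n\<bar> \<le> dt * a^3 * (real N)^3 / 8" if "n \<in> ?G" for n
 proof -
  have "\<bar>real_of_int n\<bar> \<le> real N / 2" using grid_bound[OF that] by linarith
  then have "\<bar>real_of_int n\<bar>^3 \<le> (real N / 2)^3" by (intro power_mono) auto
  then have "dt * a^3 * \<bar>real_of_int n\<bar>^3 \<le> dt * a^3 * (real N / 2)^3" using dt a by (intro mult_left_mono) auto
  then show ?thesis using dt a by (simp add: \<gamma>_def abs_mult power_abs power_mult_distrib power_divide mult.assoc)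
 qed
 have ckg: "ck * (dt * a^3 * (real N)^3 / 8) = 4 * dt * real N" using a N1 by (simp add: ck_def field_simps power2_eq_square power3_eq_cube)
 have Qg: "cmod (z * of_real (\<gamma> n)) \<le> (4 * dt * real N) * y" if "n \<in> ?G" "cmod z \<le> ck * y" "0 \<le> y" for z n y
 proof -
  have "cmod (z * of_real (\<gamma> n)) \<le> (ck * y) * (dt * a^3 * (real N)^3 / 8)"
   unfolding norm_mult norm_of_real using gb[OF that(1)] that ck by (intro mult_mono) auto
  also have "... = (4 * dt * real N) * y" by (simp add: ckg[symmetric])
  finally show ?thesis .
 qed
 have sch: "schur ?G (c * M') F" if "c \<ge> 0" "(\<Sum>l\<in>?G. cmod (b l)) \<le> M'" "\<And>l. cmod (b (l + int N)) = cmod (b l)" "\<And>l. cmod (b (- l)) = cmod (b l)"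
   "\<And>m n. m \<in> ?G ==> n \<in> ?G ==> cmod (F m n) \<le> c * cmod (b (m - n))" for c M' F and b :: "int => complex"
  by (rule schur_kernel[where f = "\<lambda>l. cmod (b l)"]) (use that N in auto)
 have B_b: "schur ?G (real N * M) (B j)" if "j \<le> J" for j
  by (rule sch[where b = "\<beta> j"]) (use sumb[OF that] per ev Abound in \<open>auto simp: B_def\<close>)
 have P_b: "schur ?G (real N * M) (P j)" if "j \<le> J" for j
  by (rule sch[where b = "\<beta> j"]) (use sumb[OF that] per ev Abound in \<open>auto simp: P_def\<close>)
 have schur_mono: "schur ?G c F ==> c \<le> c' ==> schur ?G c' F" for c c' F
  unfolding schur_def by (meson order_trans)
 have skew: "schur ?G (3 * M) (\<lambda>m n. B j m n + cnj (B j n m))" if "j \<le> J" for j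
 proof (rule schur_kernel[where f = "\<lambda>l. of_int (cyc N l) * cmod (\<beta> j l)"])
  show "of_int (cyc N (- l)) * cmod (\<beta> j (- l)) = real_of_int (cyc N l) * cmod (\<beta> j l)" for l by (simp add: cyc_uminus[OF N] ev)
  show "of_int (cyc N (l + int N)) * cmod (\<beta> j (l + int N)) = real_of_int (cyc N l) * cmod (\<beta> j l)" for l by (simp add: cyc_periodic per)
  show "(\<Sum>l\<in>?G. of_int (cyc N l) * cmod (\<beta> j l)) \<le> M"
   by (rule order_trans[OF sum_mono bM[OF that]]) (simp add: cyc_grid[OF N(1)] mult_right_mono)
  fix m n assume mn: "m \<in> ?G" "n \<in> ?G"
  have al: "aliased N n m = aliased N m n" by (auto simp: aliased_def mult.commute)
  show "cmod (B j m n + cnj (B j n m)) \<le> 3 * (of_int (cyc N (m - n)) * cmod (\<beta> j (m - n)))"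
  proof (cases "aliased N m n")
   case False
   have "cnj (\<beta> j (n - m)) = \<beta> j (m - n)" using her[of j "m - n"] by simp
   then have "B j m n + cnj (B j n m) = \<i> * \<beta> j (m - n) * of_real (wt \<kappa> m / wt \<kappa> n * of_int n - wt \<kappa> n / wt \<kappa> m * of_int m)"
    using False al by (simp add: B_def A_def algebra_simps)
   also have "wt \<kappa> m / wt \<kappa> n * of_int n - wt \<kappa> n / wt \<kappa> m * of_int m = ((wt \<kappa> m)^2 * of_int n - (wt \<kappa> n)^2 * of_int m) / (wt \<kappa> m * wt \<kappa> n)"
    using wpos[of m] wpos[of n] by (simp add: field_simps power2_eq_square)
   also have "(wt \<kappa> m)^2 * of_int n - (wt \<kappa> n)^2 * of_int m = (of_int n - of_int m) * (1 - \<kappa> * of_int m * of_int n)"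
    unfolding wt_sq[OF k0] by (simp add: algebra_simps power2_eq_square)
   finally have eqB: "B j m n + cnj (B j n m) = \<i> * \<beta> j (m - n) * of_real (((of_int n - of_int m) * (1 - \<kappa> * of_int m * of_int n)) / (wt \<kappa> m * wt \<kappa> n))" .
   have "cmod (B j m n + cnj (B j n m)) = cmod (\<beta> j (m - n)) * \<bar>((of_int n - of_int m) * (1 - \<kappa> * of_int m * of_int n)) / (wt \<kappa> m * wt \<kappa> n)\<bar>"
    unfolding eqB by (simp only: norm_mult norm_ii norm_of_real mult_1)
   also have "... = cmod (\<beta> j (m - n)) * (\<bar>of_int n - of_int m\<bar> * (\<bar>1 - \<kappa> * of_int m * of_int n\<bar> / (wt \<kappa> m * wt \<kappa> n)))"
    using wpos[of m] wpos[of n] by (simp add: abs_mult)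
   also have "... \<le> cmod (\<beta> j (m - n)) * (\<bar>of_int n - of_int m\<bar> * 1)"
   proof (intro mult_left_mono)
    have "\<bar>1 - \<kappa> * of_int m * of_int n\<bar>^2 \<le> (wt \<kappa> m * wt \<kappa> n)^2"
    proof -
     have "(wt \<kappa> m * wt \<kappa> n)^2 - \<bar>1 - \<kappa> * of_int m * of_int n\<bar>^2 = \<kappa> * (of_int m + of_int n)^2"
      unfolding power_mult_distrib wt_sq[OF k0] power2_abs
      using k by (auto simp: power2_eq_square algebra_simps)
     then show ?thesis using k0 by (smt (verit) mult_nonneg_nonneg zero_le_power2)
    qed
    then have "\<bar>1 - \<kappa> * of_int m * of_int n\<bar> \<le> wt \<kappa> m * wt \<kappa> n"
     by (rule power2_le_imp_le) (use wpos[of m] wpos[of n] in auto)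
    then show "\<bar>1 - \<kappa> * of_int m * of_int n\<bar> / (wt \<kappa> m * wt \<kappa> n) \<le> 1"
     using wpos[of m] wpos[of n] by simp
   qed auto
   also have "... \<le> cmod (\<beta> j (m - n)) * (3 * of_int (cyc N (m - n)))"
   proof (intro mult_left_mono)
    have "real_of_int \<bar>m - n\<bar> \<le> real_of_int (3 * cyc N (m - n))"
     using no_alias_cyc[OF N mn False] by (simp only: of_int_le_iff)
    then show "\<bar>real_of_int n - of_int m\<bar> * 1 \<le> 3 * of_int (cyc N (m - n))" by (simp add: abs_minus_commute)
   qed simp
   finally show ?thesis by (simp add: mult_ac)
  qed (simp add: B_def al cyc_def)
 qed (use N in auto)
 have small1: "dt * real N * M \<le> 1/64" using cfl by simp
 have dtN: "dt * real N \<le> 1/64"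
 proof -
  have "dt * real N * 1 \<le> dt * real N * M" using M dt by (intro mult_left_mono) auto
  then show ?thesis using small1 by linarith
 qed
 have ckM: "ck * M \<le> 1/16"
 proof -
  have "0 < a^3 * (real N)^2" using a N1 by simp
  then show ?thesis using Nbig by (simp add: ck_def pos_divide_le_eq)
 qed
 have ck16: "ck \<le> 1/16" using ckM M ck mult_left_mono[of 1 M ck] by simp
 have Bd: "schur ?G (3 * M) (\<lambda>m n. B (j-1) m n - B j m n)" if "1 \<le> j" "j \<le> J" for j
 proof (rule schur_mono)
  show "schur ?G (real N * (M * dt)) (\<lambda>m n. B (j-1) m n - B j m n)"
   by (rule sch[where b = "\<lambda>l. \<beta> (j-1) l - \<beta> j l"])
     (use dM[OF that] per evd Abound[of _ _ "\<lambda>l. \<beta> (j-1) l - \<beta> j l"] in \<open>auto simp: B_def Adiff\<close>)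
  have "real N * (M * dt) = dt * real N * M" by simp
  then show "real N * (M * dt) \<le> 3 * M" using small1 M by linarith
 qed
 have Qd0: "cmod (Q (j-1) m n - Q j m n) \<le> ck * cmod (\<beta> (j-1) (m - n) - \<beta> j (m - n))" if "m \<in> ?G" "n \<in> ?G" for j m n
  using Qbound[OF that, of "\<lambda>l. \<beta> (j-1) l - \<beta> j l"] ck by (auto simp: Q_def diff_divide_distrib[symmetric] Adiff)
 have Q0: "cmod (Q j m n) \<le> ck * cmod (\<beta> j (m - n))" if "m \<in> ?G" "n \<in> ?G" for j m n
  using Qbound[OF that, of "\<beta> j"] ck by (auto simp: Q_def)
 have main: "sq ?G (x (j+1)) + sq ?G (x j) \<le> exp (32 * (1 + 4 * (3 * M) + 8 * (32 * M^3 / a^3) + ck * M) * (dt * real j))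
   * (4 * (sq ?G (x 1) + sq ?G (x 0)) + 16 * (dt * real j) * \<tau>)"
 proof (rule leapfrog_stability[where B = B and P = P and K = Q and \<gamma> = \<gamma> and R = "\<lambda>j m. of_real (wt \<kappa> m) * R j m" and b = "real N * M"
    and k' = "4 * dt * real N * M" and J = J])
  show "x (j+1) m - x (j-1) m + \<i> * of_real (\<gamma> m) * (x (j+1) m + x (j-1) m)
     = 2 * of_real dt * (matv ?G (B j) (x j) m + matv ?G (P j) (x j) m + of_real (wt \<kappa> m) * R j m)"
   if "1 \<le> j" "j \<le> J" "m \<in> ?G" for j m
  proof -
   have BP: "B j m n * x j n + P j m n * x j n = of_real (wt \<kappa> m) * (\<beta> j (m - n) * (\<i> * of_int n * e j n))" for n
    using wpos[of n] by (simp add: B_def P_def A_def x_def)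
   have "matv ?G (B j) (x j) m + matv ?G (P j) (x j) m = of_real (wt \<kappa> m) * (\<Sum>n\<in>?G. \<beta> j (m - n) * (\<i> * of_int n * e j n))"
    unfolding matv_def sum.distrib[symmetric] sum_distrib_left by (intro sum.cong refl BP)
   moreover have "x (j+1) m - x (j-1) m + \<i> * of_real (\<gamma> m) * (x (j+1) m + x (j-1) m)
     = of_real (wt \<kappa> m) * (e (j+1) m - e (j-1) m + \<i> * of_real (\<gamma> m) * (e (j+1) m + e (j-1) m))"
    by (simp add: x_def algebra_simps)
   moreover have "p * (2 * d * (S + R')) = 2 * d * (p * S + p * R')" for p d S R' :: complex by (simp add: algebra_simps)
   ultimately show ?thesis using eq[OF that] by (simp only: \<gamma>_def)
  qed
  show "of_real dt * P j m n = of_real (\<gamma> m - \<gamma> n) * Q j m n" if "m \<in> ?G" "n \<in> ?G" for j m n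
  proof (cases "aliased N m n")
   case True
   have ne: "a^3 * (real_of_int m^3 - real_of_int n^3) \<noteq> 0" using cube_gap[OF True] a N1 by auto
   have "\<gamma> m - \<gamma> n = dt * (a^3 * (real_of_int m^3 - real_of_int n^3))" by (simp add: \<gamma>_def power_mult_distrib algebra_simps)
   moreover have "of_real dt * z = of_real (dt * q) * (z / of_real q)" if "q \<noteq> 0" for q :: real and z :: complex
    using that by simp
   ultimately show ?thesis using True ne by (simp only: P_def Q_def if_True)
  qed (simp add: P_def Q_def)
  show "schur ?G (ck * M) (Q j)" if "j \<le> J" for j
   by (rule sch[where b = "\<beta> j"]) (use sumb[OF that] per ev Q0 ck in auto)
  show "schur ?G (4 * dt * real N * M) (\<lambda>m n. Q j m n * of_real (\<gamma> n))" if "j \<le> J" for j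
   by (rule sch[where b = "\<beta> j"]) (use sumb[OF that] per ev dt Qg[OF _ Q0] in auto)
  show "schur ?G (3 * M * dt) (\<lambda>m n. Q (j-1) m n - Q j m n)" if "1 \<le> j" "j \<le> J" for j
  proof (rule schur_mono)
   show "schur ?G (ck * (M * dt)) (\<lambda>m n. Q (j-1) m n - Q j m n)"
    by (rule sch[where b = "\<lambda>l. \<beta> (j-1) l - \<beta> j l"]) (use dM[OF that] per evd Qd0 ck in auto)
   show "ck * (M * dt) \<le> 3 * M * dt" using ck16 M dt by (simp add: mult_right_mono)
  qed
  show "schur ?G (3 * M * dt) (\<lambda>m n. (Q (j-1) m n - Q j m n) * of_real (\<gamma> n))" if "1 \<le> j" "j \<le> J" for j
  proof (rule schur_mono)
   show "schur ?G ((4 * dt * real N) * (M * dt)) (\<lambda>m n. (Q (j-1) m n - Q j m n) * of_real (\<gamma> n))"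
    by (rule sch[where b = "\<lambda>l. \<beta> (j-1) l - \<beta> j l"]) (use dM[OF that] per evd dt Qg[OF _ Qd0] in auto)
   show "(4 * dt * real N) * (M * dt) \<le> 3 * M * dt" using dtN M dt by (simp add: mult.assoc[symmetric] mult_right_mono)
  qed
  show "sq ?G (\<lambda>m. of_real (wt \<kappa> m) * R j m) \<le> 3 * M * sq ?G (x j) + \<tau>" if "1 \<le> j" "j \<le> J" for j
  proof -
   have xj: "wsq N \<kappa> (e j) = sq ?G (x j)" unfolding wsq_def by (rule arg_cong[where f = "sq ?G"]) (simp add: x_def fun_eq_iff)
   have "M * sq ?G (x j) \<le> 3 * M * sq ?G (x j)" using M sq_nonneg[of ?G "x j"] by (intro mult_right_mono) auto
   then show ?thesis using Rb[OF that] unfolding xj by (simp add: wsq_def)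
  qed
  show "dt * (real N * M) \<le> 1/4" using small1 by (simp add: mult.assoc)
  show "ck * M + 4 * dt * real N * M \<le> 1/8" using small1 ckM by simp
  show "ck * M * (real N * M)^2 \<le> 32 * M^3 / a^3"
   using a N1 by (simp add: ck_def field_simps power2_eq_square power3_eq_cube)
  show "dt * (8 * (1 + 4 * (3 * M) + 8 * (32 * M^3 / a^3) + ck * M)) \<le> 1/2"
  proof -
   have "dt * (8 * (1 + 4 * (3 * M) + 8 * (32 * M^3 / a^3) + ck * M)) \<le> dt * (8 * stab_const a M)"
    unfolding stab_const_def using ckM dt by (intro mult_left_mono) auto
   moreover have "dt * (8 * stab_const a M) = (16 * stab_const a M * dt) / 2" by simp
   ultimately show ?thesis using dts by linarith
  qed
 qed (use M N1 a dt \<tau> ck B_b P_b skew Bd j in auto)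
 also have "... \<le> exp (32 * stab_const a M * (dt * real j)) * (4 * (sq ?G (x 1) + sq ?G (x 0)) + 16 * (dt * real j) * \<tau>)"
 proof (rule mult_right_mono)
  have "1 + 4 * (3 * M) + 8 * (32 * M^3 / a^3) + ck * M \<le> stab_const a M" unfolding stab_const_def using ckM by simp
  then show "exp (32 * (1 + 4 * (3 * M) + 8 * (32 * M^3 / a^3) + ck * M) * (dt * real j)) \<le> exp (32 * stab_const a M * (dt * real j))"
   using dt by (intro exp_le_cancel_iff[THEN iffD2] mult_right_mono mult_left_mono) auto
 qed (use sq_nonneg[of ?G "x 1"] sq_nonneg[of ?G "x 0"] dt \<tau> in auto)
 finally have fin: "sq ?G (x (j+1)) + sq ?G (x j) \<le> exp (32 * stab_const a M * (dt * real j)) * (4 * (sq ?G (x 1) + sq ?G (x 0)) + 16 * (dt * real j) * \<tau>)" .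
 have "sq ?G (x i) = wsq N \<kappa> (e i)" for i
  unfolding wsq_def by (rule arg_cong[where f = "sq ?G"]) (simp add: x_def fun_eq_iff)
 then show ?thesis using fin by simp
qed

section \<open>Taylor expansion of coefficient sequences in \<open>\<ell>\<^sup>2\<close>\<close>

lemma sob_iff_L2_set:
 assumes "0 \<le> K"
 shows "sob k K c \<longleftrightarrow> (\<forall>A. finite A \<longrightarrow> L2_set (\<lambda>m. \<bar>of_int m\<bar>^k * cmod (c m)) A \<le> K)"
proof -
 have "(\<bar>of_int m\<bar>^k * cmod (c m))^2 = (of_int m)^(2*k) * (cmod (c m))^2" for m
  by (simp add: power_mult_distrib power_mult[symmetric] mult.commute power_even_abs)
 then have "L2_set (\<lambda>m. \<bar>of_int m\<bar>^k * cmod (c m)) A = sqrt (\<Sum>m\<in>A. (of_int m)^(2*k) * (cmod (c m))^2)" for A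
  by (simp add: L2_set_def)
 then show ?thesis using assms by (auto simp: sob_def intro: real_le_lsqrt sum_nonneg sqrt_le_D)
qed

lemma sob_add:
 assumes "sob k K f" "sob k K' g" "0 \<le> K" "0 \<le> K'"
 shows "sob k (K + K') (\<lambda>m. f m + g m)"
proof -
 have "L2_set (\<lambda>m. \<bar>of_int m\<bar>^k * cmod (f m + g m)) A \<le> K + K'" if A: "finite A" for A
 proof -
  have "L2_set (\<lambda>m. \<bar>of_int m\<bar>^k * cmod (f m + g m)) A
    \<le> L2_set (\<lambda>m. \<bar>of_int m\<bar>^k * cmod (f m) + \<bar>of_int m\<bar>^k * cmod (g m)) A"
   by (intro L2_set_mono) (auto simp: distrib_left[symmetric] intro!: mult_left_mono norm_triangle_ineq)
  also have "... \<le> L2_set (\<lambda>m. \<bar>of_int m\<bar>^k * cmod (f m)) A + L2_set (\<lambda>m. \<bar>of_int m\<bar>^k * cmod (g m)) A"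
   by (rule L2_set_triangle_ineq)
  also have "... \<le> K + K'"
   using assms A by (intro add_mono) (auto simp: sob_iff_L2_set)
  finally show ?thesis .
 qed
 then show ?thesis using assms by (simp add: sob_iff_L2_set)
qed

lemma sob_cmult:
 assumes "sob k K f"
 shows "sob k (cmod z * K) (\<lambda>m. z * f m)"
 unfolding sob_def
proof (intro allI impI)
 fix A :: "int set" assume "finite A"
 then have "(cmod z)^2 * (\<Sum>m\<in>A. (of_int m)^(2*k) * (cmod (f m))^2) \<le> (cmod z)^2 * K^2"
  using assms by (intro mult_left_mono) (auto simp: sob_def)
 then show "(\<Sum>m\<in>A. (of_int m)^(2*k) * (cmod (z * f m))^2) \<le> (cmod z * K)^2"
  by (simp add: norm_mult power_mult_distrib sum_distrib_left mult_ac)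
qed

lemma sob_im_iff: "sob k K (\<lambda>m. (\<i> * of_int m)^j * f m) \<longleftrightarrow> sob (k + j) K f"
proof -
 have eq: "(of_int m :: real)^(2*k) * (cmod ((\<i> * of_int m)^j * f m))^2 = (of_int m)^(2*(k+j)) * (cmod (f m))^2" for m
 proof -
  have "(\<bar>of_int m\<bar>^j)^2 = (of_int m :: real)^(2*j)"
   by (metis power_even_abs power_mult mult.commute even_mult_iff even_numeral)
  then show ?thesis by (simp add: norm_mult norm_power power_mult_distrib add_mult_distrib2 power_add mult_ac)
 qed
 show ?thesis unfolding sob_def eq ..
qed

lemma sob_lower: "sob n K f ==> 1 \<le> k ==> k \<le> n ==> sob k K f"
proof -
 assume f: "sob n K f" and k: "1 \<le> k" "k \<le> n"
 have le: "(of_int m :: real)^(2*k) \<le> (of_int m)^(2*n)" for m :: int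
 proof (cases "m = 0")
  case False
  then have "1 \<le> \<bar>real_of_int m\<bar>" by linarith
  then have "1 \<le> \<bar>real_of_int m\<bar>^2" by (rule one_le_power)
  then have "1 \<le> (of_int m :: real)^2" by (simp only: power2_abs)
  from power_increasing[OF k(2) this] show ?thesis by (simp only: power_mult)
 next
  case True
  have "(0::real)^(2*k) = 0" "(0::real)^(2*n) = 0" using k by (auto simp: zero_power)
  then show ?thesis by (simp only: True of_int_0)
 qed
 show ?thesis unfolding sob_def
 proof (intro allI impI)
  fix A :: "int set" assume A: "finite A"
  have "(\<Sum>m\<in>A. (of_int m)^(2*k) * (cmod (f m))^2) \<le> (\<Sum>m\<in>A. (of_int m)^(2*n) * (cmod (f m))^2)"
   by (intro sum_mono mult_right_mono le) auto
  also have "... \<le> K^2" using f A by (simp add: sob_def)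
  finally show "(\<Sum>m\<in>A. (of_int m)^(2*k) * (cmod (f m))^2) \<le> K^2" .
 qed
qed

lemma sob_im: "sob n K f ==> 1 \<le> k + j ==> k + j \<le> n ==> sob k K (\<lambda>m. (\<i> * of_int m)^j * f m)"
 using sob_lower[of n K f "k + j"] by (simp only: sob_im_iff)

lemma sob_im_Cb: "Cb n M f ==> k + j \<le> n ==> sob k M (\<lambda>m. (\<i> * of_int m)^j * fc (cr f) m)"
 using Cb_sob[OF Cb_le[of n M f "k + j"]] by (simp only: sob_im_iff)

lemma sob_0_sq: "sob 0 K f ==> finite G ==> sq G f \<le> K^2"
 by (simp add: sob_def sq_def)

text \<open>The mean value inequality in \<open>\<ell>\<^sup>2\<close> follows from the scalar one by pairing with the increment itself.\<close>
lemma l2_mean_value: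
 assumes X: "convex X" "s \<in> X" "t \<in> X" and G: "finite G" and b: "0 \<le> b"
  and der: "\<And>m \<tau>. m \<in> G ==> \<tau> \<in> X ==> ((\<lambda>t. x t m) has_vector_derivative x' \<tau> m) (at \<tau> within X)"
  and bd: "\<And>\<tau>. \<tau> \<in> X ==> sq G (x' \<tau>) \<le> b^2"
 shows "sq G (\<lambda>m. x t m - x s m) \<le> (b * \<bar>t - s\<bar>)^2"
proof -
 define d where "d m = x t m - x s m" for m
 define q where "q = sqrt (sq G d)"
 have q: "0 \<le> q" "q^2 = sq G d" by (auto simp: q_def sq_nonneg)
 define \<phi> where "\<phi> \<tau> = (\<Sum>m\<in>G. inner (d m) (x \<tau> m))" for \<tau>
 define \<phi>' where "\<phi>' \<tau> = (\<Sum>m\<in>G. inner (d m) (x' \<tau> m))" for \<tau>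
 have phi: "(\<phi> has_real_derivative \<phi>' \<tau>) (at \<tau> within X)" if "\<tau> \<in> X" for \<tau>
 proof -
  have "(\<phi> has_vector_derivative \<phi>' \<tau>) (at \<tau> within X)"
   unfolding \<phi>_def \<phi>'_def
   by (intro has_vector_derivative_sum bounded_linear.has_vector_derivative[OF bounded_linear_inner_right] der that)
  then show ?thesis by (simp add: has_real_derivative_iff_has_vector_derivative)
 qed
 have "norm (\<phi>' \<tau>) \<le> q * b" if "\<tau> \<in> X" for \<tau>
 proof -
  have "\<bar>\<phi>' \<tau>\<bar> \<le> (\<Sum>m\<in>G. \<bar>cmod (d m)\<bar> * \<bar>cmod (x' \<tau> m)\<bar>)"
   unfolding \<phi>'_def by (rule order_trans[OF sum_abs]) (auto intro!: sum_mono simp: Cauchy_Schwarz_ineq2)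
  also have "... \<le> L2_set (\<lambda>m. cmod (d m)) G * L2_set (\<lambda>m. cmod (x' \<tau> m)) G"
   by (rule L2_set_mult_ineq)
  also have "... \<le> q * b"
  proof (intro mult_mono)
   show "L2_set (\<lambda>m. cmod (d m)) G \<le> q" by (simp add: L2_set_def q_def sq_def)
   show "L2_set (\<lambda>m. cmod (x' \<tau> m)) G \<le> b"
    using bd[OF that] b unfolding L2_set_def sq_def by (rule_tac real_le_lsqrt) (auto simp: sum_nonneg)
  qed (use q in auto)
  finally show ?thesis by simp
 qed
 then have "norm (\<phi> t - \<phi> s) \<le> q * b * norm (t - s)"
  using X by (intro field_differentiable_bound[of X \<phi> \<phi>'] phi)
 moreover have "\<phi> t - \<phi> s = q^2"
  unfolding q(2) by (simp add: \<phi>_def sum_subtractf[symmetric] inner_diff_right[symmetric] d_def[symmetric] sq_def power2_norm_eq_inner)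
 ultimately have "q * q \<le> q * (b * \<bar>t - s\<bar>)" by (simp add: power2_eq_square mult.assoc)
 then have "q \<le> b * \<bar>t - s\<bar>"
 proof (cases "q = 0")
  case False then show ?thesis using \<open>q * q \<le> q * (b * \<bar>t - s\<bar>)\<close> q by simp
 qed (use b in simp)
 then have "q^2 \<le> (b * \<bar>t - s\<bar>)^2" using q by (intro power_mono)
 moreover have "d = (\<lambda>m. x t m - x s m)" by (simp add: d_def fun_eq_iff)
 ultimately show ?thesis by (simp add: q(2))
qed

lemma vector_derivative_subset:
 "(f has_vector_derivative d) (at t within X) ==> Y \<subseteq> X ==> (f has_vector_derivative d) (at t within Y)"
 by (rule has_vector_derivative_within_subset)

lemma l2_taylor1:
 assumes X: "convex X" "s \<in> X" "t \<in> X" and G: "finite G" and b: "0 \<le> b"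
  and der: "\<And>m \<tau>. m \<in> G ==> \<tau> \<in> X ==> ((\<lambda>t. x t m) has_vector_derivative x1 \<tau> m) (at \<tau> within X)"
  and der1: "\<And>m \<tau>. m \<in> G ==> \<tau> \<in> X ==> ((\<lambda>t. x1 t m) has_vector_derivative x2 \<tau> m) (at \<tau> within X)"
  and bd: "\<And>\<tau>. \<tau> \<in> X ==> sq G (x2 \<tau>) \<le> b^2"
 shows "sq G (\<lambda>m. x t m - x s m - of_real (t - s) * x1 s m) \<le> (b * (t - s)^2)^2"
proof -
 define Y where "Y = X \<inter> cball s \<bar>t - s\<bar>"
 have Y: "convex Y" "s \<in> Y" "t \<in> Y" "Y \<subseteq> X" using X by (auto simp: Y_def convex_Int dist_real_def)
 define y where "y \<tau> m = x \<tau> m - of_real (\<tau> - s) * x1 s m" for \<tau> m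
 have "sq G (\<lambda>m. y t m - y s m) \<le> (b * \<bar>t - s\<bar> * \<bar>t - s\<bar>)^2"
 proof (rule l2_mean_value[OF Y(1-3) G, where x' = "\<lambda>\<tau> m. x1 \<tau> m - x1 s m"])
  fix m \<tau> assume m: "m \<in> G" "\<tau> \<in> Y"
  have "((\<lambda>\<tau>. of_real (\<tau> - s) * x1 s m) has_vector_derivative 1 * x1 s m) (at \<tau> within Y)"
   by (intro has_vector_derivative_mult_left) (auto intro!: derivative_eq_intros simp: has_vector_derivative_def scaleR_conv_of_real fun_eq_iff)
  then show "((\<lambda>t. y t m) has_vector_derivative x1 \<tau> m - x1 s m) (at \<tau> within Y)"
   unfolding y_def using vector_derivative_subset[OF der Y(4)] m Y(4) by (intro has_vector_derivative_diff) auto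
 next
  fix \<tau> assume t: "\<tau> \<in> Y"
  have "sq G (\<lambda>m. x1 \<tau> m - x1 s m) \<le> (b * \<bar>\<tau> - s\<bar>)^2"
   using t Y by (intro l2_mean_value[OF X(1,2) _ G b der1 bd]) auto
  also have "... \<le> (b * \<bar>t - s\<bar>)^2"
   using t b by (intro power_mono mult_left_mono) (auto simp: Y_def dist_real_def abs_minus_commute)
  finally show "sq G (\<lambda>m. x1 \<tau> m - x1 s m) \<le> (b * \<bar>t - s\<bar>)^2" .
 qed (use b in auto)
 moreover have "b * \<bar>t - s\<bar> * \<bar>t - s\<bar> = b * (t - s)^2" by (simp add: power2_eq_square mult.assoc)
 moreover have "(\<lambda>m. y t m - y s m) = (\<lambda>m. x t m - x s m - of_real (t - s) * x1 s m)" by (simp add: y_def fun_eq_iff)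
 ultimately show ?thesis by simp
qed

lemma l2_taylor2:
 assumes X: "convex X" "s \<in> X" "t \<in> X" and G: "finite G" and b: "0 \<le> b"
  and der: "\<And>m \<tau>. m \<in> G ==> \<tau> \<in> X ==> ((\<lambda>t. x t m) has_vector_derivative x1 \<tau> m) (at \<tau> within X)"
  and der1: "\<And>m \<tau>. m \<in> G ==> \<tau> \<in> X ==> ((\<lambda>t. x1 t m) has_vector_derivative x2 \<tau> m) (at \<tau> within X)"
  and der2: "\<And>m \<tau>. m \<in> G ==> \<tau> \<in> X ==> ((\<lambda>t. x2 t m) has_vector_derivative x3 \<tau> m) (at \<tau> within X)"
  and bd: "\<And>\<tau>. \<tau> \<in> X ==> sq G (x3 \<tau>) \<le> b^2"
 shows "sq G (\<lambda>m. x t m - x s m - of_real (t - s) * x1 s m - of_real ((t - s)^2 / 2) * x2 s m) \<le> (b * \<bar>t - s\<bar>^3)^2"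
proof -
 define Y where "Y = X \<inter> cball s \<bar>t - s\<bar>"
 have Y: "convex Y" "s \<in> Y" "t \<in> Y" "Y \<subseteq> X" using X by (auto simp: Y_def convex_Int dist_real_def)
 define y where "y \<tau> m = x \<tau> m - of_real (\<tau> - s) * x1 s m - of_real ((\<tau> - s)^2 / 2) * x2 s m" for \<tau> m
 have "sq G (\<lambda>m. y t m - y s m) \<le> (b * (t - s)^2 * \<bar>t - s\<bar>)^2"
 proof (rule l2_mean_value[OF Y(1-3) G, where x' = "\<lambda>\<tau> m. x1 \<tau> m - x1 s m - of_real (\<tau> - s) * x2 s m"])
  fix m \<tau> assume m: "m \<in> G" "\<tau> \<in> Y"
  have "((\<lambda>\<tau>. of_real (\<tau> - s) * x1 s m) has_vector_derivative 1 * x1 s m) (at \<tau> within Y)"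
   by (intro has_vector_derivative_mult_left) (auto intro!: derivative_eq_intros simp: has_vector_derivative_def scaleR_conv_of_real fun_eq_iff)
  moreover have "((\<lambda>\<tau>. of_real ((\<tau> - s)^2 / 2) * x2 s m) has_vector_derivative of_real (\<tau> - s) * x2 s m) (at \<tau> within Y)"
   by (intro has_vector_derivative_mult_left has_vector_derivative_of_real)
     (auto intro!: derivative_eq_intros simp: has_real_derivative_iff_has_vector_derivative[symmetric])
  ultimately have "((\<lambda>t. y t m) has_vector_derivative x1 \<tau> m - 1 * x1 s m - of_real (\<tau> - s) * x2 s m) (at \<tau> within Y)"
   unfolding y_def using vector_derivative_subset[OF der Y(4)] m Y(4) by (intro has_vector_derivative_diff) auto
  then show "((\<lambda>t. y t m) has_vector_derivative x1 \<tau> m - x1 s m - of_real (\<tau> - s) * x2 s m) (at \<tau> within Y)" by simp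
 next
  fix \<tau> assume t: "\<tau> \<in> Y"
  have "sq G (\<lambda>m. x1 \<tau> m - x1 s m - of_real (\<tau> - s) * x2 s m) \<le> (b * (\<tau> - s)^2)^2"
   using t Y by (intro l2_taylor1[OF X(1,2) _ G b der1 der2 bd]) auto
  also have "... \<le> (b * (t - s)^2)^2"
   using t b by (intro power_mono mult_left_mono abs_le_square_iff[THEN iffD1]) (auto simp: Y_def dist_real_def abs_minus_commute)
  finally show "sq G (\<lambda>m. x1 \<tau> m - x1 s m - of_real (\<tau> - s) * x2 s m) \<le> (b * (t - s)^2)^2" .
 qed (use b in auto)
 moreover have "b * (t - s)^2 * \<bar>t - s\<bar> = b * \<bar>t - s\<bar>^3" 
 proof -
  have "p^2 * q = q^3" if "p^2 = q^2" for p q :: real using that by (simp add: power3_eq_cube power2_eq_square)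
  from this[of "t - s" "\<bar>t - s\<bar>"] show ?thesis by (simp add: mult.assoc)
 qed
 moreover have "(\<lambda>m. y t m - y s m) = (\<lambda>m. x t m - x s m - of_real (t - s) * x1 s m - of_real ((t - s)^2 / 2) * x2 s m)" by (simp add: y_def fun_eq_iff)
 ultimately show ?thesis by simp
qed

lemma sq_cong: "(\<And>m. m \<in> G ==> x m = y m) ==> sq G x = sq G y"
 by (simp add: sq_def)

lemma sq_cmult: "sq G (\<lambda>m. z * x m) = (cmod z)^2 * sq G x"
 by (simp add: sq_def norm_mult power_mult_distrib sum_distrib_left)

lemma sq_diff_le: "sq G (\<lambda>m. x m - y m) \<le> 2 * sq G x + 2 * sq G y"
 using sq_add_le[of G x "\<lambda>m. (-1) * y m"] sq_cmult[of G "-1" y] by simp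

text \<open>Both the average and half the difference of two sequences are covered, as they occur in the centred quotients.\<close>
lemma sq_mean:
 assumes "sq G x \<le> e" "sq G y \<le> e" and z: "\<And>m. m \<in> G ==> z m = (x m + y m) / 2 \<or> z m = (x m - y m) / 2"
 shows "sq G z \<le> e"
proof -
 have "(cmod (z m))^2 \<le> ((cmod (x m))^2 + (cmod (y m))^2) / 2" if "m \<in> G" for m
 proof -
  have "2 * cmod (z m) \<le> cmod (x m) + cmod (y m)"
  proof -
   have "2 * cmod (p / 2) = cmod p" for p :: complex by (simp add: norm_divide)
   then show ?thesis
    using z[OF that] norm_triangle_ineq[of "x m" "y m"] norm_triangle_ineq4[of "x m" "y m"] by metis
  qed
  then have "(2 * cmod (z m))^2 \<le> (cmod (x m) + cmod (y m))^2" by (intro power_mono) auto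
  moreover have "(cmod (x m) + cmod (y m))^2 \<le> 2 * ((cmod (x m))^2 + (cmod (y m))^2)"
   using zero_le_power2[of "cmod (x m) - cmod (y m)"] by (simp add: power2_eq_square algebra_simps)
  ultimately show ?thesis by (simp add: power_mult_distrib)
 qed
 then have "sq G z \<le> (\<Sum>m\<in>G. ((cmod (x m))^2 + (cmod (y m))^2) / 2)" unfolding sq_def by (intro sum_mono) 
 also have "... = (sq G x + sq G y) / 2" by (simp add: sq_def sum.distrib sum_divide_distrib[symmetric])
 finally show ?thesis using assms(1,2) by simp
qed

lemma sq_scaled: "0 < d ==> sq G (\<lambda>m. of_real d * x m) \<le> (d * e)^2 ==> sq G x \<le> e^2"
 by (simp add: sq_cmult power_mult_distrib)

text \<open>The time average and the centred difference of the scheme, each at two orders, because the number of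
 controlled time derivatives drops with the power of \<open>m\<close> that the coefficients carry.\<close>
context
 fixes X :: "real set" and s dt :: real and G :: "int set" and b :: real and x x1 x2 x3 :: "real => int => complex"
 assumes X: "convex X" "s \<in> X" "s - dt \<in> X" "s + dt \<in> X" and dt: "0 < dt" and G: "finite G" and b: "0 \<le> b"
  and der: "\<And>m \<tau>. m \<in> G ==> \<tau> \<in> X ==> ((\<lambda>t. x t m) has_vector_derivative x1 \<tau> m) (at \<tau> within X)"
begin

lemma l2_midpoint1:
 assumes "\<And>\<tau>. \<tau> \<in> X ==> sq G (x1 \<tau>) \<le> b^2"
 shows "sq G (\<lambda>m. (x (s + dt) m + x (s - dt) m) / 2 - x s m) \<le> (b * dt)^2"
proof (rule sq_mean)
 show "sq G (\<lambda>m. x (s + dt) m - x s m) \<le> (b * dt)^2"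
  using l2_mean_value[OF X(1,2,4) G b der assms] dt by simp
 show "sq G (\<lambda>m. x (s - dt) m - x s m) \<le> (b * dt)^2"
  using l2_mean_value[OF X(1,2,3) G b der assms] dt by simp
qed (simp add: field_simps)

context
 assumes der1: "\<And>m \<tau>. m \<in> G ==> \<tau> \<in> X ==> ((\<lambda>t. x1 t m) has_vector_derivative x2 \<tau> m) (at \<tau> within X)"
begin

lemma l2_midpoint2:
 assumes "\<And>\<tau>. \<tau> \<in> X ==> sq G (x2 \<tau>) \<le> b^2"
 shows "sq G (\<lambda>m. (x (s + dt) m + x (s - dt) m) / 2 - x s m) \<le> (b * dt^2)^2"
proof (rule sq_mean)
 show "sq G (\<lambda>m. x (s + dt) m - x s m - of_real dt * x1 s m) \<le> (b * dt^2)^2"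
  using l2_taylor1[OF X(1,2,4) G b der der1 assms] by simp
 show "sq G (\<lambda>m. x (s - dt) m - x s m + of_real dt * x1 s m) \<le> (b * dt^2)^2"
  using l2_taylor1[OF X(1,2,3) G b der der1 assms] by simp
qed (simp add: field_simps)

lemma l2_centred1:
 assumes "\<And>\<tau>. \<tau> \<in> X ==> sq G (x2 \<tau>) \<le> b^2"
 shows "sq G (\<lambda>m. (x (s + dt) m - x (s - dt) m) / of_real (2 * dt) - x1 s m) \<le> (b * dt)^2"
proof (rule sq_scaled[OF dt], rule sq_mean)
 show "sq G (\<lambda>m. x (s + dt) m - x s m - of_real dt * x1 s m) \<le> (dt * (b * dt))^2"
  using l2_taylor1[OF X(1,2,4) G b der der1 assms] by (simp add: power2_eq_square mult_ac)
 show "sq G (\<lambda>m. x (s - dt) m - x s m + of_real dt * x1 s m) \<le> (dt * (b * dt))^2"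
  using l2_taylor1[OF X(1,2,3) G b der der1 assms] by (simp add: power2_eq_square mult_ac)
qed (use dt in \<open>simp add: field_simps\<close>)

lemma l2_centred2:
 assumes der2: "\<And>m \<tau>. m \<in> G ==> \<tau> \<in> X ==> ((\<lambda>t. x2 t m) has_vector_derivative x3 \<tau> m) (at \<tau> within X)"
  and bd: "\<And>\<tau>. \<tau> \<in> X ==> sq G (x3 \<tau>) \<le> b^2"
 shows "sq G (\<lambda>m. (x (s + dt) m - x (s - dt) m) / of_real (2 * dt) - x1 s m) \<le> (b * dt^2)^2"
proof (rule sq_scaled[OF dt], rule sq_mean)
 have e: "dt * (b * dt^2) = b * dt^3" by (simp add: power2_eq_square power3_eq_cube)
 show "sq G (\<lambda>m. x (s + dt) m - x s m - of_real dt * x1 s m - of_real (dt^2 / 2) * x2 s m) \<le> (dt * (b * dt^2))^2"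
  unfolding e using l2_taylor2[OF X(1,2,4) G b der der1 der2 bd] dt by simp
 show "sq G (\<lambda>m. x (s - dt) m - x s m + of_real dt * x1 s m - of_real (dt^2 / 2) * x2 s m) \<le> (dt * (b * dt^2))^2"
  unfolding e using l2_taylor2[OF X(1,2,3) G b der der1 der2 bd] dt by simp
qed (use dt in \<open>simp add: field_simps\<close>)

end
end

text \<open>The unpaired mode \<open>N / 2\<close> is left out: the frequencies are symmetric, so truncations of real functions are real.\<close>
definition low :: "nat => int set" where "low N = {m. 2 * \<bar>m\<bar> < int N}"

lemma finite_low [simp]: "finite (low N)"
 by (rule finite_subset[of _ "{- int N..int N}"]) (auto simp: low_def)

lemma sob_truncation:
 assumes "periodic_2pi f" "\<And>x. (f has_real_derivative f' x) (at x)" and s: "sob n M (fc (cr f))" "0 \<le> M" "i < n"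
  and N: "N > 0"
 shows "cmod (of_real (f x) - trig (low N) (fc (cr f)) x) \<le> 2^(i+1) * M / real N ^ i"
 unfolding trig_def
proof (rule fourier_truncation[OF assms(1,2)])
 fix A assume A: "finite A" "A \<inter> low N = {}"
 have R: "real N / 2 \<le> \<bar>of_int m\<bar>" if "m \<in> A" for m
 proof -
  have "int N \<le> 2 * \<bar>m\<bar>" using A that by (auto simp: low_def)
  then have "real_of_int (int N) \<le> real_of_int (2 * \<bar>m\<bar>)" by (simp only: of_int_le_iff)
  then show ?thesis by simp
 qed
 have "(\<Sum>m\<in>A. \<bar>of_int m\<bar>^0 * cmod (fc (cr f) m)) \<le> 2 * M / (real N / 2)^i"
  by (rule sob_tail[OF s(1,2) A(1) _ R]) (use N s in auto)
 then show "(\<Sum>m\<in>A. cmod (fc (cr f) m)) \<le> 2^(i+1) * M / real N ^ i" by (simp add: power_divide mult_ac)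
qed simp

section \<open>Quantitative data of a solution with a uniform Sobolev bound\<close>

locale airy_global = airy_interval a T S \<theta> "{0..T}" K for a T :: real and S :: nat and \<theta> and K :: real
begin

lemma Cb_D: "t \<in> {0..T} ==> 1 \<le> j ==> j + n \<le> S - 1 ==> Cb n (2 * K) (D j t)"
proof (induction n arbitrary: j)
 case 0
 then show ?case using D_per[of t j] DJ_bound[of t j] D_cont[of t j UNIV] by auto
next
 case (Suc n)
 have "Cb n (2 * K) (D (Suc j) t)" using Suc by auto
 moreover have "(D j t has_real_derivative D (Suc j) t x) (at x)" for x using Suc by (intro D_der) auto
 moreover have "periodic_2pi (D j t)" using Suc by (intro D_per) auto
 moreover have "\<bar>D j t x\<bar> \<le> 2 * K" for x using Suc by (intro DJ_bound) auto
 ultimately show ?case by auto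
qed

definition "M2 = 2^(S-2) * (2 * K * (2 * K))"
definition "M3 = 2^(S-2) * (M2 * (2 * K))"
definition "MP = 2 * K + \<bar>3/2\<bar> * (2^3 * (M2 * (2 * K)))"
definition "Mg = 2^3 * (M2 * MP)"
definition "MP2 = 2 * K + 3 * (2*K) * (2*K)^2 + 3/2 * (2*K)^2 * (2*K)"
definition "MP4 = 2 * K + 18 * (2*K)^2 * (2*K) + 9 * (2*K) * (2*K)^2 + 12 * (2*K) * (2*K) * (2*K) + 3/2 * (2*K)^2 * (2*K)"
definition "MW = \<bar>a^3\<bar> * (2 * (2*K) * MP * MP + (2*K)^2 * (MP4 + 3 * (2*K) * MP * (2*K) + 3/2 * (2*K)^2 * MP2))"

lemma M_nonneg: "0 \<le> M2" "0 \<le> M3" "0 \<le> MP" "0 \<le> Mg" "0 \<le> MP2" "0 \<le> MP4" "0 \<le> MW"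
proof -
 show 2: "0 \<le> M2" using K_nonneg by (simp add: M2_def)
 show "0 \<le> M3" using K_nonneg 2 by (simp add: M3_def)
 show P: "0 \<le> MP" using K_nonneg 2 by (simp add: MP_def)
 show "0 \<le> Mg" using P 2 by (simp add: Mg_def)
 show P2: "0 \<le> MP2" using K_nonneg by (simp add: MP2_def)
 show P4: "0 \<le> MP4" using K_nonneg by (simp add: MP4_def)
 show "0 \<le> MW" using K_nonneg P P2 P4 by (simp add: MW_def)
qed

definition "W t x = a^3 * (2 * D 1 t x * P1 t x * P1 t x
  + (D 1 t x)^2 * (P4 t x + 3 * D 1 t x * P1 t x * D 2 t x + 3/2 * (D 1 t x)^2 * P2 t x))"

context
 fixes t assumes t: "t \<in> {0..T}"
begin

lemma Cb_square: "Cb (S - 2) M2 (\<lambda>x. (D 1 t x)^2)"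
 unfolding power2_eq_square M2_def by (rule Cb_mult; rule Cb_D[OF t]) (use S_ge in auto)

lemma Cb_cube: "Cb (S - 2) M3 (\<lambda>x. (D 1 t x)^3)"
proof -
 have "(\<lambda>x. (D 1 t x)^3) = (\<lambda>x. (D 1 t x)^2 * D 1 t x)" by (simp add: power3_eq_cube power2_eq_square)
 moreover have "Cb (S - 2) M3 (\<lambda>x. (D 1 t x)^2 * D 1 t x)"
  unfolding M3_def by (rule Cb_mult[OF Cb_square Cb_D[OF t]]) (use S_ge in auto)
 ultimately show ?thesis by (simp only:)
qed

lemma Cb_P1: "Cb 3 MP (P1 t)"
proof -
 have "P1 t = (\<lambda>x. D 4 t x + 3/2 * ((D 1 t x)^2 * D 2 t x))" by (simp add: P1_def fun_eq_iff)
 moreover have "Cb 3 MP (\<lambda>x. D 4 t x + 3/2 * ((D 1 t x)^2 * D 2 t x))"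
  unfolding MP_def
  by (intro Cb_add Cb_cmult Cb_mult Cb_le[OF Cb_square] Cb_D[OF t]) (use S_ge in auto)
 ultimately show ?thesis by (simp only:)
qed

lemma Cb_square_P1: "Cb 3 Mg (\<lambda>x. (D 1 t x)^2 * P1 t x)"
 unfolding Mg_def by (intro Cb_mult Cb_le[OF Cb_square] Cb_P1) (use S_ge in auto)

lemma P2_le: "\<bar>P2 t x\<bar> \<le> MP2" and P4_le: "\<bar>P4 t x\<bar> \<le> MP4"
proof -
 have "\<bar>D j t x\<bar> \<le> 2 * K" if "j \<in> {1..8}" for j using that S_ge by (intro DJ_bound[OF t]) auto
 from P_bound(2,4)[OF t this] show "\<bar>P2 t x\<bar> \<le> MP2" "\<bar>P4 t x\<bar> \<le> MP4" unfolding MP2_def MP4_def by auto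
qed

lemma W_bound: "\<bar>W t x\<bar> \<le> MW"
 unfolding W_def MW_def
 by (intro abs_sum_le abs_prod_le abs_pow_le abs_num_le P2_le P4_le Cb_bound[OF Cb_P1] DJ_bound[OF t]) (use S_ge in auto)

lemma W_cont: "continuous_on X (W t)"
proof -
 have "continuous_on X (\<lambda>x. W t x)"
  unfolding W_def P1_def P2_def P4_def by (intro continuous_intros D_cont'[OF t])
 then show ?thesis by simp
qed

lemma fc_square_P1_t: "((\<lambda>t. fc (cr (\<lambda>x. (D 1 t x)^2 * P1 t x)) m) has_vector_derivative fc (cr (W t)) m) (at t within {0..T})"
proof (rule fc_t_derivative[OF J_convex t])
 fix s x assume s: "s \<in> {0..T}"
 note d = D_t_der[OF s, of x]
 have "((\<lambda>s. (D 1 s x)^2 * (D 4 s x + 3/2 * (D 1 s x)^2 * D 2 s x)) has_real_derivative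
   2 * D 1 s x * (a^3 * P1 s x) * (D 4 s x + 3/2 * (D 1 s x)^2 * D 2 s x) + (D 1 s x)^2 *
   (a^3 * P4 s x + (3/2 * (2 * D 1 s x * (a^3 * P1 s x)) * D 2 s x + 3/2 * (D 1 s x)^2 * (a^3 * P2 s x)))) (at s within {0..T})"
  by (auto intro!: derivative_eq_intros d simp del: One_nat_def simp: algebra_simps power2_eq_square power3_eq_cube)
 moreover have "W s x = 2 * D 1 s x * (a^3 * P1 s x) * (D 4 s x + 3/2 * (D 1 s x)^2 * D 2 s x) + (D 1 s x)^2 *
   (a^3 * P4 s x + (3/2 * (2 * D 1 s x * (a^3 * P1 s x)) * D 2 s x + 3/2 * (D 1 s x)^2 * (a^3 * P2 s x)))"
  unfolding P1_def[symmetric] W_def by (simp add: algebra_simps power2_eq_square power3_eq_cube)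
 ultimately show "((\<lambda>s. (D 1 s x)^2 * P1 s x) has_real_derivative W s x) (at s within {0..T})"
  unfolding P1_def by (simp only:)
next
 show "continuous_on {0..2*pi} (\<lambda>x. (D 1 s x)^2 * P1 s x)" if "s \<in> {0..T}" for s
  unfolding P1_def by (intro continuous_intros D_cont'[OF that])
 show "continuous_on ({0..T} \<times> {0..2*pi}) (\<lambda>(t, x). W t x)"
  unfolding W_def case_prod_unfold by (intro continuous_intros D_joint' P_joint)
qed

lemma fc_cube_t: "((\<lambda>t. fc (cr (\<lambda>x. (D 1 t x)^3)) m) has_vector_derivative
  of_real (3 * a^3) * fc (cr (\<lambda>x. (D 1 t x)^2 * P1 t x)) m) (at t within {0..T})"
proof -
 have "((\<lambda>t. fc (cr (\<lambda>x. (D 1 t x)^3)) m) has_vector_derivative fc (cr (\<lambda>x. 3 * a^3 * ((D 1 t x)^2 * P1 t x))) m) (at t within {0..T})"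
 proof (rule fc_t_derivative[OF J_convex t])
  fix s x assume s: "s \<in> {0..T}"
  show "((\<lambda>s. (D 1 s x)^3) has_real_derivative 3 * a^3 * ((D 1 s x)^2 * P1 s x)) (at s within {0..T})"
   by (auto intro!: derivative_eq_intros D_t_der[OF s] simp del: One_nat_def simp: algebra_simps)
 next
  show "continuous_on {0..2*pi} (\<lambda>x. (D 1 s x)^3)" if "s \<in> {0..T}" for s
   by (intro continuous_intros D_cont'[OF that])
  show "continuous_on ({0..T} \<times> {0..2*pi}) (\<lambda>(t, x). 3 * a^3 * ((D 1 t x)^2 * P1 t x))"
   unfolding case_prod_unfold by (intro continuous_intros D_joint' P_joint)
 qed
 then show ?thesis
  using fc_cmult[of "of_real (3 * a^3)" "cr (\<lambda>x. (D 1 t x)^2 * P1 t x)" m] by (simp only: of_real_mult)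
qed

end

definition "c1 t m = of_real (a^3) * ((\<i> * of_int m)^3 * c t m + 1/2 * fc (cr (\<lambda>x. (D 1 t x)^3)) m)"
definition "c2 t m = of_real (a^3) * ((\<i> * of_int m)^3 * c1 t m) + of_real (3/2 * a^6) * fc (cr (\<lambda>x. (D 1 t x)^2 * P1 t x)) m"
definition "c3 t m = of_real (a^3) * ((\<i> * of_int m)^3 * c2 t m) + of_real (3/2 * a^6) * fc (cr (W t)) m"

lemma c_t: "t \<in> {0..T} ==> ((\<lambda>t. c t m) has_vector_derivative c1 t m) (at t within {0..T})"
proof -
 assume t: "t \<in> {0..T}"
 have "((\<lambda>t. fc (cr (D 0 t)) m) has_vector_derivative fc (cr (\<lambda>x. a^3 * P0 t x)) m) (at t within {0..T})"
  by (rule fc_t_derivative[OF J_convex t, where h = "\<lambda>t x. a^3 * P0 t x"])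
    (auto simp: case_prod_unfold simp del: One_nat_def intro!: D_t_der D_cont'[OF JT] continuous_intros P_joint)
 moreover have "fc (cr (D 0 t)) m = c t m" for t
 proof -
  have "D 0 t = (\<lambda>x. \<theta> x t)" by (simp add: D0 fun_eq_iff)
  then show ?thesis by (simp only: c_def)
 qed
 moreover have "fc (cr (\<lambda>x. a^3 * P0 t x)) m = of_real (a^3) * fc (cr (P0 t)) m"
  using fc_cmult[of "of_real (a^3)" "cr (P0 t)" m] by (simp only: of_real_mult)
 moreover have "fc (cr (P0 t)) m = (\<i> * of_int m)^3 * c t m + 1/2 * fc (cr (\<lambda>x. (D 1 t x)^3)) m"
 proof -
  have "cr (P0 t) = (\<lambda>x. of_real (D 3 t x) + (1/2) * of_real (D 1 t x ^ 3))" by (simp add: P0_def fun_eq_iff)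
  then have "fc (cr (P0 t)) m = fc (\<lambda>x. of_real (D 3 t x) + (1/2) * of_real (D 1 t x ^ 3)) m" by simp
  also have "... = fc (cr (D 3 t)) m + fc (\<lambda>x. (1/2) * of_real (D 1 t x ^ 3)) m"
   by (intro fc_add continuous_intros continuous_on_of_real D_cont'[OF t])
  also have "fc (\<lambda>x. (1/2) * of_real (D 1 t x ^ 3)) m = (1/2) * fc (\<lambda>x. of_real (D 1 t x ^ 3)) m"
   by (rule fc_cmult)
  also have "fc (cr (D 3 t)) m = (\<i> * of_int m)^3 * c t m" using S_ge by (intro fc_D[OF t]) auto
  finally show ?thesis .
 qed
 ultimately show ?thesis by (simp only: c1_def)
qed

lemma c1_t: "t \<in> {0..T} ==> ((\<lambda>t. c1 t m) has_vector_derivative c2 t m) (at t within {0..T})"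
proof -
 assume t: "t \<in> {0..T}"
 have "((\<lambda>t. c1 t m) has_vector_derivative of_real (a^3) * ((\<i> * of_int m)^3 * c1 t m
   + 1/2 * (of_real (3 * a^3) * fc (cr (\<lambda>x. (D 1 t x)^2 * P1 t x)) m))) (at t within {0..T})"
  unfolding c1_def[of _ m] by (intro has_vector_derivative_mult_right has_vector_derivative_add c_t[unfolded c1_def] fc_cube_t t)
 moreover have "of_real (a^3) * (p + 1/2 * (of_real (3 * a^3) * z)) = of_real (a^3) * p + of_real (3/2 * a^6) * z" for p z :: complex
  by (simp add: algebra_simps power_add[symmetric])
 ultimately show ?thesis by (simp only: c2_def)
qed

lemma c2_t: "t \<in> {0..T} ==> ((\<lambda>t. c2 t m) has_vector_derivative c3 t m) (at t within {0..T})"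
 unfolding c2_def[of _ m] c3_def
 by (intro has_vector_derivative_mult_right has_vector_derivative_add c1_t[unfolded c2_def] fc_square_P1_t)

definition "B1 = cmod (of_real (a^3)) * (K + cmod (1/2) * M3)"
definition "B2c = cmod (of_real (a^3)) * B1 + cmod (of_real (3/2 * a^6)) * Mg"
definition "B3 = cmod (of_real (a^3)) * B2c + cmod (of_real (3/2 * a^6)) * MW"

lemma B_nonneg: "0 \<le> B1" "0 \<le> B2c" "0 \<le> B3"
proof -
 show 1: "0 \<le> B1" using K_nonneg M_nonneg unfolding B1_def by (intro mult_nonneg_nonneg add_nonneg_nonneg) auto
 show 2: "0 \<le> B2c" using 1 M_nonneg unfolding B2c_def by (intro mult_nonneg_nonneg add_nonneg_nonneg) auto
 show "0 \<le> B3" using 2 M_nonneg unfolding B3_def by (intro mult_nonneg_nonneg add_nonneg_nonneg) auto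
qed

lemma c1_sob: "t \<in> {0..T} ==> k + j \<le> 6 ==> sob k B1 (\<lambda>m. (\<i> * of_int m)^j * c1 t m)"
proof -
 assume t: "t \<in> {0..T}" and kj: "k + j \<le> 6"
 have eq: "(\<lambda>m. (\<i> * of_int m)^j * c1 t m) = (\<lambda>m. of_real (a^3) * ((\<i> * of_int m)^(j+3) * c t m + 1/2 * ((\<i> * of_int m)^j * fc (cr (\<lambda>x. (D 1 t x)^3)) m)))"
  by (simp add: c1_def fun_eq_iff power_add algebra_simps)
 show ?thesis unfolding eq B1_def
  by (intro sob_cmult sob_add sob_im[OF sobJ[OF t]] sob_im_Cb[OF Cb_cube[OF t]]) (use kj S_ge K_nonneg M_nonneg in auto)
qed

lemma c2_sob: "t \<in> {0..T} ==> k + j \<le> 3 ==> sob k B2c (\<lambda>m. (\<i> * of_int m)^j * c2 t m)"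
proof -
 assume t: "t \<in> {0..T}" and kj: "k + j \<le> 3"
 have eq: "(\<lambda>m. (\<i> * of_int m)^j * c2 t m) = (\<lambda>m. of_real (a^3) * ((\<i> * of_int m)^(j+3) * c1 t m) + of_real (3/2 * a^6) * ((\<i> * of_int m)^j * fc (cr (\<lambda>x. (D 1 t x)^2 * P1 t x)) m))"
  by (simp add: c2_def fun_eq_iff power_add algebra_simps)
 show ?thesis unfolding eq B2c_def
  by (intro sob_add sob_cmult c1_sob[OF t] sob_im_Cb[OF Cb_square_P1[OF t]] mult_nonneg_nonneg) (use kj B_nonneg M_nonneg in auto)
qed

lemma c3_sob: "t \<in> {0..T} ==> sob 0 B3 (c3 t)"
proof -
 assume t: "t \<in> {0..T}"
 have "sob 0 MW (fc (cr (W t)))"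
  unfolding sob_def using bessel_bounded[of _ "W t" MW] W_cont[OF t] W_bound[OF t] by simp
 moreover have "c3 t = (\<lambda>m. of_real (a^3) * ((\<i> * of_int m)^3 * c2 t m) + of_real (3/2 * a^6) * fc (cr (W t)) m)"
  by (simp add: c3_def fun_eq_iff)
 ultimately show ?thesis unfolding B3_def
  by (simp only:) (intro sob_add sob_cmult c2_sob[OF t] mult_nonneg_nonneg; use B_nonneg M_nonneg in auto)
qed

definition "Lip = a^3 * (MP + MP2)"
definition "Bd = 1 + 2^S * (K + M2 + M3) + 2 * K + 5 * M2 + 3 * (2^1 * (Lip * (2 * K + 2 * K)))
 + 2 * (2 * (B3^2 + (a^3 * B2c)^2)) + 2 * (B2c^2 + (a^3 * B1)^2) + 2 * B2c^2"

lemma Lip_nonneg: "0 \<le> Lip" using a_pos M_nonneg by (simp add: Lip_def)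

lemma Bd_ge: "1 \<le> Bd" "2^S * K \<le> Bd" "2^S * M2 \<le> Bd" "2^S * M3 \<le> Bd" "2 * K \<le> Bd" "5 * M2 \<le> Bd"
 "3 * (2^1 * (Lip * (2 * K + 2 * K))) \<le> Bd" "2 * (2 * (B3^2 + (a^3 * B2c)^2)) + 2 * (B2c^2 + (a^3 * B1)^2) \<le> Bd" "2 * B2c^2 \<le> Bd"
proof -
 have n: "0 \<le> 2^S * K" "0 \<le> 2^S * M2" "0 \<le> 2^S * M3" "0 \<le> 3 * (2^1 * (Lip * (2 * K + 2 * K)))"
  "0 \<le> 2 * (2 * (B3^2 + (a^3 * B2c)^2)) + 2 * (B2c^2 + (a^3 * B1)^2)" "0 \<le> 2 * B2c^2"
  using K_nonneg M_nonneg Lip_nonneg by (auto intro!: mult_nonneg_nonneg add_nonneg_nonneg)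
 note e = Bd_def distrib_left[of "2^S"]
 show "1 \<le> Bd" "2^S * K \<le> Bd" "2^S * M2 \<le> Bd" "2^S * M3 \<le> Bd" "2 * K \<le> Bd" "5 * M2 \<le> Bd"
  "3 * (2^1 * (Lip * (2 * K + 2 * K))) \<le> Bd" "2 * (2 * (B3^2 + (a^3 * B2c)^2)) + 2 * (B2c^2 + (a^3 * B1)^2) \<le> Bd" "2 * B2c^2 \<le> Bd"
  unfolding e using n K_nonneg M_nonneg by linarith+
qed

lemma Bd_sq: "Bd \<le> Bd^2" using mult_left_mono[of 1 Bd Bd] Bd_ge(1) by (simp add: power2_eq_square)

lemma truncation_bounds:
 assumes t: "t \<in> {0..T}" and N: "N > 0"
 shows "cmod (of_real (\<theta> x t) - trig (low N) (c t) x) \<le> Bd * ((1 / real N)^(S-3) / (real N)^2)"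
  and "cmod (of_real (D 1 t x) - trig (low N) (\<lambda>m. \<i> * of_int m * c t m) x) \<le> Bd * (1 / real N)^(S-3)"
  and "cmod (of_real ((D 1 t x)^2) - trig (low N) (fc (cr (\<lambda>x. (D 1 t x)^2))) x) \<le> Bd * (1 / real N)^(S-3)"
  and "cmod (of_real ((D 1 t x)^3) - trig (low N) (fc (cr (\<lambda>x. (D 1 t x)^3))) x) \<le> Bd * (1 / real N)^(S-3)"
proof -
 have aux: "2^(i+1) * M / real N ^ i \<le> Bd * (1 / real N)^i" if "2^S * M \<le> Bd" "i < S" "0 \<le> M" for i M
 proof -
  have "2^(i+1) * M \<le> 2^S * M" using that by (intro mult_right_mono power_increasing) auto
  then have "2^(i+1) * M / real N ^ i \<le> Bd / real N ^ i" using that by (intro divide_right_mono) auto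
  then show ?thesis by (simp add: power_divide)
 qed
 have D0x: "D 0 t = (\<lambda>x. \<theta> x t)" by (simp add: D0 fun_eq_iff)
 have "cmod (of_real (D 0 t x) - trig (low N) (fc (cr (D 0 t))) x) \<le> 2^(S-1+1) * K / real N ^ (S-1)"
 proof (rule sob_truncation[where f' = "D 1 t" and n = S])
  show "sob S K (fc (cr (D 0 t)))" using sobJ[OF t] by (simp add: c_def D0x)
 qed (use t S_ge N K_nonneg D_per[OF t] D_der'[OF t] in auto)
 also have "... \<le> Bd * (1 / real N)^(S-1)" using S_ge K_nonneg Bd_ge by (intro aux) auto
 also have "(1 / real N)^(S-1) = (1 / real N)^(S-3) / (real N)^2"
 proof -
  have "S - 1 = (S - 3) + 2" using S_ge by simp
  then show ?thesis by (simp only: power_add power_divide[of _ _ 2]) simp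
 qed
 finally show "cmod (of_real (\<theta> x t) - trig (low N) (c t) x) \<le> Bd * ((1 / real N)^(S-3) / (real N)^2)"
  by (simp add: D0x c_def)
 have fu: "fc (cr (D 1 t)) = (\<lambda>m. \<i> * of_int m * c t m)"
 proof
  show "fc (cr (D 1 t)) m = \<i> * of_int m * c t m" for m using fc_D[OF t, of 1 m] S_ge by simp
 qed
 have "cmod (of_real (D 1 t x) - trig (low N) (fc (cr (D 1 t))) x) \<le> 2^(S-3+1) * K / real N ^ (S-3)"
 proof (rule sob_truncation[where f' = "D 2 t" and n = "S-1"])
  show "sob (S-1) K (fc (cr (D 1 t)))" using sob_im[OF sobJ[OF t], of "S-1" 1] S_ge unfolding fu by simp
 qed (use t S_ge N K_nonneg D_per[OF t] D_der'[OF t] in \<open>auto simp del: One_nat_def\<close>)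
 also have "... \<le> Bd * (1 / real N)^(S-3)" using S_ge K_nonneg Bd_ge by (intro aux) auto
 finally show "cmod (of_real (D 1 t x) - trig (low N) (\<lambda>m. \<i> * of_int m * c t m) x) \<le> Bd * (1 / real N)^(S-3)"
  unfolding fu .
 have gen: "cmod (of_real (f x) - trig (low N) (fc (cr f)) x) \<le> Bd * (1 / real N)^(S-3)" if f: "Cb (S-2) M f" "2^S * M \<le> Bd" for f M
 proof -
  have "Cb (Suc (S-3)) M f" using f(1) S_ge by (simp add: Suc_diff_le numeral_eq_Suc Suc_diff_Suc)
  then obtain f' where f': "\<And>x. (f has_real_derivative f' x) (at x)" by auto
  have M0: "0 \<le> M" using f(1) by (rule Cb_nonneg)
  have "cmod (of_real (f x) - trig (low N) (fc (cr f)) x) \<le> 2^(S-3+1) * M / real N ^ (S-3)"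
   by (rule sob_truncation[OF Cb_periodic[OF f(1)] f' Cb_sob[OF f(1)] M0 _ N]) (use S_ge in auto)
  also have "... \<le> Bd * (1 / real N)^(S-3)" using f M0 S_ge by (intro aux) auto
  finally show ?thesis .
 qed
 show "cmod (of_real ((D 1 t x)^2) - trig (low N) (fc (cr (\<lambda>x. (D 1 t x)^2))) x) \<le> Bd * (1 / real N)^(S-3)"
  using Bd_ge by (intro gen[OF Cb_square[OF t]])
 show "cmod (of_real ((D 1 t x)^3) - trig (low N) (fc (cr (\<lambda>x. (D 1 t x)^3))) x) \<le> Bd * (1 / real N)^(S-3)"
  using Bd_ge by (intro gen[OF Cb_cube[OF t]])
qed

lemma D1_le: "t \<in> {0..T} ==> \<bar>D 1 t x\<bar> \<le> Bd"
 using DJ_bound[of t 1 x] Bd_ge(5) S_ge by linarith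

lemma l1_bound:
 assumes "sob n M f" "0 \<le> M" "cmod (f 0) \<le> M" "finite A" "j < n"
 shows "(\<Sum>m\<in>A. \<bar>of_int m\<bar>^j * cmod (f m)) \<le> 3 * M"
proof -
 have "(\<Sum>m\<in>A. \<bar>of_int m\<bar>^j * cmod (f m)) \<le> (\<Sum>m\<in>insert 0 (A - {0}). \<bar>of_int m\<bar>^j * cmod (f m))"
  using assms by (intro sum_mono2) auto
 also have "... = \<bar>of_int 0\<bar>^j * cmod (f 0) + (\<Sum>m\<in>A - {0}. \<bar>of_int m\<bar>^j * cmod (f m))"
  using assms by (intro sum.insert) auto
 also have "\<bar>of_int 0\<bar>^j * cmod (f 0) \<le> M" using assms by (cases j) auto
 also have "(\<Sum>m\<in>A - {0}. \<bar>of_int m\<bar>^j * cmod (f m)) \<le> 2 * M" using assms by (intro sob_l1) auto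
 finally show ?thesis by simp
qed

lemma square_coefficients:
 assumes t: "t \<in> {0..T}" and A: "finite A"
 shows "(\<Sum>l\<in>A. (1 + \<bar>of_int l\<bar>) * cmod (fc (cr (\<lambda>x. (D 1 t x)^2)) l)) \<le> 2 * Bd"
proof -
 let ?f = "fc (cr (\<lambda>x. (D 1 t x)^2))"
 have s: "sob (S-2) M2 ?f" using Cb_sob[OF Cb_square[OF t]] .
 have f0: "cmod (?f 0) \<le> M2"
  by (rule fc_bound) (use Cb_bound[OF Cb_square[OF t]] Cb_continuous[OF Cb_square[OF t]] in \<open>auto intro!: continuous_on_of_real simp del: of_real_power One_nat_def\<close>)
 have "(\<Sum>m\<in>A. \<bar>of_int m\<bar>^0 * cmod (?f m)) \<le> 3 * M2" "(\<Sum>m\<in>A. \<bar>of_int m\<bar>^1 * cmod (?f m)) \<le> 3 * M2"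
  by (rule l1_bound[OF s _ f0 A]; use S_ge M_nonneg in simp)+
 then have "(\<Sum>l\<in>A. (1 + \<bar>of_int l\<bar>) * cmod (?f l)) \<le> 3 * M2 + 3 * M2"
  by (simp add: distrib_right sum.distrib del: One_nat_def)
 then show ?thesis using Bd_ge(6) M_nonneg(1) by linarith
qed

lemma square_coefficients_lipschitz:
 assumes t: "t \<in> {0..T}" "s \<in> {0..T}" and A: "finite A"
 shows "(\<Sum>l\<in>A. cmod (fc (cr (\<lambda>x. (D 1 t x)^2)) l - fc (cr (\<lambda>x. (D 1 s x)^2)) l)) \<le> Bd * \<bar>t - s\<bar>"
proof -
 define L where "L = Lip * \<bar>t - s\<bar>"
 have lip: "\<bar>D 1 t x - D 1 s x\<bar> \<le> L" "\<bar>D 2 t x - D 2 s x\<bar> \<le> L" for x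
 proof -
  have b: "norm (a^3 * P1 \<tau> x) \<le> Lip" "norm (a^3 * P2 \<tau> x) \<le> Lip" if "\<tau> \<in> {0..T}" for \<tau>
  proof -
   have "a^3 * \<bar>P1 \<tau> x\<bar> \<le> Lip" "a^3 * \<bar>P2 \<tau> x\<bar> \<le> Lip" unfolding Lip_def
    using Cb_bound[OF Cb_P1[OF that], of x] P2_le[OF that, of x] M_nonneg a_pos by (intro mult_left_mono; simp)+
   then show "norm (a^3 * P1 \<tau> x) \<le> Lip" "norm (a^3 * P2 \<tau> x) \<le> Lip" using a_pos by (simp_all add: abs_mult)
  qed
  have "norm (D 1 t x - D 1 s x) \<le> Lip * norm (t - s)"
   by (rule field_differentiable_bound[OF J_convex _ b(1) t(1) t(2)]) (rule D_t_der)
  moreover have "norm (D 2 t x - D 2 s x) \<le> Lip * norm (t - s)"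
   by (rule field_differentiable_bound[OF J_convex _ b(2) t(1) t(2)]) (rule D_t_der)
  ultimately show "\<bar>D 1 t x - D 1 s x\<bar> \<le> L" "\<bar>D 2 t x - D 2 s x\<bar> \<le> L" by (simp_all add: L_def)
 qed
 have pd: "periodic_2pi (\<lambda>x. D j t x - D j s x)" if "j \<le> S-1" for j
  using D_per[OF t(1) that] D_per[OF t(2) that] by (simp add: periodic_2pi_def)
 have d: "Cb 1 L (\<lambda>x. D 1 t x - D 1 s x)"
 proof -
  have "Cb 0 L (\<lambda>x. D 2 t x - D 2 s x)"
   using pd[of 2] lip(2) S_ge by (auto intro!: continuous_intros D_cont'[OF t(1)] D_cont'[OF t(2)])
  moreover have "((\<lambda>x. D 1 t x - D 1 s x) has_real_derivative D 2 t x - D 2 s x) (at x)" for x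
   by (intro DERIV_diff D_der' t)
  ultimately have "Cb (Suc 0) L (\<lambda>x. D 1 t x - D 1 s x)"
   using pd[of 1] lip(1) S_ge unfolding Cb.simps(2)
   by (intro conjI allI exI[of _ "\<lambda>x. D 2 t x - D 2 s x"]) auto
  then show ?thesis by (simp only: One_nat_def)
 qed
 have S1: "1 \<le> S - 2" using S_ge by simp
 have w: "Cb 1 (2^1 * (L * (2 * K + 2 * K))) (\<lambda>x. (D 1 t x - D 1 s x) * (D 1 t x + D 1 s x))"
  by (intro Cb_mult d Cb_add Cb_D t) (use S_ge in auto)
 let ?w = "\<lambda>x. (D 1 t x - D 1 s x) * (D 1 t x + D 1 s x)"
 have eq: "fc (cr (\<lambda>x. (D 1 t x)^2)) l - fc (cr (\<lambda>x. (D 1 s x)^2)) l = fc (cr ?w) l" for l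
 proof -
  have "cr ?w = (\<lambda>x. of_real ((D 1 t x)^2) - of_real ((D 1 s x)^2))" by (simp add: power2_eq_square algebra_simps fun_eq_iff)
  then show ?thesis
   using fc_diff[of "cr (\<lambda>x. (D 1 t x)^2)" "cr (\<lambda>x. (D 1 s x)^2)" l]
    Cb_continuous[OF Cb_square[OF t(1)]] Cb_continuous[OF Cb_square[OF t(2)]] by (simp only: continuous_on_of_real)
 qed
 have "(\<Sum>l\<in>A. \<bar>of_int l\<bar>^0 * cmod (fc (cr ?w) l)) \<le> 3 * (2^1 * (L * (2 * K + 2 * K)))"
 proof (rule l1_bound[OF Cb_sob[OF w] Cb_nonneg[OF w] _ A])
  show "cmod (fc (cr ?w) 0) \<le> 2^1 * (L * (2 * K + 2 * K))"
   by (rule fc_bound) (use Cb_bound[OF w] Cb_continuous[OF w] in \<open>auto intro!: continuous_on_of_real simp del: of_real_mult One_nat_def\<close>)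
 qed simp
 also have "... = 3 * (2^1 * (Lip * (2 * K + 2 * K))) * \<bar>t - s\<bar>" by (simp add: L_def)
 also have "... \<le> Bd * \<bar>t - s\<bar>" using Bd_ge(7) by (rule mult_right_mono) simp
 finally show ?thesis by (simp only: eq power_0 mult_1)
qed

definition "resid dt t m = (c (t + dt) m - c (t - dt) m) / of_real (2 * dt) - c1 t m
  - of_real (a^3) * ((\<i> * of_int m)^3 * ((c (t + dt) m + c (t - dt) m) / 2 - c t m))"

lemma im_c_t: assumes "t \<in> {0..T}"
 shows "((\<lambda>t. (\<i> * of_int m)^j * c t m) has_vector_derivative (\<i> * of_int m)^j * c1 t m) (at t within {0..T})"
  "((\<lambda>t. (\<i> * of_int m)^j * c1 t m) has_vector_derivative (\<i> * of_int m)^j * c2 t m) (at t within {0..T})"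
 by (intro has_vector_derivative_mult_right c_t c1_t assms)+

lemma one_square_le:
 fixes x dt :: real
 assumes "0 < dt"
 shows "x^2 \<le> 1 / dt + dt^2 * (x^3)^2"
proof (cases "dt * x^2 \<le> 1")
 case True then have "x^2 \<le> 1 / dt" using assms by (simp add: field_simps)
 moreover have "0 \<le> dt^2 * (x^3)^2" by simp
 ultimately show ?thesis by linarith
next
 case False
 then have "1 \<le> (dt * x^2)^2" by (intro one_le_power) simp
 then have "x^2 * 1 \<le> x^2 * (dt * x^2)^2" by (intro mult_left_mono) auto
 also have "... = dt^2 * (x^3)^2" by (simp add: power2_eq_square power3_eq_cube)
 moreover have "0 \<le> 1 / dt" using assms by simp
 ultimately show ?thesis by linarith
qed

text \<open>Three time derivatives are controlled in \<open>\<ell>\<^sup>2\<close> but only two with three space derivatives;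
 interpolating between the two estimates leaves an error of order \<open>dt powr (3/2)\<close> in the first-order norm.\<close>
lemma time_consistency:
 assumes dt: "0 < dt" "dt \<le> 1" and t: "0 \<le> t - dt" "t + dt \<le> T" and G: "finite G"
 shows "sq G (resid dt t) \<le> Bd^2 * dt^4"
  and "(\<Sum>m\<in>G. (1 + (of_int m)^2) * (cmod (resid dt t m))^2) \<le> Bd^2 * dt^3"
proof -
 have X: "convex {0..T}" "t \<in> {0..T}" "t - dt \<in> {0..T}" "t + dt \<in> {0..T}" using dt t J_convex by auto
 let ?p = "\<lambda>m. (c (t + dt) m - c (t - dt) m) / of_real (2 * dt) - c1 t m"
 let ?q = "\<lambda>j m. (((\<i> * of_int m)^j * c (t + dt) m + (\<i> * of_int m)^j * c (t - dt) m) / 2 - (\<i> * of_int m)^j * c t m)"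
 have p0: "sq G ?p \<le> (B3 * dt^2)^2"
  by (rule l2_centred2[OF X dt(1) G B_nonneg(3) c_t c1_t c2_t sob_0_sq[OF c3_sob G]])
 have q3: "sq G (?q 3) \<le> (B2c * dt^2)^2"
  by (rule l2_midpoint2[OF X dt(1) G B_nonneg(2) im_c_t(1) im_c_t(2) sob_0_sq[OF c2_sob G]]) auto
 have p3: "sq G (\<lambda>m. ((\<i> * of_int m)^3 * c (t + dt) m - (\<i> * of_int m)^3 * c (t - dt) m) / of_real (2 * dt) - (\<i> * of_int m)^3 * c1 t m) \<le> (B2c * dt)^2"
  by (rule l2_centred1[OF X dt(1) G B_nonneg(2) im_c_t(1) im_c_t(2) sob_0_sq[OF c2_sob G]]) auto
 have q6: "sq G (?q 6) \<le> (B1 * dt)^2"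
  by (rule l2_midpoint1[OF X dt(1) G B_nonneg(1) im_c_t(1) sob_0_sq[OF c1_sob G]]) auto
 have A: "sq G (resid dt t) \<le> 2 * (B3^2 + (a^3 * B2c)^2) * dt^4"
 proof -
  have "sq G (resid dt t) = sq G (\<lambda>m. ?p m - of_real (a^3) * ?q 3 m)"
   by (rule sq_cong) (simp add: resid_def algebra_simps add_divide_distrib)
  also have "... \<le> 2 * sq G ?p + 2 * sq G (\<lambda>m. of_real (a^3) * ?q 3 m)" by (rule sq_diff_le)
  also have "sq G (\<lambda>m. of_real (a^3) * ?q 3 m) = (a^3)^2 * sq G (?q 3)" by (simp only: sq_cmult norm_of_real power2_abs)
  also have "... \<le> (a^3)^2 * (B2c * dt^2)^2" using q3 by (rule mult_left_mono) simp
  finally show ?thesis using p0 by (simp add: power_mult_distrib algebra_simps power_mult[symmetric])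
 qed
 have B: "sq G (\<lambda>m. (\<i> * of_int m)^3 * resid dt t m) \<le> 2 * (B2c^2 + (a^3 * B1)^2) * dt^2"
 proof -
  have "sq G (\<lambda>m. (\<i> * of_int m)^3 * resid dt t m) = sq G (\<lambda>m. (((\<i> * of_int m)^3 * c (t + dt) m - (\<i> * of_int m)^3 * c (t - dt) m) / of_real (2 * dt) - (\<i> * of_int m)^3 * c1 t m) - of_real (a^3) * ?q 6 m)"
  proof (rule sq_cong)
   fix m
   have alg: "z * ((x - y) / d - w - k * (z * ((x + y) / 2 - v))) = ((z * x - z * y) / d - z * w) - k * ((z^2 * x + z^2 * y) / 2 - z^2 * v)" for z x y d w k v :: complex
    by (simp add: algebra_simps power2_eq_square diff_divide_distrib add_divide_distrib)
   have p6: "(\<i> * of_int m)^6 = (((\<i> * of_int m)^3)^2 :: complex)" by (simp only: power_mult[symmetric]) simp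
   show "(\<i> * of_int m)^3 * resid dt t m = (((\<i> * of_int m)^3 * c (t + dt) m - (\<i> * of_int m)^3 * c (t - dt) m) / of_real (2 * dt) - (\<i> * of_int m)^3 * c1 t m) - of_real (a^3) * ?q 6 m"
    unfolding resid_def p6 by (rule alg)
  qed
  also have "... \<le> 2 * sq G (\<lambda>m. ((\<i> * of_int m)^3 * c (t + dt) m - (\<i> * of_int m)^3 * c (t - dt) m) / of_real (2 * dt) - (\<i> * of_int m)^3 * c1 t m) + 2 * sq G (\<lambda>m. of_real (a^3) * ?q 6 m)" by (rule sq_diff_le)
  also have "sq G (\<lambda>m. of_real (a^3) * ?q 6 m) = (a^3)^2 * sq G (?q 6)" by (simp only: sq_cmult norm_of_real power2_abs)
  also have "... \<le> (a^3)^2 * (B1 * dt)^2" using q6 by (rule mult_left_mono) simp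
  finally show ?thesis using p3 by (simp add: power_mult_distrib algebra_simps)
 qed
 define u v where "u = 2 * (B3^2 + (a^3 * B2c)^2)" and "v = 2 * (B2c^2 + (a^3 * B1)^2)"
 have uv: "0 \<le> u" "0 \<le> v" "2 * u + v \<le> Bd^2" using Bd_ge(8) Bd_sq unfolding u_def v_def by auto
 have "sq G (resid dt t) \<le> u * dt^4" using A by (simp only: u_def)
 also have "... \<le> Bd^2 * dt^4" using uv by (intro mult_right_mono) auto
 finally show "sq G (resid dt t) \<le> Bd^2 * dt^4" .
 have "(\<Sum>m\<in>G. (1 + (of_int m)^2) * (cmod (resid dt t m))^2)
   \<le> (\<Sum>m\<in>G. (1 + 1 / dt) * (cmod (resid dt t m))^2 + dt^2 * (cmod ((\<i> * of_int m)^3 * resid dt t m))^2)"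
 proof (rule sum_mono)
  fix m :: int
  have "(1 + (of_int m)^2) * (cmod (resid dt t m))^2 \<le> (1 + (1 / dt + dt^2 * ((of_int m)^3)^2)) * (cmod (resid dt t m))^2"
   using one_square_le[OF dt(1), of "of_int m"] by (intro mult_right_mono) auto
  also have "... = (1 + 1 / dt) * (cmod (resid dt t m))^2 + dt^2 * (cmod ((\<i> * of_int m)^3 * resid dt t m))^2"
  proof -
   have "(cmod ((\<i> * of_int m)^3 * resid dt t m))^2 = ((of_int m)^3)^2 * (cmod (resid dt t m))^2"
    by (simp add: norm_mult norm_power power_mult_distrib power_mult[symmetric] mult.commute power_even_abs)
   then show ?thesis by (simp add: algebra_simps)
  qed
  finally show "(1 + (of_int m)^2) * (cmod (resid dt t m))^2 \<le> ..." .
 qed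
 also have "... = (1 + 1 / dt) * sq G (resid dt t) + dt^2 * sq G (\<lambda>m. (\<i> * of_int m)^3 * resid dt t m)"
  by (simp add: sum.distrib sum_distrib_left sq_def)
 also have "... \<le> (1 + 1 / dt) * (u * dt^4) + dt^2 * (v * dt^2)"
  using A B dt unfolding u_def v_def by (intro add_mono mult_left_mono) auto
 also have "... = u * dt^4 + u * dt^3 + v * dt^4" using dt by (simp add: field_simps power2_eq_square power3_eq_cube power4_eq_xxxx)
 also have "... \<le> u * dt^3 + u * dt^3 + v * dt^3"
  using dt uv power_decreasing[of 3 4 dt] by (intro add_mono mult_left_mono) auto
 also have "... = (2 * u + v) * dt^3" by (simp add: algebra_simps)
 also have "... \<le> Bd^2 * dt^3" using uv dt by (intro mult_right_mono) auto
 finally show "(\<Sum>m\<in>G. (1 + (of_int m)^2) * (cmod (resid dt t m))^2) \<le> Bd^2 * dt^3" .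
qed

definition "resid0 dt m = c dt m - c 0 m - of_real dt * c1 0 m"

lemma first_step_consistency:
 assumes dt: "0 < dt" "dt \<le> 1" "dt \<le> T" and G: "finite G"
 shows "sq G (resid0 dt) \<le> Bd^2 * dt^4"
  and "(\<Sum>m\<in>G. (1 + (of_int m)^2) * (cmod (resid0 dt m))^2) \<le> Bd^2 * dt^3"
proof -
 have X: "convex {0..T}" "0 \<in> {0..T}" "dt \<in> {0..T}" using dt J_convex by auto
 have w: "sq G (\<lambda>m. (\<i> * of_int m)^j * resid0 dt m) \<le> (B2c * dt^2)^2" if "j \<le> 3" for j
 proof -
  have "sq G (\<lambda>m. (\<i> * of_int m)^j * resid0 dt m) = sq G (\<lambda>m. (\<i> * of_int m)^j * c dt m - (\<i> * of_int m)^j * c 0 m - of_real (dt - 0) * ((\<i> * of_int m)^j * c1 0 m))"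
   by (rule sq_cong) (simp add: resid0_def algebra_simps)
  also have "... \<le> (B2c * (dt - 0)^2)^2"
   by (rule l2_taylor1[OF X G B_nonneg(2) im_c_t(1) im_c_t(2) sob_0_sq[OF c2_sob G]]) (use that in auto)
  finally show ?thesis by simp
 qed
 have e: "(B2c * dt^2)^2 = B2c^2 * dt^4" by (simp add: power_mult_distrib power_mult[symmetric])
 have w0: "sq G (resid0 dt) \<le> B2c^2 * dt^4" using w[of 0] unfolding e by simp
 have w1: "sq G (\<lambda>m. (\<i> * of_int m)^1 * resid0 dt m) \<le> B2c^2 * dt^4" using w[of 1] unfolding e by simp
 have BB: "2 * B2c^2 \<le> Bd^2" using Bd_ge(9) Bd_sq by linarith
 have "B2c^2 * dt^4 \<le> Bd^2 * dt^4"
 proof (rule mult_right_mono)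
  show "B2c^2 \<le> Bd^2" using BB zero_le_power2[of B2c] by linarith
 qed simp
 then show "sq G (resid0 dt) \<le> Bd^2 * dt^4" using w0 by linarith
 have "(\<Sum>m\<in>G. (1 + (of_int m)^2) * (cmod (resid0 dt m))^2) = sq G (resid0 dt) + sq G (\<lambda>m. (\<i> * of_int m)^1 * resid0 dt m)"
  by (simp add: sq_def sum.distrib[symmetric] norm_mult power_mult_distrib algebra_simps)
 also have "... \<le> 2 * B2c^2 * dt^4" using w0 w1 by simp
 also have "... \<le> Bd^2 * dt^3" using BB dt power_decreasing[of 3 4 dt] by (intro mult_mono) auto
 finally show "(\<Sum>m\<in>G. (1 + (of_int m)^2) * (cmod (resid0 dt m))^2) \<le> Bd^2 * dt^3" .
qed

end

section \<open>Error analysis of the scheme\<close>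

lemma low_subset_grid: "even N ==> low N \<subseteq> grid_idx N"
proof
 fix m assume N: "even N" and m: "m \<in> low N"
 then obtain h where h: "int N = 2 * h" by (metis even_of_nat evenE)
 show "m \<in> grid_idx N" using m unfolding low_def grid_idx_def h by auto
qed

lemma trig_low_real: "cnj (trig (low N) (fc (cr f)) x) = trig (low N) (fc (cr f)) x"
proof -
 have "cnj (trig (low N) (fc (cr f)) x) = (\<Sum>m\<in>low N. fc (cr f) (-m) * ek (-m) x)"
  by (simp add: trig_def cis_cnj fc_cnj_real)
 also have "... = trig (low N) (fc (cr f)) x"
  unfolding trig_def by (rule sum.reindex_bij_witness[of _ uminus uminus]) (auto simp: low_def)
 finally show ?thesis .
qed

lemma wsq_eq: "0 \<le> \<kappa> ==> wsq N \<kappa> e = (\<Sum>m\<in>grid_idx N. (1 + \<kappa> * (of_int m)^2) * (cmod (e m))^2)"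
 unfolding wsq_def sq_def norm_mult power_mult_distrib norm_of_real power2_abs by (simp add: wt_sq)

lemma wsq_nonneg: "0 \<le> wsq N \<kappa> e"
 by (simp add: wsq_def sq_nonneg)

lemma wsq_0: "wsq N 0 e = sq (grid_idx N) e"
 by (simp add: wsq_eq sq_def)

lemma wsq_add: "wsq N \<kappa> (\<lambda>m. f m + g m) \<le> 2 * wsq N \<kappa> f + 2 * wsq N \<kappa> g"
 unfolding wsq_def distrib_left by (rule sq_add_le)

lemma wsq_diff: "wsq N \<kappa> (\<lambda>m. f m - g m) \<le> 2 * wsq N \<kappa> f + 2 * wsq N \<kappa> g"
 unfolding wsq_def right_diff_distrib by (rule sq_diff_le)

lemma wsq_cong: "(\<And>m. m \<in> grid_idx N ==> f m = g m) ==> wsq N \<kappa> f = wsq N \<kappa> g"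
 unfolding wsq_def by (rule sq_cong) simp

lemma wsq_mult_le:
 assumes "0 \<le> \<kappa>" "\<And>m. m \<in> grid_idx N ==> (cmod (g m))^2 \<le> b"
 shows "wsq N \<kappa> (\<lambda>m. g m * f m) \<le> b * wsq N \<kappa> f"
proof -
 have "(1 + \<kappa> * (of_int m)^2) * (cmod (g m * f m))^2 \<le> b * ((1 + \<kappa> * (of_int m)^2) * (cmod (f m))^2)" if "m \<in> grid_idx N" for m
  using mult_right_mono[OF assms(2)[OF that], of "(1 + \<kappa> * (of_int m)^2) * (cmod (f m))^2"] assms(1)
  by (simp add: norm_mult power_mult_distrib mult_ac)
 then show ?thesis unfolding wsq_eq[OF assms(1)] sum_distrib_left by (rule sum_mono)
qed

lemma wsq_le_sq:
 assumes "0 \<le> \<kappa>" shows "wsq N \<kappa> f \<le> (1 + \<kappa> * (real N)^2) * sq (grid_idx N) f"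
proof -
 have "(real_of_int m)^2 \<le> (real N)^2" if "m \<in> grid_idx N" for m
 proof -
  have "\<bar>m\<bar> \<le> int N" using grid_bound[OF that] by linarith
  then have "\<bar>real_of_int m\<bar> \<le> \<bar>real N\<bar>" by linarith
  then show ?thesis by (simp only: abs_le_square_iff)
 qed
 then show ?thesis unfolding wsq_eq[OF assms] sq_def sum_distrib_left
  using assms by (intro sum_mono mult_right_mono add_left_mono mult_left_mono) auto
qed

text \<open>On the grid a derivative costs one power of \<open>N\<close> in the plain norm. In the first-order norm it costs none, and the factor \<open>N^2\<close> is what the
 weight of the product costs. Hence one bound serves both norms.\<close>
lemma derivative_cost:
 assumes k: "\<kappa> = 0 \<or> \<kappa> = 1" and N: "N > 0"
 shows "(1 + \<kappa> * (real N)^2) * sq (grid_idx N) (\<lambda>n. \<i> * of_int n * e n) \<le> 2 * (real N)^2 * wsq N \<kappa> e"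
proof -
 have s: "sq (grid_idx N) (\<lambda>n. \<i> * of_int n * e n) = (\<Sum>n\<in>grid_idx N. (of_int n)^2 * (cmod (e n))^2)"
  by (simp add: sq_def norm_mult power_mult_distrib)
 have N1: "1 \<le> (real N)^2" using N by (intro one_le_power) simp
 from k show ?thesis
 proof
  assume k0: "\<kappa> = 0"
  have "sq (grid_idx N) (\<lambda>n. \<i> * of_int n * e n) \<le> (real N)^2 * wsq N 0 e"
   unfolding wsq_0 s unfolding sq_def sum_distrib_left
  proof (intro sum_mono mult_right_mono)
   fix m assume "m \<in> grid_idx N"
   then have "\<bar>m\<bar> \<le> int N" using grid_bound by fastforce
   then have "\<bar>real_of_int m\<bar> \<le> \<bar>real N\<bar>" by linarith
   then show "(real_of_int m)^2 \<le> (real N)^2" by (simp only: abs_le_square_iff)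
  qed simp
  moreover have "0 \<le> (real N)^2 * wsq N 0 e" using wsq_nonneg[of N 0 e] by simp
  ultimately show ?thesis unfolding k0 by simp
 next
  assume k1: "\<kappa> = 1"
  have "sq (grid_idx N) (\<lambda>n. \<i> * of_int n * e n) \<le> wsq N 1 e"
   unfolding s wsq_eq[OF zero_le_one] by (intro sum_mono mult_right_mono) auto
  then have "(1 + (real N)^2) * sq (grid_idx N) (\<lambda>n. \<i> * of_int n * e n) \<le> (1 + (real N)^2) * wsq N 1 e"
   by (intro mult_left_mono) auto
  also have "... \<le> 2 * (real N)^2 * wsq N 1 e" using N1 by (intro mult_right_mono wsq_nonneg) simp
  finally show ?thesis by (simp add: k1)
 qed
qed

definition nlin :: "nat => real => (int => complex) => int => complex" where
 "nlin N a f = dft N (\<lambda>k. 1/2 * of_real (a^3) * (spectral_deriv N f k)^3)"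

text \<open>A run of the scheme next to an exact solution, known through its coefficients \<open>c\<close>, their time derivative \<open>c'\<close> and its space derivative \<open>u\<close>. Two pairs
 of bounds are kept apart: \<open>B\<close> and \<open>\<epsilon>\<close> determine stability and hence the mesh restrictions, \<open>D\<close> and \<open>\<delta>\<close> determine accuracy.\<close>
locale cn_run =
 fixes a T dt B \<epsilon> D \<delta> :: real and N :: nat and \<theta> u :: "real => real => real" and c c' :: "real => int => complex"
  and v :: "nat => int => complex"
 assumes N: "even N" "N > 0" and a: "a > 0" and dt: "dt > 0" and B: "B \<ge> 1" and T: "T \<ge> 0"
  and eps: "0 \<le> \<epsilon>" "\<epsilon> \<le> 1 / real N"
  and D: "B \<le> D" and delta: "0 \<le> \<delta>"
  and trunc_th: "\<And>t x. t \<in> {0..T} ==> cmod (of_real (\<theta> x t) - trig (low N) (c t) x) \<le> D * (\<delta> / (real N)^2)"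
  and trunc_u_fine: "\<And>t x. t \<in> {0..T} ==> cmod (of_real (u t x) - trig (low N) (\<lambda>m. \<i> * of_int m * c t m) x) \<le> D * \<delta>"
  and trunc_u: "\<And>t x. t \<in> {0..T} ==> cmod (of_real (u t x) - trig (low N) (\<lambda>m. \<i> * of_int m * c t m) x) \<le> B * \<epsilon>"
  and trunc_u2: "\<And>t x. t \<in> {0..T} ==> cmod (of_real ((u t x)^2) - trig (low N) (fc (cr (\<lambda>x. (u t x)^2))) x) \<le> B * \<epsilon>"
  and trunc_u3: "\<And>t x. t \<in> {0..T} ==> cmod (of_real ((u t x)^3) - trig (low N) (fc (cr (\<lambda>x. (u t x)^3))) x) \<le> D * \<delta>"
  and u_bound: "\<And>t x. t \<in> {0..T} ==> \<bar>u t x\<bar> \<le> B"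
  and u2_sum: "\<And>t. t \<in> {0..T} ==> (\<Sum>l\<in>low N. (1 + \<bar>of_int l\<bar>) * cmod (fc (cr (\<lambda>x. (u t x)^2)) l)) \<le> 2 * B"
  and u2_lip: "\<And>t s. t \<in> {0..T} ==> s \<in> {0..T} ==>
    (\<Sum>l\<in>low N. cmod (fc (cr (\<lambda>x. (u t x)^2)) l - fc (cr (\<lambda>x. (u s x)^2)) l)) \<le> B * \<bar>t - s\<bar>"
  and c': "\<And>t m. c' t m = of_real (a^3) * ((\<i> * of_int m)^3 * c t m + 1/2 * fc (cr (\<lambda>x. (u t x)^3)) m)"
  and init: "\<And>k. k \<in> grid_idx N ==> v 0 k = of_real (\<theta> (grid_pt N k) 0)"
  and step1: "\<And>m. m \<in> grid_idx N ==> dft N (v 1) m = dft N (v 0) m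
    + of_real dt * (- \<i> * of_real ((a * of_int m)^3) * dft N (v 0) m + nlin N a (v 0) m)"
  and step: "\<And>j m. 1 \<le> j ==> m \<in> grid_idx N ==> dft N (v (j+1)) m - dft N (v (j-1)) m
    + \<i> * of_real (dt * (a * of_int m)^3) * (dft N (v (j+1)) m + dft N (v (j-1)) m) = 2 * of_real dt * nlin N a (v j) m"
begin

abbreviation "G \<equiv> grid_idx N"

definition "e j m = dft N (v j) m - (if m \<in> low N then c (real j * dt) m else 0)"
definition "z j k = trig G (\<lambda>n. \<i> * of_int n * e j n) (grid_pt N k)"
definition "uw t k = trig (low N) (\<lambda>m. \<i> * of_int m * c t m) (grid_pt N k)"
definition "p2 t k = trig (low N) (fc (cr (\<lambda>x. (u t x)^2))) (grid_pt N k)"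
definition "p3 t k = trig (low N) (fc (cr (\<lambda>x. (u t x)^3))) (grid_pt N k)"
definition "b t k = of_real (3/2 * a^3) * p2 t k"
definition "\<beta> j = dft N (b (real j * dt))"
definition "q j k = of_real (3/2 * a^3) * ((uw (real j * dt) k)^2 - p2 (real j * dt) k)
  + of_real (3/2 * a^3) * (uw (real j * dt) k * z j k) + of_real (1/2 * a^3) * (z j k)^2"
definition "sp t k = of_real (1/2 * a^3) * ((uw t k)^3 - p3 t k)"

lemma N1: "1 \<le> real N" using N by simp

lemma low_G: "low N \<subseteq> G" using low_subset_grid N by blast

lemma w_split: "spectral_deriv N (v j) k = uw (real j * dt) k + z j k"
proof -
 have "uw (real j * dt) k = trig G (\<lambda>m. \<i> * of_int m * (if m \<in> low N then c (real j * dt) m else 0)) (grid_pt N k)"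
  unfolding uw_def trig_def using low_G by (intro sum.mono_neutral_cong_left) auto
 then have "uw (real j * dt) k + z j k = trig G (\<lambda>m. \<i> * of_int m * dft N (v j) m) (grid_pt N k)"
  unfolding z_def e_def trig_def by (simp add: sum.distrib[symmetric] algebra_simps)
 then show ?thesis by (simp add: spectral_deriv_def idft_alt)
qed

lemma dft_trig_low: "m \<in> G ==> dft N (\<lambda>k. trig (low N) y (grid_pt N k)) m = (if m \<in> low N then y m else 0)"
 by (rule dft_trig[OF N low_G])

lemma dft_z: "dft N (\<lambda>k. g k * z j k) m = (\<Sum>n\<in>G. dft N g (m - n) * (\<i> * of_int n * e j n))"
 unfolding z_def by (rule dft_mult_trig)

text \<open>The cubic nonlinearity is expanded around the truncated exact solution. The part linear in the error is
 written with the truncation of \<open>u^2\<close> as coefficient, because its discrete coefficients are exact.\<close>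
lemma nlin_split:
 assumes m: "m \<in> G"
 shows "nlin N a (v j) m = dft N (\<lambda>k. b (real j * dt) k * z j k) m + dft N (\<lambda>k. q j k * z j k) m + dft N (sp (real j * dt)) m
   + (if m \<in> low N then of_real (1/2 * a^3) * fc (cr (\<lambda>x. (u (real j * dt) x)^3)) m else 0)"
proof -
 have pt: "1/2 * of_real (a^3) * (spectral_deriv N (v j) k)^3
   = b (real j * dt) k * z j k + q j k * z j k + sp (real j * dt) k + of_real (1/2 * a^3) * p3 (real j * dt) k" for k
 proof -
  have alg: "1/2 * A * (p + y)^3 = (3/2 * A * P) * y + (3/2 * A * (p^2 - P) + 3/2 * A * (p * y) + 1/2 * A * y^2) * y
    + 1/2 * A * (p^3 - Q) + 1/2 * A * Q" for A p y P Q :: complex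
   by (simp add: field_simps power2_eq_square power3_eq_cube)
  show ?thesis unfolding w_split b_def q_def sp_def
   using alg[of "of_real (a^3)" "uw (real j * dt) k" "z j k" "p2 (real j * dt) k" "p3 (real j * dt) k"] by simp
 qed
 have "dft N (\<lambda>k. of_real (1/2 * a^3) * p3 (real j * dt) k) m
  = (if m \<in> low N then of_real (1/2 * a^3) * fc (cr (\<lambda>x. (u (real j * dt) x)^3)) m else 0)"
  unfolding dft_cmult p3_def dft_trig_low[OF m] by simp
 then show ?thesis unfolding nlin_def pt dft_add by simp
qed

definition "res t m = (c (t + dt) m - c (t - dt) m) / of_real (2 * dt) - c' t m
  - of_real (a^3) * ((\<i> * of_int m)^3 * ((c (t + dt) m + c (t - dt) m) / 2 - c t m))"
definition "res0 m = c dt m - c 0 m - of_real dt * c' 0 m"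
definition "cutoff f m = (if m \<in> low N then f m else 0 :: complex)"

lemma i_cube: "(\<i> * of_int m)^3 = - \<i> * of_real ((of_int m)^3)"
proof -
 have "(\<i> * of_int m)^3 = (\<i> * \<i>) * (\<i> * of_int (m^3))" by (simp add: power3_eq_cube mult_ac)
 then show ?thesis by simp
qed

lemma error_eq:
 assumes j: "1 \<le> j" and m: "m \<in> G"
 shows "e (j+1) m - e (j-1) m + \<i> * of_real (dt * (a * of_int m)^3) * (e (j+1) m + e (j-1) m)
   = 2 * of_real dt * ((\<Sum>n\<in>G. \<beta> j (m - n) * (\<i> * of_int n * e j n))
    + (dft N (\<lambda>k. q j k * z j k) m + (dft N (sp (real j * dt)) m - cutoff (res (real j * dt)) m)))"
proof -
 have tp: "real (j + 1) * dt = real j * dt + dt" "real (j - 1) * dt = real j * dt - dt"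
  using j by (auto simp: algebra_simps of_nat_diff)
 let ?t = "real j * dt"
 have ex: "2 * of_real dt * (of_real (1/2 * a^3) * fc (cr (\<lambda>x. (u ?t x)^3)) m) =
   c (?t + dt) m - c (?t - dt) m + \<i> * of_real (dt * (a * of_int m)^3) * (c (?t + dt) m + c (?t - dt) m) - 2 * of_real dt * res ?t m"
 proof -
  have alg: "2 * d * (1/2 * A * f) = p - p' + \<i> * (d * (A * M)) * (p + p')
    - 2 * d * ((p - p') / (2 * d) - A * (- \<i> * M * x + 1/2 * f) - A * (- \<i> * M * ((p + p') / 2 - x)))" if "d \<noteq> 0" for d A f p p' M x :: complex
   using that by (simp add: field_simps)
  show ?thesis
   unfolding res_def c' i_cube using alg[of "of_real dt" "of_real (a^3)" "fc (cr (\<lambda>x. (u ?t x)^3)) m" "c (?t + dt) m" "c (?t - dt) m" "of_real ((of_int m)^3)" "c ?t m"] dt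
   by (simp add: power_mult_distrib)
 qed
 have bz: "dft N (\<lambda>k. b ?t k * z j k) m = (\<Sum>n\<in>G. \<beta> j (m - n) * (\<i> * of_int n * e j n))"
  unfolding dft_z \<beta>_def ..
 show ?thesis
 proof (cases "m \<in> low N")
  case True
  have alg: "(Vp - p) - (Vm - p') + g * ((Vp - p) + (Vm - p')) = D * (x + (y + (s - r)))"
   if "Vp - Vm + g * (Vp + Vm) = D * (x + y + s + F)" "D * F = p - p' + g * (p + p') - D * r" for Vp Vm p p' g D x y s r F :: complex
   using that by algebra
  have "e (j+1) m = dft N (v (j+1)) m - c (?t + dt) m" "e (j-1) m = dft N (v (j-1)) m - c (?t - dt) m"
   using True unfolding e_def tp by simp_all
  then show ?thesis
   using alg[OF step[OF j m, unfolded nlin_split[OF m] bz if_P[OF True]] ex] True by (simp only: cutoff_def if_True)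
 next
  case False
  have "e (j+1) m = dft N (v (j+1)) m" "e (j-1) m = dft N (v (j-1)) m" using False unfolding e_def by simp_all
  then show ?thesis
   using step[OF j m, unfolded nlin_split[OF m] bz if_not_P[OF False]] False by (simp only: cutoff_def if_False add_0_right diff_0_right add.assoc)
 qed
qed

text \<open>The first step is explicit, so its phase factor \<open>1 - \<i> * \<gamma>\<close> is not bounded by one. It acts only on the initial error, which consists of aliasing
 and is smaller than the final rate by two powers of \<open>N\<close>.\<close>
lemma first_error:
 assumes m: "m \<in> G"
 shows "e 1 m = ((1 - \<i> * of_real (dt * (a * of_int m)^3)) * e 0 m + of_real dt * dft N (\<lambda>k. (b 0 k + q 0 k) * z 0 k) m)
   + (of_real dt * dft N (sp 0) m - cutoff res0 m)"
proof -
 have bq: "dft N (\<lambda>k. (b 0 k + q 0 k) * z 0 k) m = dft N (\<lambda>k. b 0 k * z 0 k) m + dft N (\<lambda>k. q 0 k * z 0 k) m"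
  unfolding distrib_right dft_add ..
 have s1: "dft N (v 1) m = dft N (v 0) m + of_real dt * (- \<i> * of_real ((a * of_int m)^3) * dft N (v 0) m
   + (dft N (\<lambda>k. b 0 k * z 0 k) m + dft N (\<lambda>k. q 0 k * z 0 k) m + dft N (sp 0) m
   + (if m \<in> low N then of_real (1/2 * a^3) * fc (cr (\<lambda>x. (u 0 x)^3)) m else 0)))"
  using step1[OF m] unfolding nlin_split[OF m] of_nat_0 mult_zero_left .
 show ?thesis
 proof (cases "m \<in> low N")
  case True
  have e: "e 1 m = dft N (v 1) m - c dt m" "e 0 m = dft N (v 0) m - c 0 m" using True by (simp_all add: e_def)
  have A: "\<i> * of_real (dt * (a * of_int m)^3) = of_real dt * (\<i> * (of_real (a^3) * of_real ((of_int m)^3)))"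
   "- \<i> * of_real ((a * of_int m)^3) = - \<i> * (of_real (a^3) * of_real ((of_int m)^3))"
   by (simp_all add: power_mult_distrib)
  show ?thesis unfolding e s1 bq A cutoff_def if_P[OF True] res0_def c' i_cube by (simp add: algebra_simps)
 next
  case False
  have e: "e 1 m = dft N (v 1) m" "e 0 m = dft N (v 0) m" using False by (simp_all add: e_def)
  show ?thesis unfolding e s1 bq cutoff_def if_not_P[OF False] by (simp add: algebra_simps)
 qed
qed

lemma uw_bounds:
 assumes t: "t \<in> {0..T}"
 shows "cmod (uw t k) \<le> 2 * B" "cmod ((uw t k)^2 - p2 t k) \<le> 4 * B^2 * \<epsilon>" "cmod ((uw t k)^3 - p3 t k) \<le> 8 * D^3 * \<delta>"
  "cmod (p2 t k) \<le> 2 * B^2"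
proof -
 let ?x = "grid_pt N k"
 let ?U = "complex_of_real (u t ?x)"
 have e1: "\<epsilon> \<le> 1" using eps(2) N1 by (meson divide_le_eq_1 le_less_trans not_le order_trans zero_less_one)
 have U: "cmod ?U \<le> B" using u_bound[OF t] by simp
 have d: "cmod (uw t k - ?U) \<le> B * \<epsilon>" using trunc_u[OF t, of ?x] by (simp add: uw_def norm_minus_commute)
 have Be: "B * \<epsilon> \<le> B" using B e1 mult_left_mono[of \<epsilon> 1 B] by simp
 show w: "cmod (uw t k) \<le> 2 * B"
  using norm_triangle_ineq[of "uw t k - ?U" ?U] U d Be by simp
 have B2: "B \<le> B^2" "B \<le> B^3" using B mult_left_mono[of 1 B B] by (auto simp: power2_eq_square intro: self_le_power)
 have "cmod ((uw t k)^2 - ?U^2) = cmod (uw t k - ?U) * cmod (uw t k + ?U)"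
  by (simp add: norm_mult[symmetric] power2_eq_square algebra_simps)
 also have "... \<le> (B * \<epsilon>) * (3 * B)" using d w U norm_triangle_ineq[of "uw t k" ?U] B eps by (intro mult_mono) auto
 finally have s2: "cmod ((uw t k)^2 - ?U^2) \<le> 3 * B^2 * \<epsilon>" by (simp add: power2_eq_square mult_ac)
 have t2: "cmod (?U^2 - p2 t k) \<le> B * \<epsilon>" using trunc_u2[OF t, of ?x] by (simp add: p2_def)
 have "B * \<epsilon> \<le> B^2 * \<epsilon>" using B2 eps by (intro mult_right_mono)
 then show "cmod ((uw t k)^2 - p2 t k) \<le> 4 * B^2 * \<epsilon>"
  using norm_triangle_ineq[of "(uw t k)^2 - ?U^2" "?U^2 - p2 t k"] s2 t2 by simp
 have D0: "0 \<le> D" "1 \<le> D" using B D by auto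
 have BD: "B^2 \<le> D^2" using B D by (intro power_mono) auto
 have D1: "D \<le> D^3" using D0 by (intro self_le_power) auto
 have d3: "cmod (uw t k - ?U) \<le> D * \<delta>" using trunc_u_fine[OF t, of ?x] by (simp add: uw_def norm_minus_commute)
 have "cmod ((uw t k)^3 - ?U^3) = cmod (uw t k - ?U) * cmod ((uw t k)^2 + uw t k * ?U + ?U^2)"
  by (simp add: norm_mult[symmetric] power2_eq_square power3_eq_cube algebra_simps)
 also have "... \<le> (D * \<delta>) * (7 * D^2)"
 proof (intro mult_mono d3)
  have "cmod ((uw t k)^2) \<le> (2 * B)^2" "cmod (?U^2) \<le> B^2" unfolding norm_power using power_mono[OF w, of 2] power_mono[OF U, of 2] by auto
  moreover have "cmod (uw t k * ?U) \<le> (2 * B) * B" unfolding norm_mult using w U B by (intro mult_mono) auto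
  ultimately show "cmod ((uw t k)^2 + uw t k * ?U + ?U^2) \<le> 7 * D^2"
   using BD norm_triangle_ineq[of "(uw t k)^2 + uw t k * ?U" "?U^2"] norm_triangle_ineq[of "(uw t k)^2" "uw t k * ?U"]
   by (simp add: power2_eq_square)
 qed (use D0 delta in auto)
 finally have s3: "cmod ((uw t k)^3 - ?U^3) \<le> 7 * D^3 * \<delta>" by (simp add: power2_eq_square power3_eq_cube mult_ac)
 have t3: "cmod (?U^3 - p3 t k) \<le> D * \<delta>" using trunc_u3[OF t, of ?x] by (simp add: p3_def)
 have "D * \<delta> \<le> D^3 * \<delta>" using D1 delta by (intro mult_right_mono)
 then show "cmod ((uw t k)^3 - p3 t k) \<le> 8 * D^3 * \<delta>"
  using norm_triangle_ineq[of "(uw t k)^3 - ?U^3" "?U^3 - p3 t k"] s3 t3 by simp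
 have "cmod (?U^2) \<le> B^2" unfolding norm_power using U by (intro power_mono) auto
 moreover have "cmod (p2 t k) \<le> cmod (?U^2) + cmod (?U^2 - p2 t k)"
  using norm_triangle_ineq4[of "?U^2" "?U^2 - p2 t k"] by simp
 ultimately show "cmod (p2 t k) \<le> 2 * B^2" using t2 Be B2 by linarith
qed

lemma sp_bound: "t \<in> {0..T} ==> cmod (sp t k) \<le> 4 * a^3 * D^3 * \<delta>"
 unfolding sp_def norm_mult norm_of_real
 using mult_left_mono[OF uw_bounds(3), of t "\<bar>1/2 * a^3\<bar>" k] a by (simp add: abs_mult mult_ac)

lemma b_bound: "t \<in> {0..T} ==> cmod (b t k) \<le> 3 * a^3 * B^2"
 unfolding b_def norm_mult norm_of_real
 using mult_left_mono[OF uw_bounds(4), of t "\<bar>3/2 * a^3\<bar>" k] a by (simp add: abs_mult mult_ac)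

text \<open>The coefficient \<open>q\<close> collects everything that multiplies the spectral derivative \<open>z\<close> of the error besides \<open>u^2\<close>; being of size \<open>1 / N\<close>, it compensates
 the derivative.\<close>
lemma q_bound:
 assumes t: "real j * dt \<in> {0..T}" and z: "real N * cmod (z j k) \<le> 1"
 shows "real N * cmod (q j k) \<le> 10 * a^3 * B^2"
proof -
 have B2: "B \<le> B^2" "1 \<le> B^2" using B mult_left_mono[of 1 B B] one_le_power[of B 2] by (auto simp: power2_eq_square)
 have z1: "cmod (z j k) \<le> 1" using z N1 mult_right_mono[of 1 "real N" "cmod (z j k)"] by simp
 have "real N * cmod ((uw (real j * dt) k)^2 - p2 (real j * dt) k) \<le> real N * (4 * B^2 * (1 / real N))"
  using uw_bounds(2)[OF t, of k] eps B by (intro mult_left_mono order_trans[OF uw_bounds(2)[OF t]]) auto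
 then have 1: "real N * cmod ((uw (real j * dt) k)^2 - p2 (real j * dt) k) \<le> 4 * B^2" using N by simp
 have "(real N * cmod (z j k)) * cmod (uw (real j * dt) k) \<le> 1 * (2 * B)"
  using z uw_bounds(1)[OF t] by (intro mult_mono) auto
 then have 2: "real N * cmod (uw (real j * dt) k * z j k) \<le> 2 * B" by (simp add: norm_mult mult_ac)
 have "(real N * cmod (z j k)) * cmod (z j k) \<le> 1 * 1" using z z1 by (intro mult_mono) auto
 then have 3: "real N * cmod ((z j k)^2) \<le> 1" by (simp add: norm_power norm_mult power2_eq_square mult_ac)
 have tri: "cmod (q j k) \<le> 3/2 * a^3 * cmod ((uw (real j * dt) k)^2 - p2 (real j * dt) k)
   + 3/2 * a^3 * cmod (uw (real j * dt) k * z j k) + 1/2 * a^3 * cmod ((z j k)^2)"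
 proof -
  have n: "cmod (of_real (3/2 * a^3) * y) = 3/2 * a^3 * cmod y" "cmod (of_real (1/2 * a^3) * y) = 1/2 * a^3 * cmod y" for y
   using a by (simp_all only: norm_mult norm_of_real abs_mult) simp_all
  show ?thesis unfolding q_def by (rule order_trans[OF norm_triangle_ineq add_mono[OF order_trans[OF norm_triangle_ineq]]]) (simp_all only: n order_refl)
 qed
 have "real N * cmod (q j k) \<le> 3/2 * a^3 * (real N * cmod ((uw (real j * dt) k)^2 - p2 (real j * dt) k))
   + 3/2 * a^3 * (real N * cmod (uw (real j * dt) k * z j k)) + 1/2 * a^3 * (real N * cmod ((z j k)^2))"
  using mult_left_mono[OF tri, of "real N"] by (simp add: algebra_simps)
 also have "... \<le> 3/2 * a^3 * (4 * B^2) + 3/2 * a^3 * (2 * B^2) + 1/2 * a^3 * B^2"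
  using 1 2 3 B2 a by (intro add_mono mult_left_mono) auto
 also have "... \<le> 10 * a^3 * B^2" using a by (simp add: algebra_simps)
 finally show ?thesis .
qed

lemma wsq_gz:
 assumes k: "\<kappa> = 0 \<or> \<kappa> = 1" and g: "\<And>k. k \<in> G ==> cmod (g k) \<le> Q"
 shows "wsq N \<kappa> (dft N (\<lambda>k. g k * z j k)) \<le> 2 * (real N * Q)^2 * wsq N \<kappa> (e j)"
proof -
 have k0: "0 \<le> \<kappa>" using k by auto
 have Q: "(cmod (g i))^2 \<le> Q^2" if "i \<in> G" for i using g[OF that] by (intro power_mono) auto
 have "sq G (\<lambda>k. g k * z j k) \<le> Q^2 * sq G (z j)"
  unfolding sq_def norm_mult power_mult_distrib sum_distrib_left using Q by (intro sum_mono mult_right_mono) auto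
 also have "sq G (z j) = real N * sq G (\<lambda>n. \<i> * of_int n * e j n)"
  unfolding trig_parseval[OF N, symmetric] by (rule sq_cong) (simp add: z_def)
 finally have "sq G (dft N (\<lambda>k. g k * z j k)) \<le> Q^2 * sq G (\<lambda>n. \<i> * of_int n * e j n)"
  unfolding dft_parseval[OF N] using N by (simp add: divide_le_eq mult_ac)
 then have "(1 + \<kappa> * (real N)^2) * sq G (dft N (\<lambda>k. g k * z j k)) \<le> (1 + \<kappa> * (real N)^2) * (Q^2 * sq G (\<lambda>n. \<i> * of_int n * e j n))"
  using k0 by (intro mult_left_mono) auto
 also have "... = Q^2 * ((1 + \<kappa> * (real N)^2) * sq G (\<lambda>n. \<i> * of_int n * e j n))" by simp
 also have "... \<le> Q^2 * (2 * (real N)^2 * wsq N \<kappa> (e j))" by (intro mult_left_mono derivative_cost k N) simp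
 finally show ?thesis using wsq_le_sq[OF k0, of N "dft N (\<lambda>k. g k * z j k)"] by (simp add: power_mult_distrib mult_ac)
qed
definition "Ms = 1 + 3 * a^3 * B + 400 * (a^3)^2 * B^4"
definition "C1 = 64 * (a^3)^2 * D^6 + 4 * D^2"
definition "C2 = 4 * ((1 + (a^3)^2) * D^2 + 338 * (a^3)^2 * D^6 + 16 * (a^3)^2 * D^6 + D^2)"
definition "Cst = exp (32 * stab_const a Ms * T) * (4 * (C2 + D^2) + 16 * T * C1) + C2 + D^2"

lemma Ms1: "1 \<le> Ms" using a B by (simp add: Ms_def)

lemma BD: "B^2 \<le> D^2" using B D by (intro power_mono) auto

context
 fixes \<kappa> \<eta> E :: real
 assumes k: "\<kappa> = 0 \<or> \<kappa> = 1" and eta: "0 \<le> \<eta>" and E: "E = (1 + \<kappa> * (real N)^2) * \<delta>^2"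
  and cons: "\<And>t. dt \<le> t ==> t + dt \<le> T ==> (\<Sum>m\<in>low N. (1 + \<kappa> * (of_int m)^2) * (cmod (res t m))^2) \<le> D^2 * \<eta>"
  and cons0: "dt \<le> T ==> (\<Sum>m\<in>low N. (1 + \<kappa> * (of_int m)^2) * (cmod (res0 m))^2) \<le> D^2 * \<eta>"
  and cfl: "64 * dt * real N * Ms \<le> 1" "512 * Ms \<le> a^3 * (real N)^2" "16 * stab_const a Ms * dt \<le> 1"
begin

lemma k0: "0 \<le> \<kappa>" using k by auto

lemma E0: "0 \<le> E" using E k0 by simp

lemma wsq_cutoff: "wsq N \<kappa> (cutoff f) = (\<Sum>m\<in>low N. (1 + \<kappa> * (of_int m)^2) * (cmod (f m))^2)"
 unfolding wsq_eq[OF k0] using low_G by (intro sum.mono_neutral_cong_right) (auto simp: cutoff_def)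

lemma wsq_sup:
 assumes "\<And>k. k \<in> G ==> cmod (g k) \<le> d * \<delta>"
 shows "wsq N \<kappa> (dft N g) \<le> d^2 * E"
proof -
 have "wsq N \<kappa> (dft N g) \<le> (1 + \<kappa> * (real N)^2) * sq G (dft N g)" by (rule wsq_le_sq[OF k0])
 also have "... \<le> (1 + \<kappa> * (real N)^2) * (d * \<delta>)^2" using k0 by (intro mult_left_mono dft_sup[OF N assms]) auto
 finally show ?thesis by (simp add: E power_mult_distrib mult_ac)
qed

lemma dtN: "dt * real N \<le> 1" "dt \<le> 1"
proof -
 have "dt * real N * 1 \<le> dt * real N * Ms" using Ms1 dt by (intro mult_left_mono) auto
 then show 1: "dt * real N \<le> 1" using cfl(1) by linarith
 have "dt * 1 \<le> dt * real N" using N1 dt by (intro mult_left_mono) auto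
 then show "dt \<le> 1" using 1 by linarith
qed

lemma error0: "wsq N \<kappa> (e 0) \<le> D^2 * E / (real N)^4" "wsq N \<kappa> (e 0) \<le> D^2 * E"
proof -
 have "dft N (\<lambda>k. v 0 k - trig (low N) (c 0) (grid_pt N k)) m = e 0 m" if "m \<in> G" for m
  unfolding dft_diff dft_trig_low[OF that] by (simp add: e_def)
 then have "wsq N \<kappa> (e 0) = wsq N \<kappa> (dft N (\<lambda>k. v 0 k - trig (low N) (c 0) (grid_pt N k)))" by (intro wsq_cong) simp
 also have "... \<le> (D / (real N)^2)^2 * E"
  using T init trunc_th[of 0] by (intro wsq_sup) simp
 also have "... = D^2 * E / (real N)^4" by (simp add: power_divide power_mult[symmetric])
 finally show 1: "wsq N \<kappa> (e 0) \<le> D^2 * E / (real N)^4" .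
 have "D^2 * E / (real N)^4 \<le> D^2 * E / 1" using E0 N1 by (intro divide_left_mono) (auto intro: one_le_power)
 then show "wsq N \<kappa> (e 0) \<le> D^2 * E" using 1 by simp
qed

lemma error1:
 assumes dT: "dt \<le> T" and zs: "\<And>k. k \<in> G ==> real N * cmod (z 0 k) \<le> 1"
 shows "wsq N \<kappa> (e 1) \<le> C2 * (E + \<eta>)"
proof -
 let ?x1 = "\<lambda>m. (1 - \<i> * of_real (dt * (a * of_int m)^3)) * e 0 m"
 let ?x2 = "\<lambda>m. of_real dt * dft N (\<lambda>k. (b 0 k + q 0 k) * z 0 k) m"
 let ?x3 = "\<lambda>m. of_real dt * dft N (sp 0) m"
 have t0: "(0::real) \<in> {0..T}" using T by simp
 have cdt: "(cmod (of_real dt))^2 \<le> dt^2" for m :: int by simp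
 have dt1: "dt^2 \<le> 1" using dtN dt by (simp add: power_le_one)
 have 1: "wsq N \<kappa> ?x1 \<le> (1 + (a^3)^2) * D^2 * E"
 proof -
  have "(cmod (1 - \<i> * of_real (dt * (a * of_int m)^3)))^2 \<le> (1 + (a^3)^2) * (real N)^4" if "m \<in> G" for m
  proof -
   have "\<bar>m\<bar> \<le> int N" using grid_bound[OF that] by linarith
   then have "\<bar>real_of_int m\<bar> \<le> real N" by linarith
   then have "\<bar>real_of_int m\<bar>^3 \<le> (real N)^3" by (intro power_mono) auto
   then have "(dt * real N) * a^3 * \<bar>real_of_int m\<bar>^3 \<le> 1 * a^3 * (real N)^3"
    using dtN a dt by (intro mult_mono) auto
   then have "real N * (dt * (a^3 * \<bar>real_of_int m\<bar>^3)) \<le> real N * (a^3 * (real N)^2)"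
    by (simp add: power2_eq_square power3_eq_cube mult_ac)
   then have "dt * (a^3 * \<bar>real_of_int m\<bar>^3) \<le> a^3 * (real N)^2" using N1 by (simp only: mult_le_cancel_left)
   then have "\<bar>dt * (a * of_int m)^3\<bar> \<le> a^3 * (real N)^2" using dt a by (simp add: abs_mult power_mult_distrib power_abs)
   then have "(dt * (a * of_int m)^3)^2 \<le> (a^3 * (real N)^2)^2" using power_mono[of "\<bar>dt * (a * of_int m)^3\<bar>" _ 2] by simp
   also have "... = (a^3)^2 * (real N)^4" unfolding power_mult_distrib[of "a^3"] by (simp only: power_mult[symmetric]) simp
   finally have g: "(dt * (a * of_int m)^3)^2 \<le> (a^3)^2 * (real N)^4" .
   have "1 \<le> (real N)^4" using N1 by (rule one_le_power)
   moreover have "(cmod (1 - \<i> * of_real (dt * (a * of_int m)^3)))^2 = 1 + (dt * (a * of_int m)^3)^2"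
    unfolding cmod_power2 by simp
   ultimately show ?thesis using g by (simp only: distrib_right mult_1)
  qed
  then have "wsq N \<kappa> ?x1 \<le> (1 + (a^3)^2) * (real N)^4 * wsq N \<kappa> (e 0)" by (intro wsq_mult_le[OF k0])
  also have "... \<le> (1 + (a^3)^2) * (real N)^4 * (D^2 * E / (real N)^4)" by (intro mult_left_mono error0) auto
  also have "... = (1 + (a^3)^2) * D^2 * E" using N by simp
  finally show ?thesis .
 qed
 have 2: "wsq N \<kappa> ?x2 \<le> 338 * (a^3)^2 * D^6 * E"
 proof -
  let ?Q = "13 * a^3 * D^2"
  have "wsq N \<kappa> (dft N (\<lambda>k. (b 0 k + q 0 k) * z 0 k)) \<le> 2 * (real N * ?Q)^2 * wsq N \<kappa> (e 0)"
  proof (rule wsq_gz[OF k])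
   fix k assume "k \<in> G"
   then have "real N * cmod (q 0 k) \<le> 10 * a^3 * B^2" using q_bound[of 0 k] zs t0 by simp
   moreover have "1 * cmod (q 0 k) \<le> real N * cmod (q 0 k)" using N1 by (intro mult_right_mono) auto
   ultimately have "cmod (b 0 k + q 0 k) \<le> 13 * a^3 * B^2" using norm_triangle_ineq[of "b 0 k" "q 0 k"] b_bound[OF t0, of k] by simp
   also have "... \<le> ?Q" using a by (intro mult_left_mono BD) auto
   finally show "cmod (b 0 k + q 0 k) \<le> ?Q" .
  qed
  then have "dt^2 * wsq N \<kappa> (dft N (\<lambda>k. (b 0 k + q 0 k) * z 0 k)) \<le> dt^2 * (2 * (real N * ?Q)^2 * wsq N \<kappa> (e 0))" by (rule mult_left_mono) simp
  also have "... = (dt * real N)^2 * (2 * ?Q^2 * wsq N \<kappa> (e 0))" by (simp add: power_mult_distrib)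
  also have "... \<le> 1 * (2 * ?Q^2 * (D^2 * E))"
   using dtN dt error0(2) wsq_nonneg[of N \<kappa> "e 0"] by (intro mult_mono power_le_one) auto
  also have "... = 338 * (a^3)^2 * D^6 * E" by (simp add: power_mult_distrib power_mult[symmetric] power2_eq_square[of D] eval_nat_numeral)
  finally show ?thesis using wsq_mult_le[OF k0, of N "\<lambda>m. of_real dt" "dt^2" "dft N (\<lambda>k. (b 0 k + q 0 k) * z 0 k)"] by simp
 qed
 have sp: "wsq N \<kappa> (dft N (sp 0)) \<le> (4 * a^3 * D^3)^2 * E" by (rule wsq_sup[OF sp_bound[OF t0]])
 have 3: "wsq N \<kappa> ?x3 \<le> 16 * (a^3)^2 * D^6 * E"
 proof -
  have "wsq N \<kappa> ?x3 \<le> dt^2 * wsq N \<kappa> (dft N (sp 0))" by (rule wsq_mult_le[OF k0]) simp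
  also have "... \<le> 1 * ((4 * a^3 * D^3)^2 * E)" using sp dt1 wsq_nonneg[of N \<kappa> "dft N (sp 0)"] by (intro mult_mono) auto
  finally show ?thesis by (simp add: power_mult_distrib power_mult[symmetric])
 qed
 have 4: "wsq N \<kappa> (cutoff res0) \<le> D^2 * \<eta>" using cons0[OF dT] unfolding wsq_cutoff .
 have "wsq N \<kappa> (e 1) = wsq N \<kappa> (\<lambda>m. (?x1 m + ?x2 m) + (?x3 m - cutoff res0 m))" by (rule wsq_cong) (rule first_error)
 also have "... \<le> 2 * wsq N \<kappa> (\<lambda>m. ?x1 m + ?x2 m) + 2 * wsq N \<kappa> (\<lambda>m. ?x3 m - cutoff res0 m)" by (rule wsq_add)
 also have "... \<le> 2 * (2 * wsq N \<kappa> ?x1 + 2 * wsq N \<kappa> ?x2) + 2 * (2 * wsq N \<kappa> ?x3 + 2 * wsq N \<kappa> (cutoff res0))"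
  by (intro add_mono mult_left_mono wsq_add wsq_diff) auto
 also have "... \<le> 4 * ((1 + (a^3)^2) * D^2 * E + 338 * (a^3)^2 * D^6 * E + 16 * (a^3)^2 * D^6 * E + D^2 * \<eta>)"
 proof -
  have "2 * (2 * x1 + 2 * x2) + 2 * (2 * x3 + 2 * x4) \<le> 4 * (y1 + y2 + y3 + y4)"
   if "x1 \<le> y1" "x2 \<le> y2" "x3 \<le> y3" "x4 \<le> y4" for x1 x2 x3 x4 y1 y2 y3 y4 :: real
  proof -
   have "x1 + x2 + x3 + x4 \<le> y1 + y2 + y3 + y4" by (intro add_mono that)
   then show ?thesis by simp
  qed
  from this[OF 1 2 3 4] show ?thesis .
 qed
 also have "... \<le> C2 * (E + \<eta>)"
 proof -
  define P where "P = (1 + (a^3)^2) * D^2 + 338 * (a^3)^2 * D^6 + 16 * (a^3)^2 * D^6"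
  have "0 \<le> P" by (simp add: P_def)
  then have "0 \<le> P * \<eta> + D^2 * E" using eta E0 by simp
  then have "4 * (P * E + D^2 * \<eta>) \<le> 4 * (P + D^2) * (E + \<eta>)" by (simp add: algebra_simps)
  then show ?thesis by (simp add: P_def C2_def algebra_simps)
 qed
 finally show ?thesis .
qed

lemma C_nonneg: "0 \<le> C1" "0 \<le> C2" "0 \<le> Cst" "C2 + D^2 \<le> Cst"
proof -
 show 1: "0 \<le> C1" "0 \<le> C2" by (simp_all add: C1_def C2_def)
 then have "0 \<le> exp (32 * stab_const a Ms * T) * (4 * (C2 + D^2) + 16 * T * C1)" using T by simp
 then show "0 \<le> Cst" "C2 + D^2 \<le> Cst" using 1 by (simp_all add: Cst_def)
qed

lemma error_bound_0: "wsq N \<kappa> (e 0) \<le> Cst * (E + \<eta>)"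
proof -
 have "D^2 * E \<le> Cst * (E + \<eta>)" using C_nonneg E0 eta by (intro mult_mono) auto
 then show ?thesis using error0(2) by linarith
qed

text \<open>The nonlinear remainder \<open>R\<close> is bounded by the error itself as long as the spectral derivative of the error stays below \<open>1 / N\<close>; the
 consistency errors form the constant forcing.\<close>
theorem error_bound:
 assumes j: "real (j + 1) * dt \<le> T" and zs: "\<And>i k. i \<le> j ==> k \<in> G ==> real N * cmod (z i k) \<le> 1"
 shows "wsq N \<kappa> (e (j + 1)) \<le> Cst * (E + \<eta>)"
proof -
 have jt: "real i * dt \<in> {0..T}" if "i \<le> j" for i
 proof -
  have "real i * dt \<le> real (j + 1) * dt" using that dt by (intro mult_right_mono) auto
  from order_trans[OF this j] show ?thesis using dt by simp
 qed
 let ?R = "\<lambda>i m. dft N (\<lambda>k. q i k * z i k) m + (dft N (sp (real i * dt)) m - cutoff (res (real i * dt)) m)"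
 have bet: "\<beta> i l = of_real (3/2 * a^3) * (if l \<in> low N then fc (cr (\<lambda>x. (u (real i * dt) x)^2)) l else 0)" if "l \<in> G" for i l
  unfolding \<beta>_def b_def dft_cmult p2_def dft_trig_low[OF that] ..
 have stab: "wsq N \<kappa> (e (j + 1)) + wsq N \<kappa> (e j) \<le> exp (32 * stab_const a Ms * (dt * real j))
   * (4 * (wsq N \<kappa> (e 1) + wsq N \<kappa> (e 0)) + 16 * (dt * real j) * (C1 * (E + \<eta>)))"
 proof (rule grid_stability[where \<beta> = \<beta> and R = ?R and J = j, OF k N a dt Ms1])
  show "0 \<le> C1 * (E + \<eta>)" using C_nonneg E0 eta by simp
  show "\<beta> i (l + int N) = \<beta> i l" for i l unfolding \<beta>_def by (rule dft_periodic[OF N(2)])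
  show "\<beta> i (- l) = cnj (\<beta> i l)" for i l unfolding \<beta>_def
   by (rule dft_cnj) (simp only: b_def p2_def complex_cnj_mult complex_cnj_complex_of_real trig_low_real)
  show "(\<Sum>l\<in>G. (1 + \<bar>of_int l\<bar>) * cmod (\<beta> i l)) \<le> Ms" if i: "i \<le> j" for i
  proof -
   have "(\<Sum>l\<in>G. (1 + \<bar>of_int l\<bar>) * cmod (\<beta> i l)) = (\<Sum>l\<in>low N. 3/2 * a^3 * ((1 + \<bar>of_int l\<bar>) * cmod (fc (cr (\<lambda>x. (u (real i * dt) x)^2)) l)))"
    using low_G a by (intro sum.mono_neutral_cong_right) (auto simp: bet norm_mult simp del: of_real_mult of_real_power)
   also have "... \<le> 3/2 * a^3 * (2 * B)"
    unfolding sum_distrib_left[symmetric] using u2_sum[OF jt[OF i]] a by (intro mult_left_mono) auto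
   also have "... \<le> Ms" by (simp add: Ms_def)
   finally show ?thesis .
  qed
  show "(\<Sum>l\<in>G. cmod (\<beta> (i - 1) l - \<beta> i l)) \<le> Ms * dt" if i: "1 \<le> i" "i \<le> j" for i
  proof -
   have low: "cmod (\<beta> (i - 1) l - \<beta> i l) = 3/2 * a^3 * cmod (fc (cr (\<lambda>x. (u (real (i - 1) * dt) x)^2)) l - fc (cr (\<lambda>x. (u (real i * dt) x)^2)) l)"
    if l: "l \<in> low N" for l
   proof -
    have ab: "\<bar>3/2 * a^3\<bar> = 3/2 * a^3" using a by simp
    show ?thesis
     unfolding bet[OF subsetD[OF low_G l]] if_P[OF l] right_diff_distrib[symmetric] norm_mult norm_of_real ab ..
   qed
   have "(\<Sum>l\<in>G. cmod (\<beta> (i - 1) l - \<beta> i l)) = (\<Sum>l\<in>low N. 3/2 * a^3 * cmod (fc (cr (\<lambda>x. (u (real (i - 1) * dt) x)^2)) l - fc (cr (\<lambda>x. (u (real i * dt) x)^2)) l))"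
    using low_G a by (intro sum.mono_neutral_cong_right) (auto simp: bet low simp del: of_real_mult of_real_power One_nat_def)
   also have "... \<le> 3/2 * a^3 * (B * \<bar>real (i - 1) * dt - real i * dt\<bar>)"
    unfolding sum_distrib_left[symmetric] using i a by (intro mult_left_mono u2_lip jt) auto
   also have "\<bar>real (i - 1) * dt - real i * dt\<bar> = dt" using i dt by (simp add: of_nat_diff algebra_simps)
   also have "3/2 * a^3 * (B * dt) = (3/2 * a^3 * B) * dt" by simp
   also have "... \<le> Ms * dt"
   proof (rule mult_right_mono)
    have "0 \<le> a^3 * B" "0 \<le> (a^3)^2 * B^4" using a B by auto
    then show "3/2 * a^3 * B \<le> Ms" unfolding Ms_def by linarith
   qed (use dt in simp)
   finally show ?thesis .
  qed
  show "e (i+1) m - e (i-1) m + \<i> * of_real (dt * (a * of_int m)^3) * (e (i+1) m + e (i-1) m)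
     = 2 * of_real dt * ((\<Sum>n\<in>G. \<beta> i (m - n) * (\<i> * of_int n * e i n)) + ?R i m)" if "1 \<le> i" "i \<le> j" "m \<in> G" for i m
   by (rule error_eq[OF that(1,3)])
  show "wsq N \<kappa> (?R i) \<le> Ms * wsq N \<kappa> (e i) + C1 * (E + \<eta>)" if i: "1 \<le> i" "i \<le> j" for i
  proof -
   have "wsq N \<kappa> (dft N (\<lambda>k. q i k * z i k)) \<le> 2 * (real N * (10 * a^3 * B^2 / real N))^2 * wsq N \<kappa> (e i)"
   proof (rule wsq_gz[OF k])
    fix k assume "k \<in> G"
    then show "cmod (q i k) \<le> 10 * a^3 * B^2 / real N"
     using q_bound[OF jt[OF i(2)] zs[OF i(2)], of k] N by (simp add: le_divide_eq mult.commute)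
   qed
   also have "real N * (10 * a^3 * B^2 / real N) = 10 * a^3 * B^2" using N by simp
   finally have 1: "wsq N \<kappa> (dft N (\<lambda>k. q i k * z i k)) \<le> 200 * (a^3)^2 * B^4 * wsq N \<kappa> (e i)"
    by (simp add: power_mult_distrib power_mult[symmetric])
   have "wsq N \<kappa> (dft N (sp (real i * dt))) \<le> (4 * a^3 * D^3)^2 * E" by (rule wsq_sup[OF sp_bound[OF jt[OF i(2)]]])
   then have 2: "wsq N \<kappa> (dft N (sp (real i * dt))) \<le> 16 * (a^3)^2 * D^6 * E" by (simp add: power_mult_distrib power_mult[symmetric])
   have "1 * dt \<le> real i * dt" "(real i + 1) * dt \<le> real (j + 1) * dt" using i dt by (intro mult_right_mono; simp)+
   then have 3: "wsq N \<kappa> (cutoff (res (real i * dt))) \<le> D^2 * \<eta>"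
    unfolding wsq_cutoff using j by (intro cons) (auto simp: distrib_right)
   have "wsq N \<kappa> (?R i) \<le> 2 * wsq N \<kappa> (dft N (\<lambda>k. q i k * z i k)) + 2 * (2 * wsq N \<kappa> (dft N (sp (real i * dt))) + 2 * wsq N \<kappa> (cutoff (res (real i * dt))))"
    by (rule order_trans[OF wsq_add add_left_mono[OF mult_left_mono[OF wsq_diff]]]) simp
   also have "... \<le> 400 * (a^3)^2 * B^4 * wsq N \<kappa> (e i) + (64 * (a^3)^2 * D^6 * E + 4 * D^2 * \<eta>)"
   proof -
    have "2 * x + 2 * (2 * y + 2 * w) \<le> 2 * x' + (4 * y' + 4 * w')" if "x \<le> x'" "y \<le> y'" "w \<le> w'" for x y w x' y' w' :: real
    proof -
     have "x + (2 * y + 2 * w) \<le> x' + (2 * y' + 2 * w')" by (intro add_mono mult_left_mono that) auto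
     then show ?thesis by simp
    qed
    from this[OF 1 2 3] show ?thesis by (simp add: mult.assoc)
   qed
   also have "... \<le> Ms * wsq N \<kappa> (e i) + C1 * (E + \<eta>)"
   proof (intro add_mono mult_right_mono wsq_nonneg)
    show "400 * (a^3)^2 * B^4 \<le> Ms" using a B by (simp add: Ms_def)
    have "0 \<le> 64 * (a^3)^2 * D^6 * \<eta> + 4 * D^2 * E" using eta E0 B by simp
    then show "64 * (a^3)^2 * D^6 * E + 4 * D^2 * \<eta> \<le> C1 * (E + \<eta>)" by (simp add: C1_def algebra_simps)
   qed
   finally show ?thesis .
  qed
 qed (use cfl in auto)
 have d: "dt * real j \<le> T" "0 \<le> dt * real j" using jt[of j] dt by (auto simp: mult.commute)
 have "1 * dt \<le> real (j + 1) * dt" using dt by (intro mult_right_mono) auto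
 then have dT: "dt \<le> T" using j by simp
 have s0: "0 \<le> stab_const a Ms" using Ms1 a by (simp add: stab_const_def)
 have 4: "4 * (wsq N \<kappa> (e 1) + wsq N \<kappa> (e 0)) \<le> 4 * (C2 + D^2) * (E + \<eta>)"
 proof -
  have "D^2 * E \<le> D^2 * (E + \<eta>)" using eta by (intro mult_left_mono) auto
  then show ?thesis using error1[OF dT zs] error0(2) by (simp add: distrib_right)
 qed
 have "exp (32 * stab_const a Ms * (dt * real j)) * (4 * (wsq N \<kappa> (e 1) + wsq N \<kappa> (e 0)) + 16 * (dt * real j) * (C1 * (E + \<eta>)))
   \<le> exp (32 * stab_const a Ms * T) * (4 * (C2 + D^2) * (E + \<eta>) + 16 * T * (C1 * (E + \<eta>)))"
 proof (rule mult_mono)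
  show "exp (32 * stab_const a Ms * (dt * real j)) \<le> exp (32 * stab_const a Ms * T)"
   using s0 d by (simp add: mult_left_mono)
  have EC: "0 \<le> C1 * (E + \<eta>)" using C_nonneg E0 eta by simp
  have "16 * (dt * real j) * (C1 * (E + \<eta>)) \<le> 16 * T * (C1 * (E + \<eta>))"
   using d EC by (intro mult_right_mono) auto
  then show "4 * (wsq N \<kappa> (e 1) + wsq N \<kappa> (e 0)) + 16 * (dt * real j) * (C1 * (E + \<eta>))
    \<le> 4 * (C2 + D^2) * (E + \<eta>) + 16 * T * (C1 * (E + \<eta>))" using 4 by (rule add_mono[rotated])
  show "0 \<le> 4 * (wsq N \<kappa> (e 1) + wsq N \<kappa> (e 0)) + 16 * (dt * real j) * (C1 * (E + \<eta>))"
  proof (rule add_nonneg_nonneg)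
   show "0 \<le> 4 * (wsq N \<kappa> (e 1) + wsq N \<kappa> (e 0))" using wsq_nonneg[of N \<kappa> "e 1"] wsq_nonneg[of N \<kappa> "e 0"] by simp
   show "0 \<le> 16 * (dt * real j) * (C1 * (E + \<eta>))" using d EC by (intro mult_nonneg_nonneg[OF _ EC]) auto
  qed
 qed simp
 also have "... = exp (32 * stab_const a Ms * T) * (4 * (C2 + D^2) + 16 * T * C1) * (E + \<eta>)" by (simp add: algebra_simps)
 also have "... \<le> Cst * (E + \<eta>)" using C_nonneg E0 eta by (intro mult_right_mono) (auto simp: Cst_def)
 finally show ?thesis using stab wsq_nonneg[of N \<kappa> "e j"] by linarith
qed

end

lemma z_small:
 assumes w: "wsq N 1 (e j) \<le> 1 / (real N)^3"
 shows "real N * cmod (z j k) \<le> 1"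
proof -
 have "cmod (z j k) \<le> (\<Sum>n\<in>G. 1 * (\<bar>of_int n\<bar> * cmod (e j n)))"
  unfolding z_def trig_def by (rule order_trans[OF norm_sum]) (simp add: norm_mult)
 \<comment> \<open>Cauchy-Schwarz over the \<open>N\<close> grid modes.\<close>
 then have "(cmod (z j k))^2 \<le> (\<Sum>n\<in>G. 1 * (\<bar>of_int n\<bar> * cmod (e j n)))^2" by (intro power_mono) auto
 also have "... \<le> (\<Sum>n\<in>G. 1^2) * (\<Sum>n\<in>G. (\<bar>of_int n\<bar> * cmod (e j n))^2)" by (rule Cauchy_Schwarz_ineq_sum)
 also have "... \<le> real N * wsq N 1 (e j)"
  unfolding wsq_eq[OF zero_le_one] using card_grid[OF N(1)] by (auto intro!: mult_left_mono sum_mono simp: power_mult_distrib distrib_right)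
 also have "... \<le> real N * (1 / (real N)^3)" using w by (intro mult_left_mono) auto
 finally have "(real N * cmod (z j k))^2 \<le> (real N)^2 * (real N * (1 / (real N)^3))"
  unfolding power_mult_distrib by (intro mult_left_mono) auto
 also have "... = 1^2" using N by (simp add: power2_eq_square power3_eq_cube)
 finally show ?thesis by (rule power2_le_imp_le) simp
qed

text \<open>Continuation: as long as the first-order norm of the error is below \<open>N powr (-3/2)\<close>, the error in the spectral
 derivative is below \<open>1/N\<close> and the quadratic terms are harmless; the resulting bound, a multiple of
 \<open>N powr (-5) + dt powr (3/2)\<close>, is again below \<open>N powr (-3/2)\<close> for large \<open>N\<close> and small \<open>dt * N\<close>.\<close>
theorem bootstrap:
 assumes cons: "\<And>t. dt \<le> t ==> t + dt \<le> T ==> (\<Sum>m\<in>low N. (1 + 1 * (of_int m)^2) * (cmod (res t m))^2) \<le> D^2 * dt^3"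
  and cons0: "dt \<le> T ==> (\<Sum>m\<in>low N. (1 + 1 * (of_int m)^2) * (cmod (res0 m))^2) \<le> D^2 * dt^3"
  and cfl: "64 * dt * real N * Ms \<le> 1" "512 * Ms \<le> a^3 * (real N)^2" "16 * stab_const a Ms * dt \<le> 1"
  and small: "Cst * ((1 + 1 * (real N)^2) * \<delta>^2 + dt^3) \<le> 1 / (real N)^3"
 shows "real j * dt \<le> T ==> real N * cmod (z j k) \<le> 1"
proof -
 have d3: "0 \<le> dt^3" using dt by simp
 have eb: "wsq N 1 (e (i + 1)) \<le> Cst * ((1 + 1 * (real N)^2) * \<delta>^2 + dt^3)"
  if "real (i + 1) * dt \<le> T" "\<And>l k. l \<le> i ==> real N * cmod (z l k) \<le> 1" for i
  by (rule error_bound[OF disjI2[OF refl] d3 refl _ _ cfl that(1)]) (use cons cons0 that in auto)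
 have eb0: "wsq N 1 (e 0) \<le> Cst * ((1 + 1 * (real N)^2) * \<delta>^2 + dt^3)"
  by (rule error_bound_0[OF disjI2[OF refl] d3 refl _ _ cfl]) (use cons cons0 in auto)
 have "real j * dt \<le> T ==> wsq N 1 (e j) \<le> 1 / (real N)^3" for j
 proof (induction j rule: less_induct)
  case (less j)
  show ?case
  proof (cases j)
   case 0 then show ?thesis using order_trans[OF eb0 small] by simp
  next
   case (Suc i)
   have "real N * cmod (z l k) \<le> 1" if "l \<le> i" for l k
   proof (rule z_small, rule less.IH)
    show "l < j" using that Suc by simp
    have "real l * dt \<le> real j * dt" using that Suc dt by (intro mult_right_mono) auto
    then show "real l * dt \<le> T" using less.prems by simp
   qed
   then have "wsq N 1 (e (i + 1)) \<le> Cst * ((1 + 1 * (real N)^2) * \<delta>^2 + dt^3)"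
    using less.prems Suc by (intro eb) auto
   then show ?thesis using small Suc by simp
  qed
 qed
 then show "real j * dt \<le> T ==> real N * cmod (z j k) \<le> 1" by (rule z_small)
qed

lemma l2_error:
 assumes t: "real j * dt \<le> T" and w: "wsq N 0 (e j) \<le> Cst * (\<delta>^2 + dt^4)" and C: "0 \<le> Cst"
 shows "l2_norm N (\<lambda>k. v j k - of_real (\<theta> (grid_pt N k) (real j * dt))) \<le> sqrt (2 * pi * (2 * Cst + 2 * D^2)) * (\<delta> + dt^2)"
proof -
 let ?t = "real j * dt"
 have tT: "?t \<in> {0..T}" using t dt by simp
 let ?f = "\<lambda>k. v j k - of_real (\<theta> (grid_pt N k) ?t)"
 let ?g = "\<lambda>k. of_real (\<theta> (grid_pt N k) ?t) - trig (low N) (c ?t) (grid_pt N k)"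
 have "dft N ?f m = e j m - dft N ?g m" if "m \<in> G" for m
  unfolding dft_diff dft_trig_low[OF that] by (simp add: e_def)
 then have "sq G (dft N ?f) = sq G (\<lambda>m. e j m - dft N ?g m)" by (rule sq_cong)
 also have "... \<le> 2 * sq G (e j) + 2 * sq G (dft N ?g)" by (rule sq_diff_le)
 also have "sq G (dft N ?g) \<le> (D * (\<delta> / (real N)^2))^2" by (rule dft_sup[OF N trunc_th[OF tT]])
 also have "... \<le> (D * \<delta>)^2"
 proof -
  have "\<delta> / (real N)^2 \<le> \<delta> / 1" using delta N1 by (intro divide_left_mono) (auto intro: one_le_power)
  then show ?thesis using delta B D by (intro power_mono mult_left_mono) auto
 qed
 also have "sq G (e j) \<le> Cst * (\<delta>^2 + dt^4)" using w by (simp add: wsq_0)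
 finally have s: "sq G (dft N ?f) \<le> 2 * (Cst * (\<delta>^2 + dt^4)) + 2 * (D * \<delta>)^2" by simp
 also have "... \<le> (2 * Cst + 2 * D^2) * (\<delta> + dt^2)^2"
 proof -
  have 1: "\<delta>^2 + dt^4 \<le> (\<delta> + dt^2)^2" using delta by (simp add: power2_sum power_mult[symmetric])
  have 2: "\<delta>^2 \<le> (\<delta> + dt^2)^2" using delta by (intro power_mono) auto
  have "2 * (Cst * (\<delta>^2 + dt^4)) + 2 * (D^2 * \<delta>^2) \<le> 2 * (Cst * (\<delta> + dt^2)^2) + 2 * (D^2 * (\<delta> + dt^2)^2)"
   using C by (intro add_mono mult_left_mono 1 2) auto
  then show ?thesis by (simp add: power_mult_distrib algebra_simps)
 qed
 finally have fin: "sq G (dft N ?f) \<le> (2 * Cst + 2 * D^2) * (\<delta> + dt^2)^2" .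
 have "(\<Sum>k\<in>G. (cmod (?f k))^2 * mesh N) = 2 * pi * sq G (dft N ?f)"
  unfolding dft_parseval[OF N] using N by (simp add: sq_def mesh_def sum_distrib_left sum_divide_distrib mult_ac)
 also have "... \<le> 2 * pi * ((2 * Cst + 2 * D^2) * (\<delta> + dt^2)^2)" using fin by (intro mult_left_mono) auto
 also have "... = (2 * pi * (2 * Cst + 2 * D^2)) * (\<delta> + dt^2)^2" by (simp only: mult.assoc)
 finally have "l2_norm N ?f \<le> sqrt ((2 * pi * (2 * Cst + 2 * D^2)) * (\<delta> + dt^2)^2)"
  unfolding l2_norm_def by (rule real_sqrt_le_mono)
 also have "... = sqrt (2 * pi * (2 * Cst + 2 * D^2)) * (\<delta> + dt^2)"
  using delta by (simp add: real_sqrt_mult)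
 finally show ?thesis .
qed

end

section \<open>Convergence\<close>

lemma per_smooth_fc: "per_smooth p f ==> j \<le> p ==> fc (cr ((deriv ^^ j) f)) m = (\<i> * of_int m)^j * fc (cr f) m"
proof (induction j)
 case (Suc j)
 have "fc (cr ((deriv ^^ Suc j) f)) m = \<i> * of_int m * fc (cr ((deriv ^^ j) f)) m"
 proof (rule fc_deriv)
  show "periodic_2pi ((deriv ^^ j) f)" using Suc.prems unfolding per_smooth_def by simp
  show "((deriv ^^ j) f has_real_derivative (deriv ^^ Suc j) f x) (at x)" for x
   using Suc.prems unfolding per_smooth_def by (meson Suc_le_lessD)
  have "continuous_on UNIV ((deriv ^^ Suc j) f)" using Suc.prems unfolding per_smooth_def by blast
  then show "continuous_on {0..2*pi} ((deriv ^^ Suc j) f)" by (rule continuous_on_subset) simp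
 qed
 then show ?case using Suc by (simp add: mult_ac)
qed simp

text \<open>The top derivative is only of bounded variation, so the last classical derivative is Lipschitz; this already gives
 the Sobolev seminorm of full order.\<close>
lemma regular_imp_airy_flow:
 assumes reg: "regular_airy_solution r T L \<theta>" and T: "0 \<le> T" and r: "6 \<le> r"
 shows "airy_flow (2*pi/L) T (r + 3) \<theta>"
proof
 have L: "L > 0" and C: "\<And>t. t \<in> {0..T} ==> (\<lambda>\<alpha>. \<theta> \<alpha> t) \<in> C_per (r + 3)"
  using reg by (auto simp: regular_airy_solution_def)
 show "2*pi/L > 0" using L by simp
 show "T \<ge> 0" "r + 3 \<ge> 9" using T r by auto
 fix t assume t: "t \<in> {0..T}"
 have sm: "per_smooth (r + 3 - 1) (\<lambda>x. \<theta> x t)" using C_per_classical(1)[OF C[OF t]] r by simp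
 then show "per_smooth (r + 3 - 1) (\<lambda>x. \<theta> x t)" .
 obtain K where K: "\<And>x y. \<bar>(deriv ^^ (r + 3 - 1)) (\<lambda>x. \<theta> x t) x - (deriv ^^ (r + 3 - 1)) (\<lambda>x. \<theta> x t) y\<bar> \<le> K * \<bar>x - y\<bar>"
  using C_per_classical(2)[OF C[OF t]] r by auto
 let ?f = "(deriv ^^ (r + 3 - 1)) (\<lambda>x. \<theta> x t)"
 have per: "periodic_2pi ?f" using sm unfolding per_smooth_def by blast
 have "sob 1 \<bar>K\<bar> (fc (cr ?f))"
  unfolding sob_def using lipschitz_fourier_bound[OF per K] by (simp add: numeral_2_eq_2)
 moreover have "fc (cr ?f) = (\<lambda>m. (\<i> * of_int m)^(r + 3 - 1) * fc (cr (\<lambda>x. \<theta> x t)) m)"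
  by (rule ext) (rule per_smooth_fc[OF sm order_refl])
 ultimately have "sob (1 + (r + 3 - 1)) \<bar>K\<bar> (fc (cr (\<lambda>x. \<theta> x t)))" by (simp only: sob_im_iff)
 moreover have "1 + (r + 3 - 1) = r + 3" by simp
 ultimately have "sob (r + 3) \<bar>K\<bar> (fc (cr (\<lambda>x. \<theta> x t)))" by (simp only:)
 then show "\<exists>K\<ge>0. sob (r + 3) K (fc (cr (\<lambda>x. \<theta> x t)))" by (intro exI[of _ "\<bar>K\<bar>"]) simp
 show "((\<lambda>t. \<theta> x t) has_real_derivative (2*pi/L)^3 * ((deriv ^^ 3) (\<lambda>x. \<theta> x t) x + (deriv (\<lambda>x. \<theta> x t) x)^3 / 2)) (at t within {0..T})" for x
  using reg t unfolding regular_airy_solution_def by metis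
qed

lemma airy_flow_lower:
 assumes "airy_flow a T S \<theta>" "9 \<le> S'" "S' \<le> S"
 shows "airy_flow a T S' \<theta>"
proof -
 interpret airy_flow a T S \<theta> by fact
 show ?thesis
 proof
  show "per_smooth (S' - 1) (\<lambda>x. \<theta> x t)" if "t \<in> {0..T}" for t
   using smooth[OF that] assms(2,3) unfolding per_smooth_def by auto
  show "\<exists>K\<ge>0. sob S' K (fc (cr (\<lambda>x. \<theta> x t)))" if t: "t \<in> {0..T}" for t
  proof -
   obtain K where K: "K \<ge> 0" "sob S K (fc (cr (\<lambda>x. \<theta> x t)))" using sob_each[OF t] by blast
   have "sob S' K (fc (cr (\<lambda>x. \<theta> x t)))" by (rule sob_lower[OF K(2)]) (use assms in auto)
   then show ?thesis using K by blast
  qed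
 qed (use a_pos T_nonneg assms flow in auto)
qed

definition run_eqs :: "real => nat => real => (real => real) => (nat => int => complex) => bool" where
 "run_eqs a N dt u0 v \<longleftrightarrow> (\<forall>k\<in>grid_idx N. v 0 k = of_real (u0 (grid_pt N k))) \<and>
   (\<forall>m\<in>grid_idx N. dft N (v 1) m = dft N (v 0) m
    + of_real dt * (- \<i> * of_real ((a * of_int m)^3) * dft N (v 0) m + nlin N a (v 0) m)) \<and>
   (\<forall>j\<ge>1. \<forall>m\<in>grid_idx N. dft N (v (j+1)) m - dft N (v (j-1)) m
    + \<i> * of_real (dt * (a * of_int m)^3) * (dft N (v (j+1)) m + dft N (v (j-1)) m) = 2 * of_real dt * nlin N a (v j) m)"

lemma one_plus_i_nonzero: "1 + \<i> * of_real g \<noteq> 0"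
 by (simp add: complex_eq_iff)

lemma cn_scheme_run_eqs:
 assumes "cn_scheme N L dt u0 v" and a: "a = 2*pi/L"
 shows "run_eqs a N dt u0 v"
proof -
 have am: "2 * pi * of_int m / L = a * of_int m" for m by (simp add: a)
 have nl: "dft N (NL N L f) = nlin N a f" for f
  unfolding nlin_def NL_def[abs_def] a ..
 have eq: "x - y + \<i> * of_real g * (x + y) = 2 * d * F"
  if x: "x = (1 - \<i> * of_real g) / (1 + \<i> * of_real g) * y + 2 * d * ((1 - \<i> * of_real g) / of_real (1 + g^2)) * F" for x y d F :: complex and g
 proof -
  let ?p = "1 + \<i> * complex_of_real g"
  have p: "?p \<noteq> 0" by (rule one_plus_i_nonzero)
  have q: "complex_of_real (1 + g^2) = ?p * (1 - \<i> * of_real g)" by (simp add: algebra_simps power2_eq_square)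
  have "1 + g^2 \<noteq> 0" by (metis add_eq_0_iff neg_equal_zero sum_power2_eq_zero_iff one_power2 zero_neq_one)
  then have q0: "complex_of_real (1 + g^2) \<noteq> 0" by (simp only: of_real_eq_0_iff not_False_eq_True)
  have "?p * x = ((1 - \<i> * of_real g) / ?p * ?p) * y + 2 * d * (?p * (1 - \<i> * of_real g) / of_real (1 + g^2)) * F"
   unfolding x by (simp only: distrib_left mult_ac times_divide_eq_right times_divide_eq_left)
  also have "... = (1 - \<i> * of_real g) * y + 2 * d * F"
   using p q0 unfolding q[symmetric] by simp
  finally show ?thesis by (simp add: algebra_simps)
 qed
 show ?thesis
  unfolding run_eqs_def
 proof (intro conjI ballI allI impI)
  show "v 0 k = of_real (u0 (grid_pt N k))" if "k \<in> grid_idx N" for k using assms(1) that unfolding cn_scheme_def by blast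
  show "dft N (v 1) m = dft N (v 0) m + of_real dt * (- \<i> * of_real ((a * of_int m)^3) * dft N (v 0) m + nlin N a (v 0) m)"
   if "m \<in> grid_idx N" for m using assms(1) that unfolding cn_scheme_def nl am by blast
  fix j m assume jm: "1 \<le> (j::nat)" "m \<in> grid_idx N"
  have "dft N (v (j + 1)) m = cn_zeta1 L dt m * dft N (v (j - 1)) m + 2 * of_real dt * cn_zeta2 L dt m * nlin N a (v j) m"
   using assms(1) jm unfolding cn_scheme_def nl by blast
  then show "dft N (v (j+1)) m - dft N (v (j-1)) m
    + \<i> * of_real (dt * (a * of_int m)^3) * (dft N (v (j+1)) m + dft N (v (j-1)) m) = 2 * of_real dt * nlin N a (v j) m"
   unfolding cn_zeta1_def cn_zeta2_def cn_gamma_def am by (rule eq)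
 qed
qed

lemma solution_gives_run:
 assumes g0: "airy_global a T 9 \<theta> K0" and g: "airy_global a T S \<theta> K"
  and N: "even N" "N > 0" and dt: "dt > 0" and v: "run_eqs a N dt (\<lambda>x. \<theta> x 0) v"
  and D: "airy_global.Bd a 9 K0 \<le> D" "airy_global.Bd a S K \<le> D"
 shows "cn_run a T dt (airy_global.Bd a 9 K0) ((1 / real N)^6) D ((1 / real N)^(S - 3)) N \<theta> (airy_flow.D \<theta> 1) (airy_flow.c \<theta>) (airy_global.c1 a \<theta>) v"
proof -
 interpret g0: airy_global a T 9 \<theta> K0 by (rule g0)
 interpret g: airy_global a T S \<theta> K by (rule g)
 have wk: "x \<le> D * y" if "x \<le> g.Bd * y" "0 \<le> y" for x y
  using that mult_right_mono[OF D(2) that(2)] by linarith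
 have n: "0 \<le> (1 / real N)^(S - 3)" "0 \<le> (1 / real N)^(S - 3) / (real N)^2" by auto
 have e: "9 - 3 = (6::nat)" by simp
 show ?thesis
 proof (unfold_locales)
  show "(1 / real N)^6 \<le> 1 / real N"
   using power_decreasing[of 1 6 "1 / real N"] N by simp
  show "cmod (of_real (\<theta> x t) - trig (low N) (g.c t) x) \<le> D * ((1 / real N)^(S-3) / (real N)^2)" if "t \<in> {0..T}" for t x
   by (rule wk[OF g.truncation_bounds(1)[OF that N(2)] n(2)])
  show "cmod (of_real (g.D 1 t x) - trig (low N) (\<lambda>m. \<i> * of_int m * g.c t m) x) \<le> D * (1 / real N)^(S-3)" if "t \<in> {0..T}" for t x
   by (rule wk[OF g.truncation_bounds(2)[OF that N(2)] n(1)])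
  show "cmod (of_real ((g.D 1 t x)^3) - trig (low N) (fc (cr (\<lambda>x. (g.D 1 t x)^3))) x) \<le> D * (1 / real N)^(S-3)" if "t \<in> {0..T}" for t x
   by (rule wk[OF g.truncation_bounds(4)[OF that N(2)] n(1)])
  show "cmod (of_real (g.D 1 t x) - trig (low N) (\<lambda>m. \<i> * of_int m * g.c t m) x) \<le> g0.Bd * (1 / real N)^6" if "t \<in> {0..T}" for t x
   using g0.truncation_bounds(2)[OF that N(2)] unfolding e .
  show "cmod (of_real ((g.D 1 t x)^2) - trig (low N) (fc (cr (\<lambda>x. (g.D 1 t x)^2))) x) \<le> g0.Bd * (1 / real N)^6" if "t \<in> {0..T}" for t x
   using g0.truncation_bounds(3)[OF that N(2)] unfolding e .
  show "(\<Sum>l\<in>low N. (1 + \<bar>of_int l\<bar>) * cmod (fc (cr (\<lambda>x. (g.D 1 t x)^2)) l)) \<le> 2 * g0.Bd" if "t \<in> {0..T}" for t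
   by (rule g0.square_coefficients[OF that finite_low])
  show "(\<Sum>l\<in>low N. cmod (fc (cr (\<lambda>x. (g.D 1 t x)^2)) l - fc (cr (\<lambda>x. (g.D 1 s x)^2)) l)) \<le> g0.Bd * \<bar>t - s\<bar>"
   if "t \<in> {0..T}" "s \<in> {0..T}" for t s
   by (rule g0.square_coefficients_lipschitz[OF that finite_low])
  show "g.c1 t m = of_real (a^3) * ((\<i> * of_int m)^3 * g.c t m + 1/2 * fc (cr (\<lambda>x. (g.D 1 t x)^3)) m)" for t m
   by (rule g.c1_def)
  show "\<bar>g.D 1 t x\<bar> \<le> g0.Bd" if "t \<in> {0..T}" for t x by (rule g0.D1_le[OF that])
 qed (use N dt v D g.a_pos g.T_nonneg g0.Bd_ge(1) in \<open>auto simp: run_eqs_def simp del: One_nat_def\<close>)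
qed

text \<open>If \<open>N\<close> is at least this number and \<open>dt * N\<close> at most its inverse, all smallness conditions of the stability and
 continuation arguments hold.\<close>
definition stage_size :: "real => real => real => real" where
 "stage_size a T B = 64 * cn_run.Ms a B + 512 * cn_run.Ms a B / a^3 + 16 * stab_const a (cn_run.Ms a B) + 4 * cn_run.Cst a T B B + 1"

lemma smallness:
 fixes M s C Q dt a :: real
 assumes Q: "Q = 64 * M + 512 * M / a^3 + 16 * s + 4 * C + 1" and nn: "1 \<le> M" "0 \<le> s" "0 \<le> C" "a > 0"
  and N: "Q \<le> real N" and dt: "dt > 0" "dt * real N * Q \<le> 1"
 shows "64 * dt * real N * M \<le> 1" "512 * M \<le> a^3 * (real N)^2" "16 * s * dt \<le> 1" "dt \<le> 1"
  "C * ((1 + 1 * (real N)^2) * ((1 / real N)^6)^2 + dt^3) \<le> 1 / (real N)^3"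
proof -
 have Ma: "0 \<le> 512 * M / a^3" using nn by simp
 have Qs: "64 * M \<le> Q" "512 * M / a^3 \<le> Q" "16 * s \<le> Q" "4 * C \<le> Q" "1 \<le> Q" using Q nn Ma by linarith+
 have N1: "1 \<le> real N" using Qs N by linarith
 have dN: "0 \<le> dt * real N" using dt by simp
 have "dt * real N * (64 * M) \<le> dt * real N * Q" using Qs dN by (intro mult_left_mono)
 then show "64 * dt * real N * M \<le> 1" using dt(2) by (simp add: mult_ac)
 have "real N * 1 \<le> real N * real N" using N1 by (intro mult_left_mono) auto
 then have "512 * M / a^3 \<le> (real N)^2" unfolding power2_eq_square using Qs N by linarith
 then show "512 * M \<le> a^3 * (real N)^2" using nn by (simp add: pos_divide_le_eq mult.commute)
 have dtQ: "dt * Q \<le> 1"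
 proof -
  have "dt * Q * 1 \<le> dt * Q * real N" using N1 dt Qs by (intro mult_left_mono) auto
  then show ?thesis using dt(2) by (simp add: mult_ac)
 qed
 have "dt * (16 * s) \<le> dt * Q" using Qs dt by (intro mult_left_mono) auto
 then show "16 * s * dt \<le> 1" using dtQ by (simp add: mult_ac)
 have "dt * 1 \<le> dt * Q" using Qs dt by (intro mult_left_mono) auto
 then show "dt \<le> 1" using dtQ by simp
 have dtN: "dt * real N \<le> 1 / Q" using dt(2) Qs by (simp add: pos_le_divide_eq)
 have iQ: "1 / Q \<le> 1" using Qs by simp
 \<comment> \<open>The two contributions to the forcing take a quarter and a half of the admissible size.\<close>
 have 1: "C * (dt * real N)^3 \<le> 1/4"
 proof -
  have "(dt * real N)^3 \<le> (1/Q)^3" using dtN dN by (intro power_mono)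
  also have "... \<le> (1/Q)^1" using iQ Qs by (intro power_decreasing) auto
  finally have "C * (dt * real N)^3 \<le> C * (1 / Q)" using nn by (intro mult_left_mono) auto
  also have "... \<le> 1/4" using Qs by (simp add: field_simps)
  finally show ?thesis .
 qed
 have 2: "C * (2 / (real N)^7) \<le> 1/2"
 proof -
  have "real N ^ 1 \<le> real N ^ 7" using N1 by (intro power_increasing) auto
  then have "real N \<le> real N ^ 7" by simp
  then have "4 * C \<le> real N ^ 7" using Qs N by linarith
  then show ?thesis using N1 by (simp add: field_simps)
 qed
 have N3: "0 < (real N)^3" using N1 by simp
 have i: "(1 + 1 * (real N)^2) * ((1 / real N)^6)^2 \<le> 2 / (real N)^7 / (real N)^3"
 proof -
  have "1 \<le> (real N)^2" using N1 by (rule one_le_power)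
  then have "(1 + 1 * (real N)^2) * ((1 / real N)^6)^2 \<le> (2 * (real N)^2) * ((1 / real N)^6)^2" by (intro mult_right_mono) auto
  also have "... = 2 / (real N)^7 / (real N)^3" using N1 by (simp add: power_divide field_simps eval_nat_numeral)
  finally show ?thesis .
 qed
 have ii: "dt^3 = (dt * real N)^3 / (real N)^3" using N1 by (simp add: power_mult_distrib)
 have "C * ((1 + 1 * (real N)^2) * ((1 / real N)^6)^2 + dt^3) \<le> C * (2 / (real N)^7 / (real N)^3 + (dt * real N)^3 / (real N)^3)"
  using i nn unfolding ii by (intro mult_left_mono add_right_mono) auto
 also have "... = (C * (2 / (real N)^7) + C * (dt * real N)^3) / (real N)^3" by (simp add: add_divide_distrib distrib_left)
 also have "... \<le> 1 / (real N)^3"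
 proof (rule divide_right_mono)
  show "C * (2 / (real N)^7) + C * (dt * real N)^3 \<le> 1" using 1 2 by linarith
 qed (use N3 in simp)
 finally show "C * ((1 + 1 * (real N)^2) * ((1 / real N)^6)^2 + dt^3) \<le> 1 / (real N)^3" .
qed

text \<open>Two analyses of the same run: the one with nine derivatives gives smallness of the error for the continuation argument, the one with \<open>r + 3\<close>
 derivatives gives the rate.\<close>
theorem solution_error:
 assumes fl: "airy_flow a T (r + 3) \<theta>" and r: "6 \<le> r" and K0: "0 \<le> K0" "\<And>t. t \<in> {0..T} ==> sob 9 K0 (airy_flow.c \<theta> t)"
 shows "\<exists>C\<ge>0. \<forall>N dt v. even N \<and> N > 0 \<and> dt > 0 \<and> stage_size a T (airy_global.Bd a 9 K0) \<le> real N
   \<and> dt * real N * stage_size a T (airy_global.Bd a 9 K0) \<le> 1 \<and> run_eqs a N dt (\<lambda>x. \<theta> x 0) v \<longrightarrow>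
   (\<forall>j. real j * dt \<le> T \<longrightarrow> l2_norm N (\<lambda>k. v j k - of_real (\<theta> (grid_pt N k) (real j * dt))) \<le> C * ((1 / real N)^r + dt^2))"
proof -
 obtain K where K: "K \<ge> 0" "\<And>t. t \<in> {0..T} ==> sob (r + 3) K (airy_flow.c \<theta> t)"
  using airy_flow.sobolev_bounded[OF fl] by blast
 have fl9: "airy_flow a T 9 \<theta>" using airy_flow_lower[OF fl, of 9] r by simp
 have g0: "airy_global a T 9 \<theta> K0"
  unfolding airy_global_def by (rule airy_flow.airy_intervalI[OF fl9]) (use K0 in auto)
 have g: "airy_global a T (r + 3) \<theta> K"
  unfolding airy_global_def by (rule airy_flow.airy_intervalI[OF fl]) (use K in auto)
 interpret g0: airy_global a T 9 \<theta> K0 by (rule g0)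
 interpret g: airy_global a T "r + 3" \<theta> K by (rule g)
 define B where "B = g0.Bd"
 define D where "D = max g0.Bd g.Bd"
 define C where "C = cn_run.Cst a T B D"
 have B1: "1 \<le> B" "B \<le> D" "g.Bd \<le> D" using g0.Bd_ge(1) by (auto simp: B_def D_def)
 have rr: "r + 3 - 3 = r" "9 - 3 = (6::nat)" by auto
 have main: "l2_norm N (\<lambda>k. v j k - of_real (\<theta> (grid_pt N k) (real j * dt))) \<le> sqrt (2 * pi * (2 * \<bar>C\<bar> + 2 * D^2)) * ((1 / real N)^r + dt^2)"
  if N: "even N" "N > 0" and dt: "dt > 0" and Q: "stage_size a T B \<le> real N" "dt * real N * stage_size a T B \<le> 1"
   and v: "run_eqs a N dt (\<lambda>x. \<theta> x 0) v" and t: "real j * dt \<le> T" for N dt v j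
 proof -
  interpret s: cn_run a T dt B "(1 / real N)^6" B "(1 / real N)^6" N \<theta> "g.D 1" g.c g.c1 v
   using solution_gives_run[OF g0 g0 N dt v order_refl order_refl] unfolding rr B_def .
  interpret f: cn_run a T dt B "(1 / real N)^6" D "(1 / real N)^r" N \<theta> "g.D 1" g.c g.c1 v
   using solution_gives_run[OF g0 g N dt v, of D] B1 unfolding rr B_def by blast
  have sC: "0 \<le> s.Cst"
  proof -
   have "0 \<le> s.C1" "0 \<le> s.C2" unfolding s.C1_def s.C2_def by simp_all
   then show ?thesis unfolding s.Cst_def using g.T_nonneg by simp
  qed
  have fC: "0 \<le> f.Cst"
  proof -
   have "0 \<le> f.C1" "0 \<le> f.C2" unfolding f.C1_def f.C2_def by simp_all
   then show ?thesis unfolding f.Cst_def using g.T_nonneg by simp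
  qed
  have s0: "0 \<le> stab_const a s.Ms" using s.Ms1 g.a_pos by (simp add: stab_const_def)
  note sm = smallness[OF stage_size_def s.Ms1 s0 sC g.a_pos Q(1) dt Q(2)]
  have res: "s.res t m = g.resid dt t m" "s.res0 m = g.resid0 dt m" for t m
   by (simp_all add: s.res_def g.resid_def s.res0_def g.resid0_def)
  have BB: "g0.Bd^2 = B^2" by (simp add: B_def)
  have zs: "real N * cmod (s.z i k) \<le> 1" if "real i * dt \<le> T" for i k
  proof (rule s.bootstrap[OF _ _ sm(1,2,3,5) that])
   show "(\<Sum>m\<in>low N. (1 + 1 * (of_int m)^2) * (cmod (s.res t m))^2) \<le> B^2 * dt^3" if "dt \<le> t" "t + dt \<le> T" for t
    using g0.time_consistency(2)[OF dt sm(4) _ that(2) finite_low, of N] that(1) unfolding res BB by simp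
   show "(\<Sum>m\<in>low N. (1 + 1 * (of_int m)^2) * (cmod (s.res0 m))^2) \<le> B^2 * dt^3" if "dt \<le> T"
    using g0.first_step_consistency(2)[OF dt sm(4) that finite_low, of N] unfolding res BB by simp
  qed
  have BD: "B^2 \<le> D^2" using B1 by (intro power_mono) auto
  have c0: "(\<Sum>m\<in>low N. (1 + 0 * (of_int m)^2) * (cmod (f.res t m))^2) \<le> D^2 * dt^4" if "dt \<le> t" "t + dt \<le> T" for t
  proof -
   have "(\<Sum>m\<in>low N. (1 + 0 * (of_int m)^2) * (cmod (f.res t m))^2) \<le> B^2 * dt^4"
    using g0.time_consistency(1)[OF dt sm(4) _ that(2) finite_low, of N] that(1) unfolding res BB by (simp add: sq_def)
   also have "... \<le> D^2 * dt^4" using BD by (intro mult_right_mono) auto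
   finally show ?thesis .
  qed
  have c1: "(\<Sum>m\<in>low N. (1 + 0 * (of_int m)^2) * (cmod (f.res0 m))^2) \<le> D^2 * dt^4" if "dt \<le> T"
  proof -
   have "(\<Sum>m\<in>low N. (1 + 0 * (of_int m)^2) * (cmod (f.res0 m))^2) \<le> B^2 * dt^4"
    using g0.first_step_consistency(1)[OF dt sm(4) that finite_low, of N] unfolding res BB by (simp add: sq_def)
   also have "... \<le> D^2 * dt^4" using BD by (intro mult_right_mono) auto
   finally show ?thesis .
  qed
  have d4: "0 \<le> dt^4" using dt by simp
  have "wsq N 0 (f.e j) \<le> f.Cst * ((1 + 0 * (real N)^2) * ((1 / real N)^r)^2 + dt^4)"
  proof (cases j)
   case 0
   show ?thesis unfolding 0 by (rule f.error_bound_0[OF disjI1[OF refl] d4 refl _ _ sm(1,2,3)]) (use c0 c1 in auto)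
  next
   case (Suc i)
   have "real N * cmod (f.z l k) \<le> 1" if "l \<le> i" for l k
   proof (rule zs)
    have "real l * dt \<le> real j * dt" using that Suc dt by (intro mult_right_mono) auto
    then show "real l * dt \<le> T" using t by simp
   qed
   then have "wsq N 0 (f.e (i + 1)) \<le> f.Cst * ((1 + 0 * (real N)^2) * ((1 / real N)^r)^2 + dt^4)"
    by (intro f.error_bound[OF disjI1[OF refl] d4 refl _ _ sm(1,2,3)]) (use c0 c1 t Suc in auto)
   then show ?thesis using Suc by simp
  qed
  then have "wsq N 0 (f.e j) \<le> f.Cst * (((1 / real N)^r)^2 + dt^4)" by simp
  from f.l2_error[OF t this fC] show ?thesis using fC by (simp add: C_def)
 qed
 show ?thesis
 proof (intro exI[of _ "sqrt (2 * pi * (2 * \<bar>C\<bar> + 2 * D^2))"] conjI allI impI)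
  show "0 \<le> sqrt (2 * pi * (2 * \<bar>C\<bar> + 2 * D^2))" by simp
 qed (use main in \<open>auto simp: B_def\<close>)
qed

lemma constant_solution_exact:
 assumes N: "even N" "N > 0" and v: "run_eqs a N dt u0 v" and u0: "\<And>x. u0 x = y"
 shows "l2_norm N (\<lambda>k. v j k - of_real y) = 0"
proof -
 let ?G = "grid_idx N"
 let ?y = "\<lambda>m::int. if m = 0 then complex_of_real y else 0"
 have 0: "(0::int) \<in> ?G" using N by (auto simp: grid_idx_def elim!: evenE)
 have cst: "dft N (\<lambda>k. complex_of_real y) m = ?y m" if "m \<in> ?G" for m
  using dft_trig[OF N, of "{0}" m "\<lambda>_. complex_of_real y"] 0 that by (simp add: trig_def)
 have nl: "nlin N a f m = 0" if "\<And>m. m \<in> ?G ==> dft N f m = ?y m" for f m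
 proof -
  have "spectral_deriv N f k = 0" for k
   unfolding spectral_deriv_def idft_def by (rule sum.neutral) (auto simp: that)
  then show ?thesis by (simp add: nlin_def dft_def)
 qed
 have d0: "dft N (v 0) m = ?y m" if "m \<in> ?G" for m
 proof -
  have "dft N (v 0) m = dft N (\<lambda>k. complex_of_real y) m"
   using v u0 unfolding run_eqs_def dft_def by (auto intro!: sum.cong)
  then show ?thesis using cst[OF that] by simp
 qed
 have "\<forall>m\<in>?G. dft N (v j) m = ?y m" for j
 proof (induction j rule: less_induct)
  case (less j)
  show ?case
  proof (cases "j \<le> 1")
   case True
   have "dft N (v 1) m = ?y m" if m: "m \<in> ?G" for m
   proof -
    have "dft N (v 1) m = dft N (v 0) m + of_real dt * (- \<i> * of_real ((a * of_int m)^3) * dft N (v 0) m + nlin N a (v 0) m)"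
     using v m unfolding run_eqs_def by blast
    moreover have "nlin N a (v 0) m = 0" by (rule nl) (rule d0)
    ultimately show ?thesis unfolding d0[OF m] by simp
   qed
   moreover have "j = 0 \<or> j = 1" using True by auto
   ultimately show ?thesis using d0 by blast
  next
   case False
   then obtain i where i: "j = i + 1" "1 \<le> i" by (metis Suc_eq_plus1 not_less_eq_eq le_Suc_ex add.commute plus_1_eq_Suc nat_le_linear)
   show ?thesis
   proof
    fix m assume m: "m \<in> ?G"
    have eq: "dft N (v (i+1)) m - dft N (v (i-1)) m
     + \<i> * of_real (dt * (a * of_int m)^3) * (dft N (v (i+1)) m + dft N (v (i-1)) m) = 2 * of_real dt * nlin N a (v i) m"
     using v m i unfolding run_eqs_def by blast
    have n0: "nlin N a (v i) m = 0" by (rule nl) (use less.IH[of i] i in auto)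
    have b: "dft N (v (i-1)) m = ?y m" using less.IH[of "i-1"] i m by auto
    \<comment> \<open>At \<open>m = 0\<close> the phase vanishes; elsewhere the factor \<open>1 + \<i> * \<gamma>\<close> is invertible.\<close>
    show "dft N (v j) m = ?y m"
    proof (cases "m = 0")
     case True then show ?thesis using eq n0 b i by simp
    next
     case False
     then have "(1 + \<i> * of_real (dt * (a * of_int m)^3)) * dft N (v (i+1)) m = 0"
      using eq n0 b by (simp add: algebra_simps)
     then have "dft N (v (i+1)) m = 0" using one_plus_i_nonzero by (metis mult_eq_0_iff)
     then show ?thesis using False i by simp
    qed
   qed
  qed
 qed
 then have "dft N (\<lambda>k. v j k - of_real y) m = 0" if "m \<in> ?G" for m
  unfolding dft_diff using cst[OF that] that by simp
 then have "sq ?G (dft N (\<lambda>k. v j k - of_real y)) = 0" by (simp add: sq_def)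
 then have "sq ?G (\<lambda>k. v j k - of_real y) = 0" using N unfolding dft_parseval[OF N] by simp
 then show ?thesis by (simp add: l2_norm_def sq_def sum_distrib_right[symmetric])
qed

text \<open>The scales \<open>2 * pi / L\<close> that are compatible with a given curvature function.\<close>
definition scales :: "real => (real => real => real) => real set" where
 "scales T k = {a. \<exists>\<theta>. airy_flow a T 9 \<theta> \<and> (\<forall>x. \<forall>t\<in>{0..T}. k x t = a * deriv (\<lambda>x. \<theta> x t) x)}"

text \<open>Chosen from \<open>k\<close> rather than from \<open>\<theta>\<close>, so that it serves every solution with this scale and curvature.\<close>
definition sobolev_constant :: "real => real => (real => real => real) => real" where
 "sobolev_constant a T k = (SOME K. 0 \<le> K \<and> (\<forall>t\<in>{0..T}. sob 8 K (fc (cr (\<lambda>x. k x t / a)))))"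

context
 fixes a T \<theta> k
 assumes fl: "airy_flow a T 9 \<theta>" and k: "\<forall>x. \<forall>t\<in>{0..T}. k x t = a * deriv (\<lambda>x. \<theta> x t) x"
begin

interpretation airy_flow a T 9 \<theta> by (rule fl)

lemma k_D: "t \<in> {0..T} ==> k x t = a * D 1 t x"
 using k by (simp add: D_def)

lemma sobolev_constant_works:
 "0 \<le> sobolev_constant a T k" "t \<in> {0..T} ==> sob 9 (sobolev_constant a T k) (c t)"
proof -
 have eq: "sob 8 K (fc (cr (\<lambda>x. k x t / a))) \<longleftrightarrow> sob 9 K (c t)" if t: "t \<in> {0..T}" for K t
 proof -
  have "(\<lambda>x. k x t / a) = D 1 t" using k_D[OF t] a_pos by (simp add: fun_eq_iff)
  then have "fc (cr (\<lambda>x. k x t / a)) = (\<lambda>m. (\<i> * of_int m)^1 * c t m)"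
   using fc_D[OF t, of 1] by (simp only: fun_eq_iff) simp
  moreover have "8 + 1 = (9::nat)" by simp
  ultimately show ?thesis by (simp only: sob_im_iff)
 qed
 obtain K where "0 \<le> K" "\<forall>t\<in>{0..T}. sob 9 K (c t)" using sobolev_bounded by blast
 then have "\<exists>K. 0 \<le> K \<and> (\<forall>t\<in>{0..T}. sob 8 K (fc (cr (\<lambda>x. k x t / a))))" using eq by blast
 from someI_ex[OF this] show "0 \<le> sobolev_constant a T k" "t \<in> {0..T} ==> sob 9 (sobolev_constant a T k) (c t)"
  unfolding sobolev_constant_def[symmetric] using eq by blast+
qed

lemma curvature_equation:
 assumes t: "t \<in> {0..T}"
 shows "((\<lambda>s. k x s) has_real_derivative a^3 * (deriv ^^ 3) (\<lambda>x. k x t) x + a * (3/2 * (k x t)^2 * deriv (\<lambda>x. k x t) x)) (at t within {0..T})"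
  and "(deriv ^^ 3) (\<lambda>x. k x t) x = a * D 4 t x"
proof -
 obtain K where "0 \<le> K" "\<And>t. t \<in> {0..T} ==> sob 9 K (c t)" using sobolev_bounded by blast
 then interpret g: airy_interval a T 9 \<theta> "{0..T}" K by (intro airy_intervalI) auto
 have kf: "(\<lambda>x. k x t) = (\<lambda>x. a * D 1 t x)" using k_D[OF t] by auto
 have d: "deriv (\<lambda>x. a * D 1 t x) = (\<lambda>x. a * D 2 t x)" "deriv (\<lambda>x. a * D 2 t x) = (\<lambda>x. a * D 3 t x)"
  "deriv (\<lambda>x. a * D 3 t x) = (\<lambda>x. a * D 4 t x)"
  by (rule ext, rule DERIV_imp_deriv, rule DERIV_cmult, rule D_der'[OF t])+
 have "(deriv ^^ 3) (\<lambda>x. k x t) = deriv (deriv (deriv (\<lambda>x. k x t)))" by (simp add: eval_nat_numeral)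
 then have d3: "(deriv ^^ 3) (\<lambda>x. k x t) = (\<lambda>x. a * D 4 t x)" by (simp only: kf d)
 then show "(deriv ^^ 3) (\<lambda>x. k x t) x = a * D 4 t x" by simp
 have "((\<lambda>s. a * D 1 s x) has_real_derivative a * (a^3 * P1 t x)) (at t within {0..T})"
  by (rule DERIV_cmult, rule g.D_t_der(2)[OF t])
 then have "((\<lambda>s. k x s) has_real_derivative a * (a^3 * P1 t x)) (at t within {0..T})"
  by (rule has_field_derivative_transform_within[OF _ zero_less_one t]) (simp add: k_D)
 moreover have "a * (a^3 * P1 t x) = a^3 * (a * D 4 t x) + a * (3/2 * (a * D 1 t x)^2 * (a * D 2 t x))"
  unfolding P1_def by (simp add: algebra_simps power2_eq_square power3_eq_cube)
 ultimately show "((\<lambda>s. k x s) has_real_derivative a^3 * (deriv ^^ 3) (\<lambda>x. k x t) x + a * (3/2 * (k x t)^2 * deriv (\<lambda>x. k x t) x)) (at t within {0..T})"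
  unfolding d3 unfolding kf d(1) k_D[OF t] by simp
qed

text \<open>With vanishing third derivative of the curvature, all non-zero Fourier modes vanish.\<close>
lemma constant_solution:
 assumes z: "\<And>t x. t \<in> {0..T} ==> D 4 t x = 0" and t: "t \<in> {0..T}"
 shows "\<theta> x t = \<theta> 0 0"
proof -
 have space: "D 0 t x = D 0 t 0" if t: "t \<in> {0..T}" for t x
 proof -
  have c0: "of_int m * c t m = 0" for m
  proof -
   have "(\<i> * of_int m)^4 * c t m = fc (cr (D 4 t)) m" by (rule fc_D[OF t, symmetric]) simp
   also have "... = 0" by (simp add: fc_def z[OF t])
   finally show ?thesis by auto
  qed
  have "\<bar>D 0 t x - D 0 t 0\<bar> \<le> 0 * \<bar>x - 0\<bar>"
  proof (rule fourier_lipschitz)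
   show "periodic_2pi (D 0 t)" by (rule D_per[OF t]) simp
   show "(D 0 t has_real_derivative D 1 t x) (at x)" for x by (rule D_der'[OF t])
   have "\<bar>of_int m\<bar> * cmod (fc (cr (D 0 t)) m) = 0" for m
    using arg_cong[OF c0[of m], of cmod] fc_D[OF t, of 0 m] by (simp add: norm_mult)
   then show "(\<Sum>m\<in>A. \<bar>of_int m\<bar> * cmod (fc (cr (D 0 t)) m)) \<le> 0" for A by (simp only: sum.neutral_const order_refl)
  qed
  then show ?thesis by simp
 qed
 have z': "D (Suc j) t x = 0" if "t \<in> {0..T}" "j < 8" "\<And>x. D j t x = w" for j t x w
 proof -
  have "D j t = (\<lambda>x. w)" using that by auto
  then have "((\<lambda>x. w) has_real_derivative D (Suc j) t x) (at x)" using D_der[of t j x] that by simp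
  then show ?thesis using DERIV_const DERIV_unique by blast
 qed
 have P0: "P0 t x = 0" if t: "t \<in> {0..T}" for t x
 proof -
  have 1: "D 1 t x = 0" for x using z'[OF t, where j = 0 and w = "D 0 t 0" and x = x] space[OF t] by simp
  have 2: "D 2 t x = 0" for x using z'[OF t, where j = 1 and w = 0 and x = x] 1 by (simp add: numeral_2_eq_2)
  have 3: "D 3 t x = 0" for x using z'[OF t, where j = 2 and w = 0 and x = x] 2 by (simp add: numeral_3_eq_3)
  show ?thesis using 1 3 by (simp add: P0_def)
 qed
 have "\<exists>y. \<forall>t\<in>{0..T}. D 0 t 0 = y"
 proof (rule has_field_derivative_zero_constant)
  show "convex {0..T}" by simp
  show "((\<lambda>t. D 0 t 0) has_real_derivative 0) (at t within {0..T})" if "t \<in> {0..T}" for t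
   using flow_P0[OF that, of 0] P0[OF that] by simp
 qed
 then have "D 0 t 0 = D 0 0 0" using t T_nonneg by auto
 then show ?thesis using space[OF t, of x] by (simp add: D0)
qed

end

text \<open>Two scales carrying the same curvature both satisfy the modified Korteweg-de Vries equation, so they are roots of
 one cubic at each point; it is non-trivial unless the third space derivative of the curvature vanishes identically.\<close>
lemma finite_scales:
 assumes fl: "airy_flow a T 9 \<theta>" and k: "\<forall>x. \<forall>t\<in>{0..T}. k x t = a * deriv (\<lambda>x. \<theta> x t) x" and T: "T > 0"
  and t: "t \<in> {0..T}" and nz: "airy_flow.D \<theta> 4 t x \<noteq> 0"
 shows "finite (scales T k)"
proof -
 define X where "X = (deriv ^^ 3) (\<lambda>x. k x t) x"
 define Y where "Y = 3/2 * (k x t)^2 * deriv (\<lambda>x. k x t) x"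
 have X0: "X \<noteq> 0" using curvature_equation(2)[OF fl k t, of x] nz airy_flow.a_pos[OF fl] by (simp add: X_def)
 have "poly [:- (a^3 * X + a * Y), Y, 0, X:] s = 0" if sk: "s \<in> scales T k" for s
 proof -
  obtain \<theta>' where s: "airy_flow s T 9 \<theta>'" "\<forall>x. \<forall>t\<in>{0..T}. k x t = s * deriv (\<lambda>x. \<theta>' x t) x" using sk[unfolded scales_def] by blast
  \<comment> \<open>Both sides are the time derivative of \<open>k\<close> at the same point.\<close>
  have "a^3 * X + a * Y = s^3 * X + s * Y"
   using vector_derivative_unique_within_closed_interval[of 0 T t "\<lambda>s. k x s"] T t
    curvature_equation(1)[OF fl k t, of x] curvature_equation(1)[OF s t, of x]
   unfolding has_real_derivative_iff_has_vector_derivative X_def[symmetric] Y_def[symmetric] by auto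
  moreover have "poly [:- (a^3 * X + a * Y), Y, 0, X:] s = s^3 * X + s * Y - (a^3 * X + a * Y)"
   by (simp add: algebra_simps power3_eq_cube)
  ultimately show ?thesis by simp
 qed
 then have "scales T k \<subseteq> {s. poly [:- (a^3 * X + a * Y), Y, 0, X:] s = 0}" by blast
 moreover have "finite {s. poly [:- (a^3 * X + a * Y), Y, 0, X:] s = 0}" by (rule poly_roots_finite) (use X0 in simp)
 ultimately show ?thesis by (rule finite_subset)
qed

text \<open>If infinitely many scales carry the same curvature, the sum takes the value \<open>0\<close>; this happens only for \<open>k = 0\<close>, where
 every mesh will do.\<close>
definition resolution :: "real => (real => real => real) => real" where
 "resolution T k = 1 + (\<Sum>a\<in>scales T k. max 0 (stage_size a T (airy_global.Bd a 9 (sobolev_constant a T k))))"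

lemma resolution_ge: "1 \<le> resolution T k"
 unfolding resolution_def by (simp add: sum_nonneg)

lemma stage_size_le_resolution:
 assumes "finite (scales T k)" "a \<in> scales T k"
 shows "stage_size a T (airy_global.Bd a 9 (sobolev_constant a T k)) \<le> resolution T k"
proof -
 let ?f = "\<lambda>a. max 0 (stage_size a T (airy_global.Bd a 9 (sobolev_constant a T k)))"
 have "?f a \<le> (\<Sum>a\<in>scales T k. ?f a)" by (rule member_le_sum) (use assms in auto)
 then show ?thesis unfolding resolution_def by linarith
qed

theorem convergence:
 assumes T: "T > 0" and r: "r \<ge> 6" and reg: "regular_airy_solution r T L \<theta>"
  and k: "\<forall>x. \<forall>t\<in>{0..T}. k x t = 2*pi/L * deriv (\<lambda>x. \<theta> x t) x"
 shows "\<exists>C\<ge>0. \<forall>N dt v. even N \<and> N > 0 \<and> dt > 0 \<and> resolution T k \<le> real N \<and> dt * real N * resolution T k \<le> 1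
   \<and> run_eqs (2*pi/L) N dt (\<lambda>x. \<theta> x 0) v \<longrightarrow>
   (\<forall>j. real j * dt \<le> T \<longrightarrow> l2_norm N (\<lambda>k. v j k - of_real (\<theta> (grid_pt N k) (real j * dt))) \<le> C * ((1 / real N)^r + dt^2))"
proof -
 define a where "a = 2*pi/L"
 have fl: "airy_flow a T (r + 3) \<theta>" unfolding a_def using regular_imp_airy_flow[OF reg _ r] T by simp
 have fl9: "airy_flow a T 9 \<theta>" using airy_flow_lower[OF fl, of 9] r by simp
 have k': "\<forall>x. \<forall>t\<in>{0..T}. k x t = a * deriv (\<lambda>x. \<theta> x t) x" using k by (simp add: a_def)
 show ?thesis
 proof (cases "\<forall>t\<in>{0..T}. \<forall>x. airy_flow.D \<theta> 4 t x = 0")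
  case True
  have c: "\<theta> x t = \<theta> 0 0" if "t \<in> {0..T}" for x t
   by (rule constant_solution[OF fl9 k' _ that]) (use True in blast)
  show ?thesis
  proof (intro exI[of _ 0] conjI allI impI)
   fix N dt v j
   assume h: "even N \<and> N > 0 \<and> dt > 0 \<and> resolution T k \<le> real N \<and> dt * real N * resolution T k \<le> 1
    \<and> run_eqs (2*pi/L) N dt (\<lambda>x. \<theta> x 0) v" and t: "real j * dt \<le> T"
   have tj: "real j * dt \<in> {0..T}" using h t by auto
   have N: "even N" "N > 0" and re: "run_eqs (2*pi/L) N dt (\<lambda>x. \<theta> x 0) v" using h by auto
   have "l2_norm N (\<lambda>k. v j k - of_real (\<theta> 0 0)) = 0"
    by (rule constant_solution_exact[OF N re c]) (use T in simp)
   then show "l2_norm N (\<lambda>k. v j k - of_real (\<theta> (grid_pt N k) (real j * dt))) \<le> 0 * ((1 / real N)^r + dt^2)"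
    by (simp only: c[OF tj])
  qed simp
 next
  case False
  then obtain t x where "t \<in> {0..T}" "airy_flow.D \<theta> 4 t x \<noteq> 0" by blast
  then have fin: "finite (scales T k)" by (rule finite_scales[OF fl9 k' T])
  have "a \<in> scales T k" unfolding scales_def using fl9 k' by blast
  then have Q: "stage_size a T (airy_global.Bd a 9 (sobolev_constant a T k)) \<le> resolution T k"
   by (rule stage_size_le_resolution[OF fin])
  define Z where "Z = stage_size a T (airy_global.Bd a 9 (sobolev_constant a T k))"
  have "\<exists>C\<ge>0. \<forall>N dt v. even N \<and> N > 0 \<and> dt > 0 \<and> Z \<le> real N \<and> dt * real N * Z \<le> 1 \<and> run_eqs a N dt (\<lambda>x. \<theta> x 0) v \<longrightarrow>
   (\<forall>j. real j * dt \<le> T \<longrightarrow> l2_norm N (\<lambda>k. v j k - of_real (\<theta> (grid_pt N k) (real j * dt))) \<le> C * ((1 / real N)^r + dt^2))"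
   unfolding Z_def
   by (rule solution_error[OF fl r sobolev_constant_works(1)[OF fl9 k']]) (rule sobolev_constant_works(2)[OF fl9 k'])
  then obtain C where C: "0 \<le> C" "\<forall>N dt v. even N \<and> N > 0 \<and> dt > 0 \<and> Z \<le> real N \<and> dt * real N * Z \<le> 1 \<and> run_eqs a N dt (\<lambda>x. \<theta> x 0) v \<longrightarrow>
   (\<forall>j. real j * dt \<le> T \<longrightarrow> l2_norm N (\<lambda>k. v j k - of_real (\<theta> (grid_pt N k) (real j * dt))) \<le> C * ((1 / real N)^r + dt^2))"
   by (elim exE conjE) (rule that)
  show ?thesis
  proof (intro exI[of _ C] conjI C(1), intro allI impI)
   fix N dt v j
   assume h: "even N \<and> N > 0 \<and> dt > 0 \<and> resolution T k \<le> real N \<and> dt * real N * resolution T k \<le> 1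
    \<and> run_eqs (2*pi/L) N dt (\<lambda>x. \<theta> x 0) v" and t: "real j * dt \<le> T"
   have "dt * real N * Z \<le> dt * real N * resolution T k"
    using h Q unfolding Z_def by (intro mult_left_mono) auto
   then have "even N \<and> N > 0 \<and> dt > 0 \<and> Z \<le> real N \<and> dt * real N * Z \<le> 1 \<and> run_eqs a N dt (\<lambda>x. \<theta> x 0) v"
    using h Q unfolding a_def[symmetric] Z_def[symmetric] by linarith
   from C(2)[rule_format, OF this t]
   show "l2_norm N (\<lambda>k. v j k - of_real (\<theta> (grid_pt N k) (real j * dt))) \<le> C * ((1 / real N)^r + dt^2)" .
  qed
 qed
qed

theorem theorem2:
  shows "\<exists>h0 C0 :: real \<Rightarrow> (real \<Rightarrow> real \<Rightarrow> real) \<Rightarrow> real.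
    \<forall>(T::real) (r::nat) (L::real) (\<theta> :: real \<Rightarrow> real \<Rightarrow> real) (k :: real \<Rightarrow> real \<Rightarrow> real).
      T > 0 \<and> r \<ge> 6 \<and> regular_airy_solution r T L \<theta> \<and>
      (\<forall>\<alpha>. \<forall>t\<in>{0..T}. k \<alpha> t = 2*pi/L * deriv (\<lambda>\<beta>. \<theta> \<beta> t) \<alpha>) \<longrightarrow>
      h0 T k > 0 \<and> C0 T k > 0 \<and>
      (\<exists>C::real. \<forall>(p::nat) (N::nat) (h::real) (dt::real) (v :: nat \<Rightarrow> int \<Rightarrow> complex).
         p \<ge> 1 \<and> N = 2^p \<and> h = mesh N \<and> dt > 0 \<and> h \<le> h0 T k \<and> dt / h \<le> C0 T k \<and>
         cn_scheme N L dt (\<lambda>\<alpha>. \<theta> \<alpha> 0) v \<longrightarrow>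
         (\<forall>j::nat. real j * dt \<le> T \<longrightarrow>
            l2_norm N (\<lambda>m. v j m - of_real (\<theta> (grid_pt N m) (real j * dt)))
              \<le> C * (h^r + dt^2)))"
proof (rule exI[of _ "\<lambda>T k. 2 * pi / resolution T k"], rule exI[of _ "\<lambda>T k. 1 / (2 * pi * resolution T k)"],
  intro allI impI, elim conjE)
 fix T :: real and r :: nat and L :: real and \<theta> k :: "real => real => real"
 assume asm: "T > 0" "r \<ge> 6" "regular_airy_solution r T L \<theta>"
  "\<forall>\<alpha>. \<forall>t\<in>{0..T}. k \<alpha> t = 2*pi/L * deriv (\<lambda>\<beta>. \<theta> \<beta> t) \<alpha>"
 define Q where "Q = resolution T k"
 have Q: "0 < Q" using resolution_ge[of T k] by (simp add: Q_def)
 obtain C where C: "0 \<le> C" "\<forall>N dt v. even N \<and> N > 0 \<and> dt > 0 \<and> Q \<le> real N \<and> dt * real N * Q \<le> 1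
   \<and> run_eqs (2*pi/L) N dt (\<lambda>x. \<theta> x 0) v \<longrightarrow> (\<forall>j. real j * dt \<le> T \<longrightarrow>
   l2_norm N (\<lambda>k. v j k - of_real (\<theta> (grid_pt N k) (real j * dt))) \<le> C * ((1 / real N)^r + dt^2))"
  using convergence[OF asm, folded Q_def] by (elim exE conjE) (rule that)
 have "l2_norm N (\<lambda>m. v j m - of_real (\<theta> (grid_pt N m) (real j * dt))) \<le> C * (h^r + dt^2)"
  if p: "p \<ge> 1" and N: "N = 2^p" and h: "h = mesh N" and dt: "dt > 0" and hs: "h \<le> 2 * pi / Q" and cfl: "dt / h \<le> 1 / (2 * pi * Q)"
   and v: "cn_scheme N L dt (\<lambda>\<alpha>. \<theta> \<alpha> 0) v" and j: "real j * dt \<le> T" for p N :: nat and h dt :: real and v and j :: nat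
 proof -
  have N': "even N" "N > 0" using p N by auto
  have "2 * pi / real N \<le> 2 * pi / Q" using hs by (simp add: h mesh_def)
  then have 1: "Q \<le> real N" using Q N' by (simp add: frac_le_eq field_simps)
  have "dt * real N / (2 * pi) \<le> 1 / (2 * pi * Q)" using cfl by (simp add: h mesh_def)
  then have 2: "dt * real N * Q \<le> 1" using Q by (simp add: field_simps)
  have "l2_norm N (\<lambda>m. v j m - of_real (\<theta> (grid_pt N m) (real j * dt))) \<le> C * ((1 / real N)^r + dt^2)"
   by (rule C(2)[rule_format, OF _ j]) (use N' 1 2 dt cn_scheme_run_eqs[OF v refl] in auto)
  also have "... \<le> C * (h^r + dt^2)"
  proof (intro mult_left_mono add_right_mono power_mono C(1))
   show "1 / real N \<le> h" unfolding h mesh_def using pi_gt3 by (intro divide_right_mono) auto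
  qed simp
  finally show ?thesis .
 qed
 then have "\<exists>C::real. \<forall>(p::nat) (N::nat) (h::real) (dt::real) (v :: nat => int => complex).
     p \<ge> 1 \<and> N = 2^p \<and> h = mesh N \<and> dt > 0 \<and> h \<le> 2 * pi / Q \<and> dt / h \<le> 1 / (2 * pi * Q) \<and>
     cn_scheme N L dt (\<lambda>\<alpha>. \<theta> \<alpha> 0) v \<longrightarrow>
     (\<forall>j::nat. real j * dt \<le> T \<longrightarrow>
      l2_norm N (\<lambda>m. v j m - of_real (\<theta> (grid_pt N m) (real j * dt))) \<le> C * (h^r + dt^2))"
  by blast
 moreover have "0 < 2 * pi / Q" "0 < 1 / (2 * pi * Q)" using Q by auto
 ultimately show "2 * pi / resolution T k > 0 \<and> 1 / (2 * pi * resolution T k) > 0 \<and>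
   (\<exists>C::real. \<forall>(p::nat) (N::nat) (h::real) (dt::real) (v :: nat => int => complex).
     p \<ge> 1 \<and> N = 2^p \<and> h = mesh N \<and> dt > 0 \<and> h \<le> 2 * pi / resolution T k \<and> dt / h \<le> 1 / (2 * pi * resolution T k) \<and>
     cn_scheme N L dt (\<lambda>\<alpha>. \<theta> \<alpha> 0) v \<longrightarrow>
     (\<forall>j::nat. real j * dt \<le> T \<longrightarrow>
      l2_norm N (\<lambda>m. v j m - of_real (\<theta> (grid_pt N m) (real j * dt)))
       \<le> C * (h^r + dt^2)))"
  unfolding Q_def by blast
qed

end
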